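(* Let $\nu\in\mathcal{P}(\mathcal{P}(\mathbb{R}^3))$ have finite mean Fisher information and finite mean second moment, i.e. $\sup_{j\ge1}I(\nu^j)<+\infty$ and $\int_{\mathbb{R}^3}|v|^2\nu^1(dv)<+\infty$, where $\nu^j=\int_{\mathcal{P}(\mathbb{R}^3)}\rho^{\otimes j}\nu(d\rho)$. Let $\psi^j=\sqrt{\nu^j}\in L^2(\mathbb{R}^{3j})$, and let $\xi\in\mathcal{P}(\mathbb{S}(L^2(\mathbb{R}^3)))$ be the probability measure on the unit sphere of $L^2(\mathbb{R}^3)$ associated with $\nu$ described in the context. Let $k_0\ge1$ and let $Q$ be a (possibly unbounded) non-negative self-adjoint operator on $L^2(\mathbb{R}^{3k_0})$. Assume that for all $u\in\mathbb{S}(L^2(\mathbb{R}^3))$ in the support of $\xi$, $$\langle Qu^{\otimes k_0},u^{\otimes k_0}\rangle\ge\langle Q|u|^{\otimes k_0},|u|^{\otimes k_0}\rangle.$$ Then $$\limsup_{j\to\infty}\ \langle Q\psi^j,\psi^j\rangle\ \ge\ \int_{\mathcal{P}(\mathbb{R}^3)}\langle Q\sqrt\rho^{\otimes k_0},\sqrt\rho^{\otimes k_0}\rangle\,\nu(d\rho).$$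
   Context: $\mathcal{P}(X)$ is the space of Borel probability measures on $X$ with the weak topology. $I(F)=\frac1j\int_{\mathbb{R}^{3j}}\frac{|\nabla F|^2}{F}$ for a probability $F$ on $\mathbb{R}^{3j}$ ($+\infty$ if $F$ has no density or no gradient); in particular each $\nu^j$ has a density, also denoted $\nu^j$. $L^2$ spaces are complex. Quadratic forms: $\langle Q\psi,\psi\rangle$ means $\|Q^{1/2}\psi\|^2$ if $\psi$ is in the domain of $Q^{1/2}$ and $+\infty$ otherwise (and $\langle Q\sqrt\rho^{\otimes k_0},\sqrt\rho^{\otimes k_0}\rangle=+\infty$ if $\rho$ has no density). For $j\ge k_0$, $Q$ acts on $L^2(\mathbb{R}^{3j})$ as $Q\otimes\mathrm{Id}^{\otimes(j-k_0)}$, i.e. on the first $k_0$ variables. Construction of $\xi$: for a unit vector $\phi$, let $p(\phi)=\phi\langle\phi,\cdot\rangle$ be the orthogonal projection on its span. Let $\Gamma^j=p(\psi^j)$, a trace-class operator on $L^2(\mathbb{R}^{3j})$ of trace 1, and for $1\le k\le j$ let $\Gamma^{j:k}$ be its partial trace, the operator on $L^2(\mathbb{R}^{3k})$ defined by $\mathrm{Tr}(A\Gamma^{j:k})=\mathrm{Tr}((A\otimes\mathrm{Id}^{\otimes(j-k)})\Gamma^j)$ for all bounded $A$. Under the assumptions on $\nu$, there is a subsequence in $j$, independent of $k$, along which $\Gamma^{j:k}\to\gamma^k$ in trace norm for every $k\ge1$, with $\mathrm{Tr}(\gamma^k)=1$ and $(\gamma^k)_k$ compatible under partial traces; and (quantum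 de Finetti theorem) there is $\xi\in\mathcal{P}(\mathbb{S}(L^2(\mathbb{R}^3)))$ such that for all $k\ge1$ $$\gamma^k=\int_{\mathbb{S}(L^2(\mathbb{R}^3))}p(u^{\otimes k})\,\xi(du).$$ Moreover $\nu$ is the pushforward of $\xi$ under $u\mapsto|u|^2$. Such a subsequence and such a $\xi$ are fixed. *)

theory Defs
  imports "HOL-Probability.Probability"
begin

section \<open>Probability measures and the weak topology\<close>

definition borel_of :: "'a topology \<Rightarrow> 'a measure" where
  "borel_of X = sigma (topspace X) {U. openin X U}"

definition prob_measures :: "'a topology \<Rightarrow> 'a measure set" where
  "prob_measures X = {\<mu>. prob_space \<mu> \<and> sets \<mu> = sets (borel_of X)}"

text \<open>The coarsest topology on probability measures making all integrals of bounded continuous functions continuous.\<close>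

definition weak_topology :: "'a topology \<Rightarrow> 'a measure topology" where
  "weak_topology X = topology_generated_by
     {{\<mu> \<in> prob_measures X. (\<integral>x. f x \<partial>\<mu>) \<in> U} | (f :: 'a \<Rightarrow> real) U.
        continuous_map X euclideanreal f \<and> bounded (f ` topspace X) \<and> open U}"

definition support_of :: "'a topology \<Rightarrow> 'a measure \<Rightarrow> 'a set" where
  "support_of X \<mu> = {x \<in> topspace X. \<forall>U. openin X U \<and> x \<in> U \<longrightarrow> emeasure \<mu> U > 0}"

definition has_density :: "'a measure \<Rightarrow> 'a measure \<Rightarrow> bool" where
  "has_density M F \<longleftrightarrow> (\<exists>f \<in> borel_measurable M. density M f = F)"


section \<open>The complex Hilbert space \<open>L\<^sup>2(M)\<close>\<close>

text \<open>
  A vector is an equivalence class of square-integrable functions. The spaces for different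
  \<open>j\<close> have to coexist in one statement, so \<open>L\<^sup>2\<close> is a carrier set depending on the measure.
\<close>

type_synonym 'a l2 = "('a \<Rightarrow> complex) set"

definition l2_fun :: "'a measure \<Rightarrow> ('a \<Rightarrow> complex) set" where
  "l2_fun M = {f \<in> borel_measurable M. integrable M (\<lambda>x. (cmod (f x))\<^sup>2)}"

definition l2_rel :: "'a measure \<Rightarrow> (('a \<Rightarrow> complex) \<times> ('a \<Rightarrow> complex)) set" where
  "l2_rel M = {(f, g). f \<in> l2_fun M \<and> g \<in> l2_fun M \<and> (AE x in M. f x = g x)}"

definition L2 :: "'a measure \<Rightarrow> 'a l2 set" where
  "L2 M = l2_fun M // l2_rel M"

definition l2_class :: "'a measure \<Rightarrow> ('a \<Rightarrow> complex) \<Rightarrow> 'a l2" where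
  "l2_class M f = l2_rel M `` {f}"

definition l2_rep :: "'a l2 \<Rightarrow> 'a \<Rightarrow> complex" where
  "l2_rep a = (SOME f. f \<in> a)"

definition l2_zero :: "'a measure \<Rightarrow> 'a l2" where
  "l2_zero M = l2_class M (\<lambda>x. 0)"

definition l2_add :: "'a measure \<Rightarrow> 'a l2 \<Rightarrow> 'a l2 \<Rightarrow> 'a l2" where
  "l2_add M a b = l2_class M (\<lambda>x. l2_rep a x + l2_rep b x)"

definition l2_scale :: "'a measure \<Rightarrow> complex \<Rightarrow> 'a l2 \<Rightarrow> 'a l2" where
  "l2_scale M c a = l2_class M (\<lambda>x. c * l2_rep a x)"

definition l2_diff :: "'a measure \<Rightarrow> 'a l2 \<Rightarrow> 'a l2 \<Rightarrow> 'a l2" where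
  "l2_diff M a b = l2_class M (\<lambda>x. l2_rep a x - l2_rep b x)"

text \<open>Antilinear in the first argument.\<close>

definition l2_inner :: "'a measure \<Rightarrow> 'a l2 \<Rightarrow> 'a l2 \<Rightarrow> complex" where
  "l2_inner M a b = (\<integral>x. cnj (l2_rep a x) * l2_rep b x \<partial>M)"

definition l2_norm :: "'a measure \<Rightarrow> 'a l2 \<Rightarrow> real" where
  "l2_norm M a = sqrt (\<integral>x. (cmod (l2_rep a x))\<^sup>2 \<partial>M)"

definition l2_abs :: "'a measure \<Rightarrow> 'a l2 \<Rightarrow> 'a l2" where
  "l2_abs M a = l2_class M (\<lambda>x. complex_of_real (cmod (l2_rep a x)))"

definition l2_sphere :: "'a measure \<Rightarrow> 'a l2 set" where
  "l2_sphere M = {u \<in> L2 M. l2_norm M u = 1}"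

definition l2_sphere_topology :: "'a measure \<Rightarrow> 'a l2 topology" where
  "l2_sphere_topology M =
     Metric_space.mtopology (l2_sphere M) (\<lambda>u v. l2_norm M (l2_diff M u v))"


section \<open>Operators\<close>

text \<open>
  A (possibly unbounded) operator is represented by its graph, so that \<^const>\<open>Domain\<close> is its
  domain and \<open>S O T\<close> is the composition that applies \<open>S\<close> first and then \<open>T\<close>.
\<close>

type_synonym 'a l2op = "('a l2 \<times> 'a l2) set"

definition linear_graph :: "'a measure \<Rightarrow> 'a l2op \<Rightarrow> bool" where
  "linear_graph M G \<longleftrightarrow>
     G \<subseteq> L2 M \<times> L2 M \<and> (l2_zero M, l2_zero M) \<in> G \<and>
     (\<forall>(x, x') \<in> G. \<forall>(y, y') \<in> G. (l2_add M x y, l2_add M x' y') \<in> G) \<and>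
     (\<forall>c. \<forall>(x, x') \<in> G. (l2_scale M c x, l2_scale M c x') \<in> G)"

definition closed_graph :: "'a measure \<Rightarrow> 'a l2op \<Rightarrow> bool" where
  "closed_graph M G \<longleftrightarrow>
     (\<forall>x \<in> L2 M. \<forall>y \<in> L2 M.
        (\<forall>e>0. \<exists>(a, b) \<in> G. l2_norm M (l2_diff M x a) < e \<and> l2_norm M (l2_diff M y b) < e)
        \<longrightarrow> (x, y) \<in> G)"

definition l2_operator :: "'a measure \<Rightarrow> 'a l2op \<Rightarrow> bool" where
  "l2_operator M A \<longleftrightarrow> linear_graph M A \<and> single_valued A"

definition op_apply :: "'a l2op \<Rightarrow> 'a l2 \<Rightarrow> 'a l2" where
  "op_apply A x = (THE y. (x, y) \<in> A)"

definition op_diff :: "'a measure \<Rightarrow> 'a l2op \<Rightarrow> 'a l2op \<Rightarrow> 'a l2op" where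
  "op_diff M S T = {(x, l2_diff M y z) | x y z. (x, y) \<in> S \<and> (x, z) \<in> T}"

definition bounded_op :: "'a measure \<Rightarrow> 'a l2op \<Rightarrow> bool" where
  "bounded_op M A \<longleftrightarrow> l2_operator M A \<and> Domain A = L2 M \<and>
     (\<exists>C. \<forall>(x, y) \<in> A. l2_norm M y \<le> C * l2_norm M x)"

definition adjoint_op :: "'a measure \<Rightarrow> 'a l2op \<Rightarrow> 'a l2op" where
  "adjoint_op M A =
     {(y, z) \<in> L2 M \<times> L2 M. \<forall>(x, w) \<in> A. l2_inner M y w = l2_inner M z x}"

definition l2_dense :: "'a measure \<Rightarrow> 'a l2 set \<Rightarrow> bool" where
  "l2_dense M D \<longleftrightarrow> (\<forall>x \<in> L2 M. \<forall>e>0. \<exists>y \<in> D. l2_norm M (l2_diff M x y) < e)"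

definition selfadjoint_op :: "'a measure \<Rightarrow> 'a l2op \<Rightarrow> bool" where
  "selfadjoint_op M A \<longleftrightarrow> l2_operator M A \<and> l2_dense M (Domain A) \<and> adjoint_op M A = A"

definition nonneg_selfadjoint_op :: "'a measure \<Rightarrow> 'a l2op \<Rightarrow> bool" where
  "nonneg_selfadjoint_op M A \<longleftrightarrow>
     selfadjoint_op M A \<and> (\<forall>(x, y) \<in> A. 0 \<le> Re (l2_inner M x y))"

text \<open>Every non-negative self-adjoint operator has exactly one such square root.\<close>

definition sqrt_op :: "'a measure \<Rightarrow> 'a l2op \<Rightarrow> 'a l2op" where
  "sqrt_op M A = (THE S. nonneg_selfadjoint_op M S \<and> S O S = A)"

definition abs_op :: "'a measure \<Rightarrow> 'a l2op \<Rightarrow> 'a l2op" where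
  "abs_op M T = sqrt_op M (T O adjoint_op M T)"

definition quad_form :: "'a measure \<Rightarrow> 'a l2op \<Rightarrow> 'a l2 \<Rightarrow> ennreal" where
  "quad_form M Q \<psi> =
     (if \<psi> \<in> Domain (sqrt_op M Q)
      then ennreal ((l2_norm M (op_apply (sqrt_op M Q) \<psi>))\<^sup>2) else \<infinity>)"

definition proj_op :: "'a measure \<Rightarrow> 'a l2 \<Rightarrow> 'a l2op" where
  "proj_op M \<phi> = {(x, l2_scale M (l2_inner M \<phi> x) \<phi>) | x. x \<in> L2 M}"


section \<open>Trace class\<close>

definition orthonormal_basis :: "'a measure \<Rightarrow> 'a l2 set \<Rightarrow> bool" where
  "orthonormal_basis M B \<longleftrightarrow> B \<subseteq> L2 M \<and>
     (\<forall>e \<in> B. \<forall>f \<in> B. l2_inner M e f = (if e = f then 1 else 0)) \<and>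
     (\<forall>x \<in> L2 M. (\<forall>e \<in> B. l2_inner M e x = 0) \<longrightarrow> x = l2_zero M)"

text \<open>The trace and the trace norm do not depend on the basis chosen here.\<close>

definition some_basis :: "'a measure \<Rightarrow> 'a l2 set" where
  "some_basis M = (SOME B. orthonormal_basis M B)"

definition trace_norm :: "'a measure \<Rightarrow> 'a l2op \<Rightarrow> ennreal" where
  "trace_norm M T =
     (\<Sum>\<^sub>\<infinity>e \<in> some_basis M. ennreal (Re (l2_inner M e (op_apply (abs_op M T) e))))"

definition trace_class :: "'a measure \<Rightarrow> 'a l2op \<Rightarrow> bool" where
  "trace_class M T \<longleftrightarrow> bounded_op M T \<and> trace_norm M T < \<infinity>"

definition op_trace :: "'a measure \<Rightarrow> 'a l2op \<Rightarrow> complex" where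
  "op_trace M T = (\<Sum>\<^sub>\<infinity>e \<in> some_basis M. l2_inner M e (op_apply T e))"


section \<open>The spaces \<open>L\<^sup>2(\<real>\<^sup>3\<^sup>j)\<close>\<close>

text \<open>A point of \<open>(\<real>\<^sup>3)\<^sup>j\<close> is an extensional function on \<open>{..<j}\<close>.\<close>

type_synonym conf = "nat \<Rightarrow> real^3"

definition leb :: "nat \<Rightarrow> conf measure" where
  "leb j = PiM {..<j} (\<lambda>_. lborel)"

definition tensor_power :: "nat \<Rightarrow> (real^3) l2 \<Rightarrow> conf l2" where
  "tensor_power k u = l2_class (leb k) (\<lambda>x. \<Prod>i<k. l2_rep u (x i))"

text \<open>\<open>f \<otimes> g\<close>, with \<open>f\<close> in the first \<open>k\<close> variables and \<open>g\<close> in the last \<open>j - k\<close> ones.\<close>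

definition l2_tensor :: "nat \<Rightarrow> nat \<Rightarrow> conf l2 \<Rightarrow> conf l2 \<Rightarrow> conf l2" where
  "l2_tensor k j f g = l2_class (leb j)
     (\<lambda>x. l2_rep f (restrict x {..<k}) * l2_rep g (\<lambda>i \<in> {..<j - k}. x (k + i)))"

text \<open>
  \<open>A \<otimes> Id\<^sup>\<otimes>\<^sup>(\<^sup>j\<^sup>-\<^sup>k\<^sup>)\<close> is the closure of the operator \<open>f \<otimes> g \<mapsto> A f \<otimes> g\<close> on the algebraic tensor
  product of \<open>Domain A\<close> and \<open>L\<^sup>2(\<real>\<^sup>3\<^sup>(\<^sup>j\<^sup>-\<^sup>k\<^sup>))\<close>: its graph is the closed linear span of the pairs
  \<open>(f \<otimes> g, A f \<otimes> g)\<close>.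
\<close>

definition tensor_id :: "nat \<Rightarrow> nat \<Rightarrow> conf l2op \<Rightarrow> conf l2op" where
  "tensor_id k j A =
     (\<lambda>G. linear_graph (leb j) G \<and> closed_graph (leb j) G) hull
       {(l2_tensor k j f g, l2_tensor k j f' g) | f f' g. (f, f') \<in> A \<and> g \<in> L2 (leb (j - k))}"

definition is_partial_trace :: "nat \<Rightarrow> nat \<Rightarrow> conf l2op \<Rightarrow> conf l2op \<Rightarrow> bool" where
  "is_partial_trace k j G T \<longleftrightarrow> trace_class (leb k) T \<and>
     (\<forall>A. bounded_op (leb k) A \<longrightarrow>
        op_trace (leb k) (T O A) = op_trace (leb j) (G O tensor_id k j A))"

text \<open>
  The square root of the density of \<open>F\<close>; only meaningful if \<^term>\<open>has_density M F\<close>, as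
  \<^const>\<open>RN_deriv\<close> is \<open>0\<close> otherwise.
\<close>

definition sqrt_density :: "'a measure \<Rightarrow> 'a measure \<Rightarrow> 'a l2" where
  "sqrt_density M F = l2_class M (\<lambda>x. complex_of_real (sqrt (enn2real (RN_deriv M F x))))"

definition quad_form_sqrt_power :: "nat \<Rightarrow> conf l2op \<Rightarrow> (real^3) measure \<Rightarrow> ennreal" where
  "quad_form_sqrt_power k Q \<rho> =
     (if has_density lborel \<rho> then quad_form (leb k) Q (tensor_power k (sqrt_density lborel \<rho>))
      else \<infinity>)"

definition mod_square :: "(real^3) l2 \<Rightarrow> (real^3) measure" where
  "mod_square u = density lborel (\<lambda>v. ennreal ((cmod (l2_rep u v))\<^sup>2))"


section \<open>Mixtures of tensor powers and their Fisher information\<close>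

definition mixture :: "(real^3) measure measure \<Rightarrow> nat \<Rightarrow> conf measure" where
  "mixture \<nu> j = \<nu> \<bind> (\<lambda>\<rho>. PiM {..<j} (\<lambda>_. \<rho>))"

definition partial_deriv :: "nat \<Rightarrow> real^3 \<Rightarrow> (conf \<Rightarrow> real) \<Rightarrow> conf \<Rightarrow> real" where
  "partial_deriv i b \<phi> x = deriv (\<lambda>t. \<phi> (x(i := x i + t *\<^sub>R b))) 0"

primrec class_C :: "nat \<Rightarrow> nat \<Rightarrow> (conf \<Rightarrow> real) \<Rightarrow> bool" where
  "class_C j 0 \<phi> \<longleftrightarrow> continuous_on (space (leb j)) \<phi>"
| "class_C j (Suc n) \<phi> \<longleftrightarrow> continuous_on (space (leb j)) \<phi> \<and>
     (\<forall>i<j. \<forall>b\<in>Basis.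
        (\<forall>x\<in>space (leb j). (\<lambda>t::real. \<phi> (x(i := x i + t *\<^sub>R b))) differentiable (at 0)) \<and>
        class_C j n (partial_deriv i b \<phi>))"

definition conf_box :: "nat \<Rightarrow> real \<Rightarrow> conf set" where
  "conf_box j R = {x \<in> space (leb j). \<forall>l<j. norm (x l) \<le> R}"

text \<open>\<open>C\<^sub>c\<^sup>\<infinity>(\<real>\<^sup>3\<^sup>j)\<close>\<close>

definition test_functions :: "nat \<Rightarrow> (conf \<Rightarrow> real) set" where
  "test_functions j = {\<phi>. (\<forall>n. class_C j n \<phi>) \<and>
     (\<exists>R. \<forall>x \<in> space (leb j). x \<notin> conf_box j R \<longrightarrow> \<phi> x = 0)}"

text \<open>
  \<open>g\<close> is the locally integrable distributional gradient of \<open>f\<close>; \<open>g x i\<close> is the gradient in the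
  \<open>i\<close>-th variable.
\<close>

definition weak_gradient :: "nat \<Rightarrow> (conf \<Rightarrow> real) \<Rightarrow> (conf \<Rightarrow> nat \<Rightarrow> real^3) \<Rightarrow> bool" where
  "weak_gradient j f g \<longleftrightarrow>
     (\<forall>i<j. (\<lambda>x. g x i) \<in> borel_measurable (leb j) \<and>
        (\<forall>R. set_integrable (leb j) (conf_box j R) (\<lambda>x. g x i))) \<and>
     (\<forall>\<phi> \<in> test_functions j. \<forall>i<j. \<forall>b\<in>Basis.
        (\<integral>x. f x * partial_deriv i b \<phi> x \<partial>leb j) = - (\<integral>x. (g x i \<bullet> b) * \<phi> x \<partial>leb j))"

text \<open>
  A weak gradient is unique up to null sets, so the infimum is over at most one value; it is
  \<open>\<infinity>\<close> if there is no gradient. In \<^typ>\<open>ennreal\<close>, \<open>0 / 0 = 0\<close> and \<open>a / 0 = \<infinity>\<close> for \<open>a > 0\<close>.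
\<close>

definition fisher_info :: "nat \<Rightarrow> conf measure \<Rightarrow> ennreal" where
  "fisher_info j F =
     (if has_density (leb j) F
      then INF g \<in> {g. weak_gradient j (\<lambda>x. enn2real (RN_deriv (leb j) F x)) g}.
             (\<integral>\<^sup>+x. ennreal (\<Sum>i<j. (norm (g x i))\<^sup>2) / RN_deriv (leb j) F x \<partial>leb j) / of_nat j
      else \<infinity>)"

end

theory Submission
  imports Defs "HOL-Library.Groups_Big_Fun"
begin

text \<open>
  Let \<open>S\<close> be the square root of \<open>Q\<close> and \<open>S\<^sub>m = S (1 + S/m)\<^sup>-\<^sup>1\<close> its bounded Yosida approximations, so
  that \<open>\<parallel>S\<^sub>m v\<parallel>\<^sup>2\<close> increases to \<open>\<langle>Q v, v\<rangle>\<close>. For finitely many basis vectors \<open>e\<^sub>i\<close>, the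
  finite-rank operator \<open>A = \<Sum>\<^sub>i S\<^sub>m p(e\<^sub>i) S\<^sub>m\<close> lies below \<open>Q\<close>, hence \<open>A \<otimes> Id\<close> lies below \<open>Q \<otimes> Id\<close> and
  \<open>Tr (A \<Gamma>\<^sup>j\<^sup>:\<^sup>k) \<le> \<langle>Q \<psi>\<^sup>j, \<psi>\<^sup>j\<rangle>\<close>. As \<open>A\<close> is bounded, trace-norm convergence and the de Finetti
  representation turn the left-hand side into \<open>\<integral> \<langle>A u\<^sup>\<otimes>\<^sup>k, u\<^sup>\<otimes>\<^sup>k\<rangle> d\<xi>(u)\<close> along the subsequence.
  Monotone convergence, first over the basis and then in \<open>m\<close>, gives
  \<open>\<integral> \<langle>Q u\<^sup>\<otimes>\<^sup>k, u\<^sup>\<otimes>\<^sup>k\<rangle> d\<xi>(u) \<le> limsup \<langle>Q \<psi>\<^sup>j, \<psi>\<^sup>j\<rangle>\<close>. Since \<open>L\<^sup>2\<close> is separable, \<open>\<xi>\<close> is carried by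
  its support, so \<open>u\<close> may be replaced by \<open>|u|\<close>, and \<open>|u|\<^sup>2\<close> has law \<open>\<nu>\<close>.
\<close>

section \<open>Nonnegative self-adjoint relations on a complete subspace\<close>

text \<open>Two obstacles shape the development. First, square roots are given by definite
  descriptions, in \<open>quad_form\<close> as well as in \<open>trace_norm\<close>, so existence
  and uniqueness of non-negative self-adjoint roots have to be proved for unbounded operators. This
  is done without spectral calculus: the resolvent (1 + Q)^-1 reduces everything to roots of bounded
  operators. Second, the operators act on different spaces L2(leb j), each a set of equivalence
  classes. All of them are embedded in one real inner product space, in which an operator is a real
  subspace of pairs and complex linearity is invariance under multiplication by i. Uniqueness of the
  root shows that it inherits this invariance. The Yosida approximation is cut down to finite rank
  because then every trace is a finite sum of matrix elements, and trace-norm convergence enters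
  only through the bound of the operator norm by the trace norm. That A \<le> Q implies A \<otimes>
  Id \<le> Q \<otimes> Id is a Schur product argument on finite sums of tensors, followed by closure
  and by an extension to the form domain.\<close>

lemma quadratic_nonneg_imp:
  fixes a b c :: real
  assumes "\<And>t. 0 \<le> a + 2 * t * b + t\<^sup>2 * c"
  shows "b\<^sup>2 \<le> a * c"
proof (cases "c = 0")
  case True
  have "b = 0"
  proof (rule ccontr)
    assume "b \<noteq> 0"
    then have "a + 2 * (- (a + 1) / (2 * b)) * b = - 1"
      by (simp add: field_simps)
    with assms[of "- (a + 1) / (2 * b)"] True show False by simp
  qed
  with True show ?thesis by simp
next
  case False
  have c: "c > 0"
  proof (rule ccontr)
    assume "\<not> c > 0"
    with False have c: "c < 0" by simp
    \<comment> \<open>With this choice \<open>t \<ge> 1\<close>, and t * c lies below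
      -(\<bar>a\<bar> + 1 + 2\<bar>b\<bar>), so the quadratic term outweighs the other two.\<close>
    define t where "t = (\<bar>a\<bar> + 1 + 2 * \<bar>b\<bar>) / (- c) + 1"
    have t1: "t \<ge> 1" unfolding t_def using c by (simp add: divide_nonneg_neg divide_nonpos_neg divide_nonneg_nonpos)
    have tc: "t * c = - (\<bar>a\<bar> + 1 + 2 * \<bar>b\<bar>) + c"
      unfolding t_def using c by (simp add: field_simps)
    have "t\<^sup>2 * c = t * (t * c)" by (simp add: power2_eq_square)
    also have "\<dots> \<le> t * (- (\<bar>a\<bar> + 1 + 2 * \<bar>b\<bar>))"
      using t1 tc c by (intro mult_left_mono) auto
    finally have "a + 2 * t * b + t\<^sup>2 * c \<le> a + 2 * t * b - t * (\<bar>a\<bar> + 1) - 2 * t * \<bar>b\<bar>"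
      by (simp add: algebra_simps)
    moreover have "t * b \<le> t * \<bar>b\<bar>" using t1 by (intro mult_left_mono) auto
    moreover have "\<bar>a\<bar> + 1 \<le> t * (\<bar>a\<bar> + 1)" using t1 by (simp add: mult_le_cancel_right1)
    ultimately have "a + 2 * t * b + t\<^sup>2 * c < 0" by (simp add: algebra_simps)
    with assms[of t] show False by simp
  qed
  have "0 \<le> a + 2 * (- b / c) * b + (- b / c)\<^sup>2 * c" by (rule assms)
  also have "\<dots> = a - b\<^sup>2 / c" using c by (simp add: field_simps power2_eq_square)
  finally show ?thesis using c by (simp add: field_simps)
qed

lemma parallelogram_norm:
  fixes x y :: "'h::real_inner"
  shows "(norm (x - y))\<^sup>2 = 2 * (norm x)\<^sup>2 + 2 * (norm y)\<^sup>2 - (norm (x + y))\<^sup>2"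
  by (simp add: power2_norm_eq_inner inner_add_left inner_add_right inner_diff_left
      inner_diff_right inner_commute)

text \<open>The device by which monotone sequences of forms converge strongly: squared norms of
  increments are dominated by increments of a convergent real sequence. It serves both the iteration
  for bounded roots and the Yosida approximations.\<close>

lemma Cauchy_by_square:
  fixes f :: "nat \<Rightarrow> 'h::real_inner"
  assumes "\<And>m n. n \<le> m \<Longrightarrow> (norm (f m - f n))\<^sup>2 \<le> c * (a m - a n)"
    and "Cauchy (a :: nat \<Rightarrow> real)" and c: "c > 0"
  shows "Cauchy f"
proof (rule CauchyI')
  fix e :: real assume "e > 0"
  with c have "e\<^sup>2 / c > 0" by simp
  from CauchyD[OF assms(2) this] obtain M where M: "\<And>m n. m \<ge> M \<Longrightarrow> n \<ge> M \<Longrightarrow> norm (a m - a n) < e\<^sup>2 / c"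
    by blast
  show "\<exists>M. \<forall>m\<ge>M. \<forall>n>m. dist (f m) (f n) < e"
  proof (intro exI allI impI)
    fix m n assume mn: "M \<le> m" "m < n"
    have "(norm (f n - f m))\<^sup>2 \<le> c * (a n - a m)" using mn by (intro assms(1)) auto
    also have "\<dots> < e\<^sup>2" using M[of n m] mn c by (simp add: field_simps abs_less_iff)
    finally have "norm (f n - f m) < e" using \<open>e > 0\<close> by (simp add: power_less_imp_less_base)
    then show "dist (f m) (f n) < e" by (simp add: dist_norm norm_minus_commute)
  qed
qed

lemma orthogonal_to_closure:
  fixes w :: "'h::real_inner"
  assumes "\<And>x. x \<in> D \<Longrightarrow> w \<bullet> x = 0" "v \<in> closure D"
  shows "w \<bullet> v = 0"
proof -
  obtain f where f: "\<And>n. f n \<in> D" "f \<longlonglongrightarrow> v"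
    using assms(2) closure_sequential by blast
  have "(\<lambda>n. w \<bullet> f n) \<longlonglongrightarrow> w \<bullet> v" by (intro tendsto_intros f)
  moreover have "(\<lambda>n. w \<bullet> f n) = (\<lambda>n. 0)" using assms(1) f(1) by auto
  ultimately show ?thesis using LIMSEQ_unique tendsto_const by metis
qed

lemma subspace_closure:
  fixes S :: "'h::real_normed_vector set"
  assumes "subspace S" shows "subspace (closure S)"
  unfolding subspace_def
proof (intro conjI ballI allI)
  show "0 \<in> closure S" using subspace_0[OF assms] closure_subset by blast
  fix x assume x: "x \<in> closure S"
  then obtain f where f: "\<And>n. f n \<in> S" "f \<longlonglongrightarrow> x" using closure_sequential by blast
  show "c *\<^sub>R x \<in> closure S" for c
    unfolding closure_sequential using f tendsto_scaleR[OF tendsto_const f(2), of c]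
    by (intro exI[of _ "\<lambda>n. c *\<^sub>R f n"]) (simp add: subspace_scale[OF assms])
  fix y assume "y \<in> closure S"
  then obtain g where g: "\<And>n. g n \<in> S" "g \<longlonglongrightarrow> y" using closure_sequential by blast
  show "x + y \<in> closure S"
    unfolding closure_sequential using f g tendsto_add[OF f(2) g(2)]
    by (intro exI[of _ "\<lambda>n. f n + g n"]) (simp add: subspace_add[OF assms])
qed

section \<open>Orthogonal projection onto a complete subspace\<close>

locale hilbert_subspace =
  fixes V :: "'h::real_inner set"
  assumes V_subspace: "subspace V" and V_complete: "uniform_space_class.complete V"
begin

lemma V_closed: "closed V"
  using V_complete complete_imp_closed by blast

lemmas V_intros = subspace_0[OF V_subspace] subspace_add[OF V_subspace]
  subspace_diff[OF V_subspace] subspace_scale[OF V_subspace] subspace_neg[OF V_subspace]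

lemma V_Cauchy: "(\<And>n. f n \<in> V) \<Longrightarrow> Cauchy f \<Longrightarrow> \<exists>l\<in>V. f \<longlonglongrightarrow> l"
  using V_complete unfolding complete_def by blast

text \<open>The ambient space need not be complete, only \<open>V\<close> is. A minimising sequence
  is Cauchy by the parallelogram law, since midpoints of members of \<open>V\<close> stay in
  \<open>V\<close> and cannot beat the infimum \<open>D\<close>.\<close>

lemma nearest_point: "\<exists>p\<in>V. \<forall>v\<in>V. (x - p) \<bullet> v = 0"
proof -
  define D where "D = Inf ((\<lambda>v. (norm (x - v))\<^sup>2) ` V)"
  have bdd: "bdd_below ((\<lambda>v. (norm (x - v))\<^sup>2) ` V)" by (intro bdd_belowI[of _ 0]) auto
  have ne: "(\<lambda>v. (norm (x - v))\<^sup>2) ` V \<noteq> {}" using V_intros(1) by auto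
  have low: "D \<le> (norm (x - v))\<^sup>2" if "v \<in> V" for v
    unfolding D_def using bdd that by (intro cInf_lower) auto
  have "\<exists>v\<in>V. (norm (x - v))\<^sup>2 < D + 1 / real (Suc n)" for n
  proof -
    have "Inf ((\<lambda>v. (norm (x - v))\<^sup>2) ` V) < D + 1 / real (Suc n)" by (simp add: D_def)
    from cInf_lessD[OF ne this] show ?thesis by auto
  qed
  then obtain f where f: "\<And>n. f n \<in> V" "\<And>n. (norm (x - f n))\<^sup>2 < D + 1 / real (Suc n)"
    by metis
  have par: "(norm (f m - f n))\<^sup>2 \<le> 4 * (1 / real (Suc n))" if "n \<le> m" for m n
  proof -
    have "(1/2) *\<^sub>R (f m + f n) \<in> V" using f by (intro V_intros)
    from low[OF this] have "4 * D \<le> (norm (2 *\<^sub>R (x - (1/2) *\<^sub>R (f m + f n))))\<^sup>2"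
      by (simp add: power_mult_distrib)
    also have "2 *\<^sub>R (x - (1/2) *\<^sub>R (f m + f n)) = (x - f m) + (x - f n)"
      by (simp add: algebra_simps scaleR_2)
    finally have "4 * D \<le> (norm ((x - f m) + (x - f n)))\<^sup>2" .
    moreover have "(norm (f m - f n))\<^sup>2 = (norm ((x - f n) - (x - f m)))\<^sup>2" by simp
    ultimately have "(norm (f m - f n))\<^sup>2 \<le> 2 * (norm (x - f n))\<^sup>2 + 2 * (norm (x - f m))\<^sup>2 - 4 * D"
      using parallelogram_norm[of "x - f n" "x - f m"] by (simp add: add.commute)
    also have "\<dots> \<le> 2 * (1 / real (Suc n)) + 2 * (1 / real (Suc m))"
      using f(2)[of n] f(2)[of m] by linarith
    also have "1 / real (Suc m) \<le> 1 / real (Suc n)" using that by (simp add: field_simps)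
    finally show ?thesis by simp
  qed
  have "Cauchy f"
  proof (rule CauchyI')
    fix e :: real assume e: "e > 0"
    then obtain M where M: "1 / real (Suc M) < e\<^sup>2 / 4"
      using nat_approx_posE[of "e\<^sup>2 / 4"] by auto
    show "\<exists>M. \<forall>m\<ge>M. \<forall>n>m. dist (f m) (f n) < e"
    proof (intro exI allI impI)
      fix m n assume mn: "M \<le> m" "m < n"
      have "(norm (f n - f m))\<^sup>2 \<le> 4 * (1 / real (Suc m))" using mn by (intro par) auto
      also have "1 / real (Suc m) \<le> 1 / real (Suc M)" using mn by (simp add: field_simps)
      finally have "(norm (f n - f m))\<^sup>2 < e\<^sup>2" using M by linarith
      then have "norm (f n - f m) < e" using e by (simp add: power_less_imp_less_base)
      then show "dist (f m) (f n) < e" by (simp add: dist_norm norm_minus_commute)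
    qed
  qed
  then obtain p where p: "p \<in> V" "f \<longlonglongrightarrow> p" using V_Cauchy f(1) by blast
  have lim: "(\<lambda>n. (norm (x - f n))\<^sup>2) \<longlonglongrightarrow> (norm (x - p))\<^sup>2" by (intro tendsto_intros p)
  have lim2: "(\<lambda>n. D + 1 / real (Suc n)) \<longlonglongrightarrow> D + 0"
    using LIMSEQ_inverse_real_of_nat by (intro tendsto_intros) (simp add: inverse_eq_divide)
  have nD: "(norm (x - p))\<^sup>2 \<le> D"
    using LIMSEQ_le[OF lim lim2] f(2) less_imp_le by auto
  have "(x - p) \<bullet> v = 0" if v: "v \<in> V" for v
  proof -
    \<comment> \<open>Moving from \<open>p\<close> along \<open>v\<close> does not decrease the
      distance. The resulting quadratic in \<open>t\<close> has constant term 0, which forces its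
      linear coefficient to vanish.\<close>
    have "0 \<le> 0 + 2 * t * (- ((x - p) \<bullet> v)) + t\<^sup>2 * (v \<bullet> v)" for t
    proof -
      have "(norm (x - p))\<^sup>2 \<le> (norm (x - (p + t *\<^sub>R v)))\<^sup>2"
        using nD low[OF V_intros(2)[OF p(1) V_intros(4)[OF v]], of t] by linarith
      also have "x - (p + t *\<^sub>R v) = (x - p) - t *\<^sub>R v" by simp
      finally show ?thesis
        unfolding power2_norm_eq_inner
        by (simp add: inner_diff_left inner_diff_right inner_commute algebra_simps power2_eq_square)
    qed
    from quadratic_nonneg_imp[OF this] show ?thesis by simp
  qed
  with p show ?thesis by blast
qed

definition proj :: "'h \<Rightarrow> 'h" where
  "proj x = (SOME p. p \<in> V \<and> (\<forall>v\<in>V. (x - p) \<bullet> v = 0))"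

lemma proj_in [simp]: "proj x \<in> V" and proj_orth: "v \<in> V \<Longrightarrow> (x - proj x) \<bullet> v = 0"
  using someI_ex[of "\<lambda>p. p \<in> V \<and> (\<forall>v\<in>V. (x - p) \<bullet> v = 0)"] nearest_point[of x]
  unfolding proj_def by blast+

lemma eq_if_inner_V: "a \<in> V \<Longrightarrow> b \<in> V \<Longrightarrow> (\<And>v. v \<in> V \<Longrightarrow> a \<bullet> v = b \<bullet> v) \<Longrightarrow> a = b"
proof -
  assume ab: "a \<in> V" "b \<in> V" "\<And>v. v \<in> V \<Longrightarrow> a \<bullet> v = b \<bullet> v"
  then have "(a - b) \<bullet> (a - b) = 0" using V_intros(3) by (simp add: inner_diff_left)
  then show "a = b" by simp
qed

lemma inner_proj_left: "v \<in> V \<Longrightarrow> proj x \<bullet> v = x \<bullet> v"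
  using proj_orth[of v x] by (simp add: inner_diff_left)

lemma inner_proj_right: "v \<in> V \<Longrightarrow> v \<bullet> proj x = v \<bullet> x"
  using inner_proj_left inner_commute by metis

lemma proj_eqI: "p \<in> V \<Longrightarrow> (\<And>v. v \<in> V \<Longrightarrow> p \<bullet> v = x \<bullet> v) \<Longrightarrow> proj x = p"
  by (rule eq_if_inner_V) (auto simp: inner_proj_left)

lemma proj_ident [simp]: "x \<in> V \<Longrightarrow> proj x = x"
  by (rule proj_eqI) auto

lemma proj_symmetric: "proj x \<bullet> y = x \<bullet> proj y"
  by (metis inner_proj_left inner_proj_right proj_in)

lemma norm_proj_le: "norm (proj x) \<le> norm x"
proof -
  have "(norm (proj x))\<^sup>2 = x \<bullet> proj x"
    by (simp add: power2_norm_eq_inner inner_proj_left)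
  also have "\<dots> \<le> norm x * norm (proj x)" by (rule norm_cauchy_schwarz)
  finally show ?thesis
    by (simp add: power2_eq_square) (metis mult_right_le_imp_le norm_ge_zero not_less order_le_less)
qed

lemma bounded_linear_proj: "bounded_linear proj"
proof (rule bounded_linear_intro[where K = 1])
  show "proj (x + y) = proj x + proj y" for x y
    by (rule proj_eqI) (auto intro: V_intros simp: inner_add_left inner_proj_left)
  show "proj (r *\<^sub>R x) = r *\<^sub>R proj x" for r x
    by (rule proj_eqI) (auto intro: V_intros simp: inner_proj_left)
  show "norm (proj x) \<le> norm x * 1" for x using norm_proj_le by simp
qed

lemma closed_subspace_trivial_complement:
  assumes "subspace R" "uniform_space_class.complete R" "R \<subseteq> V" "\<And>h. h \<in> V \<Longrightarrow> (\<And>r. r \<in> R \<Longrightarrow> h \<bullet> r = 0) \<Longrightarrow> h = 0"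
  shows "R = V"
proof -
  interpret R: hilbert_subspace R using assms by unfold_locales
  have "x \<in> R" if "x \<in> V" for x
  proof -
    have "x - R.proj x = 0"
      using V_intros(3)[OF that subsetD[OF assms(3) R.proj_in]] R.proj_orth
      by (intro assms(4)) auto
    then show ?thesis using R.proj_in[of x] by simp
  qed
  with assms(3) show ?thesis by auto
qed

lemma dense_if_trivial_complement:
  assumes D: "subspace D" "D \<subseteq> V" and triv: "\<And>h. h \<in> V \<Longrightarrow> (\<And>d. d \<in> D \<Longrightarrow> h \<bullet> d = 0) \<Longrightarrow> h = 0"
  shows "V \<subseteq> closure D"
proof -
  have sub: "closure D \<subseteq> V" using D(2) V_closed closure_minimal by blast
  have "closure D = V"
  proof (rule closed_subspace_trivial_complement[OF subspace_closure[OF D(1)] _ sub])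
    show "uniform_space_class.complete (closure D)"
      using complete_Int_closed[OF V_complete closed_closure[of D]] sub by (simp only: Int_absorb1)
    show "h = 0" if "h \<in> V" "\<And>r. r \<in> closure D \<Longrightarrow> h \<bullet> r = 0" for h
      using that closure_subset by (intro triv) blast+
  qed
  then show ?thesis by simp
qed

section \<open>Adjoints and non-negative self-adjoint relations\<close>

definition adj :: "('h \<times> 'h) set \<Rightarrow> ('h \<times> 'h) set" where
  "adj S = {(y, z). y \<in> V \<and> z \<in> V \<and> (\<forall>x w. (x, w) \<in> S \<longrightarrow> y \<bullet> w = z \<bullet> x)}"

text \<open>Adjoints are always closed real subspaces, so \<open>adj S = S\<close> already makes
  \<open>S\<close> closed and linear, and density of the domain makes it single-valued. The adjoint
  uses only the real inner product; for complex-linear relations it is the usual one.\<close>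

definition nnsa :: "('h \<times> 'h) set \<Rightarrow> bool" where
  "nnsa S \<longleftrightarrow> adj S = S \<and> V \<subseteq> closure (Domain S) \<and> (\<forall>x y. (x, y) \<in> S \<longrightarrow> 0 \<le> x \<bullet> y)"

lemma adjI: "y \<in> V \<Longrightarrow> z \<in> V \<Longrightarrow> (\<And>x w. (x, w) \<in> S \<Longrightarrow> y \<bullet> w = z \<bullet> x) \<Longrightarrow> (y, z) \<in> adj S"
  unfolding adj_def by auto

lemma subspace_adj: "subspace (adj S)"
  unfolding subspace_def adj_def zero_prod_def
  by (auto simp: inner_add_left intro: V_intros)

lemma complete_adj: "uniform_space_class.complete (adj S)"
  unfolding complete_def
proof (intro allI impI, elim conjE)
  fix f assume f: "\<forall>n. f n \<in> adj S" and C: "Cauchy f"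
  have fV: "fst (f n) \<in> V" "snd (f n) \<in> V" for n using f by (metis (no_types, lifting) adj_def case_prod_beta mem_Collect_eq)+
  obtain a b where a: "a \<in> V" "(\<lambda>n. fst (f n)) \<longlonglongrightarrow> a" and b: "b \<in> V" "(\<lambda>n. snd (f n)) \<longlonglongrightarrow> b"
    using V_Cauchy[OF fV(1) Cauchy_fst[OF C]] V_Cauchy[OF fV(2) Cauchy_snd[OF C]] by blast
  have "(a, b) \<in> adj S"
  proof (rule adjI[OF a(1) b(1)])
    fix x w assume "(x, w) \<in> S"
    then have "fst (f n) \<bullet> w = snd (f n) \<bullet> x" for n
      using f by (auto simp: adj_def split: prod.splits)
    moreover have "(\<lambda>n. fst (f n) \<bullet> w) \<longlonglongrightarrow> a \<bullet> w" "(\<lambda>n. snd (f n) \<bullet> x) \<longlonglongrightarrow> b \<bullet> x"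
      by (intro tendsto_intros a b)+
    ultimately show "a \<bullet> w = b \<bullet> x" using LIMSEQ_unique by simp
  qed
  moreover have "f \<longlonglongrightarrow> (a, b)" using tendsto_Pair[OF a(2) b(2)] by simp
  ultimately show "\<exists>l\<in>adj S. f \<longlonglongrightarrow> l" by blast
qed

lemma nnsa_adj: "nnsa S \<Longrightarrow> adj S = S" by (simp add: nnsa_def)
lemma nnsa_dense: "nnsa S \<Longrightarrow> V \<subseteq> closure (Domain S)" by (simp add: nnsa_def)
lemma nnsa_nonneg: "nnsa S \<Longrightarrow> (x, y) \<in> S \<Longrightarrow> 0 \<le> x \<bullet> y" by (simp add: nnsa_def)

lemma nnsa_subspace: "nnsa S \<Longrightarrow> subspace S"
  using subspace_adj nnsa_adj by metis

lemma nnsa_complete: "nnsa S \<Longrightarrow> uniform_space_class.complete S"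
  using complete_adj nnsa_adj by metis

lemma nnsa_in_V: "nnsa S \<Longrightarrow> (x, y) \<in> S \<Longrightarrow> x \<in> V" "nnsa S \<Longrightarrow> (x, y) \<in> S \<Longrightarrow> y \<in> V"
  using nnsa_adj[of S] unfolding adj_def by blast+

lemma nnsa_symmetric: "nnsa S \<Longrightarrow> (x, y) \<in> S \<Longrightarrow> (x', y') \<in> S \<Longrightarrow> x \<bullet> y' = y \<bullet> x'"
  using nnsa_adj[of S] unfolding adj_def by blast

lemma nnsa_memI:
  "nnsa S \<Longrightarrow> y \<in> V \<Longrightarrow> z \<in> V \<Longrightarrow> (\<And>x w. (x, w) \<in> S \<Longrightarrow> y \<bullet> w = z \<bullet> x) \<Longrightarrow> (y, z) \<in> S"
  using adjI nnsa_adj by metis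

lemma graph_add: "subspace S \<Longrightarrow> (x, y) \<in> S \<Longrightarrow> (x', y') \<in> S \<Longrightarrow> (x + x', y + y') \<in> S"
  using subspace_add[of S "(x, y)" "(x', y')"] by simp

lemma graph_diff: "subspace S \<Longrightarrow> (x, y) \<in> S \<Longrightarrow> (x', y') \<in> S \<Longrightarrow> (x - x', y - y') \<in> S"
  using subspace_diff[of S "(x, y)" "(x', y')"] by simp

lemma graph_scale: "subspace S \<Longrightarrow> (x, y) \<in> S \<Longrightarrow> (c *\<^sub>R x, c *\<^sub>R y) \<in> S"
  using subspace_scale[of S "(x, y)" c] by simp

lemma nnsa_zero: "nnsa S \<Longrightarrow> (0, w) \<in> S \<Longrightarrow> w = 0"
proof -
  assume S: "nnsa S" and w: "(0, w) \<in> S"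
  have "w \<bullet> x = 0" if "x \<in> Domain S" for x using nnsa_symmetric[OF S w] that by force
  from orthogonal_to_closure[OF this] have "w \<bullet> w = 0"
    using nnsa_dense[OF S] nnsa_in_V(2)[OF S w] by blast
  then show ?thesis by simp
qed

lemma nnsa_unique: "nnsa S \<Longrightarrow> (x, y) \<in> S \<Longrightarrow> (x, y') \<in> S \<Longrightarrow> y = y'"
  using nnsa_zero[of S "y - y'"] graph_diff[OF nnsa_subspace, of S x y x y'] by simp

lemma nnsa_limit:
  assumes "nnsa S" "\<And>n. (f n, g n) \<in> S" "f \<longlonglongrightarrow> x" "g \<longlonglongrightarrow> y"
  shows "(x, y) \<in> S"
  using complete_imp_closed[OF nnsa_complete[OF assms(1)]] assms(2) tendsto_Pair[OF assms(3,4)]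
    closed_sequentially[of S "\<lambda>n. (f n, g n)"] by blast

lemma norm_pair_le_norm_sum:
  fixes x y :: 'h assumes "0 \<le> x \<bullet> y" shows "norm (x, y) \<le> norm (x + y)"
proof -
  have "(norm (x, y))\<^sup>2 \<le> (norm (x + y))\<^sup>2"
  proof -
    have "(norm (x, y))\<^sup>2 = x \<bullet> x + y \<bullet> y" by (simp add: power2_norm_eq_inner)
    moreover have "(norm (x + y))\<^sup>2 = x \<bullet> x + y \<bullet> y + 2 * (x \<bullet> y)"
      by (simp add: power2_norm_eq_inner inner_add_left inner_add_right inner_commute[of y x])
    ultimately show ?thesis using assms by simp
  qed
  then show ?thesis by (rule power2_le_imp_le) simp
qed

text \<open>Surjectivity of 1 + K. Non-negativity makes (x, y) \<mapsto> x + y bounded below, so the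
  image of the complete \<open>K\<close> is complete; a complete subspace with trivial orthogonal
  complement is all of \<open>V\<close>.\<close>

lemma sum_range:
  assumes K: "subspace K" "uniform_space_class.complete K" "K \<subseteq> V \<times> V"
    and nonneg: "\<And>x y. (x, y) \<in> K \<Longrightarrow> 0 \<le> x \<bullet> y"
    and triv: "\<And>h. h \<in> V \<Longrightarrow> (\<And>x y. (x, y) \<in> K \<Longrightarrow> h \<bullet> (x + y) = 0) \<Longrightarrow> h = 0"
    and h: "h \<in> V"
  shows "\<exists>x y. (x, y) \<in> K \<and> x + y = h"
proof -
  have bl: "bounded_linear (\<lambda>p :: 'h \<times> 'h. fst p + snd p)"
    by (intro bounded_linear_add bounded_linear_fst bounded_linear_snd)
  let ?R = "(\<lambda>p. fst p + snd p) ` K"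
  have "?R = V"
  proof (rule closed_subspace_trivial_complement)
    show "subspace ?R" using K(1) bl by (intro linear_subspace_image) (auto dest: bounded_linear.linear)
    show "uniform_space_class.complete ?R"
    proof (rule complete_isometric_image[of 1])
      show "\<forall>x\<in>K. 1 * norm x \<le> norm (fst x + snd x)"
        using norm_pair_le_norm_sum nonneg by (auto split: prod.splits)
    qed (use K bl in auto)
    show "?R \<subseteq> V" using K(3) V_intros(2) by fastforce
    show "h = 0" if "h \<in> V" "\<And>r. r \<in> ?R \<Longrightarrow> h \<bullet> r = 0" for h
      using that(2)[OF imageI, of "(x, y)" for x y] that(1) by (intro triv) auto
  qed
  with h have "h \<in> ?R" by blast
  then show ?thesis by force
qed

text \<open>A symmetric relation with 1 + K onto is self-adjoint: an element of the adjoint and the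
  element of \<open>K\<close> with the same sum of components differ by some (d, -d) in the adjoint,
  and then \<open>d\<close> is orthogonal to the range of 1 + K.\<close>

lemma nnsaI:
  assumes sub: "K \<subseteq> V \<times> V" "subspace K"
    and nonneg: "\<And>x y. (x, y) \<in> K \<Longrightarrow> 0 \<le> x \<bullet> y"
    and sym: "\<And>x y x' y'. (x, y) \<in> K \<Longrightarrow> (x', y') \<in> K \<Longrightarrow> x \<bullet> y' = y \<bullet> x'"
    and dense: "V \<subseteq> closure (Domain K)"
    and range: "\<And>h. h \<in> V \<Longrightarrow> \<exists>x y. (x, y) \<in> K \<and> x + y = h"
  shows "nnsa K"
  unfolding nnsa_def
proof (intro conjI)
  show "adj K = K"
  proof
    show "K \<subseteq> adj K" unfolding adj_def using sub(1) sym by fast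
    show "adj K \<subseteq> K"
    proof clarify
      fix y z assume yz: "(y, z) \<in> adj K"
      then have V: "y \<in> V" "z \<in> V" and a: "\<And>x w. (x, w) \<in> K \<Longrightarrow> y \<bullet> w = z \<bullet> x"
        unfolding adj_def by auto
      obtain a b where ab: "(a, b) \<in> K" "a + b = y + z" using range V V_intros(2) by metis
      obtain x w where xw: "(x, w) \<in> K" "x + w = y - a"
        using range V V_intros(3) ab sub(1) by (metis mem_Sigma_iff subsetD)
      have "(y - a) \<bullet> w = (z - b) \<bullet> x"
        using a[OF xw(1)] sym[OF ab(1) xw(1)] by (simp add: inner_diff_left)
      moreover have "z - b = - (y - a)" using ab(2) by (simp add: algebra_simps)
      ultimately have "(y - a) \<bullet> w = - ((y - a) \<bullet> x)" by (simp only: inner_minus_left)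
      then have "(y - a) \<bullet> (x + w) = 0" by (simp only: inner_add_right)
      with xw have "y = a" by simp
      with ab show "(y, z) \<in> K" by simp
    qed
  qed
qed (use dense nonneg in auto)

text \<open>The resolvent \<open>(1 + S)\<^sup>-\<^sup>1\<close>, extended by \<open>0\<close> to the orthogonal complement of \<open>V\<close>.\<close>

definition res :: "('h \<times> 'h) set \<Rightarrow> 'h \<Rightarrow> 'h" where
  "res S x = (SOME a. (a, proj x - a) \<in> S)"

lemma res_mem: assumes S: "nnsa S" shows "(res S x, proj x - res S x) \<in> S"
proof -
  have "\<exists>a b. (a, b) \<in> S \<and> a + b = proj x"
  proof (rule sum_range[OF nnsa_subspace[OF S] nnsa_complete[OF S]])
    show "S \<subseteq> V \<times> V" using nnsa_in_V[OF S] by auto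
    fix h assume h: "h \<in> V" and o: "\<And>x y. (x, y) \<in> S \<Longrightarrow> h \<bullet> (x + y) = 0"
    \<comment> \<open>Orthogonality to every x + y says exactly that (h, -h) belongs to the adjoint
      of \<open>S\<close>; non-negativity of \<open>S\<close> then reads h \<bullet> h \<le>
      0.\<close>
    have "(h, - h) \<in> S"
      using o h V_intros(5) by (intro nnsa_memI[OF S]) (auto simp: inner_add_right eq_neg_iff_add_eq_0 add.commute)
    from nnsa_nonneg[OF S this] have "h \<bullet> h \<le> 0" by simp
    then show "h = 0" using inner_gt_zero_iff[of h] by fastforce
  qed (use nnsa_nonneg[OF S] in auto)
  then obtain a b where ab: "(a, b) \<in> S" "a + b = proj x" by blast
  then have "b = proj x - a" by (simp add: algebra_simps)
  with ab have "(a, proj x - a) \<in> S" by simp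
  then show ?thesis unfolding res_def by (rule someI)
qed

lemma nnsa_sum_unique:
  assumes "nnsa S" "(a, b) \<in> S" "(a', b') \<in> S" "a + b = a' + b'" shows "a = a'"
proof -
  have "(a - a', b - b') \<in> S" using assms graph_diff nnsa_subspace by blast
  moreover have "b - b' = - (a - a')" using assms(4) by (simp add: algebra_simps)
  ultimately have "(a - a') \<bullet> (- (a - a')) \<ge> 0" using nnsa_nonneg[OF assms(1)] by metis
  then have "(a - a') \<bullet> (a - a') \<le> 0" unfolding inner_minus_right by simp
  then have "a - a' = 0" using inner_gt_zero_iff[of "a - a'"] by linarith
  then show ?thesis by simp
qed

lemma res_eqI: "nnsa S \<Longrightarrow> (a, proj x - a) \<in> S \<Longrightarrow> res S x = a"
  using nnsa_sum_unique[OF _ res_mem] by fastforce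

lemma res_sum: "nnsa S \<Longrightarrow> (a, b) \<in> S \<Longrightarrow> res S (a + b) = a"
  by (rule res_eqI) (auto simp: V_intros nnsa_in_V)

lemma res_in_V: "nnsa S \<Longrightarrow> res S x \<in> V"
  using res_mem nnsa_in_V by blast

section \<open>Bounded positive operators and the resolvent\<close>

definition posop :: "('h \<Rightarrow> 'h) \<Rightarrow> bool" where
  "posop A \<longleftrightarrow> bounded_linear A \<and> (\<forall>x. A x \<in> V) \<and> (\<forall>x y. A x \<bullet> y = x \<bullet> A y) \<and> (\<forall>x. 0 \<le> x \<bullet> A x)"

lemma posop_linear: "posop A \<Longrightarrow> bounded_linear A" by (simp add: posop_def)
lemma posop_in_V: "posop A \<Longrightarrow> A x \<in> V" by (simp add: posop_def)
lemma posop_symmetric: "posop A \<Longrightarrow> A x \<bullet> y = x \<bullet> A y" by (simp add: posop_def)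
lemma posop_nonneg: "posop A \<Longrightarrow> 0 \<le> x \<bullet> A x" by (simp add: posop_def)

text \<open>Symmetry holds on the whole ambient space while the values stay in \<open>V\<close>.
  Hence a \<open>posop\<close> vanishes on the orthogonal complement of \<open>V\<close>, and
  \<open>proj\<close> plays the role of the identity.\<close>

lemma posop_proj: "posop A \<Longrightarrow> A (proj x) = A x"
proof (rule eq_if_inner_V)
  fix v assume "posop A" "v \<in> V"
  then show "A (proj x) \<bullet> v = A x \<bullet> v" by (simp add: posop_symmetric inner_proj_left posop_in_V)
qed (auto simp: posop_in_V)

lemma posop_Cauchy_Schwarz:
  assumes A: "posop A" shows "(x \<bullet> A y)\<^sup>2 \<le> (x \<bullet> A x) * (y \<bullet> A y)"
proof (rule quadratic_nonneg_imp)
  fix t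
  interpret A: bounded_linear A by (rule posop_linear[OF A])
  have "y \<bullet> A x = x \<bullet> A y" using posop_symmetric[OF A, of y x] by (simp add: inner_commute)
  moreover have "0 \<le> (x + t *\<^sub>R y) \<bullet> A (x + t *\<^sub>R y)" by (rule posop_nonneg[OF A])
  ultimately show "0 \<le> x \<bullet> A x + 2 * t * (x \<bullet> A y) + t\<^sup>2 * (y \<bullet> A y)"
    by (simp add: A.add A.scaleR inner_add_left inner_add_right power2_eq_square algebra_simps)
qed

text \<open>Cauchy-Schwarz for the form of \<open>A\<close>, with A x as second argument. Applied to
  increments, it turns convergence of the numbers x \<bullet> A x into norm convergence of the
  vectors A x.\<close>

lemma posop_norm_le_form:
  assumes A: "posop A" and c: "\<And>x. norm (A x) \<le> c * norm x"
  shows "(norm (A x))\<^sup>2 \<le> c * (x \<bullet> A x)"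
proof (cases "A x = 0")
  case False
  have "((norm (A x))\<^sup>2)\<^sup>2 = (x \<bullet> A (A x))\<^sup>2"
    using posop_symmetric[OF A, of x "A x"] by (simp add: power2_norm_eq_inner)
  also have "\<dots> \<le> (x \<bullet> A x) * (A x \<bullet> A (A x))" by (rule posop_Cauchy_Schwarz[OF A])
  also have "\<dots> \<le> (x \<bullet> A x) * (norm (A x) * (c * norm (A x)))"
    using order_trans[OF norm_cauchy_schwarz mult_left_mono[OF c[of "A x"] norm_ge_zero]]
    by (intro mult_left_mono posop_nonneg[OF A])
  also have "\<dots> = (norm (A x))\<^sup>2 * (c * (x \<bullet> A x))" by (simp add: power2_eq_square)
  finally have "(norm (A x))\<^sup>2 * (norm (A x))\<^sup>2 \<le> (norm (A x))\<^sup>2 * (c * (x \<bullet> A x))"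
    by (simp only: power2_eq_square[of "(norm (A x))\<^sup>2"])
  then show ?thesis using False by (metis mult_left_le_imp_le zero_less_norm_iff zero_less_power)
qed (simp add: posop_nonneg[OF A])

lemma posop_form_zero: assumes A: "posop A" "x \<bullet> A x = 0" shows "A x = 0"
proof -
  have "(A x \<bullet> A x)\<^sup>2 \<le> (A x \<bullet> A (A x)) * (x \<bullet> A x)"
    by (rule posop_Cauchy_Schwarz[OF A(1)])
  with A(2) show ?thesis by simp
qed

lemma contraction_form_le:
  assumes "\<And>x. norm (A x) \<le> norm x" and A: "posop A" shows "x \<bullet> A x \<le> x \<bullet> proj x"
proof -
  have "x \<bullet> A x = proj x \<bullet> A (proj x)"
    using A by (metis inner_proj_left posop_in_V posop_proj)
  also have "\<dots> \<le> norm (proj x) * norm (proj x)"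
    using norm_cauchy_schwarz assms(1) by (meson mult_left_mono norm_ge_zero order_trans)
  also have "\<dots> = x \<bullet> proj x"
    by (metis inner_proj_left power2_eq_square power2_norm_eq_inner proj_in)
  finally show ?thesis .
qed

lemma form_le_contraction:
  assumes "\<And>x. x \<bullet> A x \<le> x \<bullet> x" and A: "posop A" shows "norm (A x) \<le> norm x"
proof (cases "A x = 0")
  case False
  have "((norm (A x))\<^sup>2)\<^sup>2 = (x \<bullet> A (A x))\<^sup>2"
    using posop_symmetric[OF A, of x "A x"] by (simp add: power2_norm_eq_inner)
  also have "\<dots> \<le> (x \<bullet> A x) * (A x \<bullet> A (A x))" by (rule posop_Cauchy_Schwarz[OF A])
  also have "\<dots> \<le> (x \<bullet> x) * (A x \<bullet> A x)"
    using posop_nonneg[OF A] assms(1) by (intro mult_mono) auto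
  also have "\<dots> = (norm x)\<^sup>2 * (norm (A x))\<^sup>2" by (simp add: power2_norm_eq_inner)
  finally have "(norm (A x))\<^sup>2 * (norm (A x))\<^sup>2 \<le> (norm x)\<^sup>2 * (norm (A x))\<^sup>2"
    by (simp only: power2_eq_square[of "(norm (A x))\<^sup>2"])
  then have "(norm (A x))\<^sup>2 \<le> (norm x)\<^sup>2" using False by (metis mult_right_le_imp_le zero_less_norm_iff zero_less_power)
  then show ?thesis by (rule power2_le_imp_le) simp
qed simp

lemma posop_complement:
  assumes A: "posop A" and le: "\<And>x. norm (A x) \<le> norm x"
  shows "posop (\<lambda>x. proj x - A x)" "norm (proj x - A x) \<le> norm x"
proof -
  show *: "posop (\<lambda>x. proj x - A x)"
    unfolding posop_def
  proof (intro conjI allI)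
    show "bounded_linear (\<lambda>x. proj x - A x)"
      by (intro bounded_linear_sub bounded_linear_proj posop_linear A)
    show "proj x - A x \<in> V" for x using posop_in_V[OF A] by (intro V_intros) auto
    show "(proj x - A x) \<bullet> y = x \<bullet> (proj y - A y)" for x y
      by (simp add: inner_diff_left inner_diff_right proj_symmetric posop_symmetric[OF A])
    show "0 \<le> x \<bullet> (proj x - A x)" for x
      using contraction_form_le[OF le A] by (simp add: inner_diff_right)
  qed
  show "norm (proj x - A x) \<le> norm x"
  proof (rule form_le_contraction[OF _ *])
    fix x
    have "x \<bullet> proj x \<le> x \<bullet> x"
      by (metis inner_proj_left norm_proj_le power2_norm_eq_inner power_mono norm_ge_zero proj_in)
    then show "x \<bullet> (proj x - A x) \<le> x \<bullet> x"
      using posop_nonneg[OF A, of x] by (simp add: inner_diff_right)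
  qed
qed

lemma posop_res: assumes S: "nnsa S" shows "posop (res S)" "norm (res S x) \<le> norm x"
proof -
  have le: "norm (res S x) \<le> norm x" for x
  proof -
    have "(norm (res S x))\<^sup>2 \<le> res S x \<bullet> proj x"
      using nnsa_nonneg[OF S res_mem[OF S]] by (simp add: inner_diff_right power2_norm_eq_inner)
    also have "\<dots> \<le> norm (res S x) * norm x"
      using norm_cauchy_schwarz[of "res S x" "proj x"] norm_proj_le[of x]
      by (meson mult_left_mono norm_ge_zero order_trans)
    finally show ?thesis
      by (cases "res S x = 0") (simp_all add: power2_eq_square)
  qed
  then show "norm (res S x) \<le> norm x" .
  interpret P: bounded_linear proj by (rule bounded_linear_proj)
  show "posop (res S)"
    unfolding posop_def
  proof (intro conjI allI)
    show "bounded_linear (res S)"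
    proof (rule bounded_linear_intro[where K = 1])
      fix x y r
      show "res S (x + y) = res S x + res S y"
      proof (rule res_eqI[OF S])
        show "(res S x + res S y, proj (x + y) - (res S x + res S y)) \<in> S"
          using graph_add[OF nnsa_subspace[OF S] res_mem[OF S, of x] res_mem[OF S, of y]]
          by (simp add: P.add algebra_simps)
      qed
      show "res S (r *\<^sub>R x) = r *\<^sub>R res S x"
      proof (rule res_eqI[OF S])
        show "(r *\<^sub>R res S x, proj (r *\<^sub>R x) - r *\<^sub>R res S x) \<in> S"
          using graph_scale[OF nnsa_subspace[OF S] res_mem[OF S, of x]]
          by (simp add: P.scaleR scaleR_diff_right)
      qed
    qed (use le in simp)
    show "res S x \<in> V" for x using S by (rule res_in_V)
    show "res S x \<bullet> y = x \<bullet> res S y" for x y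
    proof -
      have "res S x \<bullet> (proj y - res S y) = (proj x - res S x) \<bullet> res S y"
        by (intro nnsa_symmetric[OF S] res_mem[OF S])
      then show ?thesis
        by (simp add: inner_diff_left inner_diff_right inner_proj_left inner_proj_right res_in_V[OF S])
    qed
    show "0 \<le> x \<bullet> res S x" for x
    proof -
      have "0 \<le> res S x \<bullet> (proj x - res S x)" by (rule nnsa_nonneg[OF S res_mem[OF S]])
      then have "res S x \<bullet> res S x \<le> res S x \<bullet> x"
        by (simp add: inner_diff_right inner_proj_right res_in_V[OF S])
      then show ?thesis by (metis inner_commute inner_ge_zero order_trans)
    qed
  qed
qed

end

text \<open>
  For a positive contraction \<open>X\<close>, the iterates increase to \<open>1 - (1 - X)\<^sup>1\<^sup>/\<^sup>2\<close>. Their increments are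
  polynomials in \<open>X\<close> with nonnegative coefficients, which is why they are positive.
\<close>

primrec sqrt_iter :: "('h::real_inner \<Rightarrow> 'h) \<Rightarrow> nat \<Rightarrow> 'h \<Rightarrow> 'h" where
  "sqrt_iter X 0 = (\<lambda>x. 0)"
| "sqrt_iter X (Suc n) = (\<lambda>x. (1/2) *\<^sub>R (X x + sqrt_iter X n (sqrt_iter X n x)))"

text \<open>The power 0 is left out because the identity does not map the ambient space into
  \<open>V\<close>; all members of the cone are therefore of the type \<open>posop\<close> as soon
  as \<open>X\<close> is.\<close>

inductive power_cone :: "('h::real_inner \<Rightarrow> 'h) \<Rightarrow> ('h \<Rightarrow> 'h) \<Rightarrow> bool" for X where
  zero: "power_cone X (\<lambda>x. 0)"
| power: "power_cone X (X ^^ Suc n)"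
| add: "power_cone X A \<Longrightarrow> power_cone X B \<Longrightarrow> power_cone X (\<lambda>x. A x + B x)"
| scale: "0 \<le> c \<Longrightarrow> power_cone X A \<Longrightarrow> power_cone X (\<lambda>x. c *\<^sub>R A x)"

lemma bounded_linear_funpow:
  fixes X :: "'h::real_normed_vector \<Rightarrow> 'h"
  shows "bounded_linear X \<Longrightarrow> bounded_linear (X ^^ n)"
proof (induction n)
  case 0
  have "X ^^ 0 = (\<lambda>x. x)" by (simp add: fun_eq_iff)
  then show ?case using bounded_linear_ident by metis
next
  case (Suc n)
  then show ?case using bounded_linear_compose[of X "X ^^ n"] by (simp add: o_def)
qed

lemma power_cone_power_comp:
  assumes X: "bounded_linear X" and B: "power_cone X B"
  shows "power_cone X (\<lambda>x. (X ^^ Suc n) (B x))"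
proof -
  interpret p: bounded_linear "X ^^ Suc n" by (rule bounded_linear_funpow[OF X])
  show ?thesis using B
  proof induction
    case zero show ?case unfolding p.zero by (rule power_cone.zero)
  next
    case (power m)
    have "(\<lambda>x. (X ^^ Suc n) ((X ^^ Suc m) x)) = X ^^ Suc (n + Suc m)"
      using funpow_add[of "Suc n" "Suc m" X] by (simp add: fun_eq_iff)
    then show ?case by (metis power_cone.power)
  next
    case (add A B) then show ?case unfolding p.add by (intro power_cone.add)
  next
    case (scale c A) then show ?case unfolding p.scaleR by (intro power_cone.scale)
  qed
qed

lemma power_cone_comp:
  assumes X: "bounded_linear X" and "power_cone X A" and B: "power_cone X B"
  shows "power_cone X (\<lambda>x. A (B x))"
  using assms(2)
proof induction
  case (power n)
  show ?case by (rule power_cone_power_comp[OF X B])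
qed (auto intro: power_cone.intros)

lemma power_cone_iter:
  assumes X: "bounded_linear X" shows "power_cone X (sqrt_iter X n)"
proof (induction n)
  case (Suc n)
  have "power_cone X X" using power_cone.power[of X 0] by simp
  then show ?case
    unfolding sqrt_iter.simps using Suc power_cone_comp[OF X Suc Suc]
    by (intro power_cone.scale power_cone.add) simp_all
qed (simp add: power_cone.zero)

section \<open>Square roots of bounded positive operators\<close>

context hilbert_subspace
begin

lemma posop_power: assumes X: "posop X" shows "posop (X ^^ Suc n)"
  unfolding posop_def
proof (intro conjI allI)
  show "bounded_linear (X ^^ Suc n)" by (intro bounded_linear_funpow posop_linear X)
  show "(X ^^ Suc n) x \<in> V" for x by (simp add: posop_in_V[OF X])
  have sym: "(X ^^ m) x \<bullet> y = x \<bullet> (X ^^ m) y" for m x y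
  proof (induction m arbitrary: x y)
    case (Suc m)
    have "(X ^^ Suc m) x \<bullet> y = (X ^^ m) x \<bullet> X y" by (simp add: posop_symmetric[OF X])
    also have "\<dots> = x \<bullet> (X ^^ Suc m) y" by (simp only: Suc funpow_Suc_right o_apply)
    finally show ?case .
  qed simp
  then show "(X ^^ Suc n) x \<bullet> y = x \<bullet> (X ^^ Suc n) y" for x y .
  \<comment> \<open>An even power gives the squared norm of a smaller power of \<open>X\<close> at
    \<open>x\<close>, an odd one the form of \<open>X\<close> at that vector.\<close>
  have "0 \<le> x \<bullet> (X ^^ m) x" for m x
  proof (cases "even m")
    case True
    then obtain p where "m = p + p" by (metis evenE mult_2)
    then have "x \<bullet> (X ^^ m) x = (X ^^ p) x \<bullet> (X ^^ p) x" by (simp add: funpow_add sym)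
    then show ?thesis by simp
  next
    case False
    then obtain p where "m = p + Suc p" by (metis add_Suc_right mult_2 oddE Suc_eq_plus1)
    then have "x \<bullet> (X ^^ m) x = (X ^^ p) x \<bullet> X ((X ^^ p) x)" by (simp only: funpow_add o_apply sym funpow.simps)
    then show ?thesis using posop_nonneg[OF X] by simp
  qed
  then show "0 \<le> x \<bullet> (X ^^ Suc n) x" for x .
qed

lemma posop_zero: "posop (\<lambda>x. 0)"
  unfolding posop_def by (simp add: V_intros)

lemma posop_add: "posop A \<Longrightarrow> posop B \<Longrightarrow> posop (\<lambda>x. A x + B x)"
  unfolding posop_def by (auto intro: V_intros bounded_linear_add simp: inner_add_left inner_add_right)

lemma posop_scale: "0 \<le> c \<Longrightarrow> posop A \<Longrightarrow> posop (\<lambda>x. c *\<^sub>R A x)"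
  unfolding posop_def by (auto intro: V_intros bounded_linear_const_scaleR)

lemma posop_power_cone: "power_cone X A \<Longrightarrow> posop X \<Longrightarrow> posop A"
  by (induction rule: power_cone.induct) (auto intro: posop_zero posop_power posop_add posop_scale simp del: funpow.simps)

lemma power_cone_increment:
  assumes X: "posop X"
  shows "power_cone X (\<lambda>x. sqrt_iter X (Suc n) x - sqrt_iter X n x)"
proof (induction n)
  case 0
  show ?case using power_cone.scale[OF _ power_cone.power[of X 0], of "1/2"] by simp
next
  case (Suc n)
  note bl = posop_linear[OF X]
  interpret a: bounded_linear "sqrt_iter X (Suc n)"
    by (rule posop_linear[OF posop_power_cone[OF power_cone_iter[OF bl] X]])
  let ?Y = "sqrt_iter X (Suc n)" and ?Z = "sqrt_iter X n"
  let ?d = "\<lambda>x. ?Y x - ?Z x"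
  \<comment> \<open>Y (Y x) - Z (Z x) = Y ((Y - Z) x) + (Y - Z) (Z x): the new increment is built
    from the old one and from iterates, all of which lie in the cone.\<close>
  have eq: "(\<lambda>x. sqrt_iter X (Suc (Suc n)) x - ?Y x) = (\<lambda>x. (1/2) *\<^sub>R (?Y (?d x) + ?d (?Z x)))"
  proof
    fix x
    have "sqrt_iter X (Suc (Suc n)) x - ?Y x
       = (1/2) *\<^sub>R (X x + ?Y (?Y x)) - (1/2) *\<^sub>R (X x + ?Z (?Z x))"
      by (simp only: sqrt_iter.simps)
    also have "\<dots> = (1/2) *\<^sub>R (?Y (?d x) + ?d (?Z x))"
      unfolding a.diff by (simp only: scaleR_diff_right[symmetric]) (simp del: sqrt_iter.simps)
    finally show "sqrt_iter X (Suc (Suc n)) x - ?Y x = (1/2) *\<^sub>R (?Y (?d x) + ?d (?Z x))" .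
  qed
  show ?case unfolding eq
    by (intro power_cone.scale power_cone.add power_cone_comp[OF bl _ Suc] power_cone_iter[OF bl]
        power_cone_comp[OF bl Suc]) simp
qed

lemma power_cone_mono:
  assumes X: "posop X" and "n \<le> m"
  shows "power_cone X (\<lambda>x. sqrt_iter X m x - sqrt_iter X n x)"
  using assms(2)
proof (induction m rule: dec_induct)
  case base then show ?case by (simp add: power_cone.zero)
next
  case (step m)
  from power_cone.add[OF power_cone_increment[OF X, of m] step.IH]
  show ?case by (simp del: sqrt_iter.simps)
qed

lemma norm_sqrt_iter:
  assumes X: "\<And>x. norm (X x) \<le> norm x" shows "norm (sqrt_iter X n x) \<le> norm x"
proof (induction n arbitrary: x)
  case (Suc n)
  have "norm (sqrt_iter X (Suc n) x) \<le> (1/2) * (norm (X x) + norm (sqrt_iter X n (sqrt_iter X n x)))"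
    using norm_triangle_ineq by simp
  also have "\<dots> \<le> (1/2) * (norm x + norm x)"
    using X[of x] Suc[of "sqrt_iter X n x"] Suc[of x] by simp
  finally show ?case by simp
qed simp

text \<open>The numbers \<open>x \<bullet> sqrt_iter X n x\<close> increase and are bounded by the
  squared norm of \<open>x\<close>. Differences of iterates are positive operators of norm at most
  2, so \<open>posop_norm_le_form\<close> makes the vectors Cauchy.\<close>

lemma sqrt_iter_limit:
  assumes X: "posop X" and le: "\<And>x. norm (X x) \<le> norm x"
  shows "\<exists>l\<in>V. (\<lambda>n. sqrt_iter X n x) \<longlonglongrightarrow> l"
proof (rule V_Cauchy)
  note bl = posop_linear[OF X]
  have Y: "posop (sqrt_iter X n)" for n by (rule posop_power_cone[OF power_cone_iter[OF bl] X])
  have mono: "n \<le> m \<Longrightarrow> posop (\<lambda>x. sqrt_iter X m x - sqrt_iter X n x)" for m n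
    by (rule posop_power_cone[OF power_cone_mono[OF X] X])
  show "sqrt_iter X n x \<in> V" for n by (rule posop_in_V[OF Y])
  let ?a = "\<lambda>n. x \<bullet> sqrt_iter X n x"
  have "incseq ?a"
    using posop_nonneg[OF mono] by (intro incseq_SucI) (simp add: inner_diff_right del: sqrt_iter.simps)
  moreover have "?a n \<le> norm x * norm x" for n
    using order_trans[OF norm_cauchy_schwarz mult_left_mono[OF norm_sqrt_iter[OF le] norm_ge_zero]] by blast
  ultimately have "convergent ?a"
    using incseq_convergent[of ?a "norm x * norm x"] convergentI by blast
  then have C: "Cauchy ?a" by (rule convergent_Cauchy)
  show "Cauchy (\<lambda>n. sqrt_iter X n x)"
  proof (rule Cauchy_by_square[OF _ C])
    fix m n :: nat assume "n \<le> m"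
    have "norm (sqrt_iter X m y - sqrt_iter X n y) \<le> 2 * norm y" for y
      using norm_triangle_ineq4[of "sqrt_iter X m y" "sqrt_iter X n y"]
        norm_sqrt_iter[OF le, of m y] norm_sqrt_iter[OF le, of n y] by linarith
    from posop_norm_le_form[OF mono[OF \<open>n \<le> m\<close>] this]
    show "(norm (sqrt_iter X m x - sqrt_iter X n x))\<^sup>2 \<le> 2 * (?a m - ?a n)"
      by (simp add: inner_diff_right)
  qed simp
qed

text \<open>With X = 1 - A, the limit Y of the iterates solves 2 Y = X + Y^2, so (1 - Y)^2 = 1 - X =
  A. The commutation clause holds because each iterate is a polynomial in \<open>X\<close>;
  uniqueness and the products of several roots below depend on it.\<close>

lemma bounded_sqrt:
  assumes A: "posop A" and le: "\<And>x. norm (A x) \<le> norm x"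
  shows "\<exists>C. posop C \<and> (\<forall>x. C (C x) = A x) \<and> (\<forall>x. norm (C x) \<le> norm x) \<and>
    (\<forall>K. bounded_linear K \<longrightarrow> (\<forall>y. K (proj y) = proj (K y)) \<longrightarrow> (\<forall>y. K (A y) = A (K y))
       \<longrightarrow> (\<forall>x. K (C x) = C (K x)))"
proof -
  define X where "X = (\<lambda>x. proj x - A x)"
  note X = posop_complement[OF A le, folded X_def]
  have X1: "posop X" and X2: "norm (X x) \<le> norm x" for x using X unfolding X_def by auto
  note bl = posop_linear[OF X1]
  let ?Y = "sqrt_iter X"
  have Yp: "posop (?Y n)" for n by (rule posop_power_cone[OF power_cone_iter[OF bl] X1])
  obtain Y where YV: "\<And>x. Y x \<in> V" and Y: "\<And>x. (\<lambda>n. ?Y n x) \<longlonglongrightarrow> Y x"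
    using sqrt_iter_limit[OF X1 X2] by metis
  have Yle: "norm (Y x) \<le> norm x" for x
    using LIMSEQ_le_const2[OF tendsto_norm[OF Y]] norm_sqrt_iter[OF X2] by blast
  have Ysym: "Y x \<bullet> y = x \<bullet> Y y" for x y
  proof -
    have "(\<lambda>n. ?Y n x \<bullet> y) \<longlonglongrightarrow> Y x \<bullet> y" "(\<lambda>n. x \<bullet> ?Y n y) \<longlonglongrightarrow> x \<bullet> Y y"
      by (intro tendsto_intros Y)+
    then show ?thesis using posop_symmetric[OF Yp] LIMSEQ_unique by simp
  qed
  have Ynn: "0 \<le> x \<bullet> Y x" for x
    using LIMSEQ_le_const[OF tendsto_inner[OF tendsto_const Y]] posop_nonneg[OF Yp] by blast
  have Yadd: "Y (x + y) = Y x + Y y" for x y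
  proof (rule LIMSEQ_unique[OF Y])
    show "(\<lambda>n. ?Y n (x + y)) \<longlonglongrightarrow> Y x + Y y"
      using tendsto_add[OF Y Y] bounded_linear.axioms(1)[OF posop_linear[OF Yp]]
      by (simp add: linear_add)
  qed
  have Ysc: "Y (r *\<^sub>R x) = r *\<^sub>R Y x" for r x
  proof (rule LIMSEQ_unique[OF Y])
    show "(\<lambda>n. ?Y n (r *\<^sub>R x)) \<longlonglongrightarrow> r *\<^sub>R Y x"
      using tendsto_scaleR[OF tendsto_const Y] bounded_linear.axioms(1)[OF posop_linear[OF Yp]]
      by (simp add: linear_scale)
  qed
  have Ybl: "bounded_linear Y"
    by (rule bounded_linear_intro[where K = 1]) (use Yadd Ysc Yle in auto)
  interpret Y: bounded_linear Y by (rule Ybl)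
  have Ypos: "posop Y" unfolding posop_def using Ybl YV Ysym Ynn by blast
  have fix1: "Y x = (1/2) *\<^sub>R (X x + Y (Y x))" for x
  proof (rule LIMSEQ_unique)
    show "(\<lambda>n. ?Y (Suc n) x) \<longlonglongrightarrow> Y x" using Y LIMSEQ_Suc by blast
    \<comment> \<open>The operators \<open>?Y n\<close> are contractions, so the inner argument may
      be replaced by its limit.\<close>
    have "(\<lambda>n. ?Y n (?Y n x) - ?Y n (Y x)) \<longlonglongrightarrow> 0"
    proof (rule Lim_null_comparison)
      show "\<forall>\<^sub>F n in sequentially. norm (?Y n (?Y n x) - ?Y n (Y x)) \<le> norm (?Y n x - Y x)"
      proof (intro always_eventually allI)
        fix n
        have "?Y n (?Y n x) - ?Y n (Y x) = ?Y n (?Y n x - Y x)"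
          using bounded_linear.axioms(1)[OF posop_linear[OF Yp]] by (simp add: linear_diff)
        then show "norm (?Y n (?Y n x) - ?Y n (Y x)) \<le> norm (?Y n x - Y x)"
          using norm_sqrt_iter[OF X2] by metis
      qed
      show "(\<lambda>n. norm (?Y n x - Y x)) \<longlonglongrightarrow> 0"
        using Y[of x] by (simp add: LIM_zero tendsto_norm_zero)
    qed
    from tendsto_add[OF this Y[of "Y x"]] have "(\<lambda>n. ?Y n (?Y n x)) \<longlonglongrightarrow> Y (Y x)" by simp
    then show "(\<lambda>n. ?Y (Suc n) x) \<longlonglongrightarrow> (1/2) *\<^sub>R (X x + Y (Y x))"
      unfolding sqrt_iter.simps by (intro tendsto_intros)
  qed
  have YY: "Y (Y x) = 2 *\<^sub>R Y x - X x" for x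
    using arg_cong[OF fix1[of x], of "\<lambda>z. 2 *\<^sub>R z"] by simp
  define C where "C = (\<lambda>x. proj x - Y x)"
  have C: "posop C" "norm (C x) \<le> norm x" for x
    using posop_complement[OF Ypos Yle] by (auto simp: C_def)
  have CC: "C (C x) = A x" for x
  proof -
    interpret P: bounded_linear proj by (rule bounded_linear_proj)
    have "C (C x) = proj x - Y x - (Y x - Y (Y x))"
      unfolding C_def Y.diff P.diff by (simp add: posop_proj[OF Ypos] YV)
    also have "\<dots> = proj x - X x" unfolding YY by (simp add: scaleR_2)
    finally show ?thesis by (simp add: X_def)
  qed
  have comm: "K (C x) = C (K x)"
    if K: "bounded_linear K" and KP: "\<And>y. K (proj y) = proj (K y)" and KA: "\<And>y. K (A y) = A (K y)"
    for K x
  proof -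
    interpret K: bounded_linear K by (rule K)
    have KX: "K (X y) = X (K y)" for y unfolding X_def by (simp add: K.diff KP KA)
    have KY: "K (?Y n y) = ?Y n (K y)" for n y
      by (induction n arbitrary: y) (simp_all add: K.zero K.scaleR K.add KX)
    have "K (Y y) = Y (K y)" for y
    proof (rule LIMSEQ_unique)
      show "(\<lambda>n. K (?Y n y)) \<longlonglongrightarrow> K (Y y)" by (rule K.tendsto[OF Y])
      show "(\<lambda>n. K (?Y n y)) \<longlonglongrightarrow> Y (K y)" unfolding KY by (rule Y)
    qed
    then show ?thesis unfolding C_def by (simp add: K.diff KP)
  qed
  show ?thesis using C CC comm by blast
qed

text \<open>Any positive root Z commutes with its square, hence with the constructed root C. Then Z
  + C annihilates v = Z x - C x, so both forms vanish at v, which gives Z v = C v = 0, and v is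
  orthogonal to itself.\<close>

lemma bounded_sqrt_unique:
  assumes X: "posop X" and Y: "posop Y" and eq: "\<And>x. X (X x) = Y (Y x)"
    and le: "\<And>x. norm (X (X x)) \<le> norm x"
  shows "X x = Y x"
proof -
  have sq: "posop (\<lambda>x. X (X x))"
    unfolding posop_def
  proof (intro conjI allI)
    show "bounded_linear (\<lambda>x. X (X x))"
      using bounded_linear_compose[OF posop_linear[OF X] posop_linear[OF X]] .
    show "X (X x) \<in> V" for x by (rule posop_in_V[OF X])
    show "X (X x) \<bullet> y = x \<bullet> X (X y)" for x y by (simp only: posop_symmetric[OF X])
    show "0 \<le> x \<bullet> X (X x)" for x unfolding posop_symmetric[OF X, of x "X x", symmetric] by simp
  qed
  obtain C where C: "posop C" "\<And>x. C (C x) = X (X x)"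
    and com: "\<And>K x. bounded_linear K \<Longrightarrow> (\<And>y. K (proj y) = proj (K y)) \<Longrightarrow> (\<And>y. K (X (X y)) = X (X (K y)))
       \<Longrightarrow> K (C x) = C (K x)"
    using bounded_sqrt[OF sq le] by blast
  have key: "Z x = C x" if Z: "posop Z" and ZZ: "\<And>x. Z (Z x) = X (X x)" for Z x
  proof -
    interpret Z: bounded_linear Z by (rule posop_linear[OF Z])
    interpret C: bounded_linear C by (rule posop_linear[OF C(1)])
    have ZC: "Z (C y) = C (Z y)" for y
    proof (rule com[OF Z.bounded_linear_axioms])
      show "Z (proj y) = proj (Z y)" for y by (simp add: posop_proj[OF Z] posop_in_V[OF Z])
      show "Z (X (X y)) = X (X (Z y))" for y by (simp only: ZZ[symmetric])
    qed
    define v where "v = Z x - C x"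
    have "Z v + C v = 0" unfolding v_def Z.diff C.diff by (simp add: ZZ ZC C(2))
    then have "v \<bullet> Z v + v \<bullet> C v = 0" by (metis inner_add_right inner_zero_right)
    then have "v \<bullet> Z v = 0" "v \<bullet> C v = 0"
      using posop_nonneg[OF Z, of v] posop_nonneg[OF C(1), of v] by linarith+
    then have 0: "Z v = 0" "C v = 0"
      using posop_form_zero[OF Z] posop_form_zero[OF C(1)] by blast+
    have "v \<bullet> v = v \<bullet> Z x - v \<bullet> C x" by (simp add: v_def inner_diff_right)
    also have "\<dots> = Z v \<bullet> x - C v \<bullet> x" by (simp add: posop_symmetric[OF Z] posop_symmetric[OF C(1)])
    finally have "v = 0" using 0 by simp
    then show ?thesis by (simp add: v_def)
  qed
  show ?thesis using key[OF X refl] key[OF Y eq[symmetric]] by (rule trans[OF _ sym])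
qed

section \<open>Square roots of unbounded non-negative self-adjoint relations\<close>

lemma nnsa_iff_res:
  assumes Q: "nnsa Q"
  shows "(x, y) \<in> Q \<longleftrightarrow> (\<exists>f\<in>V. x = res Q f \<and> y = f - res Q f)"
proof
  assume xy: "(x, y) \<in> Q"
  then have V: "x \<in> V" "y \<in> V" using nnsa_in_V[OF Q] by blast+
  have r: "res Q (x + y) = x" by (rule res_sum[OF Q xy])
  then show "\<exists>f\<in>V. x = res Q f \<and> y = f - res Q f"
    using V V_intros(2) by (intro bexI[of _ "x + y"]) auto
next
  assume "\<exists>f\<in>V. x = res Q f \<and> y = f - res Q f"
  then show "(x, y) \<in> Q" using res_mem[OF Q] by (metis proj_ident)
qed

text \<open>With R = (1 + Q)^-1 take the commuting roots C of R and B of 1 - R, so that C^2 + B^2 =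
  1 on \<open>V\<close>. The relation of all pairs (C f, B f) is formally B C^-1, whose square is (1
  - R) R^-1 = Q.\<close>

lemma nnsa_sqrt_exists:
  assumes Q: "nnsa Q" shows "\<exists>S. nnsa S \<and> S O S = Q"
proof -
  let ?R = "res Q"
  interpret P: bounded_linear proj by (rule bounded_linear_proj)
  have R: "posop ?R" "\<And>x. norm (?R x) \<le> norm x" using posop_res[OF Q] by auto
  interpret R: bounded_linear ?R by (rule posop_linear[OF R(1)])
  note R' = posop_complement[OF R]
  obtain B where B: "posop B" and BB: "\<And>x. B (B x) = proj x - ?R x"
    and Bc: "\<And>K x. bounded_linear K \<Longrightarrow> (\<And>y. K (proj y) = proj (K y)) \<Longrightarrow>
       (\<And>y. K (proj y - ?R y) = proj (K y) - ?R (K y)) \<Longrightarrow> K (B x) = B (K x)"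
    using bounded_sqrt[OF R'] by auto
  obtain C where C: "posop C" and CC: "\<And>x. C (C x) = ?R x" and Cn: "\<And>x. norm (C x) \<le> norm x"
    and Cc: "\<And>K x. bounded_linear K \<Longrightarrow> (\<And>y. K (proj y) = proj (K y)) \<Longrightarrow>
       (\<And>y. K (?R y) = ?R (K y)) \<Longrightarrow> K (C x) = C (K x)"
    using bounded_sqrt[OF R] by auto
  \<comment> \<open>A further root, of \<open>C\<close> itself: it turns C f \<bullet> B f into D f
    \<bullet> B (D f), which is visibly non-negative.\<close>
  obtain D where D: "posop D" and DD: "\<And>x. D (D x) = C x"
    and Dc: "\<And>K x. bounded_linear K \<Longrightarrow> (\<And>y. K (proj y) = proj (K y)) \<Longrightarrow>
       (\<And>y. K (C y) = C (K y)) \<Longrightarrow> K (D x) = D (K x)"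
    using bounded_sqrt[OF C Cn] by auto
  interpret B: bounded_linear B by (rule posop_linear[OF B])
  interpret C: bounded_linear C by (rule posop_linear[OF C])
  have RB: "?R (B x) = B (?R x)" for x
  proof (rule Bc[OF R.bounded_linear_axioms])
    show "?R (proj y) = proj (?R y)" for y by (simp add: posop_proj[OF R(1)] posop_in_V[OF R(1)])
    show "?R (proj y - ?R y) = proj (?R y) - ?R (?R y)" for y
      by (simp add: R.diff posop_proj[OF R(1)] posop_in_V[OF R(1)])
  qed
  have BP: "B (proj y) = proj (B y)" for y by (simp add: posop_proj[OF B] posop_in_V[OF B])
  have BC: "B (C x) = C (B x)" for x
    by (rule Cc[OF B.bounded_linear_axioms BP]) (simp add: RB)
  have BD: "B (D x) = D (B x)" for x
    by (rule Dc[OF B.bounded_linear_axioms BP]) (simp add: BC)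
  have id: "C (C x) + B (B x) = x" if "x \<in> V" for x using that by (simp add: CC BB)
  define S where "S = {(C f, B f) |f. f \<in> V}"
  have SV: "S \<subseteq> V \<times> V" unfolding S_def using posop_in_V[OF B] posop_in_V[OF C] by auto
  \<comment> \<open>\<open>S\<close> is also the set of pairs with B x = C y; the common source of
    such a pair is f = C x + B y.\<close>
  have S_I: "(x, y) \<in> S" if "x \<in> V" "y \<in> V" "B x = C y" for x y
  proof -
    have "C (B y) = B (B x)" "B (C x) = C (C y)" using that(3) BC by metis+
    then have "C (C x + B y) = x" "B (C x + B y) = y"
      using id[OF that(1)] id[OF that(2)] by (simp_all only: C.add B.add)
    moreover have "C x + B y \<in> V" using posop_in_V[OF B] posop_in_V[OF C] by (intro V_intros)
    ultimately show ?thesis unfolding S_def by (metis (mono_tags, lifting) mem_Collect_eq)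
  qed
  have S_E: "B x = C y" if "(x, y) \<in> S" for x y using that unfolding S_def by (auto simp: BC)
  have "nnsa S"
    unfolding nnsa_def
  proof (intro conjI allI impI)
    show "adj S = S"
    proof
      show "adj S \<subseteq> S"
      proof clarify
        fix y z assume yz: "(y, z) \<in> adj S"
        then have V: "y \<in> V" "z \<in> V" and o: "\<And>f. f \<in> V \<Longrightarrow> y \<bullet> B f = z \<bullet> C f"
          unfolding adj_def S_def by auto
        show "(y, z) \<in> S"
        proof (rule S_I[OF V], rule eq_if_inner_V)
          show "B y \<bullet> v = C z \<bullet> v" if "v \<in> V" for v
            using o[OF that] by (simp add: posop_symmetric[OF B] posop_symmetric[OF C])
        qed (simp_all add: posop_in_V[OF B] posop_in_V[OF C])
      qed
      show "S \<subseteq> adj S"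
      proof clarify
        fix y z assume yz: "(y, z) \<in> S"
        show "(y, z) \<in> adj S"
        proof (rule adjI)
          fix x w assume "(x, w) \<in> S"
          then obtain f where f: "x = C f" "w = B f" unfolding S_def by auto
          show "y \<bullet> w = z \<bullet> x" using S_E[OF yz] f
            by (simp flip: posop_symmetric[OF B] posop_symmetric[OF C])
        qed (use yz SV in auto)
      qed
    qed
    have "Domain Q \<subseteq> Domain S"
    proof
      fix x assume "x \<in> Domain Q"
      then obtain f where "x = ?R f" using nnsa_iff_res[OF Q] by blast
      then have "(x, B (C f)) \<in> S" unfolding S_def using CC posop_in_V[OF C]
        by (intro CollectI exI[of _ "C f"]) auto
      then show "x \<in> Domain S" by blast
    qed
    then show "V \<subseteq> closure (Domain S)" using nnsa_dense[OF Q] closure_mono by blast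
    fix x y assume "(x, y) \<in> S"
    then obtain f where f: "x = C f" "y = B f" unfolding S_def by auto
    have "x \<bullet> y = D (D f) \<bullet> B f" by (simp add: f DD)
    also have "\<dots> = D f \<bullet> B (D f)" by (simp add: posop_symmetric[OF D] BD)
    finally show "0 \<le> x \<bullet> y" using posop_nonneg[OF B] by simp
  qed
  moreover have "S O S = Q"
  proof
    show "S O S \<subseteq> Q"
    proof
      fix p assume "p \<in> S O S"
      then obtain x y z where xyz: "p = (x, z)" "(x, y) \<in> S" "(y, z) \<in> S" by blast
      then obtain f g where fg: "f \<in> V" "g \<in> V" "x = C f" "y = B f" "y = C g" "z = B g"
        unfolding S_def by auto
      \<comment> \<open>Because B f = C g, this vector satisfies C h = f and B h = g, so the
        composed pair is (R h, h - R h).\<close>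
      define h where "h = C f + B g"
      have h: "h \<in> V" unfolding h_def using posop_in_V[OF B] posop_in_V[OF C] by (intro V_intros)
      have "C h = f" unfolding h_def using id[OF fg(1)] fg(4,5) by (simp only: C.add flip: BC)
      moreover have "B h = g" unfolding h_def using id[OF fg(2)] fg(4,5) by (simp add: B.add BC)
      ultimately have "x = ?R h" "z = h - ?R h" using fg CC[of h] BB[of h] h by auto
      with h xyz show "p \<in> Q" using nnsa_iff_res[OF Q] by blast
    qed
    show "Q \<subseteq> S O S"
    proof clarify
      fix x z assume "(x, z) \<in> Q"
      then obtain f where f: "f \<in> V" "x = ?R f" "z = f - ?R f" using nnsa_iff_res[OF Q] by blast
      have "(C (C f), B (C f)) \<in> S" "(C (B f), B (B f)) \<in> S"
        unfolding S_def using posop_in_V[OF B] posop_in_V[OF C] by blast+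
      then show "(x, z) \<in> S O S" using f CC BB BC by auto
    qed
  qed
  ultimately show ?thesis by blast
qed

text \<open>The domain of the square of \<open>S\<close> is a core for \<open>S\<close>: the
  resolvent of \<open>S\<close> maps \<open>Domain S\<close> into that domain, and it maps
  approximations of x + w to approximations of \<open>x\<close>.\<close>

lemma nnsa_sqrt_core:
  assumes S: "nnsa S" and xw: "(x, w) \<in> S"
  shows "\<exists>f g h. (\<forall>n. (f n, g n) \<in> S \<and> (g n, h n) \<in> S) \<and> f \<longlonglongrightarrow> x \<and> g \<longlonglongrightarrow> w"
proof -
  let ?W = "res S"
  interpret W: bounded_linear ?W by (rule posop_linear[OF posop_res(1)[OF S]])
  have V: "x \<in> V" "w \<in> V" using nnsa_in_V[OF S xw] by blast+
  then have "x + w \<in> closure (Domain S)" using nnsa_dense[OF S] V_intros(2) by blast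
  then obtain e where e: "\<And>n. e n \<in> Domain S" "e \<longlonglongrightarrow> x + w" using closure_sequential by blast
  have "\<forall>n. \<exists>d. (e n, d) \<in> S" using e(1) by blast
  then obtain d where d: "\<And>n. (e n, d n) \<in> S" by metis
  have eV: "e n \<in> V" for n using nnsa_in_V(1)[OF S d] .
  have 1: "(?W (e n), e n - ?W (e n)) \<in> S" for n using res_mem[OF S, of "e n"] eV by simp
  have 2: "(e n - ?W (e n), d n - (e n - ?W (e n))) \<in> S" for n
    by (rule graph_diff[OF nnsa_subspace[OF S] d 1])
  have 3: "(\<lambda>n. ?W (e n)) \<longlonglongrightarrow> x" using W.tendsto[OF e(2)] res_sum[OF S xw] by simp
  have 4: "(\<lambda>n. e n - ?W (e n)) \<longlonglongrightarrow> w" using tendsto_diff[OF e(2) 3] by simp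
  show ?thesis
    using 1 2 3 4 by (intro exI[of _ "\<lambda>n. ?W (e n)"] exI[of _ "\<lambda>n. e n - ?W (e n)"]
      exI[of _ "\<lambda>n. d n - (e n - ?W (e n))"]) simp
qed

text \<open>For a root \<open>S\<close> of \<open>Q\<close> the operator X = S (1 + Q)^-1 is bounded
  and positive, and its square R (1 - R) involves only \<open>Q\<close>. This reduces uniqueness of
  unbounded roots to that of bounded ones.\<close>

lemma nnsa_sqrt_res:
  assumes Q: "nnsa Q" and S: "nnsa S" and SQ: "S O S = Q"
  shows "\<exists>X. posop X \<and> (\<forall>f. (res Q f, X f) \<in> S) \<and> (\<forall>f. X (X f) = res Q (proj f - res Q f)) \<and>
    (\<forall>f. norm (X (X f)) \<le> norm f)"
proof -
  let ?R = "res Q"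
  interpret P: bounded_linear proj by (rule bounded_linear_proj)
  have R: "posop ?R" "\<And>x. norm (?R x) \<le> norm x" using posop_res[OF Q] by auto
  interpret R: bounded_linear ?R by (rule posop_linear[OF R(1)])
  have "\<exists>y. (?R f, y) \<in> S \<and> (y, proj f - ?R f) \<in> S" for f using res_mem[OF Q, of f] SQ by blast
  then obtain X where X: "\<And>f. (?R f, X f) \<in> S" "\<And>f. (X f, proj f - ?R f) \<in> S" by metis
  have XV: "X f \<in> V" for f by (rule nnsa_in_V(2)[OF S X(1)])
  have le: "norm (X f) \<le> norm f" for f
  proof -
    have "(norm (X f))\<^sup>2 = ?R f \<bullet> (proj f - ?R f)"
      unfolding power2_norm_eq_inner by (rule nnsa_symmetric[OF S X(1) X(2), symmetric])
    also have "\<dots> \<le> norm (?R f) * norm (proj f - ?R f)" by (rule norm_cauchy_schwarz)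
    also have "\<dots> \<le> norm f * norm f"
      by (intro mult_mono R(2) posop_complement(2)[OF R]) auto
    finally have "(norm (X f))\<^sup>2 \<le> norm f * norm f" .
    then show ?thesis by (simp only: power2_eq_square[symmetric] power2_le_iff_abs_le norm_ge_zero abs_norm_cancel)
  qed
  have sym: "X f \<bullet> g = f \<bullet> X g" for f g
  proof -
    have "X f \<bullet> g = X f \<bullet> ?R g + X f \<bullet> (proj g - ?R g)"
      by (simp add: inner_diff_right inner_proj_right XV)
    also have "X f \<bullet> ?R g = ?R f \<bullet> X g" by (rule nnsa_symmetric[OF S X(1) X(1), symmetric])
    also have "X f \<bullet> (proj g - ?R g) = (proj f - ?R f) \<bullet> X g" by (rule nnsa_symmetric[OF S X(2) X(2)])
    also have "?R f \<bullet> X g + (proj f - ?R f) \<bullet> X g = f \<bullet> X g"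
      by (simp add: inner_diff_left inner_proj_left XV)
    finally show ?thesis .
  qed
  have "posop X"
    unfolding posop_def
  proof (intro conjI allI)
    show "bounded_linear X"
    proof (rule bounded_linear_intro[where K = 1])
      show "X (f + g) = X f + X g" for f g
        using nnsa_unique[OF S X(1), of "f + g"] graph_add[OF nnsa_subspace[OF S] X(1) X(1), of f g]
        by (simp add: R.add)
      show "X (r *\<^sub>R f) = r *\<^sub>R X f" for r f
        using nnsa_unique[OF S X(1), of "r *\<^sub>R f"] graph_scale[OF nnsa_subspace[OF S] X(1), of r f]
        by (simp add: R.scaleR)
    qed (use le in simp)
    show "0 \<le> f \<bullet> X f" for f
    proof -
      have "f \<bullet> X f = ?R f \<bullet> X f + X f \<bullet> (proj f - ?R f)"
        by (simp add: inner_diff_right inner_proj_right XV inner_commute)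
      then show ?thesis using nnsa_nonneg[OF S X(1)] nnsa_nonneg[OF S X(2)] by simp
    qed
  qed (use XV sym in auto)
  moreover have "X (X f) = ?R (proj f - ?R f)" for f
  proof -
    let ?q = "proj f - ?R f"
    have qV: "?q \<in> V" using posop_in_V[OF R(1)] by (intro V_intros) auto
    have "(X (X f), X f - ?R (X f)) \<in> S" using X(2)[of "X f"] XV by simp
    moreover have "(X f - ?R (X f), ?q - X (X f)) \<in> S"
      by (rule graph_diff[OF nnsa_subspace[OF S] X(2) X(1)])
    ultimately have "(X (X f), ?q - X (X f)) \<in> Q" using SQ by blast
    then show ?thesis using res_eqI[OF Q, of _ ?q] qV by simp
  qed
  moreover have "norm (X (X f)) \<le> norm f" for f using le order_trans by blast
  ultimately show ?thesis using X(1) by blast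
qed

text \<open>Both roots have the same X by uniqueness of bounded roots, so they agree on the domain
  of \<open>Q\<close>, which is a core for each. Every element of one root is therefore in the
  adjoint of the other.\<close>

lemma nnsa_sqrt_unique:
  assumes Q: "nnsa Q" and S: "nnsa S" "S O S = Q" and T: "nnsa T" "T O T = Q"
  shows "S = T"
proof -
  have sub: "S \<subseteq> T" if S: "nnsa S" "S O S = Q" and T: "nnsa T" "T O T = Q" for S T
  proof clarify
    fix u u' assume u: "(u, u') \<in> S"
    obtain X where X: "posop X" "\<And>f. (res Q f, X f) \<in> S" "\<And>f. X (X f) = res Q (proj f - res Q f)"
      "\<And>f. norm (X (X f)) \<le> norm f"
      using nnsa_sqrt_res[OF Q S] by blast
    obtain Y where Y: "posop Y" "\<And>f. (res Q f, Y f) \<in> T" "\<And>f. Y (Y f) = res Q (proj f - res Q f)"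
      using nnsa_sqrt_res[OF Q T] by blast
    have XY: "X f = Y f" for f
      by (rule bounded_sqrt_unique[OF X(1) Y(1) _ X(4)]) (simp add: X(3) Y(3))
    show "(u, u') \<in> T"
    proof (rule nnsa_memI[OF T(1)])
      fix x w assume "(x, w) \<in> T"
      from nnsa_sqrt_core[OF T(1) this] obtain f g h
        where fg: "\<And>n. (f n, g n) \<in> T" "\<And>n. (g n, h n) \<in> T" and lim: "f \<longlonglongrightarrow> x" "g \<longlonglongrightarrow> w"
        by blast
      have "u \<bullet> g n = u' \<bullet> f n" for n
      proof -
        have "(f n, h n) \<in> Q" using fg T(2) by blast
        then have r: "res Q (f n + h n) = f n" by (rule res_sum[OF Q])
        have "g n = Y (f n + h n)" using nnsa_unique[OF T(1) fg(1) ] Y(2)[of "f n + h n"] r by simp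
        then have "(f n, g n) \<in> S" using X(2)[of "f n + h n"] r XY by simp
        then show ?thesis by (rule nnsa_symmetric[OF S(1) u])
      qed
      moreover have "(\<lambda>n. u \<bullet> g n) \<longlonglongrightarrow> u \<bullet> w" "(\<lambda>n. u' \<bullet> f n) \<longlonglongrightarrow> u' \<bullet> x"
        by (intro tendsto_intros lim)+
      ultimately show "u \<bullet> w = u' \<bullet> x" using LIMSEQ_unique by simp
    qed (use nnsa_in_V[OF S(1) u] in auto)
  qed
  show ?thesis using sub[OF S T] sub[OF T S] by blast
qed

text \<open>The inequality is given on the domain of \<open>Q\<close>; approximation along the core
  extends it to the domain of the root, that is, to the form domain.\<close>

lemma nnsa_form_bound:
  assumes S: "nnsa S" "S O S = Q" and A: "bounded_linear A"
    and le: "\<And>x y. (x, y) \<in> Q \<Longrightarrow> x \<bullet> A x \<le> x \<bullet> y" and vw: "(v, w) \<in> S"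
  shows "v \<bullet> A v \<le> (norm w)\<^sup>2"
proof -
  interpret A: bounded_linear A by (rule A)
  from nnsa_sqrt_core[OF S(1) vw] obtain f g h
    where fg: "\<And>n. (f n, g n) \<in> S" "\<And>n. (g n, h n) \<in> S" and lim: "f \<longlonglongrightarrow> v" "g \<longlonglongrightarrow> w"
    by blast
  have "f n \<bullet> A (f n) \<le> (norm (g n))\<^sup>2" for n
  proof -
    have "(f n, h n) \<in> Q" using fg S(2) by blast
    from le[OF this] show ?thesis
      using nnsa_symmetric[OF S(1) fg(1) fg(2)] by (simp add: power2_norm_eq_inner)
  qed
  moreover have "(\<lambda>n. f n \<bullet> A (f n)) \<longlonglongrightarrow> v \<bullet> A v" "(\<lambda>n. (norm (g n))\<^sup>2) \<longlonglongrightarrow> (norm w)\<^sup>2"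
    by (intro tendsto_intros lim A.tendsto)+
  ultimately show ?thesis using LIMSEQ_le by blast
qed

section \<open>Yosida approximation\<close>

definition graph_scaled :: "real \<Rightarrow> ('h \<times> 'h) set \<Rightarrow> ('h \<times> 'h) set" where
  "graph_scaled c S = {(x, y). (x, (1 / c) *\<^sub>R y) \<in> S}"

lemma nnsa_graph_scaled:
  assumes S: "nnsa S" and c: "c > 0" shows "nnsa (graph_scaled c S)"
  unfolding nnsa_def
proof (intro conjI allI impI)
  have mem: "(x, y) \<in> S \<Longrightarrow> (x, c *\<^sub>R y) \<in> graph_scaled c S" for x y
    using c by (simp add: graph_scaled_def)
  have "Domain (graph_scaled c S) = Domain S" using mem unfolding graph_scaled_def by blast
  then show "V \<subseteq> closure (Domain (graph_scaled c S))" using nnsa_dense[OF S] by simp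
  show "0 \<le> x \<bullet> y" if "(x, y) \<in> graph_scaled c S" for x y
    using that nnsa_nonneg[OF S, of x "(1/c) *\<^sub>R y"] c by (simp add: graph_scaled_def zero_le_divide_iff)
  show "adj (graph_scaled c S) = graph_scaled c S"
  proof
    show "adj (graph_scaled c S) \<subseteq> graph_scaled c S"
    proof clarify
      fix y z assume yz: "(y, z) \<in> adj (graph_scaled c S)"
      have "(y, (1/c) *\<^sub>R z) \<in> S"
      proof (rule nnsa_memI[OF S])
        fix x w assume "(x, w) \<in> S"
        with yz mem have "y \<bullet> (c *\<^sub>R w) = z \<bullet> x" unfolding adj_def by blast
        then show "y \<bullet> w = (1/c) *\<^sub>R z \<bullet> x" using c by (simp add: field_simps)
      qed (use yz in \<open>auto simp: adj_def intro: V_intros\<close>)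
      then show "(y, z) \<in> graph_scaled c S" by (simp add: graph_scaled_def)
    qed
    show "graph_scaled c S \<subseteq> adj (graph_scaled c S)"
    proof clarify
      fix y z assume "(y, z) \<in> graph_scaled c S"
      then have yz: "(y, (1/c) *\<^sub>R z) \<in> S" by (simp add: graph_scaled_def)
      then have V: "y \<in> V" "(1/c) *\<^sub>R z \<in> V" using nnsa_in_V[OF S] by blast+
      from V_intros(4)[OF V(2), of c] c have "z \<in> V" by simp
      then show "(y, z) \<in> adj (graph_scaled c S)"
      proof (rule adjI[OF V(1)])
        fix x w assume "(x, w) \<in> graph_scaled c S"
        then have "(x, (1/c) *\<^sub>R w) \<in> S" by (simp add: graph_scaled_def)
        from nnsa_symmetric[OF S yz this] show "y \<bullet> w = z \<bullet> x" using c by simp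
      qed
    qed
  qed
qed

text \<open>This is S (1 + c S)^-1, written as (1 - (1 + c S)^-1) / c;
  \<open>graph_scaled c S\<close> is the relation c S. Later c = 1/(m + 1), with \<open>S\<close>
  the square root of \<open>Q\<close>.\<close>

definition yosida :: "real \<Rightarrow> ('h \<times> 'h) set \<Rightarrow> 'h \<Rightarrow> 'h" where
  "yosida c S v = (1 / c) *\<^sub>R (proj v - res (graph_scaled c S) v)"

lemma posop_yosida: "nnsa S \<Longrightarrow> c > 0 \<Longrightarrow> posop (yosida c S)"
  unfolding yosida_def
  by (intro posop_scale posop_complement posop_res nnsa_graph_scaled) simp_all

lemma yosida_mem:
  assumes "nnsa S" "c > 0"
  shows "(proj v - c *\<^sub>R yosida c S v, yosida c S v) \<in> S"
  using res_mem[OF nnsa_graph_scaled[OF assms], of v] assms(2)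
  by (simp add: graph_scaled_def yosida_def)

lemma norm_yosida_le:
  assumes S: "nnsa S" and c: "c > 0" and vw: "(v, w) \<in> S"
  shows "norm (yosida c S v) \<le> norm w"
proof -
  let ?p = "yosida c S v"
  have v: "v \<in> V" by (rule nnsa_in_V(1)[OF S vw])
  \<comment> \<open>The difference of (v, w) and the pair (v - c p, p) of \<open>S\<close>. Its
    non-negativity says c p \<bullet> (w - p) \<ge> 0.\<close>
  have "(v - (v - c *\<^sub>R ?p), w - ?p) \<in> S"
    using graph_diff[OF nnsa_subspace[OF S] vw yosida_mem[OF S c, of v]] v by simp
  from nnsa_nonneg[OF S this] have "0 \<le> ?p \<bullet> (w - ?p)" using c by (simp add: zero_le_mult_iff)
  then have "norm ?p * norm ?p \<le> norm ?p * norm w"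
    using norm_cauchy_schwarz[of ?p w] by (simp add: inner_diff_right flip: power2_norm_eq_inner power2_eq_square)
  then show ?thesis by (cases "?p = 0") simp_all
qed

text \<open>Non-negativity of \<open>S\<close> at the difference of (v - a p, p) and (v - b q, q)
  gives (a + b) \<parallel>q - p\<parallel>^2 \<le> (a - b) (\<parallel>q\<parallel>^2 -
  \<parallel>p\<parallel>^2). So the norms grow as the parameter decreases, and they control the
  increments.\<close>

lemma yosida_increment:
  assumes S: "nnsa S" and b: "0 < b" and ba: "b \<le> a"
  shows "(norm (yosida b S v - yosida a S v))\<^sup>2 \<le> (norm (yosida b S v))\<^sup>2 - (norm (yosida a S v))\<^sup>2"
proof -
  let ?p = "yosida a S v" and ?q = "yosida b S v"
  have a: "a > 0" using assms by simp
  have "((proj v - a *\<^sub>R ?p) - (proj v - b *\<^sub>R ?q), ?p - ?q) \<in> S"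
    by (intro graph_diff nnsa_subspace S yosida_mem a b)
  from nnsa_nonneg[OF S this] have "0 \<le> (b *\<^sub>R ?q - a *\<^sub>R ?p) \<bullet> (?p - ?q)" by simp
  then have 1: "a * (?p \<bullet> ?p) + b * (?q \<bullet> ?q) \<le> (a + b) * (?p \<bullet> ?q)"
    by (simp add: inner_diff_left inner_diff_right inner_commute algebra_simps)
  have 2: "(norm (?q - ?p))\<^sup>2 = ?q \<bullet> ?q + ?p \<bullet> ?p - 2 * (?p \<bullet> ?q)"
    unfolding power2_norm_eq_inner
    by (simp add: inner_diff_left inner_diff_right inner_commute[of ?q ?p])
  have "(a + b) * (norm (?q - ?p))\<^sup>2 \<le> (a - b) * (?q \<bullet> ?q - ?p \<bullet> ?p)"
    using 1 unfolding 2 by (simp add: algebra_simps)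
  also have "\<dots> \<le> (a + b) * (?q \<bullet> ?q - ?p \<bullet> ?p)"
  proof (cases "a = b")
    case False
    have "0 \<le> (a + b) * (norm (?q - ?p))\<^sup>2" using a b by simp
    from order_trans[OF this
        \<open>(a + b) * (norm (?q - ?p))\<^sup>2 \<le> (a - b) * (?q \<bullet> ?q - ?p \<bullet> ?p)\<close>]
    have "0 \<le> ?q \<bullet> ?q - ?p \<bullet> ?p" using False ba by (simp add: zero_le_mult_iff)
    then show ?thesis using b by (intro mult_right_mono) auto
  qed (use a in \<open>simp add: \<close>)
  finally show ?thesis using a b by (simp add: power2_norm_eq_inner)
qed

text \<open>Bounded norms force \<open>v\<close> into the domain of \<open>S\<close>: being monotone
  they converge, so the approximations p are Cauchy; as c tends to 0 the points v - c p tend to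
  \<open>v\<close>, and \<open>S\<close> is closed.\<close>

lemma yosida_limit:
  assumes S: "nnsa S" and v: "v \<in> V"
    and K: "\<And>n. (norm (yosida (1 / real (Suc n)) S v))\<^sup>2 \<le> K"
  shows "\<exists>w. (v, w) \<in> S \<and> (norm w)\<^sup>2 \<le> K"
proof -
  let ?p = "\<lambda>n. yosida (1 / real (Suc n)) S v"
  let ?a = "\<lambda>n. (norm (?p n))\<^sup>2"
  have inc: "(norm (?p m - ?p n))\<^sup>2 \<le> 1 * (?a m - ?a n)" if "n \<le> m" for m n
    using yosida_increment[OF S, of "1 / real (Suc m)" "1 / real (Suc n)" v] that
    by (simp add: field_simps)
  have mono: "?a n \<le> ?a m" if "n \<le> m" for m n
    using order_trans[OF zero_le_power2 inc[OF that]] by simp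
  then have "incseq ?a" by (simp add: incseq_def)
  then have "convergent ?a"
    using incseq_convergent[of ?a K] convergentI K by blast
  then have "Cauchy ?p" by (intro Cauchy_by_square[OF inc] convergent_Cauchy) auto
  moreover have "?p n \<in> V" for n by (intro posop_in_V posop_yosida S) simp
  ultimately obtain w where w: "?p \<longlonglongrightarrow> w" using V_Cauchy[of ?p] by blast
  have "(\<lambda>n. 1 / real (Suc n)) \<longlonglongrightarrow> 0"
    using LIMSEQ_inverse_real_of_nat by (simp add: inverse_eq_divide)
  from tendsto_diff[OF tendsto_const tendsto_scaleR[OF this w], of v]
  have "(\<lambda>n. proj v - (1 / real (Suc n)) *\<^sub>R ?p n) \<longlonglongrightarrow> v" using v by simp
  then have "(v, w) \<in> S"
    by (intro nnsa_limit[OF S yosida_mem[OF S] _ w]) simp_all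
  moreover have "(norm w)\<^sup>2 \<le> K"
    using LIMSEQ_le_const2[OF tendsto_power[OF tendsto_norm[OF w]]] K by blast
  ultimately show ?thesis by blast
qed

section \<open>Complex linearity of roots, and the absolute value of a bounded operator\<close>

lemma nnsa_complex_rotate:
  assumes S: "nnsa S" and U: "bounded_linear U" "\<And>x. x \<in> V \<Longrightarrow> U x \<in> V"
    "\<And>x. U (U x) = - x" "\<And>x y. U x \<bullet> U y = x \<bullet> y"
  shows "nnsa {(a, b). (U a, U b) \<in> S}"
  unfolding nnsa_def
proof (intro conjI allI impI)
  interpret U: bounded_linear U by (rule U(1))
  let ?J = "{(a, b). (U a, U b) \<in> S}"
  have UV: "x \<in> V" if "U x \<in> V" for x using U(2)[OF that] V_intros(5) U(3) by force
  have mem: "(- U x, - U y) \<in> ?J" if "(x, y) \<in> S" for x y using that by (simp add: U.neg U(3))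
  show "adj ?J = ?J"
  proof
    show "?J \<subseteq> adj ?J"
      using nnsa_in_V[OF S] UV nnsa_symmetric[OF S] U(4)
      by (auto simp: adj_def) (metis)
    show "adj ?J \<subseteq> ?J"
    proof clarify
      fix y z assume yz: "(y, z) \<in> adj ?J"
      show "(U y, U z) \<in> S"
      proof (rule nnsa_memI[OF S])
        fix x w assume "(x, w) \<in> S"
        from mem[OF this] yz have "y \<bullet> (- U w) = z \<bullet> (- U x)" unfolding adj_def by blast
        then have "U y \<bullet> U (- U w) = U z \<bullet> U (- U x)" by (simp only: U(4))
        then show "U y \<bullet> w = U z \<bullet> x" by (simp add: U.neg U(3))
      qed (use yz in \<open>auto simp: adj_def U(2)\<close>)
    qed
  qed
  show "V \<subseteq> closure (Domain ?J)"
  proof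
    fix v assume v: "v \<in> V"
    then have "U v \<in> closure (Domain S)" using nnsa_dense[OF S] U(2) by blast
    then obtain f where f: "\<And>n. f n \<in> Domain S" "f \<longlonglongrightarrow> U v" using closure_sequential by blast
    have "(\<lambda>n. - U (f n)) \<longlonglongrightarrow> - U (U v)" by (intro tendsto_intros U.tendsto f)
    then have "(\<lambda>n. - U (f n)) \<longlonglongrightarrow> v" by (simp add: U(3))
    moreover have "- U (f n) \<in> Domain ?J" for n using f(1)[of n] mem by blast
    ultimately show "v \<in> closure (Domain ?J)" unfolding closure_sequential
      by (intro exI[of _ "\<lambda>n. - U (f n)"]) simp
  qed
  show "0 \<le> x \<bullet> y" if "(x, y) \<in> ?J" for x y
    using that nnsa_nonneg[OF S, of "U x" "U y"] by (simp add: U(4))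
qed

text \<open>\<open>U\<close> stands for multiplication by i. Conjugating \<open>S\<close> by
  \<open>U\<close> gives another non-negative self-adjoint root of \<open>Q\<close>, which is
  \<open>S\<close> by uniqueness; so the root of a complex-linear operator is
  complex-linear.\<close>

lemma nnsa_sqrt_rotate:
  assumes Q: "nnsa Q" and S: "nnsa S" "S O S = Q" and U: "bounded_linear U" "\<And>x. x \<in> V \<Longrightarrow> U x \<in> V"
    "\<And>x. U (U x) = - x" "\<And>x y. U x \<bullet> U y = x \<bullet> y"
    and UQ: "\<And>x y. (x, y) \<in> Q \<Longrightarrow> (U x, U y) \<in> Q" and xy: "(x, y) \<in> S"
  shows "(U x, U y) \<in> S"
proof -
  interpret U: bounded_linear U by (rule U(1))
  let ?J = "{(a, b). (U a, U b) \<in> S}"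
  have neg: "(- a, - b) \<in> Q \<longleftrightarrow> (a, b) \<in> Q" for a b
    using graph_scale[OF nnsa_subspace[OF Q], of _ _ "-1"] by force
  have J: "(U a, U b) \<in> Q \<longleftrightarrow> (a, b) \<in> Q" for a b
    using UQ[of "U a" "U b"] UQ neg by (auto simp: U(3))
  have "?J O ?J = Q"
  proof (intro set_eqI iffI)
    fix p assume "p \<in> ?J O ?J"
    then obtain a b c where "p = (a, c)" "(U a, U b) \<in> S" "(U b, U c) \<in> S" by blast
    then show "p \<in> Q" using S(2) J by blast
  next
    fix p assume p: "p \<in> Q"
    obtain a c where ac: "p = (a, c)" by fastforce
    with p have "(U a, U c) \<in> S O S" using J S(2) by blast
    then obtain b where "(U a, b) \<in> S" "(b, U c) \<in> S" by blast
    then have "(a, - U b) \<in> ?J" "(- U b, c) \<in> ?J" by (simp_all add: U.neg U(3))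
    with ac show "p \<in> ?J O ?J" by blast
  qed
  then have "?J = S" by (intro nnsa_sqrt_unique[OF Q _ _ S] nnsa_complex_rotate[OF S(1) U])
  with xy show ?thesis by blast
qed

text \<open>Von Neumann's argument: the orthogonal projection of (h, 0) onto the graph of
  \<open>d\<close> is some (x, d x), and orthogonality of the remainder to the graph says that the
  adjoint of \<open>d\<close> sends d x to h - x. Thus 1 + K is onto.\<close>

lemma nnsa_gram:
  assumes d: "bounded_linear d" "\<And>x. x \<in> V \<Longrightarrow> d x \<in> V"
  defines "G \<equiv> {(x, d x) |x. x \<in> V}"
  shows "nnsa (G O adj G)"
proof -
  interpret d: bounded_linear d by (rule d(1))
  have G: "(x, y) \<in> G \<longleftrightarrow> x \<in> V \<and> y = d x" for x y by (auto simp: G_def)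
  define K where "K = G O adj G"
  have GG: "(x, z) \<in> K \<longleftrightarrow> x \<in> V \<and> z \<in> V \<and> (\<forall>a\<in>V. d x \<bullet> d a = z \<bullet> a)" for x z
    unfolding K_def relcomp_unfold adj_def using d(2) by (auto simp: G)
  have Gimg: "G = (\<lambda>x. (x, d x)) ` V" by (auto simp: G_def)
  have bl: "bounded_linear (\<lambda>x. (x, d x))"
    by (intro bounded_linear_Pair bounded_linear_ident d)
  have "hilbert_subspace G"
  proof
    show "subspace G" unfolding Gimg
      by (intro linear_subspace_image V_subspace) (rule bounded_linear.linear[OF bl])
    show "uniform_space_class.complete G" unfolding Gimg
    proof (rule complete_isometric_image[of 1])
      show "\<forall>x\<in>V. 1 * norm x \<le> norm (x, d x)" by (simp add: norm_fst_le)
    qed (use bl V_subspace V_complete in auto)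
  qed
  then interpret G: hilbert_subspace G .
  have range: "\<exists>x y. (x, y) \<in> K \<and> x + y = h" if h: "h \<in> V" for h
  proof -
    obtain p where p: "p \<in> G" "\<forall>v\<in>G. ((h, 0) - p) \<bullet> v = 0"
      using G.nearest_point[of "(h, 0)"] by blast
    from p(1) obtain x where x: "p = (x, d x)" "x \<in> V" unfolding G_def by auto
    have "(x, h - x) \<in> K"
      unfolding GG
    proof (intro conjI ballI)
      show "x \<in> V" "h - x \<in> V" using x h by (auto intro: V_intros)
      fix a assume "a \<in> V"
      then have "(a, d a) \<in> G" by (simp add: G)
      with p(2) have "((h, 0) - p) \<bullet> (a, d a) = 0" by blast
      then show "d x \<bullet> d a = (h - x) \<bullet> a" by (simp add: x inner_diff_left)
    qed
    then show ?thesis by (intro exI[of _ x] exI[of _ "h - x"]) simp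
  qed
  have nonneg: "0 \<le> x \<bullet> y" if "(x, y) \<in> K" for x y
  proof -
    have "d x \<bullet> d x = y \<bullet> x" using that unfolding GG by blast
    then show ?thesis by (metis inner_commute inner_ge_zero)
  qed
  have subK: "subspace K"
    unfolding subspace_def zero_prod_def split_paired_all GG
    by (auto simp: GG d.zero d.add d.scaleR inner_add_left intro: V_intros)
  show ?thesis
    unfolding K_def[symmetric]
  proof (rule nnsaI[OF _ subK nonneg _ _ range])
    show "K \<subseteq> V \<times> V" using GG by auto
    show "x \<bullet> y' = y \<bullet> x'" if "(x, y) \<in> K" "(x', y') \<in> K" for x y x' y'
      using that unfolding GG by (metis inner_commute)
    show "V \<subseteq> closure (Domain K)"
    proof (rule dense_if_trivial_complement)
      show "subspace (Domain K)"
        unfolding Domain_fst by (intro linear_subspace_image bounded_linear.linear[OF bounded_linear_fst] subK)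
      show "Domain K \<subseteq> V" using GG by blast
      fix h assume h: "h \<in> V" "\<And>r. r \<in> Domain K \<Longrightarrow> h \<bullet> r = 0"
      obtain x y where xy: "(x, y) \<in> K" "x + y = h" using range[OF h(1)] by blast
      from h(2)[OF DomainI[OF xy(1)]] have "x \<bullet> x + y \<bullet> x = 0" by (simp only: inner_add_left xy(2)[symmetric])
      moreover have "y \<bullet> x \<ge> 0" using nonneg[OF xy(1)] by (simp add: inner_commute)
      ultimately have "x \<bullet> x = 0" using inner_ge_zero[of x] by linarith
      then have "x = 0" by simp
      with xy h(1) have "h \<bullet> h = 0" unfolding GG by (metis add.left_neutral d.zero inner_zero_left)
      then show "h = 0" by simp
    qed
  qed
qed

text \<open>\<open>G O adj G\<close> is the relation \<open>d\<^sup>* d\<close>, so \<open>P\<close> is the absolute value of \<open>d\<close>.\<close>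

lemma gram_sqrt_total:
  assumes d: "bounded_linear d" "\<And>x. x \<in> V \<Longrightarrow> d x \<in> V"
  defines "G \<equiv> {(x, d x) |x. x \<in> V}"
  assumes P: "nnsa P" "P O P = G O adj G" and v: "v \<in> V"
  shows "\<exists>w. (v, w) \<in> P \<and> norm w = norm (d v)"
proof -
  interpret d: bounded_linear d by (rule d(1))
  let ?K = "G O adj G"
  have "nnsa ?K" unfolding G_def by (rule nnsa_gram[OF d])
  then have "v \<in> closure (Domain ?K)" using v nnsa_dense by blast
  then obtain f where f: "\<And>n. f n \<in> Domain ?K" "f \<longlonglongrightarrow> v" using closure_sequential by blast
  \<comment> \<open>On the domain of the product both squared norms equal x \<bullet> z; density of
    that domain extends the identity to \<open>V\<close>.\<close>
  have 1: "\<exists>p. (x, p) \<in> P \<and> norm p = norm (d x)" if "x \<in> Domain ?K" for x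
  proof -
    from that obtain z where z: "(x, z) \<in> ?K" by blast
    with P(2) obtain p where p: "(x, p) \<in> P" "(p, z) \<in> P" by blast
    from z have "d x \<bullet> d x = z \<bullet> x" unfolding relcomp_unfold adj_def G_def by auto
    moreover have "x \<bullet> z = p \<bullet> p" by (rule nnsa_symmetric[OF P(1) p])
    ultimately have "norm p = norm (d x)" by (simp add: norm_eq_sqrt_inner inner_commute)
    with p(1) show ?thesis by blast
  qed
  then obtain p where p: "\<And>x. x \<in> Domain ?K \<Longrightarrow> (x, p x) \<in> P"
    "\<And>x. x \<in> Domain ?K \<Longrightarrow> norm (p x) = norm (d x)" by metis
  let ?g = "\<lambda>n. p (f n)"
  have KD: "x - y \<in> Domain ?K" if "x \<in> Domain ?K" "y \<in> Domain ?K" for x y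
    using that graph_diff[OF nnsa_subspace[OF \<open>nnsa ?K\<close>]] by blast
  have diff: "norm (p x - p y) = norm (d x - d y)" if "x \<in> Domain ?K" "y \<in> Domain ?K" for x y
  proof -
    have "p x - p y = p (x - y)"
      using nnsa_unique[OF P(1) graph_diff[OF nnsa_subspace[OF P(1)] p(1)[OF that(1)] p(1)[OF that(2)]]
          p(1)[OF KD[OF that]]] .
    then show ?thesis using p(2)[OF KD[OF that]] by (simp add: d.diff)
  qed
  have "Cauchy (\<lambda>n. d (f n))" using d.tendsto[OF f(2)] LIMSEQ_imp_Cauchy by blast
  then have "Cauchy ?g" unfolding Cauchy_def dist_norm using diff f(1) by simp
  moreover have "?g n \<in> V" for n using nnsa_in_V(2)[OF P(1) p(1)[OF f(1)]] .
  ultimately obtain w where w: "?g \<longlonglongrightarrow> w" using V_Cauchy[of ?g] by blast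
  have "(v, w) \<in> P" by (rule nnsa_limit[OF P(1) p(1)[OF f(1)] f(2) w])
  moreover have "norm w = norm (d v)"
    using LIMSEQ_unique[OF tendsto_norm[OF w]] tendsto_norm[OF d.tendsto[OF f(2)]] p(2)[OF f(1)] by simp
  ultimately show ?thesis by blast
qed

end

section \<open>Square-integrable functions\<close>

lemma borel_measurable_cnj [measurable]:
  "f \<in> borel_measurable M \<Longrightarrow> (\<lambda>x. cnj (f x)) \<in> borel_measurable M"
  by (rule borel_measurable_continuous_on[of cnj]) (intro continuous_intros)

lemma l2_funD: "f \<in> l2_fun M \<Longrightarrow> f \<in> borel_measurable M"
  "f \<in> l2_fun M \<Longrightarrow> integrable M (\<lambda>x. (cmod (f x))\<^sup>2)"
  by (auto simp: l2_fun_def)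

lemma l2_fun_zero [simp]: "(\<lambda>x. 0) \<in> l2_fun M"
  by (simp add: l2_fun_def)

lemma l2_fun_scale: "f \<in> l2_fun M \<Longrightarrow> (\<lambda>x. c * f x) \<in> l2_fun M"
  by (auto simp: l2_fun_def norm_mult power_mult_distrib)

lemma l2_fun_uminus: "f \<in> l2_fun M \<Longrightarrow> (\<lambda>x. - f x) \<in> l2_fun M"
  using l2_fun_scale[of f M "-1"] by simp

lemma cmod_add_square_le: "(cmod (a + b))\<^sup>2 \<le> 2 * (cmod a)\<^sup>2 + 2 * (cmod b)\<^sup>2"
  using parallelogram_norm[of a b] by (smt (verit) zero_le_power2)

lemma l2_fun_add: "f \<in> l2_fun M \<Longrightarrow> g \<in> l2_fun M \<Longrightarrow> (\<lambda>x. f x + g x) \<in> l2_fun M"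
  unfolding l2_fun_def
proof clarify
  assume f: "f \<in> borel_measurable M" "integrable M (\<lambda>x. (cmod (f x))\<^sup>2)"
    and g: "g \<in> borel_measurable M" "integrable M (\<lambda>x. (cmod (g x))\<^sup>2)"
  have "integrable M (\<lambda>x. (cmod (f x + g x))\<^sup>2)"
  proof (rule Bochner_Integration.integrable_bound)
    show "integrable M (\<lambda>x. 2 * (cmod (f x))\<^sup>2 + 2 * (cmod (g x))\<^sup>2)" using f g by simp
    show "AE x in M. norm ((cmod (f x + g x))\<^sup>2) \<le> norm (2 * (cmod (f x))\<^sup>2 + 2 * (cmod (g x))\<^sup>2)"
      using cmod_add_square_le by simp
  qed (use f g in measurable)
  with f g show "(\<lambda>x. f x + g x) \<in> borel_measurable M \<and> integrable M (\<lambda>x. (cmod (f x + g x))\<^sup>2)"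
    by simp
qed

lemma l2_fun_diff: "f \<in> l2_fun M \<Longrightarrow> g \<in> l2_fun M \<Longrightarrow> (\<lambda>x. f x - g x) \<in> l2_fun M"
  using l2_fun_add[OF _ l2_fun_uminus] by force

lemma integrable_l2_prod: "f \<in> l2_fun M \<Longrightarrow> g \<in> l2_fun M \<Longrightarrow> integrable M (\<lambda>x. cnj (f x) * g x)"
proof (rule Bochner_Integration.integrable_bound)
  assume f: "f \<in> l2_fun M" and g: "g \<in> l2_fun M"
  note fg = l2_funD[OF f] l2_funD[OF g]
  show "integrable M (\<lambda>x. (cmod (f x))\<^sup>2 + (cmod (g x))\<^sup>2)" using fg by simp
  have "cmod (cnj a * b) \<le> (cmod a)\<^sup>2 + (cmod b)\<^sup>2" for a b :: complex
  proof -
    have "2 * (cmod a * cmod b) \<le> (cmod a)\<^sup>2 + (cmod b)\<^sup>2"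
      using sum_squares_bound[of "cmod a" "cmod b"] by simp
    moreover have "0 \<le> cmod a * cmod b" by simp
    ultimately show ?thesis unfolding norm_mult complex_mod_cnj by linarith
  qed
  then show "AE x in M. norm (cnj (f x) * g x) \<le> norm ((cmod (f x))\<^sup>2 + (cmod (g x))\<^sup>2)"
    by simp
  show "(\<lambda>x. cnj (f x) * g x) \<in> borel_measurable M" using fg by simp
qed

lemma l2_prod_AE_cong:
  assumes "f \<in> borel_measurable M" "f' \<in> borel_measurable M" "g \<in> borel_measurable M" "g' \<in> borel_measurable M"
    and "AE x in M. f x = f' x" "AE x in M. g x = g' x"
  shows "(\<integral>x. cnj (f x) * g x \<partial>M) = (\<integral>x. cnj (f' x) * g' x \<partial>M)"
proof (rule integral_cong_AE)
  show "AE x in M. cnj (f x) * g x = cnj (f' x) * g' x"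
    using assms(5,6) by eventually_elim simp
qed (use assms(1-4) in measurable)

lemma l2_self_zero_iff:
  assumes f: "f \<in> l2_fun M"
  shows "Re (\<integral>x. cnj (f x) * f x \<partial>M) = 0 \<longleftrightarrow> (AE x in M. f x = 0)"
proof -
  have eq: "cnj (f x) * f x = complex_of_real ((cmod (f x))\<^sup>2)" for x
    by (metis complex_norm_square mult.commute)
  have "Re (\<integral>x. cnj (f x) * f x \<partial>M) = (\<integral>x. (cmod (f x))\<^sup>2 \<partial>M)"
    unfolding eq integral_complex_of_real by simp
  also have "\<dots> = 0 \<longleftrightarrow> (AE x in M. (cmod (f x))\<^sup>2 = 0)"
    by (intro integral_nonneg_eq_0_iff_AE l2_funD f) auto
  finally show ?thesis by simp
qed

lemma l2_self_nonneg: "0 \<le> Re (\<integral>x. cnj (f x) * f x \<partial>M)"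
proof -
  have eq: "cnj (f x) * f x = complex_of_real ((cmod (f x))\<^sup>2)" for x
    by (metis complex_norm_square mult.commute)
  show ?thesis unfolding eq integral_complex_of_real by simp
qed

section \<open>The direct sum of all L2 spaces as a real inner product space\<close>

definition hs_good :: "('a measure \<Rightarrow> 'a \<Rightarrow> complex) \<Rightarrow> bool" where
  "hs_good F \<longleftrightarrow> (\<forall>M. F M \<in> l2_fun M) \<and> finite {M. F M \<noteq> (\<lambda>x. 0)}"

definition hs_rel :: "('a measure \<Rightarrow> 'a \<Rightarrow> complex) \<Rightarrow> ('a measure \<Rightarrow> 'a \<Rightarrow> complex) \<Rightarrow> bool" where
  "hs_rel F G \<longleftrightarrow> hs_good F \<and> hs_good G \<and> (\<forall>M. AE x in M. F M x = G M x)"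

text \<open>
  The algebraic orthogonal direct sum of all \<open>L\<^sup>2(M)\<close>: operators on \<open>L\<^sup>2(leb j)\<close> for all \<open>j\<close>
  become relations on one inner product space, in which each \<open>L\<^sup>2(M)\<close> is a complete subspace.
\<close>

quotient_type 'a hs = "'a measure \<Rightarrow> 'a \<Rightarrow> complex" / partial: hs_rel
proof (rule part_equivpI, goal_cases)
  case 1
  show ?case by (rule exI[of _ "\<lambda>M x. 0"]) (simp add: hs_rel_def hs_good_def)
next
  case 2
  show ?case unfolding symp_def hs_rel_def by (auto simp: eq_commute)
next
  case 3
  show ?case
    unfolding transp_def hs_rel_def
  proof (intro allI impI conjI; (elim conjE)?)
    fix F G H :: "'a measure \<Rightarrow> 'a \<Rightarrow> complex" and M :: "'a measure"
    assume "\<forall>M. AE x in M. F M x = G M x" "\<forall>M. AE x in M. G M x = H M x"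
    then have "AE x in M. F M x = G M x" "AE x in M. G M x = H M x" by blast+
    then show "AE x in M. F M x = H M x" by eventually_elim simp
  qed auto
qed

lemma hs_relD: "hs_rel F G \<Longrightarrow> hs_good F" "hs_rel F G \<Longrightarrow> hs_good G"
  by (simp_all add: hs_rel_def)

lemma hs_rel_eqI: "hs_good F \<Longrightarrow> (\<And>M x. F M x = G M x) \<Longrightarrow> hs_rel F G"
proof -
  assume F: "hs_good F" and "\<And>M x. F M x = G M x"
  then have "F = G" by (intro ext)
  with F show ?thesis by (simp add: hs_rel_def)
qed

lemma hs_good_scale: "hs_good F \<Longrightarrow> hs_good (\<lambda>M x. c * F M x)"
proof -
  assume F: "hs_good F"
  have "{M. (\<lambda>x. c * F M x) \<noteq> (\<lambda>x. 0)} \<subseteq> {M. F M \<noteq> (\<lambda>x. 0)}" by auto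
  then show ?thesis using F l2_fun_scale unfolding hs_good_def by (blast intro: finite_subset)
qed

lemma hs_good_add: "hs_good F \<Longrightarrow> hs_good G \<Longrightarrow> hs_good (\<lambda>M x. F M x + G M x)"
proof -
  assume F: "hs_good F" and G: "hs_good G"
  have "{M. (\<lambda>x. F M x + G M x) \<noteq> (\<lambda>x. 0)} \<subseteq> {M. F M \<noteq> (\<lambda>x. 0)} \<union> {M. G M \<noteq> (\<lambda>x. 0)}"
    by auto
  moreover have "finite ({M. F M \<noteq> (\<lambda>x. 0)} \<union> {M. G M \<noteq> (\<lambda>x. 0)})"
    using F G by (simp add: hs_good_def)
  ultimately show ?thesis using F G l2_fun_add unfolding hs_good_def by (blast intro: finite_subset)
qed

lemma hs_good_uminus: "hs_good F \<Longrightarrow> hs_good (\<lambda>M x. - F M x)"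
  using hs_good_scale[of F "-1"] by simp

lemma hs_good_diff: "hs_good F \<Longrightarrow> hs_good G \<Longrightarrow> hs_good (\<lambda>M x. F M x - G M x)"
  using hs_good_add[OF _ hs_good_uminus, of F G] by simp

lemma hs_good_zero: "hs_good (\<lambda>M x. 0)"
  by (simp add: hs_good_def)

lemmas hs_good_intros = hs_good_scale hs_good_add hs_good_uminus hs_good_diff hs_good_zero

lemma hs_rel_bin:
  assumes FF: "hs_rel F F'" and GG: "hs_rel G G'"
    and "hs_good (\<lambda>M x. c (F M x) (G M x))" "hs_good (\<lambda>M x. c (F' M x) (G' M x))"
  shows "hs_rel (\<lambda>M x. c (F M x) (G M x)) (\<lambda>M x. c (F' M x) (G' M x))"
  unfolding hs_rel_def
proof (intro conjI allI assms)
  fix M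
  have "AE x in M. F M x = F' M x" "AE x in M. G M x = G' M x"
    using FF GG by (auto simp: hs_rel_def)
  then show "AE x in M. c (F M x) (G M x) = c (F' M x) (G' M x)" by eventually_elim simp
qed

text \<open>For families satisfying \<open>hs_good\<close> the support is finite, so
  \<open>Sum_any\<close> is a genuine finite sum. Only the real part is kept, since the ambient
  space is a real inner product space; \<open>cinner\<close> recovers the imaginary part.\<close>

definition raw_inner :: "('a measure \<Rightarrow> 'a \<Rightarrow> complex) \<Rightarrow> ('a measure \<Rightarrow> 'a \<Rightarrow> complex) \<Rightarrow> real" where
  "raw_inner F G = Sum_any (\<lambda>M. Re (\<integral>x. cnj (F M x) * G M x \<partial>M))"

lemma finite_raw_inner: "hs_good F \<Longrightarrow> finite {M. Re (\<integral>x. cnj (F M x) * G M x \<partial>M) \<noteq> 0}"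
proof -
  assume F: "hs_good F"
  have "{M. Re (\<integral>x. cnj (F M x) * G M x \<partial>M) \<noteq> 0} \<subseteq> {M. F M \<noteq> (\<lambda>x. 0)}"
  proof
    fix M assume "M \<in> {M. Re (\<integral>x. cnj (F M x) * G M x \<partial>M) \<noteq> 0}"
    then have "F M \<noteq> (\<lambda>x. 0)" by (intro notI) simp
    then show "M \<in> {M. F M \<noteq> (\<lambda>x. 0)}" by simp
  qed
  then show ?thesis using F unfolding hs_good_def by (blast intro: finite_subset)
qed

instantiation hs :: (type) real_inner
begin

lift_definition zero_hs :: "'a hs" is "\<lambda>M x. 0"
  by (simp add: hs_rel_def hs_good_def)

lift_definition plus_hs :: "'a hs \<Rightarrow> 'a hs \<Rightarrow> 'a hs" is "\<lambda>F G M x. F M x + G M x"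
  by (rule hs_rel_bin) (auto intro!: hs_good_intros dest: hs_relD)

lift_definition minus_hs :: "'a hs \<Rightarrow> 'a hs \<Rightarrow> 'a hs" is "\<lambda>F G M x. F M x - G M x"
  by (rule hs_rel_bin) (auto intro!: hs_good_intros dest: hs_relD)

lift_definition uminus_hs :: "'a hs \<Rightarrow> 'a hs" is "\<lambda>F M x. - F M x"
  subgoal for F F' by (rule hs_rel_bin[of F F' F F' "\<lambda>a b. - a"]) (auto intro!: hs_good_intros dest: hs_relD)
  done

lift_definition scaleR_hs :: "real \<Rightarrow> 'a hs \<Rightarrow> 'a hs" is "\<lambda>r F M x. complex_of_real r * F M x"
  subgoal for r F F'
    by (rule hs_rel_bin[of F F' F F' "\<lambda>a b. complex_of_real r * a"]) (auto intro!: hs_good_intros dest: hs_relD)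
  done

lift_definition inner_hs :: "'a hs \<Rightarrow> 'a hs \<Rightarrow> real" is raw_inner
proof -
  fix F F' G G' :: "'a measure \<Rightarrow> 'a \<Rightarrow> complex"
  assume "hs_rel F F'" "hs_rel G G'"
  then have "(\<integral>x. cnj (F M x) * G M x \<partial>M) = (\<integral>x. cnj (F' M x) * G' M x \<partial>M)" for M
    by (intro l2_prod_AE_cong) (auto simp: hs_rel_def hs_good_def l2_fun_def)
  then show "raw_inner F G = raw_inner F' G'" by (simp add: raw_inner_def)
qed

definition "norm (x :: 'a hs) = sqrt (inner x x)"
definition "dist (x :: 'a hs) y = norm (x - y)"
definition "sgn (x :: 'a hs) = inverse (norm x) *\<^sub>R x"
definition [code del]: "uniformity = (INF e\<in>{0 <..}. principal {(x :: 'a hs, y). dist x y < e})"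
definition [code del]: "open U = (\<forall>x\<in>U. eventually (\<lambda>(x', y). x' = x \<longrightarrow> y \<in> U) (uniformity :: ('a hs \<times> 'a hs) filter))"

instance
proof
  fix x y z :: "'a hs" and r s :: real
  show "x + y + z = x + (y + z)"
    by transfer (rule hs_rel_eqI, (intro hs_good_intros; erule hs_relD), simp add: algebra_simps)
  show "x + y = y + x"
    by transfer (rule hs_rel_eqI, (intro hs_good_intros; erule hs_relD), simp add: algebra_simps)
  show "0 + x = x"
    by transfer (rule hs_rel_eqI, (intro hs_good_intros; erule hs_relD), simp add: algebra_simps)
  show "- x + x = 0"
    by transfer (rule hs_rel_eqI, (intro hs_good_intros; erule hs_relD), simp add: algebra_simps)
  show "x - y = x + - y"
    by transfer (rule hs_rel_eqI, (intro hs_good_intros; erule hs_relD), simp add: algebra_simps)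
  show "r *\<^sub>R (x + y) = r *\<^sub>R x + r *\<^sub>R y"
    by transfer (rule hs_rel_eqI, (intro hs_good_intros; erule hs_relD), simp add: algebra_simps)
  show "(r + s) *\<^sub>R x = r *\<^sub>R x + s *\<^sub>R x"
    by transfer (rule hs_rel_eqI, (intro hs_good_intros; erule hs_relD), simp add: algebra_simps)
  show "r *\<^sub>R s *\<^sub>R x = (r * s) *\<^sub>R x"
    by transfer (rule hs_rel_eqI, (intro hs_good_intros; erule hs_relD), simp add: algebra_simps)
  show "1 *\<^sub>R x = x"
    by transfer (rule hs_rel_eqI, (intro hs_good_intros; erule hs_relD), simp add: algebra_simps)
  show "dist x y = norm (x - y)" by (rule dist_hs_def)
  show "sgn x = inverse (norm x) *\<^sub>R x" by (rule sgn_hs_def)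
  show "uniformity = (INF e\<in>{0 <..}. principal {(x :: 'a hs, y). dist x y < e})" by (rule uniformity_hs_def)
  show "open U = (\<forall>x\<in>U. eventually (\<lambda>(x', y). x' = x \<longrightarrow> y \<in> U) uniformity)" for U :: "'a hs set"
    by (rule open_hs_def)
  show "norm x = sqrt (inner x x)" by (rule norm_hs_def)
  show "inner x y = inner y x"
  proof transfer
    fix F G :: "'a measure \<Rightarrow> 'a \<Rightarrow> complex"
    have "Re (\<integral>x. cnj (F M x) * G M x \<partial>M) = Re (\<integral>x. cnj (G M x) * F M x \<partial>M)" for M
    proof -
      have "(\<integral>x. cnj (F M x) * G M x \<partial>M) = (\<integral>x. cnj (cnj (G M x) * F M x) \<partial>M)" by (simp add: mult.commute)
      also have "\<dots> = cnj (\<integral>x. cnj (G M x) * F M x \<partial>M)" by (rule Bochner_Integration.integral_cnj)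
      finally show ?thesis by simp
    qed
    then show "raw_inner F G = raw_inner G F" by (simp add: raw_inner_def)
  qed
  show "inner (x + y) z = inner x z + inner y z"
  proof transfer
    fix F G H :: "'a measure \<Rightarrow> 'a \<Rightarrow> complex"
    assume "hs_rel F F" "hs_rel G G" "hs_rel H H"
    then have g: "hs_good F" "hs_good G" "hs_good H" by (auto simp: hs_rel_def)
    have "Re (\<integral>x. cnj (F M x + G M x) * H M x \<partial>M)
        = Re (\<integral>x. cnj (F M x) * H M x \<partial>M) + Re (\<integral>x. cnj (G M x) * H M x \<partial>M)" for M
      using g by (simp add: distrib_right integrable_l2_prod hs_good_def)
    then show "raw_inner (\<lambda>M x. F M x + G M x) H = raw_inner F H + raw_inner G H"
      unfolding raw_inner_def by (simp add: Sum_any.distrib[OF finite_raw_inner finite_raw_inner] g)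
  qed
  show "inner (r *\<^sub>R x) y = r * inner x y"
  proof transfer
    fix r :: real and F G :: "'a measure \<Rightarrow> 'a \<Rightarrow> complex"
    assume "hs_rel F F" "hs_rel G G"
    then have g: "hs_good F" "hs_good G" by (auto simp: hs_rel_def)
    have "Re (\<integral>x. cnj (complex_of_real r * F M x) * G M x \<partial>M) = r * Re (\<integral>x. cnj (F M x) * G M x \<partial>M)" for M
      by (simp add: mult.assoc)
    then show "raw_inner (\<lambda>M x. complex_of_real r * F M x) G = r * raw_inner F G"
      unfolding raw_inner_def by (simp add: Sum_any_right_distrib[OF finite_raw_inner] g)
  qed
  show "0 \<le> inner x x"
    by transfer (auto simp: raw_inner_def Sum_any.expand_set intro!: sum_nonneg l2_self_nonneg)
  show "inner x x = 0 \<longleftrightarrow> x = 0"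
  proof transfer
    fix F :: "'a measure \<Rightarrow> 'a \<Rightarrow> complex"
    assume "hs_rel F F"
    then have g: "hs_good F" by (auto simp: hs_rel_def)
    have "raw_inner F F = 0 \<longleftrightarrow> (\<forall>M. Re (\<integral>x. cnj (F M x) * F M x \<partial>M) = 0)"
    proof -
      have "raw_inner F F = 0 \<longleftrightarrow> (\<forall>M\<in>{M. Re (\<integral>x. cnj (F M x) * F M x \<partial>M) \<noteq> 0}. Re (\<integral>x. cnj (F M x) * F M x \<partial>M) = 0)"
        unfolding raw_inner_def Sum_any.expand_set
        by (intro sum_nonneg_eq_0_iff finite_raw_inner[OF g] l2_self_nonneg)
      then show ?thesis by auto
    qed
    also have "\<dots> \<longleftrightarrow> (\<forall>M. AE x in M. F M x = 0)" using g by (simp add: l2_self_zero_iff hs_good_def)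
    finally show "raw_inner F F = 0 \<longleftrightarrow> hs_rel F (\<lambda>M x. 0)" using g by (simp add: hs_rel_def hs_good_def)
  qed
qed

end

text \<open>Multiplication by the imaginary unit: complex linearity of a real subspace is invariance under it.\<close>

lift_definition ii :: "'a hs \<Rightarrow> 'a hs" is "\<lambda>F M x. \<i> * F M x"
  subgoal for F F'
    by (rule hs_rel_bin[of F F' F F' "\<lambda>a b. \<i> * a"]) (auto intro!: hs_good_intros dest: hs_relD)
  done

lemma hs_good_vec: "hs_good (\<lambda>N x. if f \<in> l2_fun M \<and> N = M then f x else 0)"
proof -
  have "finite {N. (\<lambda>x. if f \<in> l2_fun M \<and> N = M then f x else 0) \<noteq> (\<lambda>x. 0)}"
    by (rule finite_subset[of _ "{M}"]) auto
  moreover have "(\<lambda>x. if f \<in> l2_fun M \<and> N = M then f x else 0) \<in> l2_fun N" for N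
    by (cases "f \<in> l2_fun M \<and> N = M") auto
  ultimately show ?thesis by (simp only: hs_good_def) simp
qed

text \<open>The \<open>if\<close> makes the map total: functions that are not square-integrable go
  to 0.\<close>

lift_definition vec :: "'a measure \<Rightarrow> ('a \<Rightarrow> complex) \<Rightarrow> 'a hs" is
  "\<lambda>M f N x. if f \<in> l2_fun M \<and> N = M then f x else 0"
  by (intro hs_rel_eqI hs_good_vec refl)

lemma ii_add: "ii (x + y) = ii x + ii y"
  by transfer (rule hs_rel_eqI, (intro hs_good_intros; erule hs_relD), simp add: algebra_simps)

lemma ii_scaleR: "ii (r *\<^sub>R x) = r *\<^sub>R ii x"
  by transfer (rule hs_rel_eqI, (intro hs_good_intros; erule hs_relD), simp add: algebra_simps)

lemma ii_ii [simp]: "ii (ii x) = - x"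
  by transfer (rule hs_rel_eqI, (intro hs_good_intros; erule hs_relD), simp add: algebra_simps)

lemma inner_ii_ii [simp]: "ii x \<bullet> ii y = x \<bullet> y"
proof transfer
  fix F G :: "'a measure \<Rightarrow> 'a \<Rightarrow> complex"
  have "cnj (\<i> * a) * (\<i> * b) = cnj a * b" for a b by (simp add: algebra_simps)
  then show "raw_inner (\<lambda>M x. \<i> * F M x) (\<lambda>M x. \<i> * G M x) = raw_inner F G" by (simp add: raw_inner_def)
qed

lemma vec_add: "f \<in> l2_fun M \<Longrightarrow> g \<in> l2_fun M \<Longrightarrow> vec M (\<lambda>x. f x + g x) = vec M f + vec M g"
  by transfer (rule hs_rel_eqI[OF hs_good_vec], simp add: l2_fun_add)

lemma vec_diff: "f \<in> l2_fun M \<Longrightarrow> g \<in> l2_fun M \<Longrightarrow> vec M (\<lambda>x. f x - g x) = vec M f - vec M g"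
  by transfer (rule hs_rel_eqI[OF hs_good_vec], simp add: l2_fun_diff)

lemma vec_scaleR: "f \<in> l2_fun M \<Longrightarrow> vec M (\<lambda>x. complex_of_real c * f x) = c *\<^sub>R vec M f"
  by transfer (rule hs_rel_eqI[OF hs_good_vec], simp add: l2_fun_scale)

lemma vec_ii: "f \<in> l2_fun M \<Longrightarrow> vec M (\<lambda>x. \<i> * f x) = ii (vec M f)"
  by transfer (rule hs_rel_eqI[OF hs_good_vec], simp add: l2_fun_scale)

lemma vec_zero: "vec M (\<lambda>x. 0) = 0"
  by transfer (rule hs_rel_eqI[OF hs_good_vec], simp)

lemma vec_eq_iff:
  assumes "f \<in> l2_fun M" "g \<in> l2_fun M"
  shows "vec M f = vec M g \<longleftrightarrow> (AE x in M. f x = g x)"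
proof -
  have "vec M f = vec M g \<longleftrightarrow> hs_rel (\<lambda>N x. if f \<in> l2_fun M \<and> N = M then f x else 0)
      (\<lambda>N x. if g \<in> l2_fun M \<and> N = M then g x else 0)"
    by (transfer fixing: M f g) (rule refl)
  also have "\<dots> \<longleftrightarrow> (\<forall>N. AE x in N. (if N = M then f x else 0) = (if N = M then g x else 0))"
    unfolding hs_rel_def using hs_good_vec[of f M] hs_good_vec[of g M] assms by simp
  also have "\<dots> \<longleftrightarrow> (AE x in M. f x = g x)"
  proof
    assume "\<forall>N. AE x in N. (if N = M then f x else 0) = (if N = M then g x else 0)"
    from spec[OF this, of M] show "AE x in M. f x = g x" by simp
  next
    assume *: "AE x in M. f x = g x"
    show "\<forall>N. AE x in N. (if N = M then f x else 0) = (if N = M then g x else 0)"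
    proof
      fix N show "AE x in N. (if N = M then f x else 0) = (if N = M then g x else 0)"
      proof (cases "N = M")
        case True
        then show ?thesis using * by (simp only: True simp_thms if_True)
      qed simp
    qed
  qed
  finally show ?thesis .
qed

lemma inner_vec:
  assumes "f \<in> l2_fun M" "g \<in> l2_fun M"
  shows "vec M f \<bullet> vec M g = Re (\<integral>x. cnj (f x) * g x \<partial>M)"
  using assms
proof (transfer fixing: M f g)
  let ?h = "\<lambda>N. Re (\<integral>x. cnj (if f \<in> l2_fun M \<and> N = M then f x else 0) * (if g \<in> l2_fun M \<and> N = M then g x else 0) \<partial>N)"
  have "?h N = 0" if "N \<noteq> M" for N using that by simp
  then have "{N. ?h N \<noteq> 0} \<subseteq> {M}" by blast
  then have "Sum_any ?h = sum ?h {M}" by (intro Sum_any.expand_superset) auto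
  then show "raw_inner (\<lambda>N x. if f \<in> l2_fun M \<and> N = M then f x else 0)
      (\<lambda>N x. if g \<in> l2_fun M \<and> N = M then g x else 0) = Re (\<integral>x. cnj (f x) * g x \<partial>M)"
    using assms by (simp add: raw_inner_def)
qed

section \<open>Complex scalars and the complex inner product\<close>

definition scaleC :: "complex \<Rightarrow> 'a hs \<Rightarrow> 'a hs" where
  "scaleC c x = Re c *\<^sub>R x + Im c *\<^sub>R ii x"

text \<open>The imaginary part is right because the real part of cnj(i f) g is the imaginary part of
  cnj(f) g. The product is antilinear in its first argument.\<close>

definition cinner :: "'a hs \<Rightarrow> 'a hs \<Rightarrow> complex" where
  "cinner x y = Complex (x \<bullet> y) (ii x \<bullet> y)"

lemma norm_ii [simp]: "norm (ii x) = norm x"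
  by (simp add: norm_eq_sqrt_inner)

lemma bounded_linear_ii: "bounded_linear ii"
  by (rule bounded_linear_intro[where K = 1]) (simp_all add: ii_add ii_scaleR)

lemma inner_ii_left: "ii x \<bullet> y = - (x \<bullet> ii y)"
  using inner_ii_ii[of "ii x" y] by simp

lemma inner_ii_self [simp]: "ii x \<bullet> x = 0" "x \<bullet> ii x = 0"
  using inner_ii_left[of x x] by (simp_all add: inner_commute)

lemma cinner_add_left: "cinner (x + y) z = cinner x z + cinner y z"
  and cinner_add_right: "cinner x (y + z) = cinner x y + cinner x z"
  by (simp_all add: cinner_def ii_add inner_add_left inner_add_right complex_eq_iff)

lemma cinner_diff_right: "cinner x (y - z) = cinner x y - cinner x z"
  by (simp_all add: cinner_def inner_diff_right complex_eq_iff)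

lemma ii_zero [simp]: "ii 0 = 0"
  using ii_scaleR[of 0 "0 :: 'a hs"] by simp

lemma cinner_zero [simp]: "cinner 0 x = 0" "cinner x 0 = 0"
  by (simp_all add: cinner_def complex_eq_iff)

lemma cinner_scaleC_right: "cinner x (scaleC c y) = c * cinner x y"
  by (simp add: cinner_def scaleC_def inner_add_right inner_ii_left complex_eq_iff)

lemma cinner_commute: "cnj (cinner x y) = cinner y x"
  using inner_ii_left[of x y] by (simp add: cinner_def complex_eq_iff inner_commute)

lemma cinner_scaleC_left: "cinner (scaleC c x) y = cnj c * cinner x y"
  by (metis cinner_commute cinner_scaleC_right complex_cnj_mult)

lemma Re_cinner [simp]: "Re (cinner x y) = x \<bullet> y"
  by (simp add: cinner_def)

lemma cinner_self: "cinner x x = complex_of_real ((norm x)\<^sup>2)"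
  by (simp add: cinner_def complex_eq_iff power2_norm_eq_inner)

lemma norm_scaleC [simp]: "norm (scaleC c x) = cmod c * norm x"
proof -
  have "complex_of_real ((norm (scaleC c x))\<^sup>2) = complex_of_real ((cmod c * norm x)\<^sup>2)"
  proof -
    have "complex_of_real ((norm (scaleC c x))\<^sup>2) = (c * cnj c) * cinner x x"
      unfolding cinner_self[symmetric] cinner_scaleC_left cinner_scaleC_right by simp
    also have "\<dots> = complex_of_real ((cmod c)\<^sup>2) * complex_of_real ((norm x)\<^sup>2)"
      unfolding cinner_self complex_norm_square ..
    finally show ?thesis by (simp add: power_mult_distrib)
  qed
  then have "(norm (scaleC c x))\<^sup>2 = (cmod c * norm x)\<^sup>2" by (simp only: of_real_eq_iff)
  then show ?thesis by (rule power2_eq_imp_eq) simp_all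
qed

lemma scaleC_add_right: "scaleC c (x + y) = scaleC c x + scaleC c y"
  by (simp add: scaleC_def ii_add algebra_simps)

lemma scaleC_add_left: "scaleC (c + d) x = scaleC c x + scaleC d x"
  by (simp add: scaleC_def algebra_simps)

lemma scaleC_scaleC: "scaleC c (scaleC d x) = scaleC (c * d) x"
  by (simp add: scaleC_def ii_add ii_scaleR algebra_simps)

lemma scaleC_i: "scaleC \<i> x = ii x"
  by (simp add: scaleC_def)

lemma scaleC_of_real: "scaleC (complex_of_real r) x = r *\<^sub>R x"
  by (simp add: scaleC_def)

lemma scaleC_zero [simp]: "scaleC 0 x = 0" "scaleC c 0 = 0"
  by (simp_all add: scaleC_def)

lemma bounded_linear_scaleC: "bounded_linear (scaleC c)"
  by (rule bounded_linear_intro[where K = "cmod c"])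
    (simp_all add: scaleC_add_right scaleC_scaleC mult.commute flip: scaleC_of_real)

lemma bounded_linear_scaleC_left: "bounded_linear (\<lambda>c. scaleC c x)"
  by (rule bounded_linear_intro[where K = "norm x"])
    (simp_all add: scaleC_add_left scaleC_scaleC scaleR_conv_of_real flip: scaleC_of_real)

text \<open>Real and imaginary part are bounded separately, whence the factor 2; it reappears in the
  trace estimates.\<close>

lemma norm_cinner_le: "cmod (cinner x y) \<le> 2 * (norm x * norm y)"
proof -
  have "cmod (cinner x y) \<le> \<bar>x \<bullet> y\<bar> + \<bar>ii x \<bullet> y\<bar>"
    using cmod_le[of "cinner x y"] by (simp add: cinner_def)
  also have "\<dots> \<le> norm x * norm y + norm (ii x) * norm y"
    by (intro add_mono Cauchy_Schwarz_ineq2)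
  finally show ?thesis by simp
qed

lemma bounded_linear_cinner_right: "bounded_linear (cinner x)"
  by (rule bounded_linear_intro[where K = "2 * norm x"])
    (use norm_cinner_le[of x] in \<open>simp_all add: cinner_add_right cinner_scaleC_right scaleR_conv_of_real mult.commute
      mult.left_commute flip: scaleC_of_real\<close>)

lemma cinner_sum_left: "cinner (\<Sum>i\<in>I. f i) y = (\<Sum>i\<in>I. cinner (f i) y)"
  by (induction I rule: infinite_finite_induct) (auto simp: cinner_add_left)

lemma cinner_sum_right: "cinner y (\<Sum>i\<in>I. f i) = (\<Sum>i\<in>I. cinner y (f i))"
  by (induction I rule: infinite_finite_induct) (auto simp: cinner_add_right)

lemma vec_scaleC:
  assumes f: "f \<in> l2_fun M" shows "vec M (\<lambda>x. c * f x) = scaleC c (vec M f)"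
proof -
  have "(\<lambda>x. c * f x) = (\<lambda>x. complex_of_real (Re c) * f x + complex_of_real (Im c) * (\<i> * f x))"
    by (auto simp: complex_eq_iff)
  then show ?thesis
    using f by (simp only: vec_add vec_scaleR vec_ii l2_fun_scale scaleC_def)
qed

lemma cinner_vec:
  assumes f: "f \<in> l2_fun M" and g: "g \<in> l2_fun M"
  shows "cinner (vec M f) (vec M g) = (\<integral>x. cnj (f x) * g x \<partial>M)"
proof (rule complex_eqI)
  show "Re (cinner (vec M f) (vec M g)) = Re (\<integral>x. cnj (f x) * g x \<partial>M)"
    by (simp add: inner_vec f g)
  have "Im (cinner (vec M f) (vec M g)) = Re (\<integral>x. cnj (\<i> * f x) * g x \<partial>M)"
    using inner_vec[OF l2_fun_scale[OF f, of \<i>] g] by (simp add: cinner_def vec_ii f)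
  also have "(\<lambda>x. cnj (\<i> * f x) * g x) = (\<lambda>x. - \<i> * (cnj (f x) * g x))" by (simp add: mult.assoc)
  also have "(\<integral>x. - \<i> * (cnj (f x) * g x) \<partial>M) = - \<i> * (\<integral>x. cnj (f x) * g x \<partial>M)"
    by (intro Bochner_Integration.integral_mult_right integrable_l2_prod f g)
  finally show "Im (cinner (vec M f) (vec M g)) = Im (\<integral>x. cnj (f x) * g x \<partial>M)" by simp
qed

lemma norm_vec: "f \<in> l2_fun M \<Longrightarrow> (norm (vec M f))\<^sup>2 = (\<integral>x. (cmod (f x))\<^sup>2 \<partial>M)"
proof -
  assume f: "f \<in> l2_fun M"
  have eq: "cnj (f x) * f x = complex_of_real ((cmod (f x))\<^sup>2)" for x
    by (metis complex_norm_square mult.commute)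
  have "complex_of_real ((norm (vec M f))\<^sup>2) = complex_of_real (\<integral>x. (cmod (f x))\<^sup>2 \<partial>M)"
    unfolding cinner_self[symmetric] cinner_vec[OF f f] eq integral_complex_of_real ..
  then show ?thesis by (simp only: of_real_eq_iff)
qed

lemma nn_integral_norm_vec: "f \<in> l2_fun M \<Longrightarrow> (\<integral>\<^sup>+x. ennreal ((cmod (f x))\<^sup>2) \<partial>M) = ennreal ((norm (vec M f))\<^sup>2)"
  unfolding norm_vec by (intro nn_integral_eq_integral l2_funD) auto

section \<open>Completeness of L2\<close>

definition VV :: "'a measure \<Rightarrow> 'a hs set" where
  "VV M = vec M ` l2_fun M"

lemma vec_in_VV [simp]: "f \<in> l2_fun M \<Longrightarrow> vec M f \<in> VV M"
  by (simp add: VV_def)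

lemma subspace_VV: "subspace (VV M)"
  unfolding subspace_def
proof (intro conjI ballI allI)
  show "0 \<in> VV M" using vec_in_VV[OF l2_fun_zero] by (simp add: vec_zero)
next
  fix x y assume "x \<in> VV M" "y \<in> VV M"
  then obtain f g where "f \<in> l2_fun M" "g \<in> l2_fun M" "x = vec M f" "y = vec M g" by (auto simp: VV_def)
  then show "x + y \<in> VV M" using vec_in_VV[OF l2_fun_add, of f M g] by (simp add: vec_add)
next
  fix x c assume "x \<in> VV M"
  then obtain f where "f \<in> l2_fun M" "x = vec M f" by (auto simp: VV_def)
  then show "c *\<^sub>R x \<in> VV M" using vec_in_VV[OF l2_fun_scale, of f M] by (simp flip: vec_scaleR)
qed

lemma scaleC_in_VV: "x \<in> VV M \<Longrightarrow> scaleC c x \<in> VV M"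
  unfolding VV_def by (auto simp: vec_scaleC[symmetric] l2_fun_scale)

lemma ii_in_VV: "x \<in> VV M \<Longrightarrow> ii x \<in> VV M"
  using scaleC_in_VV[of x M \<i>] by (simp add: scaleC_i)

text \<open>The weight 2^k turns finiteness of the sum into a bound of order (1 / sqrt 2)^k for the
  increments, which is summable.\<close>

lemma rapidly_Cauchy_convergent:
  fixes g :: "nat \<Rightarrow> complex"
  assumes "suminf (\<lambda>k. ennreal (2 ^ k * (cmod (g (Suc k) - g k))\<^sup>2)) < \<infinity>"
  shows "convergent g"
proof -
  let ?d = "\<lambda>k. g (Suc k) - g k"
  obtain C where C: "C \<ge> 0" "suminf (\<lambda>k. ennreal (2 ^ k * (cmod (?d k))\<^sup>2)) = ennreal C"
    using assms unfolding infinity_ennreal_def less_top_ennreal by blast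
  have b: "cmod (?d k) \<le> sqrt C * (1 / sqrt 2) ^ k" for k
  proof -
    have "ennreal (2 ^ k * (cmod (?d k))\<^sup>2) \<le> ennreal C"
      using sum_le_suminf[of "\<lambda>k. ennreal (2 ^ k * (cmod (?d k))\<^sup>2)" "{k}"] C by simp
    then have "2 ^ k * (cmod (?d k))\<^sup>2 \<le> C" using C by simp
    then have "(cmod (?d k))\<^sup>2 \<le> C / 2 ^ k" by (simp add: field_simps)
    then have "cmod (?d k) \<le> sqrt (C / 2 ^ k)" by (simp add: real_le_rsqrt)
    also have "\<dots> = sqrt C * (1 / sqrt 2) ^ k" by (simp add: real_sqrt_divide real_sqrt_power power_one_over)
    finally show ?thesis .
  qed
  have "summable (\<lambda>k. sqrt C * (1 / sqrt 2) ^ k)" by (intro summable_mult summable_geometric) simp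
  then have "summable ?d" by (rule summable_comparison_test') (rule b)
  then have "convergent (\<lambda>n. \<Sum>k<n. ?d k)" by (simp add: summable_iff_convergent)
  then have "convergent (\<lambda>n. g n - g 0)" by (simp add: sum_lessThan_telescope)
  then show ?thesis using convergent_diff_const_right_iff by blast
qed

text \<open>Fatou's lemma gives square integrability of the pointwise limit and the norm estimate at
  the same time.\<close>

lemma Fatou_l2:
  assumes g: "\<And>k. g k \<in> l2_fun M" and lim: "AE x in M. (\<lambda>k. g k x) \<longlonglongrightarrow> h x"
    and h: "h \<in> borel_measurable M" and f: "f \<in> l2_fun M"
    and K: "\<And>k. k \<ge> k0 \<Longrightarrow> (norm (vec M (g k) - vec M f))\<^sup>2 \<le> K"
  shows "(\<lambda>x. h x - f x) \<in> l2_fun M" "(norm (vec M (\<lambda>x. h x - f x)))\<^sup>2 \<le> K"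
proof -
  have fm [measurable]: "f \<in> borel_measurable M" and gm [measurable]: "g k \<in> borel_measurable M" for k
    using f g l2_funD by auto
  note h [measurable]
  have K0: "0 \<le> K" using order_trans[OF zero_le_power2 K[of k0]] by simp
  have "(\<integral>\<^sup>+x. ennreal ((cmod (h x - f x))\<^sup>2) \<partial>M) = (\<integral>\<^sup>+x. liminf (\<lambda>k. ennreal ((cmod (g k x - f x))\<^sup>2)) \<partial>M)"
  proof (rule nn_integral_cong_AE, use lim in eventually_elim)
    fix x assume "(\<lambda>k. g k x) \<longlonglongrightarrow> h x"
    then have "(\<lambda>k. ennreal ((cmod (g k x - f x))\<^sup>2)) \<longlonglongrightarrow> ennreal ((cmod (h x - f x))\<^sup>2)"
      by (intro tendsto_ennrealI tendsto_intros)
    then show "ennreal ((cmod (h x - f x))\<^sup>2) = liminf (\<lambda>k. ennreal ((cmod (g k x - f x))\<^sup>2))"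
      using lim_imp_Liminf[OF sequentially_bot] by metis
  qed
  also have "\<dots> \<le> liminf (\<lambda>k. \<integral>\<^sup>+x. ennreal ((cmod (g k x - f x))\<^sup>2) \<partial>M)"
    by (rule nn_integral_liminf) measurable
  also have "\<dots> \<le> ennreal K"
  proof (rule Liminf_le)
    show "\<forall>\<^sub>F k in sequentially. (\<integral>\<^sup>+x. ennreal ((cmod (g k x - f x))\<^sup>2) \<partial>M) \<le> ennreal K"
      using eventually_ge_at_top[of k0]
    proof eventually_elim
      case (elim k)
      then show ?case using nn_integral_norm_vec[OF l2_fun_diff[OF g f], of k] K[OF elim]
        by (simp add: vec_diff g f ennreal_leI)
    qed
  qed simp
  finally have le: "(\<integral>\<^sup>+x. ennreal ((cmod (h x - f x))\<^sup>2) \<partial>M) \<le> ennreal K" .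
  have "(\<integral>\<^sup>+x. ennreal (norm ((cmod (h x - f x))\<^sup>2)) \<partial>M) < \<infinity>"
    using le_less_trans[OF le, of \<infinity>] by simp
  then show l2: "(\<lambda>x. h x - f x) \<in> l2_fun M"
    unfolding l2_fun_def by (auto intro!: integrableI_bounded)
  from le show "(norm (vec M (\<lambda>x. h x - f x)))\<^sup>2 \<le> K"
    unfolding nn_integral_norm_vec[OF l2] using K0 by simp
qed

lemma complete_VV: "uniform_space_class.complete (VV M)"
  unfolding complete_def
proof (intro allI impI, elim conjE)
  fix f assume "\<forall>n. f n \<in> VV M" and C: "Cauchy f"
  then have "\<forall>n. \<exists>g. g \<in> l2_fun M \<and> f n = vec M g" by (auto simp: VV_def)
  then obtain g where g: "\<And>n. g n \<in> l2_fun M" and f: "f = (\<lambda>n. vec M (g n))" by metis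
  have gm [measurable]: "g k \<in> borel_measurable M" for k using g l2_funD by auto
  \<comment> \<open>The rate 8^-k for squared norms leaves room for the weight 2^k: the k-th
    weighted increment has integral at most 4^-k.\<close>
  have "\<forall>k. \<exists>N. \<forall>m\<ge>N. \<forall>n\<ge>N. norm (f m - f n) < sqrt ((1 / 8) ^ k)"
    using CauchyD[OF C] by simp
  then obtain N where N: "\<And>k m n. m \<ge> N k \<Longrightarrow> n \<ge> N k \<Longrightarrow> norm (f m - f n) < sqrt ((1 / 8) ^ k)" by metis
  \<comment> \<open>Partial sums make \<open>r\<close> increasing, with \<open>r k\<close> at least
    \<open>N k\<close> and at least \<open>k\<close>.\<close>
  define r where "r k = (\<Sum>i\<le>k. Suc (N i))" for k
  have rN: "N k \<le> r k" "r k \<le> r (Suc k)" for k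
  proof -
    have "Suc (N k) \<le> r k" unfolding r_def by (rule member_le_sum[of k "{..k}"]) auto
    then show "N k \<le> r k" "r k \<le> r (Suc k)" by (auto simp: r_def)
  qed
  have rk: "k \<le> r k" for k
  proof -
    have "(\<Sum>i\<le>k. 1) \<le> r k" unfolding r_def by (rule sum_mono) simp
    then show ?thesis by simp
  qed
  let ?d = "\<lambda>k x. g (r (Suc k)) x - g (r k) x"
  have d: "(\<integral>\<^sup>+x. ennreal (2 ^ k * (cmod (?d k x))\<^sup>2) \<partial>M) \<le> ennreal ((1 / 4) ^ k)" for k
  proof -
    have "norm (f (r (Suc k)) - f (r k)) < sqrt ((1 / 8) ^ k)"
      using rN[of k] by (intro N) auto
    then have "(norm (f (r (Suc k)) - f (r k)))\<^sup>2 < (sqrt ((1 / 8) ^ k))\<^sup>2"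
      by (intro power_strict_mono) auto
    then have le: "(norm (f (r (Suc k)) - f (r k)))\<^sup>2 \<le> (1 / 8) ^ k" by simp
    have "(\<integral>\<^sup>+x. ennreal (2 ^ k * (cmod (?d k x))\<^sup>2) \<partial>M) = ennreal (2 ^ k) * (\<integral>\<^sup>+x. ennreal ((cmod (?d k x))\<^sup>2) \<partial>M)"
      by (subst nn_integral_cmult[symmetric]) (simp_all add: ennreal_mult)
    also have "\<dots> = ennreal (2 ^ k * (norm (f (r (Suc k)) - f (r k)))\<^sup>2)"
      using nn_integral_norm_vec[OF l2_fun_diff[OF g g], of "r (Suc k)" "r k"]
      by (simp add: f vec_diff g ennreal_mult)
    also have "\<dots> \<le> ennreal (2 ^ k * (1 / 8) ^ k)" using le by (intro ennreal_leI mult_left_mono) auto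
    also have "2 ^ k * (1 / 8) ^ k = (1 / 4 :: real) ^ k" by (simp flip: power_mult_distrib)
    finally show ?thesis .
  qed
  have "(\<integral>\<^sup>+x. suminf (\<lambda>k. ennreal (2 ^ k * (cmod (?d k x))\<^sup>2)) \<partial>M) = suminf (\<lambda>k. \<integral>\<^sup>+x. ennreal (2 ^ k * (cmod (?d k x))\<^sup>2) \<partial>M)"
    by (rule nn_integral_suminf) measurable
  also have "\<dots> \<le> suminf (\<lambda>k. ennreal ((1 / 4) ^ k))" by (intro suminf_le d) auto
  also have "\<dots> = ennreal (suminf (\<lambda>k. (1 / 4) ^ k))" by (intro suminf_ennreal2 summable_geometric) auto
  finally have fin: "(\<integral>\<^sup>+x. suminf (\<lambda>k. ennreal (2 ^ k * (cmod (?d k x))\<^sup>2)) \<partial>M) \<noteq> \<infinity>"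
    by (metis ennreal_less_top infinity_ennreal_def leD)
  have "AE x in M. suminf (\<lambda>k. ennreal (2 ^ k * (cmod (?d k x))\<^sup>2)) \<noteq> \<infinity>"
    by (rule nn_integral_PInf_AE[OF _ fin]) measurable
  then have conv: "AE x in M. convergent (\<lambda>k. g (r k) x)"
    by eventually_elim (rule rapidly_Cauchy_convergent, simp add: top.not_eq_extremum)
  define h where "h x = lim (\<lambda>k. g (r k) x)" for x
  have hm: "h \<in> borel_measurable M" unfolding h_def by measurable
  have lim: "AE x in M. (\<lambda>k. g (r k) x) \<longlonglongrightarrow> h x"
    using conv by eventually_elim (simp add: h_def convergent_LIMSEQ_iff)
  have est: "(\<lambda>x. h x - g n x) \<in> l2_fun M \<and> (norm (vec M (\<lambda>x. h x - g n x)))\<^sup>2 \<le> (1 / 8) ^ k"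
    if "n \<ge> N k" for n k
  proof -
    have "(norm (vec M (g (r m)) - vec M (g n)))\<^sup>2 \<le> (1 / 8) ^ k" if "m \<ge> N k" for m
    proof -
      have "norm (f (r m) - f n) < sqrt ((1 / 8) ^ k)"
        using that \<open>n \<ge> N k\<close> rk[of m] by (intro N) auto
      then have "(norm (f (r m) - f n))\<^sup>2 < (sqrt ((1 / 8) ^ k))\<^sup>2" by (intro power_strict_mono) auto
      then show ?thesis by (simp add: f)
    qed
    from Fatou_l2[OF g lim hm g this] show ?thesis by blast
  qed
  from est[of 0 "N 0"] have "(\<lambda>x. h x - g (N 0) x) \<in> l2_fun M" by simp
  from l2_fun_add[OF this g[of "N 0"]] have h: "h \<in> l2_fun M" by simp
  have "f \<longlonglongrightarrow> vec M h"
  proof (rule LIMSEQ_I)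
    fix e :: real assume e: "e > 0"
    then obtain k where k: "(1 / 8) ^ k < e\<^sup>2" using real_arch_pow_inv[of "e\<^sup>2" "1 / 8"] by auto
    show "\<exists>no. \<forall>n\<ge>no. norm (f n - vec M h) < e"
    proof (intro exI allI impI)
      fix n assume "n \<ge> N k"
      with est[OF this] k have "(norm (vec M h - f n))\<^sup>2 < e\<^sup>2" by (simp add: vec_diff h g f)
      then show "norm (f n - vec M h) < e"
        using e by (metis less_eq_real_def norm_minus_commute power_less_imp_less_base)
    qed
  qed
  then show "\<exists>l\<in>VV M. f \<longlonglongrightarrow> l" using h by auto
qed

interpretation VV: hilbert_subspace "VV M" for M
  by unfold_locales (rule subspace_VV complete_VV)+

section \<open>Transfer between operators on equivalence classes and relations on the ambient
  space\<close>

lemma equiv_l2_rel: "equiv (l2_fun M) (l2_rel M)"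
  unfolding equiv_def
proof (intro conjI)
  show "l2_rel M \<subseteq> l2_fun M \<times> l2_fun M" by (auto simp: l2_rel_def)
  show "refl_on (l2_fun M) (l2_rel M)" by (auto simp: refl_on_def l2_rel_def)
  show "sym (l2_rel M)" by (auto simp: sym_def l2_rel_def eq_commute)
  show "trans (l2_rel M)"
  proof (rule transI)
    fix f g h assume fg: "(f, g) \<in> l2_rel M" and gh: "(g, h) \<in> l2_rel M"
    then have "AE x in M. f x = g x" "AE x in M. g x = h x" by (auto simp: l2_rel_def)
    then have "AE x in M. f x = h x" by eventually_elim simp
    with fg gh show "(f, h) \<in> l2_rel M" by (simp add: l2_rel_def)
  qed
qed

lemma l2_class_in [simp]: "f \<in> l2_fun M \<Longrightarrow> l2_class M f \<in> L2 M"
  unfolding L2_def l2_class_def by (rule quotientI)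

lemma l2_rep_in:
  assumes "a \<in> L2 M" shows "l2_rep a \<in> l2_fun M" and "l2_class M (l2_rep a) = a"
proof -
  obtain f where f: "f \<in> l2_fun M" "a = l2_rel M `` {f}"
    using assms unfolding L2_def by (auto elim: quotientE)
  have "f \<in> a" using f equiv_class_self[OF equiv_l2_rel] by blast
  then have r: "l2_rep a \<in> a" unfolding l2_rep_def by (rule someI[of "\<lambda>f. f \<in> a"])
  then have "(f, l2_rep a) \<in> l2_rel M" using f by auto
  then show "l2_rep a \<in> l2_fun M" "l2_class M (l2_rep a) = a"
    using f equiv_class_eq[OF equiv_l2_rel] by (auto simp: l2_rel_def l2_class_def)
qed

definition emb :: "'a measure \<Rightarrow> 'a l2 \<Rightarrow> 'a hs" where
  "emb M a = vec M (l2_rep a)"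

lemma emb_class [simp]: "f \<in> l2_fun M \<Longrightarrow> emb M (l2_class M f) = vec M f"
proof -
  assume f: "f \<in> l2_fun M"
  note r = l2_rep_in[OF l2_class_in[OF f]]
  from r(2) have "(l2_rep (l2_class M f), f) \<in> l2_rel M"
    using eq_equiv_class_iff[OF equiv_l2_rel r(1) f] by (simp add: l2_class_def)
  then show ?thesis using r(1) f by (simp add: emb_def vec_eq_iff l2_rel_def)
qed

lemma emb_in_VV [simp]: "a \<in> L2 M \<Longrightarrow> emb M a \<in> VV M"
  by (simp add: emb_def l2_rep_in)

lemma VV_emb: "x \<in> VV M \<Longrightarrow> \<exists>a\<in>L2 M. x = emb M a"
  unfolding VV_def using emb_class l2_class_in by (metis imageE)

lemma emb_eq_iff: "a \<in> L2 M \<Longrightarrow> b \<in> L2 M \<Longrightarrow> emb M a = emb M b \<longleftrightarrow> a = b"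
proof
  assume ab: "a \<in> L2 M" "b \<in> L2 M" "emb M a = emb M b"
  then have "(l2_rep a, l2_rep b) \<in> l2_rel M"
    by (simp add: emb_def vec_eq_iff l2_rep_in l2_rel_def)
  then have "l2_class M (l2_rep a) = l2_class M (l2_rep b)"
    unfolding l2_class_def by (rule equiv_class_eq[OF equiv_l2_rel])
  then show "a = b" using ab l2_rep_in(2) by metis
qed simp

lemma l2_zero: "l2_zero M \<in> L2 M" "emb M (l2_zero M) = 0"
  by (simp_all add: l2_zero_def vec_zero)

lemma l2_add:
  assumes "a \<in> L2 M" "b \<in> L2 M"
  shows "l2_add M a b \<in> L2 M" "emb M (l2_add M a b) = emb M a + emb M b"
  using assms by (simp_all add: l2_add_def l2_fun_add l2_rep_in vec_add emb_def[of M a] emb_def[of M b])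

lemma l2_diff:
  assumes "a \<in> L2 M" "b \<in> L2 M"
  shows "l2_diff M a b \<in> L2 M" "emb M (l2_diff M a b) = emb M a - emb M b"
  using assms by (simp_all add: l2_diff_def l2_fun_diff l2_rep_in vec_diff emb_def[of M a] emb_def[of M b])

lemma l2_scale:
  assumes "a \<in> L2 M"
  shows "l2_scale M c a \<in> L2 M" "emb M (l2_scale M c a) = scaleC c (emb M a)"
  using assms by (simp_all add: l2_scale_def l2_fun_scale l2_rep_in vec_scaleC emb_def[of M a])

lemma l2_inner: "a \<in> L2 M \<Longrightarrow> b \<in> L2 M \<Longrightarrow> l2_inner M a b = cinner (emb M a) (emb M b)"
  by (simp add: l2_inner_def emb_def cinner_vec l2_rep_in)

lemma l2_norm: "a \<in> L2 M \<Longrightarrow> l2_norm M a = norm (emb M a)"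
  unfolding l2_norm_def emb_def by (subst norm_vec[symmetric]) (simp_all add: l2_rep_in)

definition lift_graph :: "'a measure \<Rightarrow> 'a l2op \<Rightarrow> ('a hs \<times> 'a hs) set" where
  "lift_graph M G = {(emb M a, emb M b) |a b. (a, b) \<in> G}"

definition pull_graph :: "'a measure \<Rightarrow> ('a hs \<times> 'a hs) set \<Rightarrow> 'a l2op" where
  "pull_graph M K = {(a, b). a \<in> L2 M \<and> b \<in> L2 M \<and> (emb M a, emb M b) \<in> K}"

lemma lift_graph_mem:
  "G \<subseteq> L2 M \<times> L2 M \<Longrightarrow> a \<in> L2 M \<Longrightarrow> b \<in> L2 M \<Longrightarrow> (emb M a, emb M b) \<in> lift_graph M G \<longleftrightarrow> (a, b) \<in> G"
  unfolding lift_graph_def by (auto simp: emb_eq_iff subset_iff)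

lemma lift_graph_sub: "G \<subseteq> L2 M \<times> L2 M \<Longrightarrow> lift_graph M G \<subseteq> VV M \<times> VV M"
  unfolding lift_graph_def by auto

lemma pull_graph_sub: "pull_graph M K \<subseteq> L2 M \<times> L2 M"
  by (auto simp: pull_graph_def)

lemma lift_pull: "K \<subseteq> VV M \<times> VV M \<Longrightarrow> lift_graph M (pull_graph M K) = K"
proof
  assume K: "K \<subseteq> VV M \<times> VV M"
  show "K \<subseteq> lift_graph M (pull_graph M K)"
  proof clarify
    fix x y assume xy: "(x, y) \<in> K"
    with K obtain a b where "a \<in> L2 M" "b \<in> L2 M" "x = emb M a" "y = emb M b" using VV_emb by blast
    with xy show "(x, y) \<in> lift_graph M (pull_graph M K)" unfolding lift_graph_def pull_graph_def by auto
  qed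
qed (auto simp: lift_graph_def pull_graph_def)

lemma pull_lift: "G \<subseteq> L2 M \<times> L2 M \<Longrightarrow> pull_graph M (lift_graph M G) = G"
proof (intro set_eqI iffI)
  fix p assume G: "G \<subseteq> L2 M \<times> L2 M"
  show "p \<in> G" if "p \<in> pull_graph M (lift_graph M G)"
    using that lift_graph_mem[OF G] by (auto simp: pull_graph_def)
  show "p \<in> pull_graph M (lift_graph M G)" if p: "p \<in> G"
  proof -
    obtain a b where "p = (a, b)" by fastforce
    with p G show ?thesis unfolding pull_graph_def lift_graph_def by blast
  qed
qed

lemma lift_relcomp:
  assumes G: "G \<subseteq> L2 M \<times> L2 M" and H: "H \<subseteq> L2 M \<times> L2 M"
  shows "lift_graph M (G O H) = lift_graph M G O lift_graph M H"
proof
  show "lift_graph M G O lift_graph M H \<subseteq> lift_graph M (G O H)"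
  proof clarify
    fix x y z assume "(x, y) \<in> lift_graph M G" "(y, z) \<in> lift_graph M H"
    then obtain a b b' c where *: "(a, b) \<in> G" "(b', c) \<in> H" "x = emb M a" "y = emb M b" "y = emb M b'" "z = emb M c"
      unfolding lift_graph_def by blast
    moreover from * have "b = b'" using G H emb_eq_iff by blast
    ultimately show "(x, z) \<in> lift_graph M (G O H)" unfolding lift_graph_def by blast
  qed
qed (auto simp: lift_graph_def)

definition ii_invariant :: "('a hs \<times> 'a hs) set \<Rightarrow> bool" where
  "ii_invariant K \<longleftrightarrow> (\<forall>x y. (x, y) \<in> K \<longrightarrow> (ii x, ii y) \<in> K)"

lemma linear_graph_ii_invariant: "linear_graph M G \<Longrightarrow> ii_invariant (lift_graph M G)"
  unfolding ii_invariant_def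
proof (intro allI impI)
  fix x y assume G: "linear_graph M G" and xy: "(x, y) \<in> lift_graph M G"
  then obtain a b where ab: "(a, b) \<in> G" "x = emb M a" "y = emb M b" by (auto simp: lift_graph_def)
  with G have "(l2_scale M \<i> a, l2_scale M \<i> b) \<in> G" "a \<in> L2 M" "b \<in> L2 M" by (auto simp: linear_graph_def)
  then show "(ii x, ii y) \<in> lift_graph M G"
    unfolding lift_graph_def using ab by (metis (mono_tags, lifting) l2_scale(2) mem_Collect_eq scaleC_i)
qed

lemma graph_scaleC:
  assumes "subspace K" "ii_invariant K" "(x, y) \<in> K" shows "(scaleC c x, scaleC c y) \<in> K"
  using assms subspace_add[OF assms(1) subspace_scale[OF assms(1), of "(x, y)" "Re c"]
      subspace_scale[OF assms(1), of "(ii x, ii y)" "Im c"]]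
  by (simp add: scaleC_def ii_invariant_def)

lemma subspace_lift_graph:
  assumes G: "linear_graph M G" shows "subspace (lift_graph M G)"
proof -
  have sub: "G \<subseteq> L2 M \<times> L2 M" using G by (simp add: linear_graph_def)
  show ?thesis
    unfolding subspace_def
  proof (intro conjI ballI allI)
    have "(l2_zero M, l2_zero M) \<in> G" using G by (simp add: linear_graph_def)
    then show "0 \<in> lift_graph M G" unfolding lift_graph_def zero_prod_def using l2_zero(2) by force
  next
    fix p q assume "p \<in> lift_graph M G" "q \<in> lift_graph M G"
    then obtain a b c d where *: "(a, b) \<in> G" "(c, d) \<in> G" "p = (emb M a, emb M b)" "q = (emb M c, emb M d)"
      by (auto simp: lift_graph_def)
    with G have "(l2_add M a c, l2_add M b d) \<in> G" unfolding linear_graph_def by blast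
    moreover have "p + q = (emb M (l2_add M a c), emb M (l2_add M b d))"
      using * sub by (subst (1 2) l2_add(2)) auto
    ultimately show "p + q \<in> lift_graph M G" unfolding lift_graph_def by blast
  next
    fix p r assume "p \<in> lift_graph M G"
    then obtain a b where *: "(a, b) \<in> G" "p = (emb M a, emb M b)"
      by (auto simp: lift_graph_def)
    with G have "(l2_scale M (complex_of_real r) a, l2_scale M (complex_of_real r) b) \<in> G" unfolding linear_graph_def by blast
    moreover have "r *\<^sub>R p = (emb M (l2_scale M (complex_of_real r) a), emb M (l2_scale M (complex_of_real r) b))"
      using * sub by (subst (1 2) l2_scale(2)) (auto simp: scaleC_of_real)
    ultimately show "r *\<^sub>R p \<in> lift_graph M G" unfolding lift_graph_def by blast
  qed
qed

lemma linear_graph_pull: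
  assumes K: "subspace K" "ii_invariant K" shows "linear_graph M (pull_graph M K)"
  unfolding linear_graph_def
proof (intro conjI)
  show "pull_graph M K \<subseteq> L2 M \<times> L2 M" by (rule pull_graph_sub)
  show "(l2_zero M, l2_zero M) \<in> pull_graph M K"
    using subspace_0[OF K(1)] by (simp add: pull_graph_def l2_zero zero_prod_def)
  show "\<forall>(x, x')\<in>pull_graph M K. \<forall>(y, y')\<in>pull_graph M K. (l2_add M x y, l2_add M x' y') \<in> pull_graph M K"
    using VV.graph_add[OF K(1)] by (auto simp: pull_graph_def l2_add)
  show "\<forall>c. \<forall>(x, x')\<in>pull_graph M K. (l2_scale M c x, l2_scale M c x') \<in> pull_graph M K"
    using graph_scaleC[OF K] by (auto simp: pull_graph_def l2_scale)
qed

lemma closed_graph_pull: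
  assumes "closed K" shows "closed_graph M (pull_graph M K)"
  unfolding closed_graph_def
proof (intro ballI impI)
  fix x y assume xy: "x \<in> L2 M" "y \<in> L2 M"
    and ap: "\<forall>e>0. \<exists>(a, b)\<in>pull_graph M K. l2_norm M (l2_diff M x a) < e \<and> l2_norm M (l2_diff M y b) < e"
  have "(emb M x, emb M y) \<in> closure K"
    unfolding closure_approachable
  proof (intro allI impI)
    fix e :: real assume "e > 0"
    then have "e / 2 > 0" by simp
    with ap obtain a b where ab: "(a, b) \<in> pull_graph M K" "l2_norm M (l2_diff M x a) < e / 2" "l2_norm M (l2_diff M y b) < e / 2"
      by blast
    then have L: "a \<in> L2 M" "b \<in> L2 M" "(emb M a, emb M b) \<in> K" by (auto simp: pull_graph_def)
    have "dist (emb M a, emb M b) (emb M x, emb M y) \<le> dist (emb M a) (emb M x) + dist (emb M b) (emb M y)"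
      unfolding dist_Pair_Pair by (rule sqrt_sum_squares_le_sum) auto
    also have "\<dots> < e" using ab L xy by (simp add: l2_norm l2_diff dist_norm norm_minus_commute)
    finally show "\<exists>p\<in>K. dist p (emb M x, emb M y) < e" using L by blast
  qed
  then show "(x, y) \<in> pull_graph M K" using assms xy by (simp add: pull_graph_def)
qed

lemma closed_lift_graph:
  assumes G: "closed_graph M G" "G \<subseteq> L2 M \<times> L2 M" shows "closed (lift_graph M G)"
proof (rule closed_sequential_limits[THEN iffD2], intro allI impI, elim conjE)
  fix f l assume f: "\<forall>n. f n \<in> lift_graph M G" and l: "f \<longlonglongrightarrow> l"
  have "l \<in> VV M \<times> VV M"
  proof -
    have "closed (VV M \<times> VV M)" by (intro closed_Times VV.V_closed)
    then show ?thesis using f l lift_graph_sub[OF G(2)] closed_sequentially by blast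
  qed
  then obtain x y where xy: "x \<in> L2 M" "y \<in> L2 M" "l = (emb M x, emb M y)" using VV_emb by blast
  have "(x, y) \<in> G"
  proof (rule G(1)[unfolded closed_graph_def, rule_format, OF xy(1,2)])
    fix e :: real assume "e > 0"
    with l obtain n where n: "dist (f n) l < e" unfolding LIMSEQ_def by blast
    obtain a b where ab: "(a, b) \<in> G" "f n = (emb M a, emb M b)" using f by (force simp: lift_graph_def)
    then have L: "a \<in> L2 M" "b \<in> L2 M" using G(2) by auto
    have "dist (emb M a) (emb M x) < e" "dist (emb M b) (emb M y) < e"
      using le_less_trans[OF dist_fst_le n] le_less_trans[OF dist_snd_le n] ab xy by simp_all
    then show "\<exists>(a, b)\<in>G. l2_norm M (l2_diff M x a) < e \<and> l2_norm M (l2_diff M y b) < e"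
      using ab(1) xy L by (intro bexI[OF _ ab(1)]) (simp add: l2_norm l2_diff dist_norm norm_minus_commute)
  qed
  then show "l \<in> lift_graph M G" using xy unfolding lift_graph_def by blast
qed

lemma l2_dense_iff:
  assumes "D \<subseteq> L2 M" shows "l2_dense M D \<longleftrightarrow> VV M \<subseteq> closure (emb M ` D)"
proof -
  have "l2_dense M D \<longleftrightarrow> (\<forall>x\<in>L2 M. emb M x \<in> closure (emb M ` D))"
    unfolding l2_dense_def closure_approachable using assms
    by (auto simp: l2_norm l2_diff dist_norm norm_minus_commute subset_iff)
  also have "\<dots> \<longleftrightarrow> VV M \<subseteq> closure (emb M ` D)" using VV_emb emb_in_VV by blast
  finally show ?thesis .
qed

lemma Domain_lift: "Domain (lift_graph M G) = emb M ` Domain G"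
  by (auto simp: lift_graph_def)

text \<open>\<open>adjoint_op\<close> tests with the complex inner product, \<open>VV.adj\<close>
  only with its real part. The graph is invariant under \<open>ii\<close>, and testing with the
  rotated pair supplies the imaginary part.\<close>

lemma lift_adjoint:
  assumes A: "linear_graph M A"
  shows "lift_graph M (adjoint_op M A) = VV.adj M (lift_graph M A)"
proof
  have sub: "A \<subseteq> L2 M \<times> L2 M" using A by (simp add: linear_graph_def)
  show "lift_graph M (adjoint_op M A) \<subseteq> VV.adj M (lift_graph M A)"
  proof clarify
    fix y z assume "(y, z) \<in> lift_graph M (adjoint_op M A)"
    then obtain a b where ab: "(a, b) \<in> adjoint_op M A" "y = emb M a" "z = emb M b"
      unfolding lift_graph_def by blast
    then have L: "a \<in> L2 M" "b \<in> L2 M" by (auto simp: adjoint_op_def)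
    show "(y, z) \<in> VV.adj M (lift_graph M A)"
    proof (rule VV.adjI)
      fix x w assume "(x, w) \<in> lift_graph M A"
      then obtain c d where cd: "(c, d) \<in> A" "x = emb M c" "w = emb M d" unfolding lift_graph_def by blast
      then have "l2_inner M a d = l2_inner M b c" using ab(1) by (auto simp: adjoint_op_def)
      moreover have "c \<in> L2 M" "d \<in> L2 M" using cd(1) sub by auto
      ultimately have "cinner y w = cinner z x" using ab cd L by (simp add: l2_inner)
      then show "y \<bullet> w = z \<bullet> x" by (metis Re_cinner)
    qed (use ab L in auto)
  qed
  show "VV.adj M (lift_graph M A) \<subseteq> lift_graph M (adjoint_op M A)"
  proof clarify
    fix y z assume yz: "(y, z) \<in> VV.adj M (lift_graph M A)"
    then obtain a b where ab: "a \<in> L2 M" "b \<in> L2 M" "y = emb M a" "z = emb M b"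
      unfolding VV.adj_def using VV_emb by blast
    have "l2_inner M a d = l2_inner M b c" if cd: "(c, d) \<in> A" for c d
    proof -
      from cd have m: "(emb M c, emb M d) \<in> lift_graph M A" by (auto simp: lift_graph_def)
      have "y \<bullet> emb M d = z \<bullet> emb M c" "y \<bullet> ii (emb M d) = z \<bullet> ii (emb M c)"
        using yz m linear_graph_ii_invariant[OF A] unfolding VV.adj_def ii_invariant_def by blast+
      then have "cinner y (emb M d) = cinner z (emb M c)"
        by (simp add: cinner_def inner_ii_left)
      moreover have "c \<in> L2 M" "d \<in> L2 M" using cd sub by auto
      ultimately show ?thesis using ab by (simp add: l2_inner)
    qed
    then have "(a, b) \<in> adjoint_op M A" using ab by (auto simp: adjoint_op_def)
    then show "(y, z) \<in> lift_graph M (adjoint_op M A)" using ab by (auto simp: lift_graph_def)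
  qed
qed

lemma nnsa_lift:
  assumes A: "nonneg_selfadjoint_op M A"
  shows "A \<subseteq> L2 M \<times> L2 M" "VV.nnsa M (lift_graph M A)" "ii_invariant (lift_graph M A)"
proof -
  have lin: "linear_graph M A" and ad: "adjoint_op M A = A" and dense: "l2_dense M (Domain A)"
    and nonneg: "\<And>x y. (x, y) \<in> A \<Longrightarrow> 0 \<le> Re (l2_inner M x y)"
    using A by (auto simp: nonneg_selfadjoint_op_def selfadjoint_op_def l2_operator_def)
  show sub: "A \<subseteq> L2 M \<times> L2 M" using lin by (simp add: linear_graph_def)
  show inv: "ii_invariant (lift_graph M A)" by (rule linear_graph_ii_invariant[OF lin])
  show "VV.nnsa M (lift_graph M A)"
    unfolding VV.nnsa_def
  proof (intro conjI allI impI)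
    show "VV M \<subseteq> closure (Domain (lift_graph M A))"
      using dense sub by (subst (asm) l2_dense_iff) (auto simp: Domain_lift)
    show "0 \<le> x \<bullet> y" if xy: "(x, y) \<in> lift_graph M A" for x y
    proof -
      obtain a b where ab: "(a, b) \<in> A" "x = emb M a" "y = emb M b" using xy unfolding lift_graph_def by blast
      then have "a \<in> L2 M" "b \<in> L2 M" using sub by auto
      with ab have "l2_inner M a b = cinner x y" by (simp add: l2_inner)
      with nonneg[OF ab(1)] show ?thesis by simp
    qed
    show "VV.adj M (lift_graph M A) = lift_graph M A" using lift_adjoint[OF lin] ad by simp
  qed
qed

lemma nnsa_pull:
  assumes K: "VV.nnsa M K" "ii_invariant K"
  shows "nonneg_selfadjoint_op M (pull_graph M K)" "lift_graph M (pull_graph M K) = K"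
proof -
  have KV: "K \<subseteq> VV M \<times> VV M" using VV.nnsa_in_V[OF K(1)] by auto
  show lp: "lift_graph M (pull_graph M K) = K" by (rule lift_pull[OF KV])
  have P: "(a, b) \<in> pull_graph M K \<longleftrightarrow> a \<in> L2 M \<and> b \<in> L2 M \<and> (emb M a, emb M b) \<in> K" for a b
    by (simp add: pull_graph_def)
  have lin: "linear_graph M (pull_graph M K)" by (rule linear_graph_pull[OF VV.nnsa_subspace[OF K(1)] K(2)])
  have "single_valued (pull_graph M K)"
    unfolding single_valued_def P using VV.nnsa_unique[OF K(1)] emb_eq_iff by blast
  moreover have "l2_dense M (Domain (pull_graph M K))"
    using VV.nnsa_dense[OF K(1)] pull_graph_sub[of M K]
    by (subst l2_dense_iff) (auto simp flip: Domain_lift simp: lp)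
  moreover have "adjoint_op M (pull_graph M K) = pull_graph M K"
  proof -
    have "adjoint_op M (pull_graph M K) \<subseteq> L2 M \<times> L2 M" by (auto simp: adjoint_op_def)
    then have "adjoint_op M (pull_graph M K) = pull_graph M (VV.adj M K)"
      using pull_lift lift_adjoint[OF lin] lp by metis
    then show ?thesis by (simp add: VV.nnsa_adj[OF K(1)])
  qed
  moreover have "0 \<le> Re (l2_inner M x y)" if "(x, y) \<in> pull_graph M K" for x y
    using that VV.nnsa_nonneg[OF K(1)] by (auto simp: P l2_inner)
  ultimately show "nonneg_selfadjoint_op M (pull_graph M K)"
    using lin by (auto simp: nonneg_selfadjoint_op_def selfadjoint_op_def l2_operator_def)
qed

text \<open>Justifies the definite description in \<open>sqrt_op\<close>. The root found in the
  ambient space comes from an operator because it is invariant under \<open>ii\<close>, by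
  \<open>nnsa_sqrt_rotate\<close>.\<close>

lemma sqrt_op:
  assumes A: "nonneg_selfadjoint_op M A"
  shows "nonneg_selfadjoint_op M (sqrt_op M A)" "sqrt_op M A O sqrt_op M A = A"
proof -
  note L = nnsa_lift[OF A]
  obtain S where S: "VV.nnsa M S" "S O S = lift_graph M A" using VV.nnsa_sqrt_exists[OF L(2)] by blast
  have inv: "ii_invariant S"
    unfolding ii_invariant_def
    using VV.nnsa_sqrt_rotate[OF L(2) S bounded_linear_ii ii_in_VV ii_ii inner_ii_ii] L(3)
    by (auto simp: ii_invariant_def)
  note P = nnsa_pull[OF S(1) inv]
  have ex: "pull_graph M S O pull_graph M S = A"
  proof -
    have "lift_graph M (pull_graph M S O pull_graph M S) = lift_graph M A"
      using P S by (simp add: lift_relcomp pull_graph_sub)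
    moreover have "pull_graph M S O pull_graph M S \<subseteq> L2 M \<times> L2 M"
      using pull_graph_sub[of M S] by blast
    ultimately show ?thesis using pull_lift L(1) by metis
  qed
  have uniq: "T = pull_graph M S" if T: "nonneg_selfadjoint_op M T" "T O T = A" for T
  proof -
    note LT = nnsa_lift[OF T(1)]
    have "lift_graph M T O lift_graph M T = lift_graph M A" using T LT by (simp flip: lift_relcomp)
    then have "lift_graph M T = S" by (intro VV.nnsa_sqrt_unique[OF L(2) LT(2) _ S])
    then show ?thesis using pull_lift[OF LT(1)] by simp
  qed
  have "sqrt_op M A = pull_graph M S"
    unfolding sqrt_op_def
  proof (rule the_equality)
    show "nonneg_selfadjoint_op M (pull_graph M S) \<and> pull_graph M S O pull_graph M S = A"
      by (intro conjI P(1) ex)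
    show "T = pull_graph M S" if "nonneg_selfadjoint_op M T \<and> T O T = A" for T
      using uniq that by blast
  qed
  with P(1) ex show "nonneg_selfadjoint_op M (sqrt_op M A)" "sqrt_op M A O sqrt_op M A = A" by simp_all
qed

lemma lift_sqrt_op:
  assumes A: "nonneg_selfadjoint_op M A"
  shows "VV.nnsa M (lift_graph M (sqrt_op M A))"
    "lift_graph M (sqrt_op M A) O lift_graph M (sqrt_op M A) = lift_graph M A"
    "ii_invariant (lift_graph M (sqrt_op M A))"
proof -
  note L = nnsa_lift[OF sqrt_op(1)[OF A]]
  show "VV.nnsa M (lift_graph M (sqrt_op M A))" "ii_invariant (lift_graph M (sqrt_op M A))" by (fact L)+
  show "lift_graph M (sqrt_op M A) O lift_graph M (sqrt_op M A) = lift_graph M A"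
    unfolding lift_relcomp[OF L(1) L(1), symmetric] sqrt_op(2)[OF A] ..
qed

lemma op_apply_eq: "single_valued A \<Longrightarrow> (x, y) \<in> A \<Longrightarrow> op_apply A x = y"
  unfolding op_apply_def by (rule the_equality) (auto simp: single_valued_def)

lemma nonneg_selfadjoint_single_valued: "nonneg_selfadjoint_op M A \<Longrightarrow> single_valued A"
  by (simp add: nonneg_selfadjoint_op_def selfadjoint_op_def l2_operator_def)

lemma quad_form_eq:
  assumes Q: "nonneg_selfadjoint_op M Q" and a: "a \<in> L2 M" and w: "(emb M a, w) \<in> lift_graph M (sqrt_op M Q)"
  shows "quad_form M Q a = ennreal ((norm w)\<^sup>2)"
proof -
  note S = nnsa_lift[OF sqrt_op(1)[OF Q]]
  obtain b where b: "b \<in> L2 M" "w = emb M b" using VV.nnsa_in_V(2)[OF S(2) w] VV_emb by blast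
  then have ab: "(a, b) \<in> sqrt_op M Q" using w a lift_graph_mem[OF S(1)] by blast
  then have "op_apply (sqrt_op M Q) a = b"
    by (intro op_apply_eq nonneg_selfadjoint_single_valued[OF sqrt_op(1)[OF Q]])
  with ab b show ?thesis unfolding quad_form_def by (auto simp: l2_norm)
qed

lemma quad_form_inf:
  assumes Q: "nonneg_selfadjoint_op M Q" and "\<nexists>w. (emb M a, w) \<in> lift_graph M (sqrt_op M Q)"
  shows "quad_form M Q a = \<infinity>"
  using assms(2) unfolding quad_form_def lift_graph_def by auto

section \<open>Orthonormal bases and traces\<close>

lemma scaleC_sum: "scaleC c (\<Sum>i\<in>I. f i) = (\<Sum>i\<in>I. scaleC c (f i))"
  by (induction I rule: infinite_finite_induct) (auto simp: scaleC_add_right)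

lemma has_sum_finite_sum:
  fixes f :: "'i \<Rightarrow> 'e \<Rightarrow> complex"
  shows "(\<And>i. i \<in> I \<Longrightarrow> (f i has_sum s i) A) \<Longrightarrow> ((\<lambda>e. \<Sum>i\<in>I. f i e) has_sum (\<Sum>i\<in>I. s i)) A"
  by (induction I rule: infinite_finite_induct) (auto intro: has_sum_add)

definition coeff_sum :: "'a measure \<Rightarrow> 'a l2 set \<Rightarrow> ('a l2 \<Rightarrow> complex) \<Rightarrow> 'a hs" where
  "coeff_sum M F c = (\<Sum>e\<in>F. scaleC (c e) (emb M e))"

lemma orthonormal_basis_exists: "\<exists>B. orthonormal_basis M B"
proof -
  define ON where "ON = {B. B \<subseteq> L2 M \<and> (\<forall>e\<in>B. \<forall>f\<in>B. l2_inner M e f = (if e = f then 1 else 0))}"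
  have "\<exists>B\<in>ON. \<forall>X\<in>ON. B \<subseteq> X \<longrightarrow> X = B"
  proof (rule subset_Zorn')
    fix C assume C: "subset.chain ON C"
    show "\<Union>C \<in> ON"
      unfolding ON_def
    proof (intro CollectI conjI ballI)
      show "\<Union>C \<subseteq> L2 M" using C unfolding subset.chain_def ON_def by blast
      fix e f assume "e \<in> \<Union>C" "f \<in> \<Union>C"
      then obtain X Y where "e \<in> X" "X \<in> C" "f \<in> Y" "Y \<in> C" by blast
      moreover from this have "X \<subseteq> Y \<or> Y \<subseteq> X" using C unfolding subset.chain_def by blast
      ultimately obtain Z where "Z \<in> C" "e \<in> Z" "f \<in> Z" by blast
      then show "l2_inner M e f = (if e = f then 1 else 0)" using C unfolding subset.chain_def ON_def by blast
    qed
  qed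
  then obtain B where B: "B \<in> ON" and max: "\<And>X. X \<in> ON \<Longrightarrow> B \<subseteq> X \<Longrightarrow> X = B" by blast
  have "x = l2_zero M" if x: "x \<in> L2 M" and o: "\<forall>e\<in>B. l2_inner M e x = 0" for x
  proof (rule ccontr)
    assume "x \<noteq> l2_zero M"
    then have nx: "emb M x \<noteq> 0" using emb_eq_iff[OF x l2_zero(1)] l2_zero(2) by metis
    define y where "y = l2_scale M (complex_of_real (1 / norm (emb M x))) x"
    have y: "y \<in> L2 M" "emb M y = scaleC (complex_of_real (1 / norm (emb M x))) (emb M x)"
      using l2_scale[OF x] unfolding y_def by blast+
    have "norm (emb M y) = 1" using nx unfolding y(2) by (simp add: norm_divide)
    then have yy: "l2_inner M y y = 1" by (simp add: l2_inner y(1) cinner_self)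
    have BL: "e \<in> L2 M" if "e \<in> B" for e using that B by (auto simp: ON_def)
    have ey: "l2_inner M e y = 0" if "e \<in> B" for e
      using bspec[OF o that] x y BL[OF that] by (simp add: l2_inner cinner_scaleC_right)
    have ye: "l2_inner M y e = 0" if "e \<in> B" for e
      using ey[OF that] y BL[OF that] cinner_commute[of "emb M e" "emb M y"] by (simp add: l2_inner)
    have "y \<notin> B" using ey yy by auto
    have "insert y B \<in> ON" using B yy ey ye y(1) \<open>y \<notin> B\<close> unfolding ON_def by auto
    with max[OF this] \<open>y \<notin> B\<close> show False by blast
  qed
  with B have "orthonormal_basis M B" unfolding orthonormal_basis_def ON_def by blast
  then show ?thesis by blast
qed

lemma some_basis: "orthonormal_basis M (some_basis M)"
  unfolding some_basis_def using orthonormal_basis_exists by (rule someI_ex)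

section \<open>Expansion in an orthonormal basis\<close>

locale l2_basis =
  fixes M :: "'a measure" and B :: "'a l2 set"
  assumes B: "orthonormal_basis M B"
begin

lemma B_L2: "e \<in> B \<Longrightarrow> e \<in> L2 M"
  using B by (auto simp: orthonormal_basis_def)

lemma orthonormal: "e \<in> B \<Longrightarrow> f \<in> B \<Longrightarrow> cinner (emb M e) (emb M f) = (if e = f then 1 else 0)"
  using B B_L2 by (simp add: orthonormal_basis_def l2_inner flip: l2_inner)

lemma total: "x \<in> VV M \<Longrightarrow> (\<And>e. e \<in> B \<Longrightarrow> cinner (emb M e) x = 0) \<Longrightarrow> x = 0"
proof -
  assume x: "x \<in> VV M" and o: "\<And>e. e \<in> B \<Longrightarrow> cinner (emb M e) x = 0"
  from VV_emb[OF x] obtain a where a: "a \<in> L2 M" "x = emb M a" by blast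
  then have "\<forall>e\<in>B. l2_inner M e a = 0" using o B_L2 by (simp add: l2_inner)
  then have "a = l2_zero M" using B a(1) by (simp add: orthonormal_basis_def)
  then show "x = 0" using a l2_zero by simp
qed

abbreviation partial_expansion where
  "partial_expansion x F \<equiv> coeff_sum M F (\<lambda>e. cinner (emb M e) x)"

lemma cinner_coeff_sum:
  assumes "finite F" "F \<subseteq> B" "e \<in> F"
  shows "cinner (emb M e) (coeff_sum M F c) = c e"
proof -
  have "cinner (emb M e) (coeff_sum M F c) = (\<Sum>f\<in>F. c f * (if e = f then 1 else 0))"
    unfolding coeff_sum_def cinner_sum_right cinner_scaleC_right
    using assms by (intro sum.cong refl) (auto simp: orthonormal subset_iff)
  then show ?thesis using assms by (simp add: if_distrib[of "\<lambda>z. _ * z"] cong: if_cong)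
qed

lemma best_approximation:
  assumes F: "finite F" "F \<subseteq> B"
  shows "norm (x - partial_expansion x F) \<le> norm (x - coeff_sum M F c)"
proof -
  let ?p = "partial_expansion x F" and ?d = "\<lambda>e. cinner (emb M e) x - c e"
  let ?y = "coeff_sum M F ?d"
  have eq: "x - coeff_sum M F c = (x - ?p) + ?y"
    unfolding coeff_sum_def using scaleC_add_left[of "c e" "cinner (emb M e) x - c e" "emb M e" for e]
    by (simp add: sum.distrib[symmetric] algebra_simps)
  have "cinner ?y (x - ?p) = (\<Sum>e\<in>F. cnj (?d e) * cinner (emb M e) (x - ?p))"
    by (subst coeff_sum_def) (simp add: cinner_sum_left cinner_scaleC_left)
  also have "\<dots> = 0" using cinner_coeff_sum[OF F] by (intro sum.neutral) (simp add: cinner_diff_right)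
  finally have "?y \<bullet> (x - ?p) = 0" by (metis Re_cinner zero_complex.sel(1))
  then have "(norm ((x - ?p) + ?y))\<^sup>2 = (norm (x - ?p))\<^sup>2 + (norm ?y)\<^sup>2"
    by (simp add: power2_norm_eq_inner inner_add_left inner_add_right inner_commute)
  then have "(norm (x - ?p))\<^sup>2 \<le> (norm (x - coeff_sum M F c))\<^sup>2" unfolding eq by simp
  then show ?thesis by (rule power2_le_imp_le) simp
qed

lemma subspace_coeff_sums: "subspace {coeff_sum M F c |F c. finite F \<and> F \<subseteq> B}"
  unfolding subspace_def
proof (intro conjI ballI allI)
  show "0 \<in> {coeff_sum M F c |F c. finite F \<and> F \<subseteq> B}"
    by (intro CollectI exI[of _ "{}"] exI) (simp add: coeff_sum_def)
next
  fix x y assume "x \<in> {coeff_sum M F c |F c. finite F \<and> F \<subseteq> B}" "y \<in> {coeff_sum M F c |F c. finite F \<and> F \<subseteq> B}"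
  then obtain F c G d where F: "finite F" "F \<subseteq> B" "x = coeff_sum M F c"
    and G: "finite G" "G \<subseteq> B" "y = coeff_sum M G d" by blast
  let ?c = "\<lambda>e. (if e \<in> F then c e else 0) + (if e \<in> G then d e else 0)"
  have "x = (\<Sum>e\<in>F \<union> G. scaleC (if e \<in> F then c e else 0) (emb M e))"
    unfolding F coeff_sum_def using F G by (intro sum.mono_neutral_cong_left) auto
  moreover have "y = (\<Sum>e\<in>F \<union> G. scaleC (if e \<in> G then d e else 0) (emb M e))"
    unfolding G coeff_sum_def using F G by (intro sum.mono_neutral_cong_left) auto
  ultimately have "x + y = coeff_sum M (F \<union> G) ?c"
    unfolding coeff_sum_def by (simp only: scaleC_add_left sum.distrib)
  then show "x + y \<in> {coeff_sum M F c |F c. finite F \<and> F \<subseteq> B}" using F G by blast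
next
  fix x r assume "x \<in> {coeff_sum M F c |F c. finite F \<and> F \<subseteq> B}"
  then obtain F c where F: "finite F" "F \<subseteq> B" "x = coeff_sum M F c" by blast
  then have "r *\<^sub>R x = coeff_sum M F (\<lambda>e. complex_of_real r * c e)"
    by (simp add: coeff_sum_def scaleC_sum flip: scaleC_of_real scaleC_scaleC)
  then show "r *\<^sub>R x \<in> {coeff_sum M F c |F c. finite F \<and> F \<subseteq> B}" using F by blast
qed

lemma coeff_sums_dense: "VV M \<subseteq> closure {coeff_sum M F c |F c. finite F \<and> F \<subseteq> B}" (is "_ \<subseteq> closure ?W")
proof (rule VV.dense_if_trivial_complement[OF subspace_coeff_sums])
  show "?W \<subseteq> VV M"
    unfolding coeff_sum_def using B_L2
    by (auto intro!: subspace_sum[OF subspace_VV] scaleC_in_VV emb_in_VV)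
  have single: "scaleC c (emb M e) \<in> ?W" if "e \<in> B" for e c
    using that by (intro CollectI exI[of _ "{e}"] exI[of _ "\<lambda>_. c"]) (simp add: coeff_sum_def)
  fix h assume h: "h \<in> VV M" and o: "\<And>r. r \<in> ?W \<Longrightarrow> h \<bullet> r = 0"
  show "h = 0"
  proof (rule total[OF h])
    fix e assume e: "e \<in> B"
    have "h \<bullet> scaleC 1 (emb M e) = 0" "h \<bullet> scaleC \<i> (emb M e) = 0"
      using o[OF single[OF e]] by blast+
    then show "cinner (emb M e) h = 0"
      by (simp add: cinner_def scaleC_def inner_commute complex_eq_iff)
  qed
qed

text \<open>Finite combinations of basis vectors are dense, and the Fourier partial sum is the best
  approximation from each finite set. Enlarging the set can only improve it, which is convergence
  along finite subsets, whatever the cardinality of the basis.\<close>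

lemma has_sum_expansion:
  assumes x: "x \<in> VV M"
  shows "((\<lambda>e. scaleC (cinner (emb M e) x) (emb M e)) has_sum x) B"
  unfolding has_sum_def
proof (rule tendstoI)
  fix \<epsilon> :: real assume "\<epsilon> > 0"
  then obtain F c where F: "finite F" "F \<subseteq> B" "dist (coeff_sum M F c) x < \<epsilon>"
    using x coeff_sums_dense unfolding closure_approachable by (smt (verit, best) mem_Collect_eq subsetD closure_approachable)
  show "\<forall>\<^sub>F G in finite_subsets_at_top B. dist (\<Sum>e\<in>G. scaleC (cinner (emb M e) x) (emb M e)) x < \<epsilon>"
    unfolding eventually_finite_subsets_at_top
  proof (intro exI conjI allI impI)
    fix G assume G: "finite G \<and> F \<subseteq> G \<and> G \<subseteq> B"
    have "coeff_sum M F c = coeff_sum M G (\<lambda>e. if e \<in> F then c e else 0)"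
      unfolding coeff_sum_def using F G by (intro sum.mono_neutral_cong_left) auto
    then have "norm (x - partial_expansion x G) \<le> norm (x - coeff_sum M F c)"
      using best_approximation[of G x] G by metis
    then show "dist (\<Sum>e\<in>G. scaleC (cinner (emb M e) x) (emb M e)) x < \<epsilon>"
      using F(3) by (simp add: dist_norm norm_minus_commute coeff_sum_def)
  qed (use F in auto)
qed

lemma has_sum_cinner:
  assumes x: "x \<in> VV M"
  shows "((\<lambda>e. cinner (emb M e) x * cinner y (emb M e)) has_sum cinner y x) B"
  using has_sum_bounded_linear[OF bounded_linear_cinner_right has_sum_expansion[OF x], of y]
  by (simp add: cinner_scaleC_right o_def)

lemma has_sum_norm:
  assumes x: "x \<in> VV M"
  shows "((\<lambda>e. (cmod (cinner (emb M e) x))\<^sup>2) has_sum (norm x)\<^sup>2) B"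
proof -
  have "cinner (emb M e) x * cinner x (emb M e) = complex_of_real ((cmod (cinner (emb M e) x))\<^sup>2)" for e
    by (metis cinner_commute complex_norm_square)
  then have "((\<lambda>e. complex_of_real ((cmod (cinner (emb M e) x))\<^sup>2)) has_sum complex_of_real ((norm x)\<^sup>2)) B"
    using has_sum_cinner[OF x, of x] by (simp only: cinner_self)
  then show ?thesis by (simp only: has_sum_of_real_iff)
qed

end

interpretation some_basis: l2_basis M "some_basis M" for M
  by unfold_locales (rule some_basis)

section \<open>Traces against rank-one and finite-rank operators\<close>

lemma op_trace_eqI:
  assumes "((\<lambda>e. l2_inner M e (op_apply T e)) has_sum t) (some_basis M)" shows "op_trace M T = t"
  using infsumI[OF assms] by (simp add: op_trace_def)

lemma l2_operatorD: "l2_operator M A \<Longrightarrow> linear_graph M A" "l2_operator M A \<Longrightarrow> single_valued A"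
  "l2_operator M A \<Longrightarrow> A \<subseteq> L2 M \<times> L2 M"
  by (auto simp: l2_operator_def linear_graph_def)

text \<open>\<open>O\<close> applies its left factor first, so this is the trace of A p(\<phi>): the
  sum over e of \<langle>e, A \<phi>\<rangle> \<langle>\<phi>, e\<rangle>, which is the expansion of
  \<langle>\<phi>, A \<phi>\<rangle>.\<close>

lemma op_trace_proj:
  assumes A: "l2_operator M A" and \<phi>: "(\<phi>, w) \<in> A"
  shows "op_trace M (proj_op M \<phi> O A) = cinner (emb M \<phi>) (emb M w)"
proof (rule op_trace_eqI)
  have L: "\<phi> \<in> L2 M" "w \<in> L2 M" using A \<phi> l2_operatorD(3) by blast+
  have "l2_inner M e (op_apply (proj_op M \<phi> O A) e) = cinner (emb M e) (emb M w) * cinner (emb M \<phi>) (emb M e)"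
    if e: "e \<in> some_basis M" for e
  proof -
    have eL: "e \<in> L2 M" by (rule some_basis.B_L2[OF e])
    let ?c = "l2_inner M \<phi> e"
    have "(l2_scale M ?c \<phi>, l2_scale M ?c w) \<in> A"
      using l2_operatorD(1)[OF A] \<phi> unfolding linear_graph_def by blast
    then have "(e, l2_scale M ?c w) \<in> proj_op M \<phi> O A" using eL unfolding proj_op_def by blast
    moreover have "single_valued (proj_op M \<phi> O A)"
      using l2_operatorD(2)[OF A] by (intro single_valued_relcomp) (auto simp: single_valued_def proj_op_def)
    ultimately have "op_apply (proj_op M \<phi> O A) e = l2_scale M ?c w" by (intro op_apply_eq)
    then show ?thesis using eL L by (simp add: l2_inner l2_scale cinner_scaleC_right)
  qed
  then show "((\<lambda>e. l2_inner M e (op_apply (proj_op M \<phi> O A) e)) has_sum cinner (emb M \<phi>) (emb M w)) (some_basis M)"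
    using some_basis.has_sum_cinner[of "emb M w" M "emb M \<phi>"] L by (subst has_sum_cong) auto
qed

text \<open>A bounded operator becomes a total function on the ambient space, so that the calculus
  of \<open>bounded_linear\<close> applies; complex homogeneity is asked on \<open>VV M\<close>,
  where the operator lives.\<close>

definition represents :: "'a measure \<Rightarrow> ('a hs \<Rightarrow> 'a hs) \<Rightarrow> 'a l2op \<Rightarrow> bool" where
  "represents M t T \<longleftrightarrow> bounded_linear t \<and> (\<forall>x. t x \<in> VV M) \<and>
     (\<forall>x\<in>VV M. \<forall>c. t (scaleC c x) = scaleC c (t x)) \<and> T = pull_graph M {(x, t x) |x. x \<in> VV M}"

lemma representsD:
  assumes "represents M t T"
  shows "bounded_linear t" "t x \<in> VV M" "x \<in> VV M \<Longrightarrow> t (scaleC c x) = scaleC c (t x)"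
    "T = pull_graph M {(x, t x) |x. x \<in> VV M}" "lift_graph M T = {(x, t x) |x. x \<in> VV M}"
  using assms by (auto simp: represents_def intro!: lift_pull)

lemma represents_mem: "represents M t T \<Longrightarrow> (a, b) \<in> T \<longleftrightarrow> a \<in> L2 M \<and> b \<in> L2 M \<and> emb M b = t (emb M a)"
proof -
  assume T: "represents M t T"
  show ?thesis unfolding representsD(4)[OF T] by (auto simp: pull_graph_def)
qed

lemma represents_ex: "represents M t T \<Longrightarrow> a \<in> L2 M \<Longrightarrow> \<exists>b\<in>L2 M. (a, b) \<in> T \<and> emb M b = t (emb M a)"
  using represents_mem VV_emb representsD(2) by metis

lemma represents_l2_operator:
  assumes T: "represents M t T" shows "l2_operator M T"
  unfolding l2_operator_def
proof
  interpret t: bounded_linear t by (rule representsD[OF T])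
  have "linear_graph M (pull_graph M {(x, t x) |x. x \<in> VV M})"
  proof (rule linear_graph_pull)
    show "subspace {(x, t x) |x. x \<in> VV M}"
      unfolding subspace_def by (auto simp: t.add t.scaleR t.zero zero_prod_def intro: VV.V_intros)
    show "ii_invariant {(x, t x) |x. x \<in> VV M}"
      unfolding ii_invariant_def using representsD(3)[OF T, of _ \<i>] by (auto simp: scaleC_i ii_in_VV)
  qed
  then show "linear_graph M T" using representsD(4)[OF T] by simp
  show "single_valued T" unfolding single_valued_def represents_mem[OF T] using emb_eq_iff by metis
qed

lemma represents_bounded_op:
  assumes T: "represents M t T" shows "bounded_op M T"
  unfolding bounded_op_def
proof (intro conjI)
  interpret t: bounded_linear t by (rule representsD[OF T])
  show "l2_operator M T" by (rule represents_l2_operator[OF T])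
  show "Domain T = L2 M" using represents_mem[OF T] represents_ex[OF T] by blast
  show "\<exists>C. \<forall>(x, y)\<in>T. l2_norm M y \<le> C * l2_norm M x"
  proof -
    obtain C where "\<And>x. norm (t x) \<le> norm x * C" using t.bounded by blast
    then show ?thesis
      by (intro exI[of _ C]) (auto simp: represents_mem[OF T] l2_norm mult.commute)
  qed
qed

lemma bounded_op_represents:
  assumes T: "bounded_op M T" shows "\<exists>t. represents M t T"
proof -
  have lin: "l2_operator M T" and dom: "Domain T = L2 M" using T by (auto simp: bounded_op_def)
  obtain C where C: "\<And>x y. (x, y) \<in> T \<Longrightarrow> l2_norm M y \<le> C * l2_norm M x" 
    using T unfolding bounded_op_def by blast
  let ?K = "lift_graph M T"
  have sub: "subspace ?K" and inv: "ii_invariant ?K" and TV: "T \<subseteq> L2 M \<times> L2 M"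
    using subspace_lift_graph linear_graph_ii_invariant l2_operatorD[OF lin] by blast+
  have KV: "?K \<subseteq> VV M \<times> VV M" by (rule lift_graph_sub[OF TV])
  \<comment> \<open>Precomposition with the projection extends the operator to the whole ambient
    space.\<close>
  have "\<exists>y. (VV.proj M x, y) \<in> ?K" for x
  proof -
    obtain a where "a \<in> L2 M" "VV.proj M x = emb M a" using VV_emb[OF VV.proj_in] by blast
    with dom show ?thesis unfolding lift_graph_def by blast
  qed
  then obtain t where t: "\<And>x. (VV.proj M x, t x) \<in> ?K" by metis
  have uniq: "y = y'" if xy: "(x, y) \<in> ?K" "(x, y') \<in> ?K" for x y y'
  proof -
    obtain a b where 1: "(a, b) \<in> T" "x = emb M a" "y = emb M b" using xy(1) unfolding lift_graph_def by blast
    obtain a' b' where 2: "(a', b') \<in> T" "x = emb M a'" "y' = emb M b'" using xy(2) unfolding lift_graph_def by blast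
    have "a = a'" using 1 2 TV emb_eq_iff by blast
    then show ?thesis using 1 2 l2_operatorD(2)[OF lin] by (simp add: single_valued_def) blast
  qed
  have bd: "norm y \<le> C * norm x" if xy: "(x, y) \<in> ?K" for x y
  proof -
    obtain a b where 1: "(a, b) \<in> T" "x = emb M a" "y = emb M b" using xy unfolding lift_graph_def by blast
    then have "a \<in> L2 M" "b \<in> L2 M" using TV by auto
    with C[OF 1(1)] 1 show ?thesis by (simp add: l2_norm)
  qed
  interpret P: bounded_linear "VV.proj M" by (rule VV.bounded_linear_proj)
  have "bounded_linear t"
  proof (rule bounded_linear_intro[where K = "\<bar>C\<bar>"])
    show "t (x + y) = t x + t y" for x y
      using uniq[OF t] VV.graph_add[OF sub t t, of x y] by (simp add: P.add)
    show "t (r *\<^sub>R x) = r *\<^sub>R t x" for r x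
      using uniq[OF t] VV.graph_scale[OF sub t, of r x] by (simp add: P.scaleR)
    show "norm (t x) \<le> norm x * \<bar>C\<bar>" for x
    proof -
      have "norm (t x) \<le> C * norm (VV.proj M x)" by (rule bd[OF t])
      also have "\<dots> \<le> \<bar>C\<bar> * norm x" by (intro mult_mono VV.norm_proj_le) auto
      finally show ?thesis by (simp add: mult.commute)
    qed
  qed
  moreover have "t x \<in> VV M" for x using t KV by blast
  moreover have "t (scaleC c x) = scaleC c (t x)" if x: "x \<in> VV M" for x c
    using uniq[OF t] graph_scaleC[OF sub inv t[of x], of c] x by (simp add: scaleC_in_VV)
  moreover have "?K = {(x, t x) |x. x \<in> VV M}"
  proof
    show "?K \<subseteq> {(x, t x) |x. x \<in> VV M}" using uniq t KV by (auto simp: subset_iff) (metis VV.proj_ident)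
    show "{(x, t x) |x. x \<in> VV M} \<subseteq> ?K" using t by (auto) (metis VV.proj_ident)
  qed
  then have "T = pull_graph M {(x, t x) |x. x \<in> VV M}" using pull_lift[OF TV] by simp
  ultimately show ?thesis unfolding represents_def by (intro exI[of _ t]) blast
qed

text \<open>The sum of the rank-one maps x \<mapsto> \<langle>\<phi>_i, x\<rangle> \<phi>_i. If
  \<phi>_i is the image of a basis vector e_i under a symmetric S_m, this is the sum of the S_m
  p(e_i) S_m.\<close>

definition finite_rank :: "('i \<Rightarrow> 'a hs) \<Rightarrow> 'i set \<Rightarrow> 'a hs \<Rightarrow> 'a hs" where
  "finite_rank \<phi> I x = (\<Sum>i\<in>I. scaleC (cinner (\<phi> i) x) (\<phi> i))"

lemma bounded_linear_finite_rank: "bounded_linear (finite_rank \<phi> I)"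
  unfolding finite_rank_def
  by (intro bounded_linear_sum bounded_linear_compose[OF bounded_linear_scaleC_left bounded_linear_cinner_right])

lemma finite_rank_scaleC: "finite_rank \<phi> I (scaleC c x) = scaleC c (finite_rank \<phi> I x)"
  by (simp add: finite_rank_def cinner_scaleC_right scaleC_sum scaleC_scaleC)

lemma cinner_finite_rank: "cinner y (finite_rank \<phi> I x) = (\<Sum>i\<in>I. cinner (\<phi> i) x * cinner y (\<phi> i))"
  by (simp add: finite_rank_def cinner_sum_right cinner_scaleC_right)

lemma cinner_finite_rank_self: "cinner x (finite_rank \<phi> I x) = complex_of_real (\<Sum>i\<in>I. (cmod (cinner (\<phi> i) x))\<^sup>2)"
  unfolding cinner_finite_rank of_real_sum complex_norm_square by (simp add: cinner_commute)

lemma finite_rank_in_VV: "(\<And>i. i \<in> I \<Longrightarrow> \<phi> i \<in> VV M) \<Longrightarrow> finite_rank \<phi> I x \<in> VV M"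
  unfolding finite_rank_def by (intro subspace_sum[OF subspace_VV] scaleC_in_VV)

lemma posop_finite_rank:
  assumes "\<And>i. i \<in> I \<Longrightarrow> \<phi> i \<in> VV M" shows "VV.posop M (finite_rank \<phi> I)"
  unfolding VV.posop_def
proof (intro conjI allI)
  show "finite_rank \<phi> I x \<bullet> y = x \<bullet> finite_rank \<phi> I y" for x y
  proof -
    have "cinner x (finite_rank \<phi> I y) = cnj (cinner y (finite_rank \<phi> I x))"
      unfolding cinner_finite_rank by (simp add: cinner_commute mult.commute)
    then have "cinner x (finite_rank \<phi> I y) = cinner (finite_rank \<phi> I x) y" by (simp add: cinner_commute)
    then show ?thesis by (metis Re_cinner)
  qed
  show "0 \<le> x \<bullet> finite_rank \<phi> I x" for x
    using cinner_finite_rank_self[of x \<phi> I] by (metis Re_cinner Re_complex_of_real sum_nonneg zero_le_power2)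
  show "finite_rank \<phi> I x \<in> VV M" for x by (rule finite_rank_in_VV[OF assms])
qed (rule bounded_linear_finite_rank)

definition finite_rank_op :: "'a measure \<Rightarrow> ('i \<Rightarrow> 'a hs) \<Rightarrow> 'i set \<Rightarrow> 'a l2op" where
  "finite_rank_op M \<phi> I = pull_graph M {(x, finite_rank \<phi> I x) |x. x \<in> VV M}"

lemma represents_finite_rank:
  "(\<And>i. i \<in> I \<Longrightarrow> \<phi> i \<in> VV M) \<Longrightarrow> represents M (finite_rank \<phi> I) (finite_rank_op M \<phi> I)"
  unfolding represents_def finite_rank_op_def
  using bounded_linear_finite_rank finite_rank_in_VV finite_rank_scaleC by blast

text \<open>Cyclicity of the trace by hand: each \<phi>_i is expanded in the basis and
  \<open>t\<close> is applied termwise, which leaves finitely many matrix elements.\<close>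

lemma op_trace_finite_rank:
  assumes \<phi>: "\<And>i. i \<in> I \<Longrightarrow> \<phi> i \<in> VV M" and T: "represents M t T"
  shows "op_trace M (T O finite_rank_op M \<phi> I) = (\<Sum>i\<in>I. cinner (\<phi> i) (t (\<phi> i)))"
proof (rule op_trace_eqI)
  have F: "represents M (finite_rank \<phi> I) (finite_rank_op M \<phi> I)"
    by (rule represents_finite_rank) (rule \<phi>)
  interpret t: bounded_linear t by (rule representsD[OF T])
  have "((\<lambda>e. cinner (\<phi> i) (t (scaleC (cinner (emb M e) (\<phi> i)) (emb M e)))) has_sum cinner (\<phi> i) (t (\<phi> i))) (some_basis M)"
    if "i \<in> I" for i
    using has_sum_bounded_linear[OF bounded_linear_compose[OF bounded_linear_cinner_right t.bounded_linear_axioms]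
        some_basis.has_sum_expansion[OF \<phi>[OF that]], of "\<phi> i"] by (simp add: o_def)
  then have "((\<lambda>e. \<Sum>i\<in>I. cinner (\<phi> i) (t (scaleC (cinner (emb M e) (\<phi> i)) (emb M e)))) has_sum (\<Sum>i\<in>I. cinner (\<phi> i) (t (\<phi> i)))) (some_basis M)"
    by (rule has_sum_finite_sum)
  moreover have "l2_inner M e (op_apply (T O finite_rank_op M \<phi> I) e)
      = (\<Sum>i\<in>I. cinner (\<phi> i) (t (scaleC (cinner (emb M e) (\<phi> i)) (emb M e))))" if "e \<in> some_basis M" for e
  proof -
    have e: "e \<in> L2 M" by (rule some_basis.B_L2[OF that])
    obtain b where b: "b \<in> L2 M" "(e, b) \<in> T" "emb M b = t (emb M e)" using represents_ex[OF T e] by blast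
    obtain c where c: "c \<in> L2 M" "(b, c) \<in> finite_rank_op M \<phi> I" "emb M c = finite_rank \<phi> I (emb M b)"
      using represents_ex[OF F b(1)] by (elim bexE conjE) (rule that)
    have "single_valued (T O finite_rank_op M \<phi> I)"
      by (intro single_valued_relcomp l2_operatorD(2)[OF represents_l2_operator[OF T]]
          l2_operatorD(2)[OF represents_l2_operator[OF F]])
    then have "op_apply (T O finite_rank_op M \<phi> I) e = c"
      by (rule op_apply_eq) (rule relcompI[OF b(2) c(2)])
    then have "l2_inner M e (op_apply (T O finite_rank_op M \<phi> I) e)
        = (\<Sum>i\<in>I. cinner (\<phi> i) (t (emb M e)) * cinner (emb M e) (\<phi> i))"
      using e c(1) by (simp only: l2_inner c(3) b(3) cinner_finite_rank)
    then show ?thesis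
      by (simp only: representsD(3)[OF T emb_in_VV[OF e]] cinner_scaleC_right mult.commute)
  qed
  ultimately show "((\<lambda>e. l2_inner M e (op_apply (T O finite_rank_op M \<phi> I) e)) has_sum (\<Sum>i\<in>I. cinner (\<phi> i) (t (\<phi> i)))) (some_basis M)"
    by (subst has_sum_cong) auto
qed

section \<open>The trace norm dominates the operator norm\<close>

context hilbert_subspace
begin

lemma nnsa_Cauchy_Schwarz:
  assumes S: "nnsa S" and xy: "(x, y) \<in> S" "(x', y') \<in> S"
  shows "(x \<bullet> y')\<^sup>2 \<le> (x \<bullet> y) * (x' \<bullet> y')"
proof (rule quadratic_nonneg_imp)
  fix t
  have "(x + t *\<^sub>R x', y + t *\<^sub>R y') \<in> S"
    by (intro graph_add graph_scale nnsa_subspace S xy)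
  from nnsa_nonneg[OF S this] show "0 \<le> x \<bullet> y + 2 * t * (x \<bullet> y') + t\<^sup>2 * (x' \<bullet> y')"
    using nnsa_symmetric[OF S xy]
    by (simp add: inner_add_left inner_add_right power2_eq_square inner_commute algebra_simps)
qed

lemma nnsa_posop_graph:
  assumes A: "posop A" shows "nnsa {(x, A x) |x. x \<in> V}"
  unfolding nnsa_def
proof (intro conjI allI impI)
  show "V \<subseteq> closure (Domain {(x, A x) |x. x \<in> V})" using closure_subset by (force simp: Domain_unfold)
  show "0 \<le> x \<bullet> y" if "(x, y) \<in> {(x, A x) |x. x \<in> V}" for x y using that posop_nonneg[OF A] by auto
  show "adj {(x, A x) |x. x \<in> V} = {(x, A x) |x. x \<in> V}"
  proof
    show "{(x, A x) |x. x \<in> V} \<subseteq> adj {(x, A x) |x. x \<in> V}"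
      by (auto simp: adj_def posop_in_V[OF A] posop_symmetric[OF A])
    show "adj {(x, A x) |x. x \<in> V} \<subseteq> {(x, A x) |x. x \<in> V}"
    proof clarify
      fix y z assume "(y, z) \<in> adj {(x, A x) |x. x \<in> V}"
      then have yz: "y \<in> V" "z \<in> V" "\<And>x. x \<in> V \<Longrightarrow> y \<bullet> A x = z \<bullet> x" by (auto simp: adj_def)
      have "A y = z"
        by (rule eq_if_inner_V) (use yz in \<open>auto simp: posop_in_V[OF A] posop_symmetric[OF A]\<close>)
      with yz show "\<exists>x. (y, z) = (x, A x) \<and> x \<in> V" by blast
    qed
  qed
qed

end

lemma represents_op_diff:
  assumes S: "represents M s S" and T: "represents M t T"
  shows "represents M (\<lambda>x. s x - t x) (op_diff M S T)"
  unfolding represents_def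
proof (intro conjI allI ballI)
  show "bounded_linear (\<lambda>x. s x - t x)" by (intro bounded_linear_sub representsD[OF S] representsD[OF T])
  show "s x - t x \<in> VV M" for x by (intro VV.V_intros representsD[OF S] representsD[OF T])
  show "s (scaleC c x) - t (scaleC c x) = scaleC c (s x - t x)" if "x \<in> VV M" for x c
    using that by (simp only: representsD(3)[OF S] representsD(3)[OF T]
        linear_diff[OF bounded_linear.linear[OF bounded_linear_scaleC]])
  show "op_diff M S T = pull_graph M {(x, s x - t x) |x. x \<in> VV M}"
  proof (intro set_eqI iffI)
    fix p assume "p \<in> op_diff M S T"
    then obtain a b c where abc: "p = (a, l2_diff M b c)" "(a, b) \<in> S" "(a, c) \<in> T"
      unfolding op_diff_def by blast
    then have L: "a \<in> L2 M" "b \<in> L2 M" "c \<in> L2 M" "emb M b = s (emb M a)" "emb M c = t (emb M a)"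
      using represents_mem[OF S] represents_mem[OF T] by blast+
    then show "p \<in> pull_graph M {(x, s x - t x) |x. x \<in> VV M}"
      unfolding abc pull_graph_def by (auto simp: l2_diff)
  next
    fix p assume "p \<in> pull_graph M {(x, s x - t x) |x. x \<in> VV M}"
    then obtain a d where ad: "p = (a, d)" "a \<in> L2 M" "d \<in> L2 M" "emb M d = s (emb M a) - t (emb M a)"
      unfolding pull_graph_def by blast
    obtain b c where bc: "b \<in> L2 M" "(a, b) \<in> S" "emb M b = s (emb M a)" "c \<in> L2 M" "(a, c) \<in> T" "emb M c = t (emb M a)"
      using represents_ex[OF S ad(2)] represents_ex[OF T ad(2)] by blast
    have "d = l2_diff M b c"
      using ad bc l2_diff[OF bc(1,4)] by (subst emb_eq_iff[symmetric, of _ M]) auto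
    then show "p \<in> op_diff M S T" unfolding op_diff_def ad(1) using bc by blast
  qed
qed

text \<open>With \<open>O\<close> read from left to right, \<open>D\<close> acts first and its
  adjoint second: this is the operator whose root is \<open>abs_op M D\<close>.\<close>

lemma gram_nonneg_selfadjoint:
  assumes D: "represents M d D"
  shows "nonneg_selfadjoint_op M (D O adjoint_op M D)"
    "lift_graph M (D O adjoint_op M D) = {(x, d x) |x. x \<in> VV M} O VV.adj M {(x, d x) |x. x \<in> VV M}"
proof -
  have lin: "linear_graph M D" using represents_l2_operator[OF D] l2_operatorD by blast
  then have sub: "D \<subseteq> L2 M \<times> L2 M" by (simp add: linear_graph_def)
  have asub: "adjoint_op M D \<subseteq> L2 M \<times> L2 M" by (auto simp: adjoint_op_def)
  let ?G = "{(x, d x) |x. x \<in> VV M}"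
  show eq: "lift_graph M (D O adjoint_op M D) = ?G O VV.adj M ?G"
    by (simp only: lift_relcomp[OF sub asub] lift_adjoint[OF lin] representsD(5)[OF D])
  have nn: "VV.nnsa M (?G O VV.adj M ?G)"
    by (rule VV.nnsa_gram) (use representsD[OF D] in auto)
  have "ii_invariant ?G" using linear_graph_ii_invariant[OF lin] representsD(5)[OF D] by simp
  then have inv: "ii_invariant (?G O VV.adj M ?G)"
    unfolding ii_invariant_def
  proof (intro allI impI)
    fix x z assume G: "\<forall>x y. (x, y) \<in> ?G \<longrightarrow> (ii x, ii y) \<in> ?G" and "(x, z) \<in> ?G O VV.adj M ?G"
    then obtain y where y: "(x, y) \<in> ?G" "(y, z) \<in> VV.adj M ?G" by blast
    have "(ii y, ii z) \<in> VV.adj M ?G"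
    proof (rule VV.adjI)
      fix a b assume ab: "(a, b) \<in> ?G"
      then have "(ii a, ii b) \<in> ?G" using G by blast
      then have "y \<bullet> ii b = z \<bullet> ii a" using y(2) unfolding VV.adj_def by blast
      then show "ii y \<bullet> b = ii z \<bullet> a" by (simp add: inner_ii_left)
    qed (use y(2) in \<open>auto simp: VV.adj_def ii_in_VV\<close>)
    moreover have "(ii x, ii y) \<in> ?G" using y(1) G by blast
    ultimately show "(ii x, ii z) \<in> ?G O VV.adj M ?G" by blast
  qed
  have "D O adjoint_op M D = pull_graph M (?G O VV.adj M ?G)"
    using pull_lift[of "D O adjoint_op M D" M] sub asub eq by force
  then show "nonneg_selfadjoint_op M (D O adjoint_op M D)" using nnsa_pull(1)[OF nn inv] by simp
qed

text \<open>Let P be the absolute value of \<open>D\<close>, so that P v and D v have equal norms.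
  Cauchy-Schwarz for the form of P, summed over the basis, gives \<parallel>P v\<parallel>^2 \<le> 2
  \<langle>v, P v\<rangle> \<tau> \<le> 2 \<tau> \<parallel>v\<parallel> \<parallel>P v\<parallel>.
  The factor 2 arises because real and imaginary part of each coefficient are estimated
  separately.\<close>

lemma norm_le_trace_norm:
  assumes D: "represents M d D" and tr: "trace_norm M D \<le> ennreal \<tau>" and \<tau>: "0 \<le> \<tau>" and v: "v \<in> VV M"
  shows "norm (d v) \<le> 2 * \<tau> * norm v"
proof -
  let ?P = "lift_graph M (abs_op M D)"
  note G = gram_nonneg_selfadjoint[OF D]
  have P: "VV.nnsa M ?P" "?P O ?P = {(x, d x) |x. x \<in> VV M} O VV.adj M {(x, d x) |x. x \<in> VV M}"
    and inv: "ii_invariant ?P"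
    using lift_sqrt_op[OF G(1)] G(2) by (simp_all add: abs_op_def)
  have "\<exists>w. (x, w) \<in> ?P \<and> norm w = norm (d x)" if "x \<in> VV M" for x
    by (rule VV.gram_sqrt_total[OF _ _ P that]) (use representsD[OF D] in auto)
  then obtain p where p: "\<And>x. x \<in> VV M \<Longrightarrow> (x, p x) \<in> ?P" "\<And>x. x \<in> VV M \<Longrightarrow> norm (p x) = norm (d x)" by metis
  have sv: "single_valued (abs_op M D)" "abs_op M D \<subseteq> L2 M \<times> L2 M"
    using nonneg_selfadjoint_single_valued nnsa_lift(1) sqrt_op(1)[OF G(1)] unfolding abs_op_def by blast+
  have diag: "Re (l2_inner M e (op_apply (abs_op M D) e)) = emb M e \<bullet> p (emb M e)" if e: "e \<in> L2 M" for e
  proof -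
    obtain b where b: "(e, b) \<in> abs_op M D" "p (emb M e) = emb M b" "b \<in> L2 M"
    proof -
      have "(emb M e, p (emb M e)) \<in> ?P" using p(1) e by simp
      then obtain a b where ab: "(a, b) \<in> abs_op M D" "emb M e = emb M a" "p (emb M e) = emb M b"
        unfolding lift_graph_def by blast
      then have "a = e" using emb_eq_iff[OF e, of a] sv(2) by auto
      with ab sv(2) that show thesis by blast
    qed
    then have "op_apply (abs_op M D) e = b" using op_apply_eq[OF sv(1)] by blast
    then show ?thesis using b e by (simp add: l2_inner)
  qed
  let ?B = "some_basis M"
  have form: "0 \<le> x \<bullet> p x" if "x \<in> VV M" for x by (rule VV.nnsa_nonneg[OF P(1) p(1)[OF that]])
  have fin: "(\<Sum>e\<in>F. emb M e \<bullet> p (emb M e)) \<le> \<tau>" if F: "finite F" "F \<subseteq> ?B" for F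
  proof -
    have "ennreal (\<Sum>e\<in>F. emb M e \<bullet> p (emb M e)) = (\<Sum>e\<in>F. ennreal (Re (l2_inner M e (op_apply (abs_op M D) e))))"
      using F some_basis.B_L2[of _ M] form emb_in_VV
      by (subst sum_ennreal[symmetric]) (auto intro!: sum.cong simp: diag subset_iff)
    also have "\<dots> \<le> trace_norm M D"
      unfolding trace_norm_def
      using F by (subst nonneg_infsum_complete) (auto intro!: SUP_upper)
    finally have "ennreal (\<Sum>e\<in>F. emb M e \<bullet> p (emb M e)) \<le> ennreal \<tau>" using tr by (rule order_trans)
    then show ?thesis using \<tau> by simp
  qed
  have coef: "(cmod (cinner (emb M e) (p v)))\<^sup>2 \<le> 2 * (v \<bullet> p v) * (emb M e \<bullet> p (emb M e))" if e: "e \<in> ?B" for e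
  proof -
    let ?x = "emb M e"
    have x: "?x \<in> VV M" using some_basis.B_L2[OF e] by simp
    \<comment> \<open>The rotated pair controls the imaginary part of the coefficient; its form
      value equals that of the original pair because \<open>ii\<close> preserves inner
      products.\<close>
    have "(ii ?x, ii (p ?x)) \<in> ?P" using p(1)[OF x] inv by (simp add: ii_invariant_def)
    from VV.nnsa_Cauchy_Schwarz[OF P(1) this p(1)[OF v]] VV.nnsa_Cauchy_Schwarz[OF P(1) p(1)[OF x] p(1)[OF v]]
    have "(?x \<bullet> p v)\<^sup>2 + (ii ?x \<bullet> p v)\<^sup>2 \<le> 2 * ((?x \<bullet> p ?x) * (v \<bullet> p v))" by simp
    moreover have "(cmod (cinner ?x (p v)))\<^sup>2 = (?x \<bullet> p v)\<^sup>2 + (ii ?x \<bullet> p v)\<^sup>2"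
      by (simp add: cmod_power2 cinner_def)
    ultimately show ?thesis by (simp add: mult.commute mult.left_commute)
  qed
  have "(norm (p v))\<^sup>2 \<le> 2 * (v \<bullet> p v) * \<tau>"
  proof (rule has_sum_le_finite_sums)
    show "((\<lambda>e. (cmod (cinner (emb M e) (p v)))\<^sup>2) has_sum (norm (p v))\<^sup>2) ?B"
      using VV.nnsa_in_V(2)[OF P(1) p(1)[OF v]] by (rule some_basis.has_sum_norm)
    fix F assume F: "finite F" "F \<subseteq> ?B"
    have "(\<Sum>e\<in>F. (cmod (cinner (emb M e) (p v)))\<^sup>2) \<le> (\<Sum>e\<in>F. 2 * (v \<bullet> p v) * (emb M e \<bullet> p (emb M e)))"
      using F coef by (intro sum_mono) auto
    also have "\<dots> = 2 * (v \<bullet> p v) * (\<Sum>e\<in>F. emb M e \<bullet> p (emb M e))" by (simp add: sum_distrib_left)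
    also have "\<dots> \<le> 2 * (v \<bullet> p v) * \<tau>" using fin[OF F] form[OF v] by (intro mult_left_mono) auto
    finally show "(\<Sum>e\<in>F. (cmod (cinner (emb M e) (p v)))\<^sup>2) \<le> 2 * (v \<bullet> p v) * \<tau>" .
  qed
  also have "\<dots> \<le> 2 * (norm v * norm (p v)) * \<tau>"
    using norm_cauchy_schwarz[of v "p v"] \<tau> by (intro mult_right_mono mult_left_mono) auto
  finally have "norm (p v) * norm (p v) \<le> norm (p v) * (2 * \<tau> * norm v)"
    by (simp add: power2_eq_square mult.commute mult.left_commute)
  then have "norm (p v) \<le> 2 * \<tau> * norm v" using \<tau> by (cases "norm (p v) = 0") auto
  then show ?thesis using p(2)[OF v] by simp
qed

text \<open>The constant 4 collects one factor 2 from \<open>norm_cinner_le\<close> and one from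
  \<open>norm_le_trace_norm\<close>.\<close>

lemma op_trace_finite_rank_diff:
  assumes \<phi>: "\<And>i. i \<in> I \<Longrightarrow> \<phi> i \<in> VV M" and S: "bounded_op M S" and T: "bounded_op M T"
    and tr: "trace_norm M (op_diff M S T) \<le> ennreal \<tau>" and \<tau>: "0 \<le> \<tau>"
  shows "cmod (op_trace M (S O finite_rank_op M \<phi> I) - op_trace M (T O finite_rank_op M \<phi> I))
    \<le> \<tau> * (\<Sum>i\<in>I. 4 * (norm (\<phi> i))\<^sup>2)"
proof -
  obtain s where s: "represents M s S" using bounded_op_represents[OF S] by blast
  obtain t where t: "represents M t T" using bounded_op_represents[OF T] by blast
  have "op_trace M (S O finite_rank_op M \<phi> I) = (\<Sum>i\<in>I. cinner (\<phi> i) (s (\<phi> i)))"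
    "op_trace M (T O finite_rank_op M \<phi> I) = (\<Sum>i\<in>I. cinner (\<phi> i) (t (\<phi> i)))"
    by (rule op_trace_finite_rank[OF _ s] op_trace_finite_rank[OF _ t], erule \<phi>)+
  then have "op_trace M (S O finite_rank_op M \<phi> I) - op_trace M (T O finite_rank_op M \<phi> I)
      = (\<Sum>i\<in>I. cinner (\<phi> i) (s (\<phi> i) - t (\<phi> i)))"
    by (simp add: cinner_diff_right sum_subtractf)
  also have "cmod \<dots> \<le> (\<Sum>i\<in>I. cmod (cinner (\<phi> i) (s (\<phi> i) - t (\<phi> i))))" by (rule norm_sum)
  also have "\<dots> \<le> (\<Sum>i\<in>I. \<tau> * (4 * (norm (\<phi> i))\<^sup>2))"
  proof (rule sum_mono)
    fix i assume "i \<in> I"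
    from norm_le_trace_norm[OF represents_op_diff[OF s t] tr \<tau> \<phi>[OF this]]
    have "cmod (cinner (\<phi> i) (s (\<phi> i) - t (\<phi> i))) \<le> 2 * (norm (\<phi> i) * (2 * \<tau> * norm (\<phi> i)))"
      by (intro order_trans[OF norm_cinner_le] mult_left_mono) auto
    then show "cmod (cinner (\<phi> i) (s (\<phi> i) - t (\<phi> i))) \<le> \<tau> * (4 * (norm (\<phi> i))\<^sup>2)"
      by (simp add: power2_eq_square algebra_simps)
  qed
  finally show ?thesis by (simp add: sum_distrib_left)
qed

section \<open>Boxes and tensor products\<close>

lemma cnj_indicator [simp]: "cnj (indicator A x) = indicator A x"
  by (cases "x \<in> A") simp_all

lemma l2_fun_indicator:
  assumes "A \<in> sets M" "emeasure M A < \<infinity>" shows "(\<lambda>x. indicator A x) \<in> l2_fun M"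
proof -
  have "(cmod (indicator A x))\<^sup>2 = indicator A x" for x by (simp add: indicator_def)
  then show ?thesis using assms by (simp add: l2_fun_def)
qed

text \<open>Real and imaginary part are treated separately. If all integrals over a generating
  \<pi>-system vanish, the positive and the negative part are densities of measures that are finite
  and equal on the generator, hence equal; so the two parts agree almost everywhere, which forces
  them to be 0.\<close>

lemma total_indicators:
  fixes h :: "'a \<Rightarrow> complex"
  assumes M: "sigma_finite_measure M" and E: "Int_stable E" "E \<subseteq> Pow (space M)" "sets M = sigma_sets (space M) E"
    and fin: "\<And>A. A \<in> E \<Longrightarrow> emeasure M A < \<infinity>"
    and \<Omega>: "range \<Omega> \<subseteq> E" "(\<Union>n::nat. \<Omega> n) = space M"
    and h: "h \<in> l2_fun M" and o: "\<And>A. A \<in> E \<Longrightarrow> (\<integral>x. indicator A x * h x \<partial>M) = 0"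
  shows "AE x in M. h x = 0"
proof -
  interpret sigma_finite_measure M by (rule M)
  have EM: "A \<in> sets M" if "A \<in> E" for A using that E(3) by auto
  have hm [measurable]: "h \<in> borel_measurable M" by (rule l2_funD[OF h])
  have int: "integrable M (\<lambda>x. indicator A x * h x)" if A: "A \<in> E" for A
  proof -
    have "(\<lambda>x. indicator A x :: complex) \<in> l2_fun M"
      by (rule l2_fun_indicator[OF EM[OF A] fin[OF A]])
    from integrable_l2_prod[OF this h] show ?thesis by (simp only: cnj_indicator)
  qed
  have zero: "AE x in M. u x = 0" if um [measurable]: "u \<in> borel_measurable M"
    and ui: "\<And>A. A \<in> E \<Longrightarrow> integrable M (\<lambda>x. indicator A x * u x)"
    and u0: "\<And>A. A \<in> E \<Longrightarrow> (\<integral>x. indicator A x * u x \<partial>M) = 0" for u :: "'a \<Rightarrow> real"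
  proof -
    let ?p = "\<lambda>x. ennreal (u x)" and ?n = "\<lambda>x. ennreal (- u x)"
    have eq: "emeasure (density M ?p) A = emeasure (density M ?n) A \<and> emeasure (density M ?p) A \<noteq> \<infinity>" if A: "A \<in> E" for A
    proof -
      have i: "integrable M (\<lambda>x. indicator A x * max 0 (u x))" "integrable M (\<lambda>x. indicator A x * max 0 (- u x))"
      proof -
        have "integrable M (\<lambda>x. max 0 (indicator A x * u x))" "integrable M (\<lambda>x. max 0 (- (indicator A x * u x)))"
          using ui[OF A] by (auto intro!: integrable_max)
        moreover have "max 0 (indicator A x * u x) = indicator A x * max 0 (u x)"
          "max 0 (- (indicator A x * u x)) = indicator A x * max 0 (- u x)" for x
          by (auto simp: indicator_def)
        ultimately show "integrable M (\<lambda>x. indicator A x * max 0 (u x))" "integrable M (\<lambda>x. indicator A x * max 0 (- u x))"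
          by simp_all
      qed
      have "emeasure (density M ?p) A = (\<integral>\<^sup>+x. ennreal (indicator A x * max 0 (u x)) \<partial>M)"
        using EM[OF A] by (subst emeasure_density) (auto intro!: nn_integral_cong simp: indicator_def max_def ennreal_neg)
      then have 1: "emeasure (density M ?p) A = ennreal (\<integral>x. indicator A x * max 0 (u x) \<partial>M)"
        using i(1) by (simp add: nn_integral_eq_integral)
      have "emeasure (density M ?n) A = (\<integral>\<^sup>+x. ennreal (indicator A x * max 0 (- u x)) \<partial>M)"
        using EM[OF A] by (subst emeasure_density) (auto intro!: nn_integral_cong simp: indicator_def max_def ennreal_neg)
      then have 2: "emeasure (density M ?n) A = ennreal (\<integral>x. indicator A x * max 0 (- u x) \<partial>M)"
        using i(2) by (simp add: nn_integral_eq_integral)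
      have "(\<integral>x. indicator A x * max 0 (u x) \<partial>M) - (\<integral>x. indicator A x * max 0 (- u x) \<partial>M)
          = (\<integral>x. indicator A x * max 0 (u x) - indicator A x * max 0 (- u x) \<partial>M)"
        by (rule Bochner_Integration.integral_diff[OF i, symmetric])
      also have "\<dots> = (\<integral>x. indicator A x * u x \<partial>M)" by (intro Bochner_Integration.integral_cong) (auto simp: indicator_def max_def)
      finally show ?thesis using 1 2 u0[OF A] by simp
    qed
    have "density M ?p = density M ?n"
    proof (rule measure_eqI_generator_eq[OF E(1,2) _ _ _ \<Omega>])
      show "emeasure (density M ?p) X = emeasure (density M ?n) X" if "X \<in> E" for X using eq[OF that] by simp
      show "emeasure (density M ?p) (\<Omega> i) \<noteq> \<infinity>" for i using eq \<Omega>(1) by auto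
    qed (simp_all add: E(3))
    then have "AE x in M. ?p x = ?n x" by (subst (asm) density_unique_iff) auto
    then show ?thesis
    proof eventually_elim
      fix x assume "ennreal (u x) = ennreal (- u x)"
      then show "u x = 0" by (cases "u x \<ge> 0") (auto simp: ennreal_neg ennreal_eq_0_iff)
    qed
  qed
  have re: "Re (indicator A x * h x) = indicator A x * Re (h x)" "Im (indicator A x * h x) = indicator A x * Im (h x)" for A x
    by (auto simp: indicator_def)
  have "AE x in M. Re (h x) = 0"
  proof (rule zero)
    show "integrable M (\<lambda>x. indicator A x * Re (h x))" if "A \<in> E" for A
      using integrable_Re[OF int[OF that]] by (simp only: re)
    show "(\<integral>x. indicator A x * Re (h x) \<partial>M) = 0" if "A \<in> E" for A
      using integral_Re[OF int[OF that]] o[OF that] by (simp only: re) simp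
  qed measurable
  moreover have "AE x in M. Im (h x) = 0"
  proof (rule zero)
    show "integrable M (\<lambda>x. indicator A x * Im (h x))" if "A \<in> E" for A
      using integrable_Im[OF int[OF that]] by (simp only: re)
    show "(\<integral>x. indicator A x * Im (h x) \<partial>M) = 0" if "A \<in> E" for A
      using integral_Im[OF int[OF that]] o[OF that] by (simp only: re) simp
  qed measurable
  ultimately show ?thesis by eventually_elim (simp add: complex_eq_iff)
qed

text \<open>Rational corners make the family countable while it stays closed under intersection and
  generating; it thus yields both totality and separability.\<close>

definition rat_boxes :: "'a::euclidean_space set set" where
  "rat_boxes = {box a b |a b. (\<forall>i\<in>Basis. a \<bullet> i \<in> \<rat>) \<and> (\<forall>i\<in>Basis. b \<bullet> i \<in> \<rat>)}"

lemma countable_rat_boxes: "countable (rat_boxes :: 'a::euclidean_space set set)"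
proof -
  let ?v = "\<lambda>f. \<Sum>i\<in>Basis. f i *\<^sub>R (i :: 'a)"
  let ?I = "(Basis :: 'a set) \<rightarrow>\<^sub>E \<rat>"
  have "rat_boxes \<subseteq> (\<lambda>(f, g). box (?v f) (?v g)) ` (?I \<times> ?I)"
  proof
    fix X :: "'a set" assume "X \<in> rat_boxes"
    then obtain a b where ab: "X = box a b" "\<forall>i\<in>Basis. a \<bullet> i \<in> \<rat>" "\<forall>i\<in>Basis. b \<bullet> i \<in> \<rat>"
      unfolding rat_boxes_def by blast
    have v: "?v (\<lambda>i\<in>Basis. c \<bullet> i) = c" for c by (simp add: euclidean_representation)
    have "X = (\<lambda>(f, g). box (?v f) (?v g)) (\<lambda>i\<in>Basis. a \<bullet> i, \<lambda>i\<in>Basis. b \<bullet> i)"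
      by (simp only: v ab case_prod_conv)
    moreover have "(\<lambda>i\<in>Basis. a \<bullet> i, \<lambda>i\<in>Basis. b \<bullet> i) \<in> ?I \<times> ?I" using ab by auto
    ultimately show "X \<in> (\<lambda>(f, g). box (?v f) (?v g)) ` (?I \<times> ?I)" by (rule image_eqI)
  qed
  moreover have "countable ((\<lambda>(f, g). box (?v f) (?v g)) ` (?I \<times> ?I))"
    by (intro countable_image countable_SIGMA countable_PiE finite_Basis countable_rat)
  ultimately show ?thesis by (rule countable_subset)
qed

lemma Int_rat_boxes: "A \<in> rat_boxes \<Longrightarrow> B \<in> rat_boxes \<Longrightarrow> A \<inter> B \<in> rat_boxes"
proof -
  assume "A \<in> rat_boxes" "B \<in> rat_boxes"
  then obtain a b c d where *: "A = box a b" "B = box c d" "\<forall>i\<in>Basis. a \<bullet> i \<in> \<rat>" "\<forall>i\<in>Basis. b \<bullet> i \<in> \<rat>"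
    "\<forall>i\<in>Basis. c \<bullet> i \<in> \<rat>" "\<forall>i\<in>Basis. d \<bullet> i \<in> \<rat>"
    unfolding rat_boxes_def by blast
  then show "A \<inter> B \<in> rat_boxes"
    unfolding rat_boxes_def *(1,2) box_Int_box
    by (intro CollectI exI conjI[OF refl]) (auto simp: max_def min_def)
qed

lemma sets_borel_rat_boxes: "sets (borel :: 'a::euclidean_space measure) = sigma_sets UNIV rat_boxes"
proof
  have "X \<in> sigma_sets UNIV rat_boxes" if "open X" for X :: "'a set"
  proof -
    let ?a = "\<lambda>f :: 'a \<Rightarrow> real \<times> real. \<Sum>i\<in>Basis. fst (f i) *\<^sub>R i"
    let ?b = "\<lambda>f :: 'a \<Rightarrow> real \<times> real. \<Sum>i\<in>Basis. snd (f i) *\<^sub>R i"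
    let ?I = "{f \<in> Basis \<rightarrow>\<^sub>E \<rat> \<times> \<rat>. box (?a f) (?b f) \<subseteq> X}"
    have X: "X = \<Union> ((\<lambda>f. box (?a f) (?b f)) ` ?I)" using open_UNION_box[OF that] by simp
    have c: "countable ((\<lambda>f. box (?a f) (?b f)) ` ?I)"
      by (intro countable_image countable_Collect countable_PiE finite_Basis countable_SIGMA countable_rat)
    have "(\<lambda>f. box (?a f) (?b f)) ` ?I \<subseteq> rat_boxes"
      unfolding rat_boxes_def by (fastforce simp: PiE_iff mem_Times_iff)
    then have "(\<lambda>f. box (?a f) (?b f)) ` ?I \<subseteq> sigma_sets UNIV rat_boxes" by (auto intro: sigma_sets.Basic)
    with c have "\<Union> ((\<lambda>f. box (?a f) (?b f)) ` ?I) \<in> sigma_sets UNIV rat_boxes"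
      using sigma_algebra.countable_Union[OF sigma_algebra_sigma_sets[of rat_boxes UNIV]] by auto
    then show ?thesis using X by simp
  qed
  then show "sets (borel :: 'a measure) \<subseteq> sigma_sets UNIV rat_boxes"
    unfolding borel_def by (auto intro!: sigma_sets_mono)
  have "rat_boxes \<subseteq> sets (borel :: 'a measure)" unfolding rat_boxes_def by auto
  then show "sigma_sets UNIV rat_boxes \<subseteq> sets (borel :: 'a measure)"
    using sets.sigma_sets_subset[of rat_boxes "borel :: 'a measure"] by simp
qed

definition cube :: "nat \<Rightarrow> 'a::euclidean_space set" where
  "cube n = box (- (real n *\<^sub>R One)) (real n *\<^sub>R One)"

lemma cube_rat_box: "cube n \<in> rat_boxes"
  unfolding rat_boxes_def cube_def by (intro CollectI exI conjI[OF refl]) auto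

lemma UN_cube: "(\<Union>n. cube n) = UNIV"
  unfolding cube_def by (rule UN_box_eq_UNIV)

lemma cube_mono: "m \<le> n \<Longrightarrow> cube m \<subseteq> cube n"
  unfolding cube_def by (intro subset_box_imp) auto

lemma rat_box_sets: "A \<in> rat_boxes \<Longrightarrow> A \<in> sets borel"
  unfolding rat_boxes_def by auto

lemma emeasure_rat_box: "A \<in> rat_boxes \<Longrightarrow> emeasure lborel A < \<infinity>"
  unfolding rat_boxes_def using emeasure_lborel_box_finite by auto

lemma total_rat_boxes:
  fixes h :: "'a::euclidean_space \<Rightarrow> complex"
  assumes "h \<in> l2_fun lborel" "\<And>A. A \<in> rat_boxes \<Longrightarrow> (\<integral>x. indicator A x * h x \<partial>lborel) = 0"
  shows "AE x in lborel. h x = 0"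
proof (rule total_indicators[OF _ _ _ _ emeasure_rat_box _ _ assms])
  show "sigma_finite_measure (lborel :: 'a measure)" by unfold_locales
  show "Int_stable (rat_boxes :: 'a set set)" using Int_rat_boxes by (auto simp: Int_stable_def)
  show "sets (lborel :: 'a measure) = sigma_sets (space lborel) rat_boxes" by (simp add: sets_borel_rat_boxes)
  show "range cube \<subseteq> (rat_boxes :: 'a set set)" using cube_rat_box by auto
  show "(\<Union>n. cube n) = space (lborel :: 'a measure)" by (simp add: UN_cube)
qed auto

interpretation leb: product_sigma_finite "\<lambda>_::nat. lborel :: (real^3) measure"
  by unfold_locales

lemma leb_sigma_finite: "sigma_finite_measure (leb k)"
  unfolding leb_def by (rule leb.sigma_finite) simp

lemma space_leb: "space (leb k) = PiE {..<k} (\<lambda>_. UNIV)"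
  by (simp add: leb_def space_PiM)

definition conf_boxes :: "nat \<Rightarrow> conf set set" where
  "conf_boxes k = PiE {..<k} ` PiE {..<k} (\<lambda>_. rat_boxes)"

lemma conf_boxesI: "(\<And>i. i < k \<Longrightarrow> A i \<in> rat_boxes) \<Longrightarrow> PiE {..<k} A \<in> conf_boxes k"
proof -
  assume A: "\<And>i. i < k \<Longrightarrow> A i \<in> rat_boxes"
  have "PiE {..<k} A = PiE {..<k} (restrict A {..<k})" by (rule PiE_cong) simp
  then show ?thesis unfolding conf_boxes_def using A by (intro image_eqI[of _ _ "restrict A {..<k}"]) auto
qed

lemma conf_boxesE:
  assumes "X \<in> conf_boxes k"
  obtains A where "X = PiE {..<k} A" "\<And>i. i < k \<Longrightarrow> A i \<in> rat_boxes"
  using assms unfolding conf_boxes_def by (auto simp: PiE_iff)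

lemma countable_conf_boxes: "countable (conf_boxes k)"
  unfolding conf_boxes_def by (intro countable_image countable_PiE countable_rat_boxes) simp

lemma emeasure_conf_box: "X \<in> conf_boxes k \<Longrightarrow> emeasure (leb k) X < \<infinity>"
proof (erule conf_boxesE)
  fix A assume A: "X = PiE {..<k} A" "\<And>i. i < k \<Longrightarrow> A i \<in> rat_boxes"
  have "emeasure (leb k) X = (\<Prod>i<k. emeasure lborel (A i))"
    unfolding A(1) leb_def using A(2) rat_box_sets by (intro leb.emeasure_PiM) auto
  also have "\<dots> = (\<Prod>i<k. ennreal (measure lborel (A i)))"
  proof (rule prod.cong)
    fix i assume "i \<in> {..<k}"
    then show "emeasure lborel (A i) = ennreal (measure lborel (A i))"
      using emeasure_rat_box[OF A(2), of i] by (simp add: emeasure_eq_ennreal_measure less_top[symmetric])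
  qed simp
  also have "\<dots> < \<infinity>" by (simp add: prod_ennreal)
  finally show ?thesis .
qed

lemma sets_leb: "sets (leb k) = sigma_sets (space (leb k)) (conf_boxes k)"
proof -
  let ?P = "{{f\<in>(\<Pi>\<^sub>E i\<in>{..<k}. UNIV). \<forall>i\<in>j. f i \<in> A i} | A j. j \<in> {{..<k}} \<and> A \<in> Pi j (\<lambda>_. rat_boxes :: (real^3) set set)}"
  have "sets (leb k) = sets (PiM {..<k} (\<lambda>_. sigma UNIV (rat_boxes :: (real^3) set set)))"
    unfolding leb_def by (intro sets_PiM_cong refl) (simp add: sets_borel_rat_boxes)
  also have "\<dots> = sets (sigma (\<Pi>\<^sub>E i\<in>{..<k}. UNIV) ?P)"
  proof (rule sets_PiM_sigma)
    show "\<exists>S\<subseteq>(rat_boxes :: (real^3) set set). countable S \<and> UNIV = \<Union> S" for i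
      using cube_rat_box UN_cube by (intro exI[of _ "range cube"]) auto
  qed auto
  also have "\<dots> = sigma_sets (\<Pi>\<^sub>E i\<in>{..<k}. UNIV) ?P" by (rule sets_measure_of) auto
  also have "?P = conf_boxes k"
  proof (intro set_eqI iffI)
    fix X assume "X \<in> ?P"
    then obtain A where A: "X = {f\<in>(\<Pi>\<^sub>E i\<in>{..<k}. UNIV). \<forall>i\<in>{..<k}. f i \<in> A i}" "A \<in> Pi {..<k} (\<lambda>_. rat_boxes)" by blast
    then have "X = PiE {..<k} A" by (auto simp: PiE_def)
    then show "X \<in> conf_boxes k" using A(2) by (auto intro: conf_boxesI)
  next
    fix X assume "X \<in> conf_boxes k"
    then obtain A where A: "X = PiE {..<k} A" "\<forall>i<k. A i \<in> rat_boxes" by (metis conf_boxesE)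
    then have "X = {f\<in>(\<Pi>\<^sub>E i\<in>{..<k}. UNIV). \<forall>i\<in>{..<k}. f i \<in> A i}" by (auto simp: PiE_def)
    then show "X \<in> ?P" using A(2) by auto
  qed
  finally show ?thesis by (simp add: space_leb)
qed

lemma total_conf_boxes:
  assumes "h \<in> l2_fun (leb k)" "\<And>A. A \<in> conf_boxes k \<Longrightarrow> (\<integral>x. indicator A x * h x \<partial>leb k) = 0"
  shows "AE x in leb k. h x = 0"
proof (rule total_indicators[OF leb_sigma_finite _ _ sets_leb emeasure_conf_box _ _ assms])
  show "Int_stable (conf_boxes k)"
    unfolding Int_stable_def by (auto elim!: conf_boxesE simp: PiE_Int intro!: conf_boxesI Int_rat_boxes)
  show "conf_boxes k \<subseteq> Pow (space (leb k))" by (auto elim!: conf_boxesE simp: space_leb PiE_iff)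
  show "range (\<lambda>n. PiE {..<k} (\<lambda>_. cube n)) \<subseteq> conf_boxes k" by (auto intro!: conf_boxesI cube_rat_box)
  show "(\<Union>n. PiE {..<k} (\<lambda>_. cube n)) = space (leb k)"
  proof
    show "space (leb k) \<subseteq> (\<Union>n. PiE {..<k} (\<lambda>_. cube n))"
    proof
      fix x assume x: "x \<in> space (leb k)"
      have "\<forall>i. \<exists>n. x i \<in> cube n" using UN_cube by blast
      then obtain n where n: "\<And>i. x i \<in> cube (n i)" by metis
      \<comment> \<open>The sum serves as a common upper bound of the finitely many
        \<open>n i\<close>; it makes sense for k = 0 as well.\<close>
      have "x i \<in> cube (\<Sum>j<k. n j)" if "i < k" for i
        using n[of i] cube_mono[OF member_le_sum[of i "{..<k}" n]] that by auto
      then have "x \<in> PiE {..<k} (\<lambda>_. cube (\<Sum>j<k. n j))" using x by (auto simp: space_leb PiE_iff)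
      then show "x \<in> (\<Union>n. PiE {..<k} (\<lambda>_. cube n))" by blast
    qed
  qed (auto simp: space_leb PiE_iff)
qed auto

section \<open>Splitting the variables into the first k and the remaining j - k\<close>

definition glue :: "nat \<Rightarrow> nat \<Rightarrow> conf \<times> conf \<Rightarrow> conf" where
  "glue k j = (\<lambda>p. \<lambda>i\<in>{..<j}. if i < k then fst p i else snd p (i - k))"

lemma measurable_glue [measurable]:
  assumes "k \<le> j" shows "glue k j \<in> measurable (leb k \<Otimes>\<^sub>M leb (j - k)) (leb j)"
  unfolding glue_def leb_def
proof (rule measurable_restrict)
  fix i assume "i \<in> {..<j}"
  show "(\<lambda>p. if i < k then fst p i else snd p (i - k)) \<in> measurable (PiM {..<k} (\<lambda>_. lborel) \<Otimes>\<^sub>M PiM {..<j - k} (\<lambda>_. lborel)) lborel"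
  proof (cases "i < k")
    case True
    then show ?thesis
      using measurable_compose[OF measurable_fst measurable_component_singleton[of i "{..<k}" "\<lambda>_. lborel"]] by simp
  next
    case False
    then show ?thesis
      using measurable_compose[OF measurable_snd measurable_component_singleton[of "i - k" "{..<j - k}" "\<lambda>_. lborel"]]
        \<open>i \<in> {..<j}\<close> by simp
  qed
qed

text \<open>Checked on boxes, whose preimages are products of boxes; the second factor carries the
  shift of indices by \<open>k\<close>.\<close>

lemma distr_glue:
  assumes kj: "k \<le> j" shows "distr (leb k \<Otimes>\<^sub>M leb (j - k)) (leb j) (glue k j) = leb j"
  unfolding leb_def[of j]
proof (rule leb.PiM_eqI)
  interpret sigma_finite_measure "leb (j - k)" by (rule leb_sigma_finite)
  fix A :: "nat \<Rightarrow> (real^3) set" assume A: "\<And>i. i \<in> {..<j} \<Longrightarrow> A i \<in> sets lborel"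
  have m: "PiE {..<j} A \<in> sets (PiM {..<j} (\<lambda>_. lborel))" using A by (intro sets_PiM_I_finite) auto
  have eq: "glue k j -` PiE {..<j} A \<inter> space (leb k \<Otimes>\<^sub>M leb (j - k))
      = PiE {..<k} A \<times> PiE {..<j - k} (\<lambda>i. A (k + i))"
  proof (intro set_eqI iffI)
    fix p assume p: "p \<in> glue k j -` PiE {..<j} A \<inter> space (leb k \<Otimes>\<^sub>M leb (j - k))"
    then have sp: "fst p \<in> extensional {..<k}" "snd p \<in> extensional {..<j - k}"
      by (auto simp: space_pair_measure space_leb PiE_def)
    have g: "glue k j p i \<in> A i" if "i < j" for i using p that by (auto simp: PiE_iff)
    have "fst p i \<in> A i" if "i < k" for i using g[of i] that kj by (simp add: glue_def)
    moreover have "snd p i \<in> A (k + i)" if "i < j - k" for i using g[of "k + i"] that by (simp add: glue_def)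
    ultimately show "p \<in> PiE {..<k} A \<times> PiE {..<j - k} (\<lambda>i. A (k + i))"
      using sp by (auto simp: mem_Times_iff PiE_def)
  next
    fix p assume "p \<in> PiE {..<k} A \<times> PiE {..<j - k} (\<lambda>i. A (k + i))"
    then have f: "fst p \<in> PiE {..<k} A" and s: "snd p \<in> PiE {..<j - k} (\<lambda>i. A (k + i))" by auto
    have "glue k j p i \<in> A i" if "i < j" for i
    proof (cases "i < k")
      case True then show ?thesis using f that by (auto simp: glue_def PiE_iff)
    next
      case False
      have "\<forall>i<j - k. snd p i \<in> A (k + i)" using s by (auto simp: PiE_iff)
      with False that have "snd p (i - k) \<in> A (k + (i - k))" by (metis diff_less_mono leI)
      with False that show ?thesis by (simp add: glue_def)
    qed
    moreover have "glue k j p \<in> extensional {..<j}" by (simp add: glue_def)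
    ultimately show "p \<in> glue k j -` PiE {..<j} A \<inter> space (leb k \<Otimes>\<^sub>M leb (j - k))"
      using f s by (auto simp: space_pair_measure space_leb PiE_def mem_Times_iff)
  qed
  have "emeasure (distr (leb k \<Otimes>\<^sub>M leb (j - k)) (PiM {..<j} (\<lambda>_. lborel)) (glue k j)) (PiE {..<j} A)
      = emeasure (leb k \<Otimes>\<^sub>M leb (j - k)) (PiE {..<k} A \<times> PiE {..<j - k} (\<lambda>i. A (k + i)))"
    using measurable_glue[OF kj] m by (subst emeasure_distr) (simp_all add: eq leb_def[of j])
  also have "\<dots> = emeasure (leb k) (PiE {..<k} A) * emeasure (leb (j - k)) (PiE {..<j - k} (\<lambda>i. A (k + i)))"
    using A kj by (intro emeasure_pair_measure_Times) (auto simp: leb_def intro!: sets_PiM_I_finite)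
  also have "\<dots> = (\<Prod>i<k. emeasure lborel (A i)) * (\<Prod>i<j - k. emeasure lborel (A (k + i)))"
    unfolding leb_def using A kj by (intro arg_cong2[of _ _ _ _ "(*)"] leb.emeasure_PiM) auto
  also have "\<dots> = (\<Prod>i<j. emeasure lborel (A i))"
    using prod.atLeastLessThan_concat[of 0 k j "\<lambda>i. emeasure lborel (A i)"] kj
      prod.atLeastLessThan_shift_0[of "\<lambda>i. emeasure lborel (A i)" k j]
    by (simp add: lessThan_atLeast0 o_def add.commute)
  finally show "emeasure (distr (leb k \<Otimes>\<^sub>M leb (j - k)) (PiM {..<j} (\<lambda>_. lborel)) (glue k j)) (PiE {..<j} A)
      = (\<Prod>i<j. emeasure lborel (A i))" .
qed simp_all

lemma (in pair_sigma_finite) integral_product_function: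
  fixes a :: "'a \<Rightarrow> 'c::{real_normed_field, banach, second_countable_topology}" and b :: "'b \<Rightarrow> 'c"
  assumes a: "integrable M1 a" and b: "integrable M2 b"
  shows "integrable (M1 \<Otimes>\<^sub>M M2) (\<lambda>p. a (fst p) * b (snd p))"
    "(\<integral>p. a (fst p) * b (snd p) \<partial>(M1 \<Otimes>\<^sub>M M2)) = (\<integral>x. a x \<partial>M1) * (\<integral>y. b y \<partial>M2)"
proof -
  have [measurable]: "a \<in> borel_measurable M1" "b \<in> borel_measurable M2" using a b by auto
  show i: "integrable (M1 \<Otimes>\<^sub>M M2) (\<lambda>p. a (fst p) * b (snd p))"
    using a b by (intro Fubini_integrable) (auto simp: norm_mult)
  from integral_fst'[OF i] show "(\<integral>p. a (fst p) * b (snd p) \<partial>(M1 \<Otimes>\<^sub>M M2)) = (\<integral>x. a x \<partial>M1) * (\<integral>y. b y \<partial>M2)"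
    by (simp add: a b)
qed

definition tensor_fun :: "nat \<Rightarrow> nat \<Rightarrow> (conf \<Rightarrow> complex) \<Rightarrow> (conf \<Rightarrow> complex) \<Rightarrow> conf \<Rightarrow> complex" where
  "tensor_fun k j f g = (\<lambda>x. f (restrict x {..<k}) * g (\<lambda>i\<in>{..<j - k}. x (k + i)))"

lemma tensor_fun_glue:
  assumes "k \<le> j" "p \<in> space (leb k \<Otimes>\<^sub>M leb (j - k))"
  shows "tensor_fun k j f g (glue k j p) = f (fst p) * g (snd p)"
proof -
  have "restrict (glue k j p) {..<k} = fst p"
  proof
    fix i show "restrict (glue k j p) {..<k} i = fst p i"
      using assms by (auto simp: glue_def restrict_def space_pair_measure space_leb PiE_def extensional_def)
  qed
  moreover have "(\<lambda>i\<in>{..<j - k}. glue k j p (k + i)) = snd p"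
  proof
    fix i show "(\<lambda>i\<in>{..<j - k}. glue k j p (k + i)) i = snd p i"
      using assms by (auto simp: glue_def restrict_def space_pair_measure space_leb PiE_def extensional_def)
  qed
  ultimately show ?thesis by (simp add: tensor_fun_def)
qed

lemma measurable_tensor_fun:
  assumes "k \<le> j" and f: "f \<in> borel_measurable (leb k)" and g: "g \<in> borel_measurable (leb (j - k))"
  shows "tensor_fun k j f g \<in> borel_measurable (leb j)"
proof -
  have "(\<lambda>x. restrict x {..<k}) \<in> measurable (leb j) (leb k)"
    unfolding leb_def using assms(1) by (intro measurable_restrict_subset) auto
  from measurable_compose[OF this f] have 1: "(\<lambda>x. f (restrict x {..<k})) \<in> borel_measurable (leb j)" .
  have "(\<lambda>x. \<lambda>i\<in>{..<j - k}. x (k + i)) \<in> measurable (leb j) (leb (j - k))"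
    unfolding leb_def by (intro measurable_restrict measurable_component_singleton) auto
  from measurable_compose[OF this g] have 2: "(\<lambda>x. g (\<lambda>i\<in>{..<j - k}. x (k + i))) \<in> borel_measurable (leb j)" .
  show ?thesis unfolding tensor_fun_def using 1 2 by (rule borel_measurable_times)
qed

lemma pair_leb: "pair_sigma_finite (leb k) (leb l)"
  by (intro pair_sigma_finite.intro leb_sigma_finite)

lemma tensor_fun_l2:
  assumes kj: "k \<le> j" and f: "f \<in> l2_fun (leb k)" and g: "g \<in> l2_fun (leb (j - k))"
  shows "tensor_fun k j f g \<in> l2_fun (leb j)"
proof -
  interpret pair_sigma_finite "leb k" "leb (j - k)" by (rule pair_leb)
  have m: "tensor_fun k j f g \<in> borel_measurable (leb j)"
    using kj l2_funD(1)[OF f] l2_funD(1)[OF g] by (rule measurable_tensor_fun)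
  have "integrable (leb k \<Otimes>\<^sub>M leb (j - k)) (\<lambda>p. (cmod (f (fst p)))\<^sup>2 * (cmod (g (snd p)))\<^sup>2)"
    by (rule integral_product_function(1)[OF l2_funD(2)[OF f] l2_funD(2)[OF g]])
  then have "integrable (leb k \<Otimes>\<^sub>M leb (j - k)) (\<lambda>p. (cmod (tensor_fun k j f g (glue k j p)))\<^sup>2)"
    by (rule Bochner_Integration.integrable_cong[THEN iffD1, OF refl, rotated])
      (simp add: tensor_fun_glue[OF kj] norm_mult power_mult_distrib)
  then have "integrable (distr (leb k \<Otimes>\<^sub>M leb (j - k)) (leb j) (glue k j)) (\<lambda>x. (cmod (tensor_fun k j f g x))\<^sup>2)"
    using m kj by (subst integrable_distr_eq) measurable
  then show ?thesis using m by (simp add: distr_glue[OF kj] l2_fun_def)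
qed

lemma cinner_tensor_fun:
  assumes kj: "k \<le> j" and f: "f \<in> l2_fun (leb k)" "f' \<in> l2_fun (leb k)"
    and g: "g \<in> l2_fun (leb (j - k))" "g' \<in> l2_fun (leb (j - k))"
  shows "cinner (vec (leb j) (tensor_fun k j f g)) (vec (leb j) (tensor_fun k j f' g'))
    = cinner (vec (leb k) f) (vec (leb k) f') * cinner (vec (leb (j - k)) g) (vec (leb (j - k)) g')"
proof -
  interpret pair_sigma_finite "leb k" "leb (j - k)" by (rule pair_leb)
  let ?F = "\<lambda>x. cnj (tensor_fun k j f g x) * tensor_fun k j f' g' x"
  have [measurable]: "tensor_fun k j f g \<in> borel_measurable (leb j)" "tensor_fun k j f' g' \<in> borel_measurable (leb j)"
    using tensor_fun_l2[OF kj] f g l2_funD by blast+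
  have "(\<integral>x. ?F x \<partial>leb j) = (\<integral>p. ?F (glue k j p) \<partial>(leb k \<Otimes>\<^sub>M leb (j - k)))"
    using kj by (subst distr_glue[OF kj, symmetric], subst integral_distr) measurable
  also have "\<dots> = (\<integral>p. (cnj (f (fst p)) * f' (fst p)) * (cnj (g (snd p)) * g' (snd p)) \<partial>(leb k \<Otimes>\<^sub>M leb (j - k)))"
    by (intro Bochner_Integration.integral_cong refl) (simp add: tensor_fun_glue[OF kj])
  also have "\<dots> = (\<integral>x. cnj (f x) * f' x \<partial>leb k) * (\<integral>y. cnj (g y) * g' y \<partial>leb (j - k))"
    by (rule integral_product_function(2)) (intro integrable_l2_prod f g)+
  finally show ?thesis using f g by (simp add: cinner_vec tensor_fun_l2[OF kj])
qed

section \<open>Tensor products in the ambient space\<close>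

definition pre :: "'a measure \<Rightarrow> 'a hs \<Rightarrow> 'a l2" where
  "pre M x = (SOME a. a \<in> L2 M \<and> emb M a = x)"

lemma pre: assumes "x \<in> VV M" shows "pre M x \<in> L2 M" "emb M (pre M x) = x"
proof -
  have "\<exists>a. a \<in> L2 M \<and> emb M a = x" using VV_emb[OF assms] by blast
  from someI_ex[OF this] show "pre M x \<in> L2 M" "emb M (pre M x) = x" by (simp_all add: pre_def)
qed

lemma pre_emb: "a \<in> L2 M \<Longrightarrow> pre M (emb M a) = a"
  by (metis emb_eq_iff emb_in_VV pre)

text \<open>Defined through preimages under \<open>emb\<close>, so that it matches
  \<open>l2_tensor\<close> by construction. Its linearity in the first argument is not computed on
  representatives but read off from inner products.\<close>

definition tens :: "nat \<Rightarrow> nat \<Rightarrow> conf hs \<Rightarrow> conf hs \<Rightarrow> conf hs" where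
  "tens k j x y = emb (leb j) (l2_tensor k j (pre (leb k) x) (pre (leb (j - k)) y))"

lemma l2_tensor:
  assumes kj: "k \<le> j" and ab: "a \<in> L2 (leb k)" "b \<in> L2 (leb (j - k))"
  shows "l2_tensor k j a b \<in> L2 (leb j)"
    "emb (leb j) (l2_tensor k j a b) = vec (leb j) (tensor_fun k j (l2_rep a) (l2_rep b))"
    "emb (leb j) (l2_tensor k j a b) = tens k j (emb (leb k) a) (emb (leb (j - k)) b)"
proof -
  have eq: "l2_tensor k j a b = l2_class (leb j) (tensor_fun k j (l2_rep a) (l2_rep b))"
    by (simp add: l2_tensor_def tensor_fun_def)
  have l2: "tensor_fun k j (l2_rep a) (l2_rep b) \<in> l2_fun (leb j)" using ab by (intro tensor_fun_l2 kj l2_rep_in)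
  show "l2_tensor k j a b \<in> L2 (leb j)"
    "emb (leb j) (l2_tensor k j a b) = vec (leb j) (tensor_fun k j (l2_rep a) (l2_rep b))"
    using l2 by (simp_all add: eq)
  show "emb (leb j) (l2_tensor k j a b) = tens k j (emb (leb k) a) (emb (leb (j - k)) b)"
    using ab by (simp add: tens_def pre_emb)
qed

lemma tens_vec:
  assumes kj: "k \<le> j" and x: "x \<in> VV (leb k)" and y: "y \<in> VV (leb (j - k))"
  shows "\<exists>f g. f \<in> l2_fun (leb k) \<and> g \<in> l2_fun (leb (j - k)) \<and> x = vec (leb k) f \<and> y = vec (leb (j - k)) g \<and>
    tens k j x y = vec (leb j) (tensor_fun k j f g)"
  using l2_tensor(2)[OF kj pre(1)[OF x] pre(1)[OF y]] pre[OF x] pre[OF y] l2_rep_in(1)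
  unfolding tens_def emb_def by metis

lemma tens_in_VV:
  "k \<le> j \<Longrightarrow> x \<in> VV (leb k) \<Longrightarrow> y \<in> VV (leb (j - k)) \<Longrightarrow> tens k j x y \<in> VV (leb j)"
  using tens_vec tensor_fun_l2 vec_in_VV by metis

lemma cinner_tens:
  assumes kj: "k \<le> j" and x: "x \<in> VV (leb k)" "x' \<in> VV (leb k)" and y: "y \<in> VV (leb (j - k))" "y' \<in> VV (leb (j - k))"
  shows "cinner (tens k j x y) (tens k j x' y') = cinner x x' * cinner y y'"
proof -
  obtain f g where fg: "f \<in> l2_fun (leb k)" "g \<in> l2_fun (leb (j - k))" "x = vec (leb k) f" "y = vec (leb (j - k)) g"
    "tens k j x y = vec (leb j) (tensor_fun k j f g)" using tens_vec[OF kj x(1) y(1)] by blast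
  obtain f' g' where fg': "f' \<in> l2_fun (leb k)" "g' \<in> l2_fun (leb (j - k))" "x' = vec (leb k) f'" "y' = vec (leb (j - k)) g'"
    "tens k j x' y' = vec (leb j) (tensor_fun k j f' g')" using tens_vec[OF kj x(2) y(2)] by blast
  show ?thesis unfolding fg(5) fg'(5) using cinner_tensor_fun[OF kj fg(1) fg'(1) fg(2) fg'(2)] fg fg' by simp
qed

text \<open>The left-hand side is the expansion of \<parallel>u - w\<parallel>^2. As inner products
  of tensors factorise, identities between tensors become algebra of complex numbers.\<close>

lemma eq_if_cinner: "cinner u u - cinner u w - cinner w u + cinner w w = 0 \<Longrightarrow> u = w"
proof -
  assume "cinner u u - cinner u w - cinner w u + cinner w w = 0"
  then have "Re (cinner u u - cinner u w - cinner w u + cinner w w) = 0" by simp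
  then have "(u - w) \<bullet> (u - w) = 0" by (simp add: inner_diff_left inner_diff_right)
  then show "u = w" by simp
qed

lemma tens_add:
  assumes kj: "k \<le> j" and x: "x \<in> VV (leb k)" "x' \<in> VV (leb k)" and y: "y \<in> VV (leb (j - k))"
  shows "tens k j (x + x') y = tens k j x y + tens k j x' y"
  using x y VV.V_intros(2)[OF x]
  by (intro eq_if_cinner) (simp add: cinner_add_left cinner_add_right cinner_tens[OF kj] algebra_simps)

lemma tens_scaleC:
  assumes kj: "k \<le> j" and x: "x \<in> VV (leb k)" and y: "y \<in> VV (leb (j - k))"
  shows "tens k j (scaleC c x) y = scaleC c (tens k j x y)"
  using x y scaleC_in_VV[OF x]
  by (intro eq_if_cinner) (simp add: cinner_scaleC_left cinner_scaleC_right cinner_tens[OF kj] algebra_simps)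

lemma norm_tens:
  assumes "k \<le> j" "x \<in> VV (leb k)" "y \<in> VV (leb (j - k))"
  shows "norm (tens k j x y) = norm x * norm y"
proof -
  have "complex_of_real ((norm (tens k j x y))\<^sup>2) = complex_of_real ((norm x * norm y)\<^sup>2)"
    unfolding cinner_self[symmetric] using assms by (simp add: cinner_tens) (simp add: cinner_self power_mult_distrib)
  then have "(norm (tens k j x y))\<^sup>2 = (norm x * norm y)\<^sup>2" by (simp only: of_real_eq_iff)
  then show ?thesis by (rule power2_eq_imp_eq) simp_all
qed

lemma conf_box_tensor:
  assumes kj: "k \<le> j" and x: "x \<in> space (leb j)"
  shows "indicator (PiE {..<j} A) x
    = tensor_fun k j (indicator (PiE {..<k} A)) (indicator (PiE {..<j - k} (\<lambda>i. A (k + i)))) x"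
proof -
  have "x \<in> PiE {..<j} A \<longleftrightarrow> (\<forall>i<k. x i \<in> A i) \<and> (\<forall>i<j - k. x (k + i) \<in> A (k + i))"
  proof -
    have "x \<in> PiE {..<j} A \<longleftrightarrow> (\<forall>i<j. x i \<in> A i)" using x by (auto simp: space_leb PiE_def)
    also have "\<dots> \<longleftrightarrow> (\<forall>i<k. x i \<in> A i) \<and> (\<forall>i<j - k. x (k + i) \<in> A (k + i))"
    proof (intro iffI conjI allI impI)
      fix i assume *: "(\<forall>i<k. x i \<in> A i) \<and> (\<forall>i<j - k. x (k + i) \<in> A (k + i))" "i < j"
      show "x i \<in> A i"
      proof (cases "i < k")
        case False
        then have "i = k + (i - k)" "i - k < j - k" using * by auto
        then show ?thesis using * by metis
      qed (use * in auto)
    qed (use kj in auto)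
    finally show ?thesis .
  qed
  moreover have "restrict x {..<k} \<in> PiE {..<k} A \<longleftrightarrow> (\<forall>i<k. x i \<in> A i)"
    by (auto simp: PiE_def Pi_def)
  moreover have "(\<lambda>i\<in>{..<j - k}. x (k + i)) \<in> PiE {..<j - k} (\<lambda>i. A (k + i)) \<longleftrightarrow> (\<forall>i<j - k. x (k + i) \<in> A (k + i))"
    by (auto simp: PiE_def Pi_def)
  ultimately show ?thesis by (simp add: tensor_fun_def indicator_def)
qed

lemma conf_box_l2: "A \<in> conf_boxes k \<Longrightarrow> (\<lambda>x. indicator A x) \<in> l2_fun (leb k)"
  by (intro l2_fun_indicator emeasure_conf_box) (auto simp: sets_leb)

text \<open>The indicator of a box in j variables is a tensor product of two box indicators, so a
  vector orthogonal to all products has vanishing integral over every box, and boxes are total.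
  Rotating the first factor by \<open>ii\<close> turns real into complex orthogonality.\<close>

lemma total_tens:
  assumes kj: "k \<le> j" and v: "v \<in> VV (leb j)"
    and o: "\<And>x y. x \<in> VV (leb k) \<Longrightarrow> y \<in> VV (leb (j - k)) \<Longrightarrow> v \<bullet> tens k j x y = 0"
  shows "v = 0"
proof -
  have o': "cinner (tens k j x y) v = 0" if x: "x \<in> VV (leb k)" "y \<in> VV (leb (j - k))" for x y
  proof -
    have "tens k j (ii x) y = ii (tens k j x y)" using tens_scaleC[OF kj x, of \<i>] by (simp only: scaleC_i)
    then have "v \<bullet> ii (tens k j x y) = 0" using o[OF ii_in_VV[OF x(1)] x(2)] by simp
    then show ?thesis using o[OF x] by (simp add: cinner_def complex_eq_iff inner_commute)
  qed
  obtain h where h: "h \<in> l2_fun (leb j)" "v = vec (leb j) h" using v by (auto simp: VV_def)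
  have "AE x in leb j. h x = 0"
  proof (rule total_conf_boxes[OF h(1)])
    fix X assume X: "X \<in> conf_boxes j"
    then obtain A where A: "X = PiE {..<j} A" "\<forall>i<j. A i \<in> rat_boxes" by (metis conf_boxesE)
    let ?f = "\<lambda>x. indicator (PiE {..<k} A) x :: complex" and ?g = "\<lambda>x. indicator (PiE {..<j - k} (\<lambda>i. A (k + i))) x :: complex"
    have fg: "?f \<in> l2_fun (leb k)" "?g \<in> l2_fun (leb (j - k))"
      using A(2) kj by (auto intro!: conf_box_l2 conf_boxesI)
    note t = tensor_fun_l2[OF kj fg]
    have "tens k j (vec (leb k) ?f) (vec (leb (j - k)) ?g) = vec (leb j) (tensor_fun k j ?f ?g)"
    proof -
      let ?a = "l2_class (leb k) ?f" and ?b = "l2_class (leb (j - k)) ?g"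
      obtain f g where *: "f \<in> l2_fun (leb k)" "g \<in> l2_fun (leb (j - k))" "vec (leb k) ?f = vec (leb k) f"
        "vec (leb (j - k)) ?g = vec (leb (j - k)) g"
        "tens k j (vec (leb k) ?f) (vec (leb (j - k)) ?g) = vec (leb j) (tensor_fun k j f g)"
        using tens_vec[OF kj vec_in_VV[OF fg(1)] vec_in_VV[OF fg(2)]] by blast
      show ?thesis
        unfolding *(5)
        by (rule eq_if_cinner)
          (simp add: cinner_tensor_fun[OF kj *(1) *(1) *(2) *(2)] cinner_tensor_fun[OF kj *(1) fg(1) *(2) fg(2)]
            cinner_tensor_fun[OF kj fg(1) *(1) fg(2) *(2)] cinner_tensor_fun[OF kj fg(1) fg(1) fg(2) fg(2)] *(3,4))
    qed
    then have "0 = cinner (vec (leb j) (tensor_fun k j ?f ?g)) v" using o'[of "vec (leb k) ?f" "vec (leb (j - k)) ?g"] fg by simp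
    also have "\<dots> = (\<integral>x. cnj (tensor_fun k j ?f ?g x) * h x \<partial>leb j)" unfolding h(2) by (rule cinner_vec[OF t h(1)])
    also have "\<dots> = (\<integral>x. indicator X x * h x \<partial>leb j)"
      unfolding A(1) by (intro Bochner_Integration.integral_cong refl) (simp flip: conf_box_tensor[OF kj])
    finally show "(\<integral>x. indicator X x * h x \<partial>leb j) = 0" by simp
  qed
  then show "v = 0" using vec_eq_iff[OF h(1) l2_fun_zero] h(2) by (simp add: vec_zero)
qed

text \<open>A Schur product statement: for fixed y the values \<open>G a y\<close> serve as
  coefficients in the hypothesis, and integration over y turns the products cnj(G a y) G b y into
  the Gram matrix of \<open>g\<close>.\<close>

lemma positive_semidefinite_tensor:
  assumes M: "\<And>c :: 'i \<Rightarrow> complex. 0 \<le> Re (\<Sum>a\<in>I. \<Sum>b\<in>I. cnj (c a) * c b * m a b)"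
    and g: "\<And>a. a \<in> I \<Longrightarrow> g a \<in> VV N"
  shows "0 \<le> Re (\<Sum>a\<in>I. \<Sum>b\<in>I. m a b * cinner (g a) (g b))"
proof -
  have "\<forall>a\<in>I. \<exists>G. G \<in> l2_fun N \<and> g a = vec N G" using g by (auto simp: VV_def)
  then obtain G where G: "\<And>a. a \<in> I \<Longrightarrow> G a \<in> l2_fun N" "\<And>a. a \<in> I \<Longrightarrow> g a = vec N (G a)" by metis
  have i: "integrable N (\<lambda>y. cnj (G a y) * G b y * m a b)" if "a \<in> I" "b \<in> I" for a b
    using integrable_l2_prod[OF G(1)[OF that(1)] G(1)[OF that(2)]] by simp
  have "(\<Sum>a\<in>I. \<Sum>b\<in>I. m a b * cinner (g a) (g b)) = (\<Sum>a\<in>I. \<Sum>b\<in>I. \<integral>y. cnj (G a y) * G b y * m a b \<partial>N)"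
    using G by (intro sum.cong refl) (simp add: cinner_vec integrable_l2_prod mult.commute)
  also have "\<dots> = (\<integral>y. (\<Sum>a\<in>I. \<Sum>b\<in>I. cnj (G a y) * G b y * m a b) \<partial>N)"
    using i by (subst Bochner_Integration.integral_sum; (intro sum.cong refl Bochner_Integration.integral_sum[symmetric] Bochner_Integration.integrable_sum)?) auto
  finally have "Re (\<Sum>a\<in>I. \<Sum>b\<in>I. m a b * cinner (g a) (g b))
      = (\<integral>y. Re (\<Sum>a\<in>I. \<Sum>b\<in>I. cnj (G a y) * G b y * m a b) \<partial>N)"
    using i by (simp only:) (intro integral_Re[symmetric] Bochner_Integration.integrable_sum)
  also have "\<dots> \<ge> 0" by (intro Bochner_Integration.integral_nonneg M)
  finally show ?thesis .
qed

lemma complete_VV_Times: "uniform_space_class.complete (VV M \<times> VV M)"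
  unfolding complete_def
proof (intro allI impI, elim conjE)
  fix f assume f: "\<forall>n. f n \<in> VV M \<times> VV M" and C: "Cauchy f"
  have "fst (f n) \<in> VV M" "snd (f n) \<in> VV M" for n using f by (auto simp: mem_Times_iff)
  then obtain a b where "a \<in> VV M" "(\<lambda>n. fst (f n)) \<longlonglongrightarrow> a" "b \<in> VV M" "(\<lambda>n. snd (f n)) \<longlonglongrightarrow> b"
    using VV.V_Cauchy[OF _ Cauchy_fst[OF C]] VV.V_Cauchy[OF _ Cauchy_snd[OF C]] by blast
  then show "\<exists>l\<in>VV M \<times> VV M. f \<longlonglongrightarrow> l"
    using tendsto_Pair[of "\<lambda>n. fst (f n)" a sequentially "\<lambda>n. snd (f n)" b] by (intro bexI[of _ "(a, b)"]) auto
qed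

lemma subspace_VV_Times: "subspace (VV M \<times> VV M)"
  unfolding subspace_def by (auto simp: zero_prod_def intro: VV.V_intros)

lemma tens_diff:
  assumes "k \<le> j" "x \<in> VV (leb k)" "x' \<in> VV (leb k)" "y \<in> VV (leb (j - k))"
  shows "tens k j (x - x') y = tens k j x y - tens k j x' y"
  using tens_add[OF assms(1) VV.V_intros(3)[OF assms(2,3)] assms(3,4)] by simp

lemma cinner_combination:
  "cinner (\<Sum>i\<in>I. scaleC (c i) (x i)) (\<Sum>i\<in>I. scaleC (c i) (y i))
    = (\<Sum>a\<in>I. \<Sum>b\<in>I. cnj (c a) * c b * cinner (x a) (y b))"
  unfolding cinner_sum_left cinner_sum_right cinner_scaleC_left cinner_scaleC_right
  by (subst sum.swap) (simp add: mult.commute mult.left_commute sum_distrib_left)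

lemma cinner_tens_sums:
  assumes "k \<le> j" "\<And>i. i \<in> I \<Longrightarrow> x i \<in> VV (leb k)" "\<And>i. i \<in> I \<Longrightarrow> y i \<in> VV (leb k)" "\<And>i. i \<in> I \<Longrightarrow> g i \<in> VV (leb (j - k))"
  shows "cinner (\<Sum>i\<in>I. tens k j (x i) (g i)) (\<Sum>i\<in>I. tens k j (y i) (g i))
    = (\<Sum>a\<in>I. \<Sum>b\<in>I. cinner (x a) (y b) * cinner (g a) (g b))"
  unfolding cinner_sum_left cinner_sum_right by (subst sum.swap) (simp add: assms cinner_tens)

text \<open>The inner product is the sum of all entries of the Schur product of the matrix
  \<open>cinner (x a) (y b)\<close> with the Gram matrix of \<open>g\<close>. This is how an
  inequality between operators survives tensoring with the identity.\<close>

lemma tens_sums_nonneg: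
  assumes kj: "k \<le> j" and V: "\<And>i. i \<in> I \<Longrightarrow> x i \<in> VV (leb k)" "\<And>i. i \<in> I \<Longrightarrow> y i \<in> VV (leb k)" "\<And>i. i \<in> I \<Longrightarrow> g i \<in> VV (leb (j - k))"
    and nn: "\<And>c. 0 \<le> (\<Sum>i\<in>I. scaleC (c i) (x i)) \<bullet> (\<Sum>i\<in>I. scaleC (c i) (y i))"
  shows "0 \<le> (\<Sum>i\<in>I. tens k j (x i) (g i)) \<bullet> (\<Sum>i\<in>I. tens k j (y i) (g i))"
proof -
  have "0 \<le> Re (\<Sum>a\<in>I. \<Sum>b\<in>I. cinner (x a) (y b) * cinner (g a) (g b))"
    by (rule positive_semidefinite_tensor[OF _ V(3)]) (simp only: cinner_combination[symmetric] Re_cinner nn)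
  then have "0 \<le> Re (cinner (\<Sum>i\<in>I. tens k j (x i) (g i)) (\<Sum>i\<in>I. tens k j (y i) (g i)))"
    by (simp only: cinner_tens_sums[OF kj V])
  then show ?thesis by (simp only: Re_cinner)
qed

section \<open>The operator T \<otimes> Id\<close>

definition tensor_gens :: "nat \<Rightarrow> nat \<Rightarrow> (conf hs \<times> conf hs) set \<Rightarrow> (conf hs \<times> conf hs) set" where
  "tensor_gens k j T = {(tens k j f g, tens k j f' g) |f f' g. (f, f') \<in> T \<and> g \<in> VV (leb (j - k))}"

text \<open>The span is real, yet for \<open>T\<close> invariant under \<open>ii\<close> the result
  is complex linear, because the rotation can be moved into the first tensor factor.\<close>

definition tensor_graph :: "nat \<Rightarrow> nat \<Rightarrow> (conf hs \<times> conf hs) set \<Rightarrow> (conf hs \<times> conf hs) set" where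
  "tensor_graph k j T = closure (span (tensor_gens k j T))"

locale tensor_relation =
  fixes k j :: nat and T :: "(conf hs \<times> conf hs) set"
  assumes kj: "k \<le> j" and TV: "T \<subseteq> VV (leb k) \<times> VV (leb k)" and T_sub: "subspace T" and T_inv: "ii_invariant T"
begin

abbreviation "L \<equiv> VV (leb j)"
abbreviation "R \<equiv> VV (leb (j - k))"

lemma gensI: "(f, f') \<in> T \<Longrightarrow> g \<in> R \<Longrightarrow> (tens k j f g, tens k j f' g) \<in> span (tensor_gens k j T)"
  by (rule span_base) (auto simp: tensor_gens_def)

lemma TD: "(f, f') \<in> T \<Longrightarrow> f \<in> VV (leb k)" "(f, f') \<in> T \<Longrightarrow> f' \<in> VV (leb k)"
  using TV by auto

lemma span_sub: "span (tensor_gens k j T) \<subseteq> L \<times> L"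
  by (rule span_minimal[OF _ subspace_VV_Times]) (auto simp: tensor_gens_def tens_in_VV[OF kj] TD)

lemma graph_sub: "tensor_graph k j T \<subseteq> L \<times> L"
  unfolding tensor_graph_def using span_sub complete_imp_closed[OF complete_VV_Times] by (rule closure_minimal)

lemma graph_subspace: "subspace (tensor_graph k j T)"
  unfolding tensor_graph_def by (intro subspace_closure subspace_span)

lemma graph_complete: "uniform_space_class.complete (tensor_graph k j T)"
  using complete_Int_closed[OF complete_VV_Times[of "leb j"], of "tensor_graph k j T"] graph_sub
  by (simp add: tensor_graph_def Int_absorb1)

lemma span_inv: "(x, y) \<in> span (tensor_gens k j T) \<Longrightarrow> (ii x, ii y) \<in> span (tensor_gens k j T)"
proof -
  assume "(x, y) \<in> span (tensor_gens k j T)"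
  then have "(ii (fst (x, y)), ii (snd (x, y))) \<in> span (tensor_gens k j T)"
  proof (induction rule: span_induct_alt)
    case base then show ?case by (simp add: zero_prod_def[symmetric] span_zero)
  next
    case (step c p q)
    then obtain f f' g where p: "p = (tens k j f g, tens k j f' g)" "(f, f') \<in> T" "g \<in> R" by (auto simp: tensor_gens_def)
    have "(ii f, ii f') \<in> T" using T_inv p(2) by (simp add: ii_invariant_def)
    from gensI[OF this p(3)] have "(ii (fst p), ii (snd p)) \<in> span (tensor_gens k j T)"
      using tens_scaleC[OF kj TD(1)[OF p(2)] p(3), of \<i>] tens_scaleC[OF kj TD(2)[OF p(2)] p(3), of \<i>]
      by (simp add: p(1) scaleC_i)
    from span_add[OF span_scale[OF this, of c] step.IH] show ?case by (simp add: ii_add ii_scaleR)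
  qed
  then show ?thesis by simp
qed

lemma graph_seq:
  assumes "(x, y) \<in> tensor_graph k j T"
  shows "\<exists>f g. (\<forall>n::nat. (f n, g n) \<in> span (tensor_gens k j T)) \<and> f \<longlonglongrightarrow> x \<and> g \<longlonglongrightarrow> y"
proof -
  obtain p where "\<forall>n. p n \<in> span (tensor_gens k j T)" "p \<longlonglongrightarrow> (x, y)"
    using assms unfolding tensor_graph_def closure_sequential by blast
  then show ?thesis
    using tendsto_fst[of p "(x, y)"] tendsto_snd[of p "(x, y)"]
    by (intro exI[of _ "\<lambda>n. fst (p n)"] exI[of _ "\<lambda>n. snd (p n)"]) auto
qed

lemma graph_limit:
  assumes "\<And>n::nat. (f n, g n) \<in> tensor_graph k j T" "f \<longlonglongrightarrow> x" "g \<longlonglongrightarrow> y"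
  shows "(x, y) \<in> tensor_graph k j T"
  using closed_sequentially[OF complete_imp_closed[OF graph_complete], of "\<lambda>n. (f n, g n)"] assms(1) tendsto_Pair[OF assms(2,3)] by blast

lemma span_in_graph: "p \<in> span (tensor_gens k j T) \<Longrightarrow> p \<in> tensor_graph k j T"
  unfolding tensor_graph_def using closure_subset by blast

lemma graph_inv: "ii_invariant (tensor_graph k j T)"
  unfolding ii_invariant_def
proof (intro allI impI)
  fix x y assume "(x, y) \<in> tensor_graph k j T"
  then obtain f g where fg: "\<And>n::nat. (f n, g n) \<in> span (tensor_gens k j T)" "f \<longlonglongrightarrow> x" "g \<longlonglongrightarrow> y"
    using graph_seq by blast
  show "(ii x, ii y) \<in> tensor_graph k j T"
    by (rule graph_limit[of "\<lambda>n. ii (f n)" "\<lambda>n. ii (g n)", OF span_in_graph[OF span_inv[OF fg(1)]]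
          bounded_linear.tendsto[OF bounded_linear_ii fg(2)] bounded_linear.tendsto[OF bounded_linear_ii fg(3)]])
qed

lemma span_sums:
  assumes "p \<in> span (tensor_gens k j T)"
  shows "\<exists>(n::nat) f f' g. (\<forall>i<n. (f i, f' i) \<in> T \<and> g i \<in> R) \<and>
    p = (\<Sum>i<n. tens k j (f i) (g i), \<Sum>i<n. tens k j (f' i) (g i))"
  using assms
proof (induction rule: span_induct_alt)
  case base
  show ?case by (rule exI[of _ 0]) (simp add: zero_prod_def)
next
  case (step c p q)
  then obtain u u' v where p: "p = (tens k j u v, tens k j u' v)" "(u, u') \<in> T" "v \<in> R" by (auto simp: tensor_gens_def)
  obtain n f f' g where q: "\<forall>i<n::nat. (f i, f' i) \<in> T \<and> g i \<in> R"
    "q = (\<Sum>i<n. tens k j (f i) (g i), \<Sum>i<n. tens k j (f' i) (g i))" using step.IH by blast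
  have "c *\<^sub>R p = (tens k j (c *\<^sub>R u) v, tens k j (c *\<^sub>R u') v)"
    using tens_scaleC[OF kj TD(1)[OF p(2)] p(3), of "complex_of_real c"] tens_scaleC[OF kj TD(2)[OF p(2)] p(3), of "complex_of_real c"]
    by (simp add: p(1) scaleC_of_real)
  then have "c *\<^sub>R p + q = (\<Sum>i<Suc n. tens k j ((f(n := c *\<^sub>R u)) i) ((g(n := v)) i), \<Sum>i<Suc n. tens k j ((f'(n := c *\<^sub>R u')) i) ((g(n := v)) i))"
    unfolding q(2) by (simp add: add.commute)
  moreover have "\<forall>i<Suc n. ((f(n := c *\<^sub>R u)) i, (f'(n := c *\<^sub>R u')) i) \<in> T \<and> (g(n := v)) i \<in> R"
    using q(1) p(2,3) VV.graph_scale[OF T_sub p(2)] by (auto simp: less_Suc_eq)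
  ultimately show ?case by blast
qed

text \<open>The hull is the intersection of all closed linear graphs above the generators. The
  closed real span is one of them, and each of them, once lifted, is a closed real subspace and so
  contains that span.\<close>

lemma tensor_id_eq:
  assumes Q: "linear_graph (leb k) Q" "lift_graph (leb k) Q = T"
  shows "tensor_id k j Q = pull_graph (leb j) (tensor_graph k j T)"
proof -
  let ?S = "{(l2_tensor k j f g, l2_tensor k j f' g) | f f' g. (f, f') \<in> Q \<and> g \<in> L2 (leb (j - k))}"
  let ?P = "\<lambda>G. linear_graph (leb j) G \<and> closed_graph (leb j) G"
  have QL: "f \<in> L2 (leb k)" "f' \<in> L2 (leb k)" if "(f, f') \<in> Q" for f f' using Q(1) that by (auto simp: linear_graph_def)
  have "?P (pull_graph (leb j) (tensor_graph k j T))"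
    by (intro conjI linear_graph_pull closed_graph_pull graph_subspace graph_inv complete_imp_closed graph_complete)
  moreover have "?S \<subseteq> pull_graph (leb j) (tensor_graph k j T)"
  proof clarify
    fix f f' g assume f: "(f, f') \<in> Q" and g: "g \<in> L2 (leb (j - k))"
    have "(emb (leb k) f, emb (leb k) f') \<in> T" using f Q(2) by (auto simp: lift_graph_def)
    from span_in_graph[OF gensI[OF this, of "emb (leb (j - k)) g"]] g
    show "(l2_tensor k j f g, l2_tensor k j f' g) \<in> pull_graph (leb j) (tensor_graph k j T)"
      using l2_tensor[OF kj QL(1)[OF f] g] l2_tensor[OF kj QL(2)[OF f] g] by (simp add: pull_graph_def)
  qed
  ultimately have "tensor_id k j Q \<subseteq> pull_graph (leb j) (tensor_graph k j T)"
    unfolding tensor_id_def by (intro hull_minimal)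
  moreover have "pull_graph (leb j) (tensor_graph k j T) \<subseteq> G" if G: "?P G" "?S \<subseteq> G" for G
  proof -
    have sub: "G \<subseteq> L2 (leb j) \<times> L2 (leb j)" using G(1) by (simp add: linear_graph_def)
    have "tensor_gens k j T \<subseteq> lift_graph (leb j) G"
      unfolding tensor_gens_def
    proof clarify
      fix f f' g assume f: "(f, f') \<in> T" and g: "g \<in> R"
      from f Q(2) obtain a a' where a: "(a, a') \<in> Q" "f = emb (leb k) a" "f' = emb (leb k) a'" unfolding lift_graph_def by blast
      obtain b where b: "b \<in> L2 (leb (j - k))" "g = emb (leb (j - k)) b" using VV_emb[OF g] by blast
      have "(l2_tensor k j a b, l2_tensor k j a' b) \<in> G" using G(2) a(1) b(1) by blast
      then have "(emb (leb j) (l2_tensor k j a b), emb (leb j) (l2_tensor k j a' b)) \<in> lift_graph (leb j) G"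
        unfolding lift_graph_def by blast
      then show "(tens k j f g, tens k j f' g) \<in> lift_graph (leb j) G"
        using l2_tensor(3)[OF kj QL(1)[OF a(1)] b(1)] l2_tensor(3)[OF kj QL(2)[OF a(1)] b(1)] a b by simp
    qed
    then have "tensor_graph k j T \<subseteq> lift_graph (leb j) G"
      unfolding tensor_graph_def using G sub
      by (intro closure_minimal span_minimal subspace_lift_graph closed_lift_graph) auto
    then have "pull_graph (leb j) (tensor_graph k j T) \<subseteq> pull_graph (leb j) (lift_graph (leb j) G)"
      by (auto simp: pull_graph_def)
    then show ?thesis by (simp add: pull_lift[OF sub])
  qed
  then have "pull_graph (leb j) (tensor_graph k j T) \<subseteq> tensor_id k j Q"
    unfolding tensor_id_def hull_def by blast
  ultimately show ?thesis by blast
qed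

lemma combination_in_T:
  assumes "\<And>i. i < n \<Longrightarrow> (f i, f' i) \<in> T"
  shows "(\<Sum>i<n. scaleC (c i) (f i), \<Sum>i<n. scaleC (c i) (f' i)) \<in> T"
proof -
  have "(\<Sum>i<n. (scaleC (c i) (f i), scaleC (c i) (f' i))) \<in> T"
    using assms by (intro subspace_sum[OF T_sub] graph_scaleC[OF T_sub T_inv]) auto
  then show ?thesis by (simp add: sum_prod)
qed

text \<open>
  The range of \<open>1 + T \<otimes> Id\<close> is closed, and it contains all \<open>u \<otimes> g\<close> because \<open>1 + T\<close> is onto;
  hence it is everything, which makes the symmetric relation \<open>T \<otimes> Id\<close> self-adjoint.
\<close>

lemma nnsa_tensor_graph:
  assumes T: "VV.nnsa (leb k) T" shows "VV.nnsa (leb j) (tensor_graph k j T)"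
proof -
  have nn_span: "0 \<le> x \<bullet> y" if xy: "(x, y) \<in> span (tensor_gens k j T)" for x y
  proof -
    obtain n f f' g where s: "\<forall>i<n::nat. (f i, f' i) \<in> T \<and> g i \<in> R"
      "x = (\<Sum>i<n. tens k j (f i) (g i))" "y = (\<Sum>i<n. tens k j (f' i) (g i))" using span_sums[OF xy] by blast
    show ?thesis unfolding s(2,3)
      using s(1) TD by (intro tens_sums_nonneg[OF kj] VV.nnsa_nonneg[OF T] combination_in_T) auto
  qed
  have nonneg: "0 \<le> x \<bullet> y" if xy: "(x, y) \<in> tensor_graph k j T" for x y
  proof -
    obtain f g where fg: "\<And>n::nat. (f n, g n) \<in> span (tensor_gens k j T)" "f \<longlonglongrightarrow> x" "g \<longlonglongrightarrow> y"
      using graph_seq[OF xy] by blast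
    show ?thesis by (rule LIMSEQ_le_const[OF tendsto_inner[OF fg(2,3)]]) (use nn_span[OF fg(1)] in blast)
  qed
  \<comment> \<open>Inner products of tensors are products of complex numbers, so symmetry has to
    hold for \<open>cinner\<close> and not just for its real part; invariance under
    \<open>ii\<close> provides it.\<close>
  have csym: "cinner f h' = cinner f' h" if "(f, f') \<in> T" "(h, h') \<in> T" for f f' h h'
  proof -
    have "(ii f, ii f') \<in> T" using T_inv that by (simp add: ii_invariant_def)
    then show ?thesis using VV.nnsa_symmetric[OF T] that by (simp add: cinner_def)
  qed
  have sym_gen: "u \<bullet> y = v \<bullet> x" if uv: "(u, v) \<in> tensor_gens k j T" and xy: "(x, y) \<in> tensor_gens k j T" for u v x y
  proof -
    obtain f f' g where 1: "u = tens k j f g" "v = tens k j f' g" "(f, f') \<in> T" "g \<in> R" using uv by (auto simp: tensor_gens_def)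
    obtain h h' e where 2: "x = tens k j h e" "y = tens k j h' e" "(h, h') \<in> T" "e \<in> R" using xy by (auto simp: tensor_gens_def)
    have "cinner u y = cinner v x"
      using 1 2 TD by (simp add: cinner_tens[OF kj] csym[OF 1(3) 2(3)])
    then show ?thesis by (metis Re_cinner)
  qed
  have sym_span1: "u \<bullet> y = v \<bullet> x" if uv: "(u, v) \<in> tensor_gens k j T" and xy: "(x, y) \<in> span (tensor_gens k j T)" for u v x y
  proof -
    from xy have "u \<bullet> snd (x, y) = v \<bullet> fst (x, y)"
    proof (induction rule: span_induct_alt)
      case (step c p q)
      then have "u \<bullet> snd p = v \<bullet> fst p" using sym_gen[OF uv, of "fst p" "snd p"] by simp
      with step.IH show ?case by (simp add: inner_add_right)
    qed simp
    then show ?thesis by simp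
  qed
  have sym_span: "u \<bullet> y = v \<bullet> x" if uv: "(u, v) \<in> span (tensor_gens k j T)" and xy: "(x, y) \<in> span (tensor_gens k j T)" for u v x y
  proof -
    from uv have "fst (u, v) \<bullet> y = snd (u, v) \<bullet> x"
    proof (induction rule: span_induct_alt)
      case (step c p q)
      then have "fst p \<bullet> y = snd p \<bullet> x" using sym_span1[OF _ xy, of "fst p" "snd p"] by simp
      with step.IH show ?case by (simp add: inner_add_left)
    qed simp
    then show ?thesis by simp
  qed
  have sym: "u \<bullet> y = v \<bullet> x" if uv: "(u, v) \<in> tensor_graph k j T" and xy: "(x, y) \<in> tensor_graph k j T" for u v x y
  proof -
    obtain f g where fg: "\<And>n::nat. (f n, g n) \<in> span (tensor_gens k j T)" "f \<longlonglongrightarrow> u" "g \<longlonglongrightarrow> v"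
      using graph_seq[OF uv] by blast
    obtain f' g' where fg': "\<And>n::nat. (f' n, g' n) \<in> span (tensor_gens k j T)" "f' \<longlonglongrightarrow> x" "g' \<longlonglongrightarrow> y"
      using graph_seq[OF xy] by blast
    have "(\<lambda>n. f n \<bullet> g' n) \<longlonglongrightarrow> u \<bullet> y" "(\<lambda>n. g n \<bullet> f' n) \<longlonglongrightarrow> v \<bullet> x" by (intro tendsto_inner fg fg')+
    moreover have "(\<lambda>n. f n \<bullet> g' n) = (\<lambda>n. g n \<bullet> f' n)" using sym_span[OF fg(1) fg'(1)] by blast
    ultimately show ?thesis using LIMSEQ_unique by metis
  qed
  have sumT: "\<exists>f f'. (f, f') \<in> T \<and> f + f' = u" if "u \<in> VV (leb k)" for u
    using VV.res_mem[OF T, of u] that by (intro exI[of _ "VV.res (leb k) T u"] exI[of _ "u - VV.res (leb k) T u"]) simp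
  show ?thesis
  proof (rule VV.nnsaI[OF graph_sub graph_subspace nonneg sym])
    show "\<exists>x y. (x, y) \<in> tensor_graph k j T \<and> x + y = h" if h: "h \<in> L" for h
    proof (rule VV.sum_range[OF graph_subspace graph_complete graph_sub nonneg _ h])
      fix h assume h: "h \<in> L" and o: "\<And>x y. (x, y) \<in> tensor_graph k j T \<Longrightarrow> h \<bullet> (x + y) = 0"
      show "h = 0"
      proof (rule total_tens[OF kj h])
        fix u g assume u: "u \<in> VV (leb k)" and g: "g \<in> R"
        obtain f f' where f: "(f, f') \<in> T" "f + f' = u" using sumT[OF u] by blast
        show "h \<bullet> tens k j u g = 0"
          using o[OF span_in_graph[OF gensI[OF f(1) g]]] tens_add[OF kj TD(1)[OF f(1)] TD(2)[OF f(1)] g] f(2) by simp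
      qed
    qed
    show "L \<subseteq> closure (Domain (tensor_graph k j T))"
    proof (rule VV.dense_if_trivial_complement)
      show "Domain (tensor_graph k j T) \<subseteq> L" using graph_sub by blast
      have "Domain (tensor_graph k j T) = fst ` tensor_graph k j T" by (rule Domain_fst)
      then show "subspace (Domain (tensor_graph k j T))"
        using linear_subspace_image[OF _ graph_subspace, of fst] bounded_linear.linear[OF bounded_linear_fst] by simp
      fix h assume h: "h \<in> L" and o: "\<And>d. d \<in> Domain (tensor_graph k j T) \<Longrightarrow> h \<bullet> d = 0"
      show "h = 0"
      proof (rule total_tens[OF kj h])
        fix u g assume u: "u \<in> VV (leb k)" and g: "g \<in> R"
        then obtain f where f: "\<And>n::nat. f n \<in> Domain T" "f \<longlonglongrightarrow> u" using VV.nnsa_dense[OF T] closure_sequential by blast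
        have fV: "f n \<in> VV (leb k)" for n using f(1)[of n] TV by blast
        have z: "h \<bullet> tens k j (f n) g = 0" for n
        proof -
          obtain f' where "(f n, f') \<in> T" using f(1)[of n] by blast
          from span_in_graph[OF gensI[OF this g]] show ?thesis by (intro o) blast
        qed
        have "(\<lambda>n. norm (f n - u) * norm g) \<longlonglongrightarrow> 0 * norm g"
          using f(2) by (intro tendsto_mult tendsto_const) (simp add: LIM_zero tendsto_norm_zero)
        then have "(\<lambda>n. norm (tens k j (f n) g - tens k j u g)) \<longlonglongrightarrow> 0"
          using tens_diff[OF kj fV u g] norm_tens[OF kj VV.V_intros(3)[OF fV u] g] by simp
        then have "(\<lambda>n. tens k j (f n) g) \<longlonglongrightarrow> tens k j u g" using LIM_zero_cancel tendsto_norm_zero_iff by blast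
        from tendsto_inner[OF tendsto_const this, of h] have "(\<lambda>n::nat. 0) \<longlonglongrightarrow> h \<bullet> tens k j u g" by (simp only: z)
        from LIMSEQ_unique[OF this tendsto_const] show "h \<bullet> tens k j u g = 0" .
      qed
    qed
  qed
qed

end

lemma tensor_relation_lift:
  assumes "k \<le> j" "linear_graph (leb k) Q" shows "tensor_relation k j (lift_graph (leb k) Q)"
proof
  show "lift_graph (leb k) Q \<subseteq> VV (leb k) \<times> VV (leb k)"
    using assms(2) by (intro lift_graph_sub) (simp add: linear_graph_def)
qed (intro assms subspace_lift_graph linear_graph_ii_invariant)+

lemma tensor_id_nonneg_selfadjoint:
  assumes kj: "k \<le> j" and Q: "nonneg_selfadjoint_op (leb k) Q"
  shows "nonneg_selfadjoint_op (leb j) (tensor_id k j Q)"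
    "lift_graph (leb j) (tensor_id k j Q) = tensor_graph k j (lift_graph (leb k) Q)"
proof -
  have lin: "linear_graph (leb k) Q" using Q by (simp add: nonneg_selfadjoint_op_def selfadjoint_op_def l2_operator_def)
  interpret tensor_relation k j "lift_graph (leb k) Q" by (rule tensor_relation_lift[OF kj lin])
  have eq: "tensor_id k j Q = pull_graph (leb j) (tensor_graph k j (lift_graph (leb k) Q))"
    by (rule tensor_id_eq[OF lin refl])
  show "nonneg_selfadjoint_op (leb j) (tensor_id k j Q)" "lift_graph (leb j) (tensor_id k j Q) = tensor_graph k j (lift_graph (leb k) Q)"
    unfolding eq by (rule nnsa_pull[OF nnsa_tensor_graph[OF nnsa_lift(2)[OF Q]] graph_inv])+
qed

text \<open>With C a bound of A, the matrix C^2 \<langle>f_a, f_b\<rangle> - \<langle>A f_a, A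
  f_b\<rangle> is positive semidefinite, so the Schur product argument bounds A \<otimes> Id by C on
  finite tensor sums. The bound passes to the closure, whose dense domain is then the whole
  space.\<close>

lemma tensor_finite_rank:
  assumes kj: "k \<le> j" and \<phi>: "\<And>i. i \<in> I \<Longrightarrow> \<phi> i \<in> VV (leb k)"
  shows "\<exists>t. represents (leb j) t (tensor_id k j (finite_rank_op (leb k) \<phi> I)) \<and>
    (\<forall>(n::nat) f g. (\<forall>i<n. f i \<in> VV (leb k) \<and> g i \<in> VV (leb (j - k))) \<longrightarrow>
      t (\<Sum>i<n. tens k j (f i) (g i)) = (\<Sum>i<n. tens k j (finite_rank \<phi> I (f i)) (g i)))"
proof -
  let ?A = "finite_rank \<phi> I"
  let ?T = "{(x, ?A x) |x. x \<in> VV (leb k)}"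
  have rep: "represents (leb k) ?A (finite_rank_op (leb k) \<phi> I)" by (rule represents_finite_rank) (rule \<phi>)
  have nnT: "VV.nnsa (leb k) ?T" by (rule VV.nnsa_posop_graph[OF posop_finite_rank]) (rule \<phi>)
  have lin: "linear_graph (leb k) (finite_rank_op (leb k) \<phi> I)" by (rule l2_operatorD[OF represents_l2_operator[OF rep]])
  have lift: "lift_graph (leb k) (finite_rank_op (leb k) \<phi> I) = ?T" by (rule representsD[OF rep])
  interpret tensor_relation k j ?T using tensor_relation_lift[OF kj lin] lift by simp
  let ?K = "tensor_graph k j ?T"
  have eq: "tensor_id k j (finite_rank_op (leb k) \<phi> I) = pull_graph (leb j) ?K" by (rule tensor_id_eq[OF lin lift])
  have nn: "VV.nnsa (leb j) ?K" by (rule nnsa_tensor_graph[OF nnT])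
  interpret A: bounded_linear ?A by (rule bounded_linear_finite_rank)
  obtain C where C: "C > 0" "\<And>x. norm (?A x) \<le> norm x * C" using A.pos_bounded by blast
  have bspan: "norm y \<le> C * norm x" if xy: "(x, y) \<in> span (tensor_gens k j ?T)" for x y
  proof -
    obtain n f f' g where s0: "\<forall>i<n::nat. (f i, f' i) \<in> ?T \<and> g i \<in> R"
      and s: "x = (\<Sum>i<n. tens k j (f i) (g i))" "y = (\<Sum>i<n. tens k j (f' i) (g i))" using span_sums[OF xy] by blast
    have V: "f i \<in> VV (leb k)" "f' i = ?A (f i)" "f' i \<in> VV (leb k)" "g i \<in> R" if i: "i \<in> {..<n}" for i
    proof -
      have T: "(f i, f' i) \<in> ?T \<and> g i \<in> R" using s0 i unfolding lessThan_iff by (elim allE impE)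
      show "f i \<in> VV (leb k)" by (rule TD(1)[OF conjunct1[OF T]])
      show "f' i \<in> VV (leb k)" by (rule TD(2)[OF conjunct1[OF T]])
      show "g i \<in> R" by (rule conjunct2[OF T])
      show "f' i = ?A (f i)" using T by simp
    qed
    let ?m = "\<lambda>a b. complex_of_real (C\<^sup>2) * cinner (f a) (f b) - cinner (f' a) (f' b)"
    have "0 \<le> Re (\<Sum>a<n. \<Sum>b<n. ?m a b * cinner (g a) (g b))"
    proof (rule positive_semidefinite_tensor[OF _ V(4)])
      fix c
      let ?x = "\<Sum>i<n. scaleC (c i) (f i)"
      have "(\<Sum>i<n. scaleC (c i) (f' i)) = ?A ?x" unfolding A.sum finite_rank_scaleC using V(2) by (intro sum.cong) auto
      have "(\<Sum>a<n. \<Sum>b<n. cnj (c a) * c b * ?m a b) = complex_of_real (C\<^sup>2) * cinner ?x ?x - cinner (?A ?x) (?A ?x)"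
      proof -
        have "(\<Sum>a<n. \<Sum>b<n. cnj (c a) * c b * ?m a b)
            = (\<Sum>a<n. \<Sum>b<n. complex_of_real (C\<^sup>2) * (cnj (c a) * c b * cinner (f a) (f b)))
              - (\<Sum>a<n. \<Sum>b<n. cnj (c a) * c b * cinner (f' a) (f' b))"
          unfolding sum_subtractf[symmetric] by (intro sum.cong refl) (simp only: right_diff_distrib mult.left_commute)
        also have "\<dots> = complex_of_real (C\<^sup>2) * cinner ?x ?x - cinner (\<Sum>i<n. scaleC (c i) (f' i)) (\<Sum>i<n. scaleC (c i) (f' i))"
          unfolding cinner_combination by (simp only: sum_distrib_left)
        finally show ?thesis using \<open>(\<Sum>i<n. scaleC (c i) (f' i)) = ?A ?x\<close> by (simp only:)
      qed
      also have "\<dots> = complex_of_real (C\<^sup>2 * (norm ?x)\<^sup>2 - (norm (?A ?x))\<^sup>2)" by (simp add: cinner_self)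
      finally have e: "(\<Sum>a<n. \<Sum>b<n. cnj (c a) * c b * ?m a b) = complex_of_real (C\<^sup>2 * (norm ?x)\<^sup>2 - (norm (?A ?x))\<^sup>2)" .
      have "(norm (?A ?x))\<^sup>2 \<le> (norm ?x * C)\<^sup>2" using C(2) by (intro power_mono) auto
      then show "0 \<le> Re (\<Sum>a<n. \<Sum>b<n. cnj (c a) * c b * ?m a b)" unfolding e by (simp add: power_mult_distrib mult.commute)
    qed
    also have "(\<Sum>a<n. \<Sum>b<n. ?m a b * cinner (g a) (g b)) = complex_of_real (C\<^sup>2) * cinner x x - cinner y y"
    proof -
      have "cinner x x = (\<Sum>a<n. \<Sum>b<n. cinner (f a) (f b) * cinner (g a) (g b))"
        "cinner y y = (\<Sum>a<n. \<Sum>b<n. cinner (f' a) (f' b) * cinner (g a) (g b))"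
        unfolding s by (rule cinner_tens_sums[OF kj], (erule V)+)+
      then show ?thesis by (simp only: left_diff_distrib sum_subtractf sum_distrib_left mult.assoc)
    qed
    finally have "(norm y)\<^sup>2 \<le> (C * norm x)\<^sup>2" by (simp add: cinner_self power_mult_distrib flip: power2_norm_eq_inner)
    then show ?thesis using C by (intro power2_le_imp_le[of "norm y"]) auto
  qed
  have bound: "norm y \<le> C * norm x" if xy: "(x, y) \<in> ?K" for x y
  proof -
    obtain f g where fg: "\<And>n::nat. (f n, g n) \<in> span (tensor_gens k j ?T)" "f \<longlonglongrightarrow> x" "g \<longlonglongrightarrow> y"
      using graph_seq[OF xy] by blast
    show ?thesis
      by (rule LIMSEQ_le[OF tendsto_norm[OF fg(3)] tendsto_mult[OF tendsto_const tendsto_norm[OF fg(2)]]])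
        (use bspan[OF fg(1)] in blast)
  qed
  have dom: "\<exists>y. (v, y) \<in> ?K" if v: "v \<in> L" for v
  proof -
    obtain f where f: "\<And>n::nat. f n \<in> Domain ?K" "f \<longlonglongrightarrow> v"
      using v VV.nnsa_dense[OF nn] closure_sequential by blast
    have "\<forall>n. \<exists>y. (f n, y) \<in> ?K" using f(1) by blast
    from choice[OF this] obtain g where "\<forall>n. (f n, g n) \<in> ?K" ..
    then have g: "(f n, g n) \<in> ?K" for n by (rule spec)
    have "norm (g m - g n) \<le> C * norm (f m - f n)" for m n
      by (rule bound[OF VV.graph_diff[OF graph_subspace g g]])
    moreover have "Cauchy f" using f(2) LIMSEQ_imp_Cauchy by blast
    ultimately have "Cauchy g" 
    proof -
      assume le: "\<And>m n. norm (g m - g n) \<le> C * norm (f m - f n)" and Cf: "Cauchy f"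
      show "Cauchy g"
      proof (rule CauchyI)
        fix e :: real assume "e > 0"
        then have "e / C > 0" using C by simp
        from CauchyD[OF Cf this] obtain N where N: "\<forall>m\<ge>N. \<forall>n\<ge>N. norm (f m - f n) < e / C" by blast
        show "\<exists>M. \<forall>m\<ge>M. \<forall>n\<ge>M. norm (g m - g n) < e"
        proof (intro exI allI impI)
          fix m n assume "N \<le> m" "N \<le> n"
          with N have "C * norm (f m - f n) < e" using C by (simp add: pos_less_divide_eq mult.commute)
          with le[of m n] show "norm (g m - g n) < e" by linarith
        qed
      qed
    qed
    moreover have "g n \<in> L" for n using g graph_sub by blast
    ultimately obtain w where "g \<longlonglongrightarrow> w" using VV.V_Cauchy[of g] by blast
    from graph_limit[OF g f(2) this] show ?thesis by blast
  qed
  note P = nnsa_pull[OF nn graph_inv]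
  have "bounded_op (leb j) (pull_graph (leb j) ?K)"
    unfolding bounded_op_def
  proof (intro conjI)
    show "l2_operator (leb j) (pull_graph (leb j) ?K)"
      using P(1) by (simp add: nonneg_selfadjoint_op_def selfadjoint_op_def)
    show "Domain (pull_graph (leb j) ?K) = L2 (leb j)"
    proof
      show "L2 (leb j) \<subseteq> Domain (pull_graph (leb j) ?K)"
      proof
        fix a assume a: "a \<in> L2 (leb j)"
        then obtain y where y: "(emb (leb j) a, y) \<in> ?K" using dom by force
        then obtain b where "b \<in> L2 (leb j)" "y = emb (leb j) b" using graph_sub VV_emb by blast
        with a y show "a \<in> Domain (pull_graph (leb j) ?K)" by (auto simp: pull_graph_def)
      qed
    qed (auto simp: pull_graph_def)
    show "\<exists>C. \<forall>(x, y)\<in>pull_graph (leb j) ?K. l2_norm (leb j) y \<le> C * l2_norm (leb j) x"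
      using bound by (intro exI[of _ C]) (auto simp: pull_graph_def l2_norm)
  qed
  from bounded_op_represents[OF this] obtain t where t: "represents (leb j) t (pull_graph (leb j) ?K)" by blast
  have Kt: "?K = {(x, t x) |x. x \<in> L}" using representsD(5)[OF t] P(2) by simp
  have "t (\<Sum>i<n. tens k j (f i) (g i)) = (\<Sum>i<n. tens k j (?A (f i)) (g i))"
    if fg: "\<forall>i<n. f i \<in> VV (leb k) \<and> g i \<in> R" for n :: nat and f g
  proof -
    have "(\<Sum>i<n. (tens k j (f i) (g i), tens k j (?A (f i)) (g i))) \<in> ?K"
      using fg by (intro subspace_sum[OF graph_subspace] span_in_graph gensI) auto
    then show ?thesis unfolding Kt by (auto simp: sum_prod)
  qed
  then show ?thesis unfolding eq using t by blast
qed

text \<open>A \<le> Q on the domain of \<open>Q\<close> becomes A \<otimes> Id \<le> Q \<otimes> Id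
  on finite tensor sums by \<open>tens_sums_nonneg\<close>, on the whole graph by closure, and on
  the form domain by \<open>nnsa_form_bound\<close>. Outside the form domain the right-hand side is
  infinite.\<close>

lemma op_trace_tensor_le_quad_form:
  assumes kj: "k \<le> j" and Q: "nonneg_selfadjoint_op (leb k) Q" and \<phi>: "\<And>i. i \<in> I \<Longrightarrow> \<phi> i \<in> VV (leb k)"
    and le: "\<And>x y. (x, y) \<in> lift_graph (leb k) Q \<Longrightarrow> x \<bullet> finite_rank \<phi> I x \<le> x \<bullet> y"
    and \<psi>: "\<psi> \<in> L2 (leb j)"
  shows "ennreal (Re (op_trace (leb j) (proj_op (leb j) \<psi> O tensor_id k j (finite_rank_op (leb k) \<phi> I))))
    \<le> quad_form (leb j) (tensor_id k j Q) \<psi>"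
proof -
  let ?A = "finite_rank \<phi> I" and ?T = "lift_graph (leb k) Q"
  interpret A: bounded_linear ?A by (rule bounded_linear_finite_rank)
  have AV: "?A x \<in> VV (leb k)" for x by (rule finite_rank_in_VV) (rule \<phi>)
  obtain t where t: "represents (leb j) t (tensor_id k j (finite_rank_op (leb k) \<phi> I))"
    and ts: "\<And>(n::nat) f g. (\<forall>i<n. f i \<in> VV (leb k) \<and> g i \<in> VV (leb (j - k))) \<Longrightarrow>
      t (\<Sum>i<n. tens k j (f i) (g i)) = (\<Sum>i<n. tens k j (?A (f i)) (g i))"
    using tensor_finite_rank[OF kj, of I \<phi>] \<phi> by blast
  interpret t: bounded_linear t by (rule representsD[OF t])
  note LQ = nnsa_lift[OF Q]
  have lin: "linear_graph (leb k) Q" using Q by (simp add: nonneg_selfadjoint_op_def selfadjoint_op_def l2_operator_def)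
  interpret tensor_relation k j ?T by (rule tensor_relation_lift[OF kj lin])
  have span_le: "x \<bullet> t x \<le> x \<bullet> y" if xy: "(x, y) \<in> span (tensor_gens k j ?T)" for x y
  proof -
    obtain n f f' g where s0: "\<forall>i<n::nat. (f i, f' i) \<in> ?T \<and> g i \<in> R"
      and s: "x = (\<Sum>i<n. tens k j (f i) (g i))" "y = (\<Sum>i<n. tens k j (f' i) (g i))" using span_sums[OF xy] by blast
    have V: "f i \<in> VV (leb k)" "f' i \<in> VV (leb k)" "g i \<in> R" if "i \<in> {..<n}" for i
      using s0 that TD by auto
    have tx: "t x = (\<Sum>i<n. tens k j (?A (f i)) (g i))" unfolding s(1) using V by (intro ts) auto
    have "0 \<le> x \<bullet> (\<Sum>i<n. tens k j (f' i - ?A (f i)) (g i))"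
      unfolding s(1)
    proof (rule tens_sums_nonneg[OF kj V(1) _ V(3)])
      show "f' i - ?A (f i) \<in> VV (leb k)" if "i \<in> {..<n}" for i using V(2)[OF that] AV by (rule VV.V_intros)
      fix c
      let ?x = "\<Sum>i<n. scaleC (c i) (f i)" and ?y = "\<Sum>i<n. scaleC (c i) (f' i)"
      have "(?x, ?y) \<in> ?T" using s0 by (intro combination_in_T) auto
      moreover have "(\<Sum>i<n. scaleC (c i) (f' i - ?A (f i))) = ?y - ?A ?x"
        by (simp add: A.sum finite_rank_scaleC sum_subtractf linear_diff[OF bounded_linear.linear[OF bounded_linear_scaleC]])
      ultimately show "0 \<le> ?x \<bullet> (\<Sum>i<n. scaleC (c i) (f' i - ?A (f i)))"
        using le by (simp add: inner_diff_right)
    qed auto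
    also have "(\<Sum>i<n. tens k j (f' i - ?A (f i)) (g i)) = y - t x"
      unfolding s(2) tx sum_subtractf[symmetric] using V by (intro sum.cong refl tens_diff kj AV) auto
    finally show ?thesis by (simp add: inner_diff_right)
  qed
  note TI = tensor_id_nonneg_selfadjoint[OF kj Q]
  have graph_le: "x \<bullet> t x \<le> x \<bullet> y" if "(x, y) \<in> lift_graph (leb j) (tensor_id k j Q)" for x y
  proof -
    have "(x, y) \<in> tensor_graph k j ?T" using that TI(2) by simp
    then obtain f g where fg: "\<And>n::nat. (f n, g n) \<in> span (tensor_gens k j ?T)" "f \<longlonglongrightarrow> x" "g \<longlonglongrightarrow> y"
      using graph_seq by blast
    show ?thesis
      by (rule LIMSEQ_le[OF tendsto_inner[OF fg(2) t.tendsto[OF fg(2)]] tendsto_inner[OF fg(2,3)]])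
        (use span_le[OF fg(1)] in blast)
  qed
  obtain b where b: "b \<in> L2 (leb j)" "(\<psi>, b) \<in> tensor_id k j (finite_rank_op (leb k) \<phi> I)" "emb (leb j) b = t (emb (leb j) \<psi>)"
    using represents_ex[OF t \<psi>] by blast
  have tr: "Re (op_trace (leb j) (proj_op (leb j) \<psi> O tensor_id k j (finite_rank_op (leb k) \<phi> I))) = emb (leb j) \<psi> \<bullet> t (emb (leb j) \<psi>)"
    unfolding op_trace_proj[OF represents_l2_operator[OF t] b(2)] by (simp add: b(3))
  note S = lift_sqrt_op[OF TI(1)]
  show ?thesis
  proof (cases "\<exists>w. (emb (leb j) \<psi>, w) \<in> lift_graph (leb j) (sqrt_op (leb j) (tensor_id k j Q))")
    case True
    then obtain w where w: "(emb (leb j) \<psi>, w) \<in> lift_graph (leb j) (sqrt_op (leb j) (tensor_id k j Q))" by blast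
    have "emb (leb j) \<psi> \<bullet> t (emb (leb j) \<psi>) \<le> (norm w)\<^sup>2"
      by (rule VV.nnsa_form_bound[OF S(1,2) t.bounded_linear_axioms graph_le w])
    then show ?thesis unfolding tr quad_form_eq[OF TI(1) \<psi> w] by (rule ennreal_leI)
  next
    case False
    then show ?thesis using quad_form_inf[OF TI(1)] by simp
  qed
qed

section \<open>Separability and the unit sphere\<close>

text \<open>Each basis vector has a non-zero coefficient against some member of the total set
  \<open>F\<close>, and by summability each member has only countably many non-zero
  coefficients.\<close>

lemma countable_some_basis:
  assumes F: "countable F" "F \<subseteq> VV M" and tot: "\<And>v. v \<in> VV M \<Longrightarrow> (\<And>x. x \<in> F \<Longrightarrow> cinner x v = 0) \<Longrightarrow> v = 0"
  shows "countable (some_basis M)"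
proof -
  let ?B = "some_basis M"
  have "?B \<subseteq> (\<Union>x\<in>F. {e \<in> ?B. (cmod (cinner (emb M e) x))\<^sup>2 \<noteq> 0})"
  proof
    fix e assume e: "e \<in> ?B"
    then have V: "emb M e \<in> VV M" by (intro emb_in_VV some_basis.B_L2)
    have "emb M e \<noteq> 0" using some_basis.orthonormal[OF e e] by auto
    then obtain x where x: "x \<in> F" "cinner x (emb M e) \<noteq> 0" using tot[OF V] by blast
    then have "cinner (emb M e) x \<noteq> 0" using cinner_commute[of x "emb M e"] by force
    with e x(1) show "e \<in> (\<Union>x\<in>F. {e \<in> ?B. (cmod (cinner (emb M e) x))\<^sup>2 \<noteq> 0})" by auto
  qed
  moreover have "countable (\<Union>x\<in>F. {e \<in> ?B. (cmod (cinner (emb M e) x))\<^sup>2 \<noteq> 0})"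
  proof (rule countable_UN[OF F(1)])
    fix x assume "x \<in> F"
    then have "((\<lambda>e. (cmod (cinner (emb M e) x))\<^sup>2) has_sum (norm x)\<^sup>2) ?B" using F(2) by (intro some_basis.has_sum_norm) auto
    then have "(\<lambda>e. (cmod (cinner (emb M e) x))\<^sup>2) summable_on ?B" by (rule has_sum_imp_summable)
    then show "countable {e \<in> ?B. (cmod (cinner (emb M e) x))\<^sup>2 \<noteq> 0}"
      by (rule summable_countable_real)
  qed
  ultimately show ?thesis by (rule countable_subset)
qed

lemma total_vec_indicators:
  assumes E: "\<And>A. A \<in> E \<Longrightarrow> (\<lambda>x. indicator A x) \<in> l2_fun M"
    and tot: "\<And>h. h \<in> l2_fun M \<Longrightarrow> (\<And>A. A \<in> E \<Longrightarrow> (\<integral>x. indicator A x * h x \<partial>M) = 0) \<Longrightarrow> AE x in M. h x = 0"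
    and v: "v \<in> VV M" "\<And>x. x \<in> (\<lambda>A. vec M (\<lambda>x. indicator A x)) ` E \<Longrightarrow> cinner x v = 0"
  shows "v = 0"
proof -
  obtain h where h: "h \<in> l2_fun M" "v = vec M h" using v(1) by (auto simp: VV_def)
  have "AE x in M. h x = 0"
  proof (rule tot[OF h(1)])
    fix A assume A: "A \<in> E"
    with v(2) have "cinner (vec M (\<lambda>x. indicator A x)) (vec M h) = 0" unfolding h(2) by blast
    then show "(\<integral>x. indicator A x * h x \<partial>M) = 0" by (simp only: cinner_vec[OF E[OF A] h(1)] cnj_indicator)
  qed
  then show "v = 0" using vec_eq_iff[OF h(1) l2_fun_zero] h(2) by (simp add: vec_zero)
qed

lemma countable_basis_leb: "countable (some_basis (leb k))"
proof (rule countable_some_basis)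
  let ?F = "(\<lambda>A. vec (leb k) (\<lambda>x. indicator A x)) ` conf_boxes k"
  show "countable ?F" by (intro countable_image countable_conf_boxes)
  show "?F \<subseteq> VV (leb k)" by (auto intro!: vec_in_VV conf_box_l2)
  show "v = 0" if "v \<in> VV (leb k)" "\<And>x. x \<in> ?F \<Longrightarrow> cinner x v = 0" for v
    by (rule total_vec_indicators[OF conf_box_l2 total_conf_boxes that])
qed

lemma countable_basis_lborel: "countable (some_basis (lborel :: 'a::euclidean_space measure))"
proof (rule countable_some_basis)
  let ?F = "(\<lambda>A. vec lborel (\<lambda>x. indicator A x)) ` (rat_boxes :: 'a set set)"
  have l2: "(\<lambda>x. indicator A x) \<in> l2_fun lborel" if "A \<in> rat_boxes" for A :: "'a set"
    using that rat_box_sets emeasure_rat_box by (intro l2_fun_indicator) auto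
  show "countable ?F" by (intro countable_image countable_rat_boxes)
  show "?F \<subseteq> VV lborel" by (auto intro!: vec_in_VV l2)
  show "v = 0" if "v \<in> VV lborel" "\<And>x. x \<in> ?F \<Longrightarrow> cinner x v = 0" for v :: "'a hs"
    by (rule total_vec_indicators[OF l2 total_rat_boxes that])
qed

text \<open>Rational combinations, encoded by lists of pairs, form a countable set; its closure is a
  real subspace because rationals approximate every real scalar.\<close>

lemma countable_dense_span:
  fixes X :: "'h::real_normed_vector set"
  assumes "countable X" shows "\<exists>D. countable D \<and> span X \<subseteq> closure D"
proof -
  define D where "D = (\<lambda>l. \<Sum>(q, x)\<leftarrow>l. q *\<^sub>R x) ` lists (\<rat> \<times> X)"
  have "countable D" unfolding D_def
    using assms countable_rat by (intro countable_image countable_lists countable_SIGMA) auto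
  have D0: "0 \<in> D" unfolding D_def by (intro image_eqI[of _ _ "[]"]) auto
  have Dadd: "x + y \<in> D" if xy: "x \<in> D" "y \<in> D" for x y
  proof -
    obtain l m where "l \<in> lists (\<rat> \<times> X)" "x = (\<Sum>(q, x)\<leftarrow>l. q *\<^sub>R x)" "m \<in> lists (\<rat> \<times> X)" "y = (\<Sum>(q, x)\<leftarrow>m. q *\<^sub>R x)"
      using xy unfolding D_def by blast
    then show ?thesis unfolding D_def by (intro image_eqI[of _ _ "l @ m"]) auto
  qed
  have Dscale: "r *\<^sub>R x \<in> D" if "r \<in> \<rat>" "x \<in> D" for r x
  proof -
    have *: "l \<in> lists (\<rat> \<times> X) \<Longrightarrow> \<exists>m\<in>lists (\<rat> \<times> X). r *\<^sub>R (\<Sum>(q, x)\<leftarrow>l. q *\<^sub>R x) = (\<Sum>(q, x)\<leftarrow>m. q *\<^sub>R x)" for l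
    proof (induction l)
      case (Cons p l)
      then obtain m where m: "m \<in> lists (\<rat> \<times> X)" "r *\<^sub>R (\<Sum>(q, x)\<leftarrow>l. q *\<^sub>R x) = (\<Sum>(q, x)\<leftarrow>m. q *\<^sub>R x)" by auto
      obtain q x where p: "p = (q, x)" by fastforce
      show ?case using Cons.prems m p \<open>r \<in> \<rat>\<close>
        by (intro bexI[of _ "(r * q, x) # m"]) (auto simp: scaleR_add_right)
    qed (auto intro: bexI[of _ "[]"])
    from that(2) obtain l where "l \<in> lists (\<rat> \<times> X)" "x = (\<Sum>(q, x)\<leftarrow>l. q *\<^sub>R x)" unfolding D_def by blast
    with *[of l] show ?thesis unfolding D_def by auto
  qed
  have "subspace (closure D)"
    unfolding subspace_def
  proof (intro conjI ballI allI)
    show "0 \<in> closure D" using D0 closure_subset by blast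
    fix x assume x: "x \<in> closure D"
    then obtain f where f: "\<And>n. f n \<in> D" "f \<longlonglongrightarrow> x" using closure_sequential by blast
    show "x + y \<in> closure D" if y: "y \<in> closure D" for y
    proof -
      obtain g where g: "\<And>n. g n \<in> D" "g \<longlonglongrightarrow> y" using y closure_sequential by blast
      show ?thesis unfolding closure_sequential using tendsto_add[OF f(2) g(2)] Dadd[OF f(1) g(1)]
        by (intro exI[of _ "\<lambda>n. f n + g n"]) simp
    qed
    show "c *\<^sub>R x \<in> closure D" for c
    proof -
      have "c \<in> closure \<rat>" by (simp add: Rats_closure_real)
      then obtain q where q: "\<And>n. q n \<in> \<rat>" "q \<longlonglongrightarrow> c" using closure_sequential by blast
      show ?thesis unfolding closure_sequential using tendsto_scaleR[OF q(2) f(2)] Dscale[OF q(1) f(1)]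
        by (intro exI[of _ "\<lambda>n. q n *\<^sub>R f n"]) simp
    qed
  qed
  moreover have "X \<subseteq> closure D"
  proof
    fix x assume "x \<in> X"
    then have "x \<in> D" unfolding D_def by (intro image_eqI[of _ _ "[(1, x)]"]) auto
    then show "x \<in> closure D" using closure_subset by blast
  qed
  ultimately have "span X \<subseteq> closure D" by (intro span_minimal)
  with \<open>countable D\<close> show ?thesis by blast
qed

lemma countable_dense_VV:
  assumes "countable (some_basis M)" shows "\<exists>D. countable D \<and> VV M \<subseteq> closure D"
proof -
  \<comment> \<open>The span is real, so the rotated basis vectors have to be included.\<close>
  let ?X = "emb M ` some_basis M \<union> (\<lambda>e. ii (emb M e)) ` some_basis M"
  obtain D where D: "countable D" "span ?X \<subseteq> closure D"
    using countable_dense_span[of ?X] assms by auto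
  have "coeff_sum M F c \<in> span ?X" if F: "F \<subseteq> some_basis M" for F c
    unfolding coeff_sum_def scaleC_def
    using F by (intro span_sum span_add span_scale span_base) auto
  then have "{coeff_sum M F c |F c. finite F \<and> F \<subseteq> some_basis M} \<subseteq> closure D" using D(2) by blast
  then have "VV M \<subseteq> closure D" using some_basis.coeff_sums_dense[of M] closure_minimal[OF _ closed_closure] by blast
  with D(1) show ?thesis by blast
qed

section \<open>The unit sphere and the support of a probability measure on it\<close>

lemma sphere_iff: "u \<in> l2_sphere M \<longleftrightarrow> u \<in> L2 M \<and> norm (emb M u) = 1"
  by (auto simp: l2_sphere_def l2_norm)

text \<open>\<open>Metric_space\<close> asks for symmetry of the distance on the whole type. Outside
  \<open>L2 M\<close> the difference of representatives may fail to be square-integrable, and then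
  its class is empty in both orders.\<close>

lemma l2_norm_diff_commute: "l2_norm M (l2_diff M u v) = l2_norm M (l2_diff M v u)"
proof -
  let ?f = "\<lambda>x. l2_rep u x - l2_rep v x" and ?g = "\<lambda>x. l2_rep v x - l2_rep u x"
  show ?thesis
  proof (cases "?f \<in> l2_fun M")
    case True
    then have "?g \<in> l2_fun M" using l2_fun_uminus[OF True] by simp
    moreover have "vec M ?g = - vec M ?f" using vec_scaleR[OF True, of "-1"] by simp
    ultimately show ?thesis using True unfolding l2_diff_def by (simp add: l2_norm)
  next
    case False
    then have "?g \<notin> l2_fun M" using l2_fun_uminus[of ?g M] by auto
    with False have "l2_class M ?f = {}" "l2_class M ?g = {}" by (auto simp: l2_class_def l2_rel_def)
    then show ?thesis unfolding l2_diff_def by simp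
  qed
qed

lemma sphere_metric: "Metric_space (l2_sphere M) (\<lambda>u v. l2_norm M (l2_diff M u v))"
proof
  show "0 \<le> l2_norm M (l2_diff M x y)" for x y by (simp add: l2_norm_def)
  show "l2_norm M (l2_diff M x y) = l2_norm M (l2_diff M y x)" for x y by (rule l2_norm_diff_commute)
  show "(l2_norm M (l2_diff M x y) = 0) = (x = y)" if "x \<in> l2_sphere M" "y \<in> l2_sphere M" for x y
    using that emb_eq_iff[of x M y] by (simp add: sphere_iff l2_norm l2_diff)
  show "l2_norm M (l2_diff M x z) \<le> l2_norm M (l2_diff M x y) + l2_norm M (l2_diff M y z)"
    if "x \<in> l2_sphere M" "y \<in> l2_sphere M" "z \<in> l2_sphere M" for x y z
    using that norm_triangle_ineq[of "emb M x - emb M y" "emb M y - emb M z"] by (simp add: sphere_iff l2_norm l2_diff)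
qed

lemma openin_sphere:
  "openin (l2_sphere_topology M) U \<longleftrightarrow>
    U \<subseteq> l2_sphere M \<and> (\<forall>u\<in>U. \<exists>r>0. \<forall>v\<in>l2_sphere M. norm (emb M v - emb M u) < r \<longrightarrow> v \<in> U)"
proof -
  interpret Metric_space "l2_sphere M" "\<lambda>u v. l2_norm M (l2_diff M u v)" by (rule sphere_metric)
  have "mball u r \<subseteq> U \<longleftrightarrow> (\<forall>v\<in>l2_sphere M. norm (emb M v - emb M u) < r \<longrightarrow> v \<in> U)" if "u \<in> l2_sphere M" for u r
    using that by (auto simp: mball_def sphere_iff l2_norm l2_diff norm_minus_commute)
  then show ?thesis
    unfolding l2_sphere_topology_def openin_mtopology by (auto simp: subset_iff)
qed

lemma topspace_sphere: "topspace (l2_sphere_topology M) = l2_sphere M"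
  unfolding l2_sphere_topology_def by (rule Metric_space.topspace_mtopology[OF sphere_metric])

lemma space_borel_of: "space (borel_of X) = topspace X"
  by (simp add: borel_of_def space_measure_of_conv)

lemma sets_borel_of: "openin X U \<Longrightarrow> U \<in> sets (borel_of X)"
  unfolding borel_of_def by (auto simp: sets_measure_of_conv dest: openin_subset intro: sigma_sets.Basic)

context
  fixes M :: "'a measure" and \<xi> :: "'a l2 measure"
  assumes xi: "\<xi> \<in> prob_measures (l2_sphere_topology M)"
begin

lemma xi_prob: "prob_space \<xi>" and xi_sets: "sets \<xi> = sets (borel_of (l2_sphere_topology M))"
  using xi by (auto simp: prob_measures_def)

lemma xi_space: "space \<xi> = l2_sphere M"
  using sets_eq_imp_space_eq[OF xi_sets] by (simp add: space_borel_of topspace_sphere)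

lemma xi_open: "openin (l2_sphere_topology M) U \<Longrightarrow> U \<in> sets \<xi>"
  by (simp add: xi_sets sets_borel_of)

lemma xi_measurable_continuous:
  fixes G :: "'a l2 \<Rightarrow> 'h::metric_space"
  assumes G: "\<And>u e. u \<in> l2_sphere M \<Longrightarrow> e > 0 \<Longrightarrow>
    \<exists>d>0. \<forall>v\<in>l2_sphere M. norm (emb M v - emb M u) < d \<longrightarrow> dist (G v) (G u) < e"
  shows "G \<in> borel_measurable \<xi>"
proof (rule borel_measurableI)
  fix S :: "'h set" assume S: "open S"
  have "openin (l2_sphere_topology M) (G -` S \<inter> space \<xi>)"
    unfolding openin_sphere xi_space
  proof (intro conjI ballI)
    fix u assume u: "u \<in> G -` S \<inter> l2_sphere M"
    then obtain e where e: "e > 0" "\<And>y. dist y (G u) < e \<Longrightarrow> y \<in> S" using S unfolding open_dist by blast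
    from G[OF _ e(1), of u] u obtain d where "d > 0" "\<forall>v\<in>l2_sphere M. norm (emb M v - emb M u) < d \<longrightarrow> dist (G v) (G u) < e" by blast
    with e(2) show "\<exists>r>0. \<forall>v\<in>l2_sphere M. norm (emb M v - emb M u) < r \<longrightarrow> v \<in> G -` S \<inter> l2_sphere M"
      by (intro exI[of _ d]) auto
  qed simp
  then show "G -` S \<inter> space \<xi> \<in> sets \<xi>" by (rule xi_open)
qed

text \<open>By separability the complement of the support is covered by countably many null balls of
  rational radius. Their centres form a dense set in the ambient sense and need not lie on the
  sphere.\<close>

lemma AE_support:
  assumes sep: "countable (some_basis M)"
  shows "AE u in \<xi>. u \<in> support_of (l2_sphere_topology M) \<xi>"
proof -
  let ?top = "l2_sphere_topology M"
  obtain D where D: "countable D" "VV M \<subseteq> closure D" using countable_dense_VV[OF sep] by blast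
  define N where "N d q = {v \<in> l2_sphere M. norm (emb M v - d) < q}" for d and q :: real
  have Nopen: "openin ?top (N d q)" for d q
    unfolding openin_sphere
  proof (intro conjI ballI)
    fix u assume u: "u \<in> N d q"
    show "\<exists>r>0. \<forall>v\<in>l2_sphere M. norm (emb M v - emb M u) < r \<longrightarrow> v \<in> N d q"
    proof (intro exI conjI ballI impI)
      show "0 < q - norm (emb M u - d)" using u by (simp add: N_def)
      fix v assume "v \<in> l2_sphere M" "norm (emb M v - emb M u) < q - norm (emb M u - d)"
      then show "v \<in> N d q" using norm_triangle_ineq[of "emb M v - emb M u" "emb M u - d"] by (simp add: N_def)
    qed
  qed (auto simp: N_def)
  let ?I = "{(d, q) \<in> D \<times> \<rat>. emeasure \<xi> (N d q) = 0}"
  have null: "(\<Union>p\<in>?I. N (fst p) (snd p)) \<in> null_sets \<xi>"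
    using D(1) Nopen by (intro null_sets_UN') (auto intro!: countable_Collect[of "D \<times> \<rat>", unfolded mem_Times_iff] simp: null_sets_def xi_open
        countable_SIGMA countable_rat intro: countable_subset[of _ "D \<times> \<rat>"])
  have "{u \<in> space \<xi>. u \<notin> support_of ?top \<xi>} \<subseteq> (\<Union>p\<in>?I. N (fst p) (snd p))"
  proof
    fix u assume "u \<in> {u \<in> space \<xi>. u \<notin> support_of ?top \<xi>}"
    then have u: "u \<in> l2_sphere M" "u \<notin> support_of ?top \<xi>" by (auto simp: xi_space)
    then obtain U where U: "openin ?top U" "u \<in> U" "emeasure \<xi> U = 0"
      unfolding support_of_def topspace_sphere by (auto simp: not_gr_zero)
    then obtain r where r: "r > 0" "\<And>v. v \<in> l2_sphere M \<Longrightarrow> norm (emb M v - emb M u) < r \<Longrightarrow> v \<in> U"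
      unfolding openin_sphere by blast
    have "emb M u \<in> closure D" using D(2) u by (auto simp: sphere_iff)
    then obtain d where d: "d \<in> D" "dist d (emb M u) < r / 4" unfolding closure_approachable using r(1) by (metis zero_less_divide_iff zero_less_numeral)
    \<comment> \<open>With the centre closer than r/4 to \<open>u\<close>, a radius between r/4 and
      r/2 makes the ball contain \<open>u\<close> and stay within distance r of it.\<close>
    obtain q where q: "q \<in> \<rat>" "r / 4 < q" "q < r / 2" using Rats_dense_in_real[of "r / 4" "r / 2"] r(1) by auto
    have "N d q \<subseteq> U"
    proof
      fix v assume v: "v \<in> N d q"
      have "norm (emb M v - emb M u) \<le> norm (emb M v - d) + norm (d - emb M u)"
        using norm_triangle_ineq[of "emb M v - d" "d - emb M u"] by simp
      also have "\<dots> < r" using v d(2) q(3) r(1) by (simp add: N_def dist_norm)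
      finally show "v \<in> U" using v r(2) by (simp add: N_def)
    qed
    then have "emeasure \<xi> (N d q) = 0" using U emeasure_mono[OF _ xi_open[OF U(1)]] by (metis le_zero_eq)
    moreover have "u \<in> N d q" using u d(2) q(2) by (simp add: N_def dist_norm norm_minus_commute)
    ultimately show "u \<in> (\<Union>p\<in>?I. N (fst p) (snd p))" using d(1) q(1) by (intro UN_I[of "(d, q)"]) auto
  qed
  then show ?thesis by (rule AE_I'[OF null])
qed

end

section \<open>Tensor powers of unit vectors\<close>

lemma tensor_power_fun:
  fixes f g :: "real^3 \<Rightarrow> complex"
  assumes f: "f \<in> l2_fun lborel"
  shows "(\<lambda>x. \<Prod>i<k. f (x i)) \<in> l2_fun (leb k)"
proof -
  have fm [measurable]: "f \<in> borel_measurable lborel" by (rule l2_funD[OF f])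
  have "(\<lambda>x. f (x i)) \<in> borel_measurable (leb k)" if "i \<in> {..<k}" for i
    using measurable_compose[OF measurable_component_singleton[OF that, of "\<lambda>_. lborel"] fm] by (simp add: leb_def)
  then have "(\<lambda>x. \<Prod>i<k. f (x i)) \<in> borel_measurable (leb k)" by (intro borel_measurable_prod) auto
  moreover have "integrable (leb k) (\<lambda>x. \<Prod>i<k. (cmod (f (x i)))\<^sup>2)"
    unfolding leb_def by (rule leb.product_integrable_prod) (use l2_funD(2)[OF f] in auto)
  ultimately show ?thesis by (simp add: l2_fun_def prod_norm[symmetric] prod_power_distrib)
qed

lemma tensor_power:
  assumes u: "u \<in> L2 lborel"
  shows "tensor_power k u \<in> L2 (leb k)"
    "emb (leb k) (tensor_power k u) = vec (leb k) (\<lambda>x. \<Prod>i<k. l2_rep u (x i))"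
  using tensor_power_fun[OF l2_rep_in(1)[OF u]] by (simp_all add: tensor_power_def)

lemma cinner_tensor_power:
  assumes u: "u \<in> L2 lborel" and v: "v \<in> L2 lborel"
  shows "cinner (emb (leb k) (tensor_power k u)) (emb (leb k) (tensor_power k v)) = cinner (emb lborel u) (emb lborel v) ^ k"
proof -
  note r = l2_rep_in(1)[OF u] l2_rep_in(1)[OF v]
  have "cinner (emb (leb k) (tensor_power k u)) (emb (leb k) (tensor_power k v))
      = (\<integral>x. (\<Prod>i<k. cnj (l2_rep u (x i)) * l2_rep v (x i)) \<partial>leb k)"
    unfolding tensor_power(2)[OF u] tensor_power(2)[OF v] cinner_vec[OF tensor_power_fun[OF r(1)] tensor_power_fun[OF r(2)]]
    by (simp add: prod.distrib)
  also have "\<dots> = (\<Prod>i<k. \<integral>x. cnj (l2_rep u x) * l2_rep v x \<partial>lborel)"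
    unfolding leb_def by (rule leb.product_integral_prod) (simp_all add: integrable_l2_prod[OF r])
  finally show ?thesis using r by (simp add: emb_def cinner_vec)
qed

lemma norm_tensor_power:
  assumes u: "u \<in> l2_sphere lborel" shows "norm (emb (leb k) (tensor_power k u)) = 1"
proof -
  have "u \<in> L2 lborel" "norm (emb lborel u) = 1" using u by (auto simp: sphere_iff)
  then have "complex_of_real ((norm (emb (leb k) (tensor_power k u)))\<^sup>2) = 1"
    unfolding cinner_self[symmetric] by (simp add: cinner_tensor_power) (simp add: cinner_self)
  then have "(norm (emb (leb k) (tensor_power k u)))\<^sup>2 = 1\<^sup>2" by (simp only: of_real_eq_1_iff one_power2)
  then show ?thesis by (rule power2_eq_imp_eq) simp_all
qed

text \<open>The map F is continuous: for unit vectors \<parallel>F v - F u\<parallel>^2 = 2 - 2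
  Re(\<langle>u, v\<rangle>^k), and \<langle>u, v\<rangle> tends to 1 as v tends to u.\<close>

lemma tensor_power_measurable:
  assumes xi: "\<xi> \<in> prob_measures (l2_sphere_topology lborel)"
  shows "(\<lambda>u. emb (leb k) (tensor_power k u)) \<in> borel_measurable \<xi>"
proof (rule xi_measurable_continuous[OF xi])
  fix u :: "(real^3) l2" and e :: real assume u: "u \<in> l2_sphere lborel" and e: "e > 0"
  let ?F = "\<lambda>u. emb (leb k) (tensor_power k u)" and ?E = "emb lborel :: (real^3) l2 \<Rightarrow> _"
  have "isCont (\<lambda>z :: complex. z ^ k) 1" by (intro continuous_intros)
  then obtain s where s: "s > 0" "\<And>z :: complex. dist z 1 < s \<Longrightarrow> dist (z ^ k) (1 ^ k) < e\<^sup>2 / 2"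
    using e unfolding continuous_at_eps_delta by (metis half_gt_zero zero_less_power)
  show "\<exists>d>0. \<forall>v\<in>l2_sphere lborel. norm (?E v - ?E u) < d \<longrightarrow> dist (?F v) (?F u) < e"
  proof (intro exI[of _ "s / 2"] conjI ballI impI)
    show "s / 2 > 0" using s by simp
    fix v assume v: "v \<in> l2_sphere lborel" and d: "norm (?E v - ?E u) < s / 2"
    have L: "u \<in> L2 lborel" "v \<in> L2 lborel" "norm (?E u) = 1" using u v by (auto simp: sphere_iff)
    have "cinner (?E u) (?E v) - 1 = cinner (?E u) (?E v - ?E u)"
      using L(3) by (simp add: cinner_diff_right cinner_self)
    then have "dist (cinner (?E u) (?E v)) 1 \<le> 2 * norm (?E v - ?E u)"
      using norm_cinner_le[of "?E u" "?E v - ?E u"] L(3) by (simp add: dist_norm)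
    then have "dist (cinner (?E u) (?E v)) 1 < s" using d by simp
    from s(2)[OF this] have "cmod (cinner (?F u) (?F v) - 1) < e\<^sup>2 / 2"
      by (simp add: dist_norm cinner_tensor_power[OF L(1,2)])
    moreover have "1 - ?F u \<bullet> ?F v \<le> cmod (cinner (?F u) (?F v) - 1)"
      using abs_Re_le_cmod[of "cinner (?F u) (?F v) - 1"] by simp
    moreover have "(norm (?F v - ?F u))\<^sup>2 = 2 - 2 * (?F u \<bullet> ?F v)"
    proof -
      have "(norm (?F v - ?F u))\<^sup>2 = (norm (?F v))\<^sup>2 + (norm (?F u))\<^sup>2 - 2 * (?F u \<bullet> ?F v)"
        by (simp add: power2_norm_eq_inner inner_diff_left inner_diff_right inner_commute)
      then show ?thesis using norm_tensor_power[OF u, of k] norm_tensor_power[OF v, of k] by simp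
    qed
    ultimately have "(norm (?F v - ?F u))\<^sup>2 < e\<^sup>2" by linarith
    then show "dist (?F v) (?F u) < e" using e by (simp add: dist_norm power_less_imp_less_base)
  qed
qed

section \<open>The lower semicontinuity argument\<close>

lemma (in hilbert_subspace) yosida_eqI:
  assumes S: "nnsa S" and c: "c > 0" and v: "v \<in> V" and p: "(v - c *\<^sub>R p, p) \<in> S"
  shows "yosida c S v = p"
proof -
  have "(v - c *\<^sub>R p, proj v - (v - c *\<^sub>R p)) \<in> graph_scaled c S"
    using p v c by (simp add: graph_scaled_def)
  then have "res (graph_scaled c S) v = v - c *\<^sub>R p" by (rule res_eqI[OF nnsa_graph_scaled[OF S c]])
  then show ?thesis using v c by (simp add: yosida_def)
qed

context
  fixes M :: "'a measure" and S :: "('a hs \<times> 'a hs) set" and c :: real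
  assumes S: "VV.nnsa M S" and inv: "ii_invariant S" and c: "c > 0"
begin

private abbreviation "Y \<equiv> VV.yosida M c S"

lemma yosida_in_VV: "Y x \<in> VV M"
  by (rule VV.posop_in_V[OF VV.posop_yosida[OF S c]])

text \<open>The rotated vector satisfies the relation that characterises \<open>yosida\<close> at
  \<open>ii a\<close>, because \<open>S\<close> is invariant under \<open>ii\<close>.\<close>

lemma yosida_ii: "a \<in> VV M \<Longrightarrow> Y (ii a) = ii (Y a)"
proof (rule VV.yosida_eqI[OF S c ii_in_VV])
  assume a: "a \<in> VV M"
  have "(a - c *\<^sub>R Y a, Y a) \<in> S" using VV.yosida_mem[OF S c, of a] a by simp
  then have "(ii (a - c *\<^sub>R Y a), ii (Y a)) \<in> S" using inv by (simp add: ii_invariant_def)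
  then show "(ii a - c *\<^sub>R ii (Y a), ii (Y a)) \<in> S"
    by (simp add: linear_diff[OF bounded_linear.linear[OF bounded_linear_ii]] ii_scaleR)
qed

lemma cinner_yosida: "a \<in> VV M \<Longrightarrow> cinner (Y a) x = cinner a (Y x)"
  using VV.posop_symmetric[OF VV.posop_yosida[OF S c]] by (simp add: cinner_def flip: yosida_ii)

lemma sum_coefficients:
  assumes I: "I \<subseteq> some_basis M"
  shows "(\<Sum>e\<in>I. (cmod (cinner (Y (emb M e)) x))\<^sup>2) = (\<Sum>e\<in>I. (cmod (cinner (emb M e) (Y x)))\<^sup>2)"
  using I some_basis.B_L2[of _ M] by (intro sum.cong refl) (auto simp: cinner_yosida subset_iff)

text \<open>With A the finite-rank operator and Y the approximation of \<open>S\<close>: \<langle>x,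
  A x\<rangle> is the sum of |\<langle>e, Y x\<rangle>|^2 over \<open>I\<close>, at most
  \<parallel>Y x\<parallel>^2 by Bessel, hence at most \<parallel>S x\<parallel>^2, which is the
  form of the square of \<open>S\<close>.\<close>

lemma finite_rank_le:
  assumes I: "finite I" "I \<subseteq> some_basis M" and xy: "(x, y) \<in> S O S"
  shows "x \<bullet> finite_rank (\<lambda>e. Y (emb M e)) I x \<le> x \<bullet> y"
proof -
  obtain w where w: "(x, w) \<in> S" "(w, y) \<in> S" using xy by blast
  have "x \<bullet> finite_rank (\<lambda>e. Y (emb M e)) I x = (\<Sum>e\<in>I. (cmod (cinner (emb M e) (Y x)))\<^sup>2)"
    using cinner_finite_rank_self[of x "\<lambda>e. Y (emb M e)" I] sum_coefficients[OF I(2)]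
    by (metis Re_cinner Re_complex_of_real)
  also have "\<dots> \<le> (norm (Y x))\<^sup>2"
    by (rule finite_sum_le_has_sum[OF some_basis.has_sum_norm[OF yosida_in_VV] I]) simp
  also have "\<dots> \<le> (norm w)\<^sup>2" using VV.norm_yosida_le[OF S c w(1)] by (intro power_mono) auto
  also have "\<dots> = x \<bullet> y" using VV.nnsa_symmetric[OF S w] by (simp add: power2_norm_eq_inner)
  finally show ?thesis .
qed

end

lemma ennreal_not_top_real: "x \<noteq> \<infinity> \<Longrightarrow> \<exists>K\<ge>0. x = ennreal K"
  by (cases x rule: ennreal_cases) auto

text \<open>If the supremum is finite, \<open>yosida_limit\<close> puts the vector into the domain
  of the root, with the supremum as bound; an infinite supremum leaves nothing to show.\<close>

lemma quad_form_le_SUP: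
  assumes Q: "nonneg_selfadjoint_op M Q" and a: "a \<in> L2 M"
  shows "quad_form M Q a
    \<le> (SUP m. ennreal ((norm (VV.yosida M (1 / real (Suc m)) (lift_graph M (sqrt_op M Q)) (emb M a)))\<^sup>2))"
    (is "_ \<le> ?SUP")
proof (cases "?SUP = \<infinity>")
  case False
  obtain K where K: "K \<ge> 0" "?SUP = ennreal K" using ennreal_not_top_real[OF False] by blast
  note S = lift_sqrt_op[OF Q]
  have "ennreal ((norm (VV.yosida M (1 / real (Suc m)) (lift_graph M (sqrt_op M Q)) (emb M a)))\<^sup>2) \<le> ennreal K" for m
    unfolding K(2)[symmetric] by (rule SUP_upper) simp
  then have "(norm (VV.yosida M (1 / real (Suc m)) (lift_graph M (sqrt_op M Q)) (emb M a)))\<^sup>2 \<le> K" for m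
    using K(1) by simp
  from VV.yosida_limit[OF S(1) emb_in_VV[OF a] this]
  obtain w where w: "(emb M a, w) \<in> lift_graph M (sqrt_op M Q)" "(norm w)\<^sup>2 \<le> K" by blast
  then show ?thesis unfolding quad_form_eq[OF Q a w(1)] K(2) by (intro ennreal_leI)
qed (simp only: infinity_ennreal_def top_greatest)

text \<open>No measurability of \<open>g\<close> is needed, as \<open>nn_integral\<close> is a lower integral.\<close>

lemma nn_integral_distr_le:
  assumes f: "f \<in> measurable M N"
  shows "(\<integral>\<^sup>+y. g y \<partial>distr M N f) \<le> (\<integral>\<^sup>+x. g (f x) \<partial>M)"
  unfolding nn_integral_def[of "distr M N f"]
proof (rule SUP_least)
  fix s assume "s \<in> {s. simple_function (distr M N f) s \<and> s \<le> g}"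
  then have s: "simple_function (distr M N f) s" "s \<le> g" by auto
  have "integral\<^sup>S (distr M N f) s = (\<integral>\<^sup>+y. s y \<partial>distr M N f)" by (rule nn_integral_eq_simple_integral[OF s(1), symmetric])
  also have "\<dots> = (\<integral>\<^sup>+x. s (f x) \<partial>M)"
    using borel_measurable_simple_function[OF s(1)] by (intro nn_integral_distr f) simp
  also have "\<dots> \<le> (\<integral>\<^sup>+x. g (f x) \<partial>M)" using s(2) by (intro nn_integral_mono) (simp add: le_fun_def)
  finally show "integral\<^sup>S (distr M N f) s \<le> (\<integral>\<^sup>+x. g (f x) \<partial>M)" .
qed

text \<open>If \<open>f\<close> were not measurable, some set and its complement would both get mass \<open>0\<close>.\<close>

lemma measurable_if_prob_space_distr:
  assumes M: "prob_space (distr M N f)" and f: "\<And>x. x \<in> space M \<Longrightarrow> f x \<in> space N"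
  shows "f \<in> measurable M N"
proof (rule measurableI[OF f])
  fix A assume A: "A \<in> sets N"
  interpret prob_space "distr M N f" by (rule M)
  let ?\<mu> = "\<lambda>A. emeasure M (f -` A \<inter> space M)"
  have em: "emeasure (distr M N f) B
      = (if B \<in> sets N \<and> measure_space (space N) (sets N) ?\<mu> then ?\<mu> B else 0)" for B
    unfolding distr_def emeasure_measure_of_conv by (simp add: sets.sigma_sets_eq)
  have "emeasure (distr M N f) (space N) = 1" using emeasure_space_1 by simp
  then have ms: "measure_space (space N) (sets N) ?\<mu>" unfolding em by (auto split: if_splits)
  have "emeasure (distr M N f) A + emeasure (distr M N f) (space N - A) = emeasure (distr M N f) (space N)"
    using A sets.sets_into_space[OF A] by (subst plus_emeasure) (auto intro: arg_cong[where f = "emeasure _"])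
  then have sum: "?\<mu> A + ?\<mu> (space N - A) = 1"
    using \<open>emeasure (distr M N f) (space N) = 1\<close> A ms by (simp add: em)
  show "f -` A \<inter> space M \<in> sets M"
  proof (rule ccontr)
    assume n: "f -` A \<inter> space M \<notin> sets M"
    have "f -` A \<inter> space M = space M - (f -` (space N - A) \<inter> space M)" using f by auto
    with n have "f -` (space N - A) \<inter> space M \<notin> sets M" by (metis sets.compl_sets)
    with n sum show False by (simp add: emeasure_notin_sets)
  qed
qed

section \<open>Densities and mixtures\<close>

lemma l2_class_cong:
  assumes "f \<in> l2_fun M" "g \<in> borel_measurable M" "AE x in M. f x = g x"
  shows "g \<in> l2_fun M" "l2_class M f = l2_class M g"
proof -
  have "integrable M (\<lambda>x. (cmod (g x))\<^sup>2)"
  proof (rule integrable_cong_AE_imp[OF l2_funD(2)[OF assms(1)]])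
    show "AE x in M. (cmod (f x))\<^sup>2 = (cmod (g x))\<^sup>2" using assms(3) by eventually_elim simp
  qed (use assms(2) in measurable)
  then show g: "g \<in> l2_fun M" using assms(2) by (simp add: l2_fun_def)
  show "l2_class M f = l2_class M g"
    unfolding l2_class_def by (rule equiv_class_eq[OF equiv_l2_rel]) (simp add: l2_rel_def assms g)
qed

text \<open>Uniqueness of Radon-Nikodym derivatives identifies the chosen \<open>RN_deriv\<close>
  with |u|^2 almost everywhere, which is enough for equality of classes.\<close>

lemma sqrt_density_mod_square:
  assumes u: "u \<in> L2 lborel"
  shows "has_density lborel (mod_square u)" "sqrt_density lborel (mod_square u) = l2_abs lborel u" "l2_abs lborel u \<in> L2 lborel"
proof -
  note r = l2_rep_in(1)[OF u]
  have m [measurable]: "l2_rep u \<in> borel_measurable lborel" by (rule l2_funD[OF r])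
  show "has_density lborel (mod_square u)" unfolding has_density_def mod_square_def 
    by (rule bexI[of _ "\<lambda>v. ennreal ((cmod (l2_rep u v))\<^sup>2)"]) (rule refl, measurable)
  have abs: "(\<lambda>x. complex_of_real (cmod (l2_rep u x))) \<in> l2_fun lborel"
    using r by (simp add: l2_fun_def)
  then show "l2_abs lborel u \<in> L2 lborel" by (simp add: l2_abs_def)
  have "AE x in lborel. ennreal ((cmod (l2_rep u x))\<^sup>2) = RN_deriv lborel (mod_square u) x"
    unfolding mod_square_def by (intro sigma_finite_measure.RN_deriv_unique[OF sigma_finite_lborel] refl) measurable
  then have "AE x in lborel. complex_of_real (cmod (l2_rep u x)) = complex_of_real (sqrt (enn2real (RN_deriv lborel (mod_square u) x)))"
  proof eventually_elim
    fix x assume "ennreal ((cmod (l2_rep u x))\<^sup>2) = RN_deriv lborel (mod_square u) x"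
    from this[symmetric] show "complex_of_real (cmod (l2_rep u x)) = complex_of_real (sqrt (enn2real (RN_deriv lborel (mod_square u) x)))"
      by simp
  qed
  from l2_class_cong(2)[OF abs _ this] show "sqrt_density lborel (mod_square u) = l2_abs lborel u"
    unfolding sqrt_density_def l2_abs_def by simp
qed

lemma mod_square_prob:
  assumes u: "u \<in> l2_sphere lborel"
  shows "mod_square u \<in> space (borel_of (weak_topology (euclidean :: (real^3) topology)))"
proof -
  have uL: "u \<in> L2 lborel" "norm (emb lborel u) = 1" using u by (auto simp: sphere_iff)
  note r = l2_rep_in(1)[OF uL(1)]
  have [measurable]: "l2_rep u \<in> borel_measurable lborel" by (rule l2_funD[OF r])
  have "emeasure (mod_square u) (space (mod_square u)) = (\<integral>\<^sup>+x. ennreal ((cmod (l2_rep u x))\<^sup>2) \<partial>lborel)"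
    unfolding mod_square_def by (simp add: emeasure_density)
  also have "\<dots> = 1" using nn_integral_norm_vec[OF r] uL(2) by (simp add: emb_def)
  finally have "prob_space (mod_square u)" by (rule prob_spaceI)
  moreover have "sets (mod_square u) = sets (borel_of (euclidean :: (real^3) topology))"
    by (simp add: mod_square_def borel_of_def borel_def)
  ultimately have "mod_square u \<in> prob_measures euclidean" by (simp add: prob_measures_def)
  \<comment> \<open>The subbasic set given by the constant function 0 and the open set
    \<open>UNIV\<close> contains every probability measure.\<close>
  then have "mod_square u \<in> topspace (weak_topology (euclidean :: (real^3) topology))"
    unfolding weak_topology_def topology_generated_by_topspace
    by (intro UnionI[of "{\<mu> \<in> prob_measures euclidean. (\<integral>x. 0 \<partial>\<mu>) \<in> (UNIV :: real set)}"])
      (auto intro!: exI[of _ "\<lambda>_. 0"] exI[of _ UNIV])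
  then show ?thesis by (simp add: space_borel_of)
qed

text \<open>Only an upper bound is asserted, so \<open>bind\<close> can be unfolded down to
  \<open>join\<close> and \<open>distr\<close>: where the underlying set function is not a measure
  the value is 0, and otherwise the integrand is at most 1.\<close>

lemma emeasure_mixture_le: "emeasure (mixture \<nu> j) X \<le> emeasure \<nu> (space \<nu>)"
proof (cases "space \<nu> = {}")
  case True
  then have "emeasure (mixture \<nu> j) X = emeasure (count_space {}) X" by (simp add: mixture_def bind_def)
  also have "\<dots> = 0" by (cases "X = {}") (auto simp: emeasure_notin_sets)
  finally show ?thesis by simp
next
  case False
  let ?f = "\<lambda>\<rho>. PiM {..<j} (\<lambda>_. \<rho>)"
  let ?N = "distr \<nu> (subprob_algebra (?f (SOME \<rho>. \<rho> \<in> space \<nu>))) ?f"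
  have eq: "mixture \<nu> j = join ?N" using False by (simp add: mixture_def bind_def)
  have "emeasure (join ?N) X \<le> (\<integral>\<^sup>+\<rho>. emeasure \<rho> X \<partial>?N)"
    unfolding join_def emeasure_measure_of_conv by simp
  also have "\<dots> \<le> (\<integral>\<^sup>+\<rho>. 1 \<partial>?N)"
  proof (rule nn_integral_mono)
    fix \<rho> assume "\<rho> \<in> space ?N"
    then have "subprob_space \<rho>" by (simp add: space_subprob_algebra)
    then show "emeasure \<rho> X \<le> 1" by (rule subprob_space.subprob_emeasure_le_1)
  qed
  also have "\<dots> = emeasure ?N (space ?N)" by simp
  also have "\<dots> \<le> emeasure \<nu> (?f -` space ?N \<inter> space \<nu>)"
    unfolding distr_def emeasure_measure_of_conv by simp
  also have "\<dots> \<le> emeasure \<nu> (space \<nu>)" by (rule emeasure_space)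
  finally show ?thesis unfolding eq .
qed

text \<open>The square of the candidate is the density, whose integral is the total mass; where the
  density is infinite \<open>enn2real\<close> gives 0, which only lowers the integral.\<close>

lemma sqrt_density_in_L2:
  assumes d: "has_density M F" and fin: "emeasure F (space M) < \<infinity>"
  shows "sqrt_density M F \<in> L2 M"
proof -
  let ?r = "RN_deriv M F"
  have r: "?r \<in> borel_measurable M" "density M ?r = F"
  proof -
    have ex: "\<exists>f. f \<in> borel_measurable M \<and> density M f = F" using d by (auto simp: has_density_def)
    from someI_ex[OF this] show "?r \<in> borel_measurable M" "density M ?r = F"
      unfolding RN_deriv_def if_P[OF ex] by blast+
  qed
  note r(1) [measurable]
  have int: "(\<integral>\<^sup>+x. ?r x \<partial>M) < \<infinity>"
    using fin emeasure_density[OF r(1), of "space M"] by (simp add: r(2) cong: nn_integral_cong)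
  have "(\<integral>\<^sup>+x. ennreal (norm (enn2real (?r x))) \<partial>M) \<le> (\<integral>\<^sup>+x. ?r x \<partial>M)"
    by (intro nn_integral_mono) (simp add: ennreal_enn2real_if)
  then have "integrable M (\<lambda>x. enn2real (?r x))" using int by (intro integrableI_bounded) auto
  then have "(\<lambda>x. complex_of_real (sqrt (enn2real (?r x)))) \<in> l2_fun M" by (simp add: l2_fun_def)
  then show ?thesis unfolding sqrt_density_def by (rule l2_class_in)
qed

theorem theorem10p7:
  fixes \<nu> :: "(real^3) measure measure"
    and \<psi> :: "nat \<Rightarrow> conf l2"
    and \<Gamma> \<gamma> :: "nat \<Rightarrow> conf l2op"
    and \<Gamma>p :: "nat \<Rightarrow> nat \<Rightarrow> conf l2op"
    and s :: "nat \<Rightarrow> nat"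
    and \<xi> :: "(real^3) l2 measure"
    and k0 :: nat
    and Q :: "conf l2op"
  assumes nu: "\<nu> \<in> prob_measures (weak_topology euclidean)"
    and fisher: "(SUP j\<in>{1..}. fisher_info j (mixture \<nu> j)) < \<infinity>"
    and moment: "(\<integral>\<^sup>+x. ennreal ((norm (x 0))\<^sup>2) \<partial>mixture \<nu> 1) < \<infinity>"
    and psi: "\<And>j. \<psi> j = sqrt_density (leb j) (mixture \<nu> j)"
    and Gamma: "\<And>j. \<Gamma> j = proj_op (leb j) (\<psi> j)"
    and Gamma_partial: "\<And>j k. 1 \<le> k \<Longrightarrow> k \<le> j \<Longrightarrow> is_partial_trace k j (\<Gamma> j) (\<Gamma>p j k)"
    and subseq: "strict_mono s"
    and gamma_trace_class: "\<And>k. 1 \<le> k \<Longrightarrow> trace_class (leb k) (\<gamma> k)"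
    and gamma_limit: "\<And>k. 1 \<le> k \<Longrightarrow>
           (\<lambda>n. trace_norm (leb k) (op_diff (leb k) (\<Gamma>p (s n) k) (\<gamma> k))) \<longlonglongrightarrow> 0"
    and gamma_trace: "\<And>k. 1 \<le> k \<Longrightarrow> op_trace (leb k) (\<gamma> k) = 1"
    and gamma_compatible: "\<And>k m. 1 \<le> k \<Longrightarrow> k \<le> m \<Longrightarrow> is_partial_trace k m (\<gamma> m) (\<gamma> k)"
    and xi: "\<xi> \<in> prob_measures (l2_sphere_topology lborel)"
    and de_finetti: "\<And>k A. 1 \<le> k \<Longrightarrow> bounded_op (leb k) A \<Longrightarrow>
           op_trace (leb k) (\<gamma> k O A) =
           (\<integral>u. op_trace (leb k) (proj_op (leb k) (tensor_power k u) O A) \<partial>\<xi>)"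
    and pushforward: "\<nu> = distr \<xi> (borel_of (weak_topology euclidean)) mod_square"
    and k0: "1 \<le> k0"
    and Q: "nonneg_selfadjoint_op (leb k0) Q"
    and Q_abs: "\<And>u. u \<in> support_of (l2_sphere_topology lborel) \<xi> \<Longrightarrow>
           quad_form (leb k0) Q (tensor_power k0 u)
             \<ge> quad_form (leb k0) Q (tensor_power k0 (l2_abs lborel u))"
  shows "limsup (\<lambda>j. quad_form (leb j) (tensor_id k0 j Q) (\<psi> j))
           \<ge> (\<integral>\<^sup>+\<rho>. quad_form_sqrt_power k0 Q \<rho> \<partial>\<nu>)"
proof -
  have "prob_space \<nu>" using nu by (simp add: prob_measures_def)
  \<comment> \<open>Finite Fisher information gives the mixture a density, and its mass is at most
    1; so \<open>\<psi> j\<close> is an honest vector for j \<ge> 1.\<close>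
  have psi_L2: "\<psi> j \<in> L2 (leb j)" if "1 \<le> j" for j
  proof -
    have "fisher_info j (mixture \<nu> j) < \<infinity>"
      using fisher that by (intro le_less_trans[OF SUP_upper[of j "{1..}" "\<lambda>j. fisher_info j (mixture \<nu> j)"]]) auto
    then have "has_density (leb j) (mixture \<nu> j)" by (auto simp: fisher_info_def split: if_splits)
    moreover have "emeasure (mixture \<nu> j) (space (leb j)) < \<infinity>"
      using emeasure_mixture_le[of \<nu> j "space (leb j)"] prob_space.emeasure_space_1[OF \<open>prob_space \<nu>\<close>]
      by (metis ennreal_one_less_top infinity_ennreal_def le_less_trans)
    ultimately show ?thesis unfolding psi by (rule sqrt_density_in_L2)
  qed
  define S where "S = lift_graph (leb k0) (sqrt_op (leb k0) Q)"
  note LS = lift_sqrt_op[OF Q, folded S_def]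
  define F where "F u = emb (leb k0) (tensor_power k0 u)" for u
  define Z where "Z m = VV.yosida (leb k0) (1 / real (Suc m)) S" for m
  define lims where "lims = limsup (\<lambda>j. quad_form (leb j) (tensor_id k0 j Q) (\<psi> j))"
  let ?B = "some_basis (leb k0)"
  interpret xi: prob_space \<xi> by (rule xi_prob[OF xi])
  have sp: "space \<xi> = l2_sphere lborel" by (rule xi_space[OF xi])
  have Fm [measurable]: "F \<in> borel_measurable \<xi>" using tensor_power_measurable[OF xi] unfolding F_def .
  have FV: "F u \<in> VV (leb k0)" "norm (F u) = 1" if "u \<in> space \<xi>" for u
    using that tensor_power(1)[of u k0] norm_tensor_power[of u k0] by (auto simp: F_def sp sphere_iff)
  have m0: "1 / real (Suc m) > 0" for m by simp
  note Y = LS(1,3) m0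
  have ZV: "Z m x \<in> VV (leb k0)" for m x unfolding Z_def by (rule yosida_in_VV[OF Y])
  have Zbl: "bounded_linear (Z m)" for m
    unfolding Z_def by (rule VV.posop_linear[OF VV.posop_yosida[OF LS(1) m0]])
  have finite_bound: "(\<integral>\<^sup>+u. ennreal (\<Sum>e\<in>I. (cmod (cinner (emb (leb k0) e) (Z m (F u))))\<^sup>2) \<partial>\<xi>) \<le> lims"
    if I: "finite I" "I \<subseteq> ?B" for I m
  proof -
    define \<phi> where "\<phi> e = Z m (emb (leb k0) e)" for e
    have \<phi>: "\<phi> e \<in> VV (leb k0)" for e unfolding \<phi>_def by (rule ZV)
    define A where "A = finite_rank_op (leb k0) \<phi> I"
    have repA: "represents (leb k0) (finite_rank \<phi> I) A" unfolding A_def by (rule represents_finite_rank) (rule \<phi>)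
    have bA: "bounded_op (leb k0) A" by (rule represents_bounded_op[OF repA])
    define r where "r u = (\<Sum>e\<in>I. (cmod (cinner (\<phi> e) (F u)))\<^sup>2)" for u
    have r_eq: "r u = (\<Sum>e\<in>I. (cmod (cinner (emb (leb k0) e) (Z m (F u))))\<^sup>2)" for u
      unfolding r_def \<phi>_def Z_def by (rule sum_coefficients[OF Y I(2)])
    have tr_xi: "op_trace (leb k0) (proj_op (leb k0) (tensor_power k0 u) O A) = complex_of_real (r u)" if u: "u \<in> space \<xi>" for u
    proof -
      have "tensor_power k0 u \<in> L2 (leb k0)" using u by (intro tensor_power(1)) (simp add: sp sphere_iff)
      from represents_ex[OF repA this] obtain b where b: "(tensor_power k0 u, b) \<in> A" "emb (leb k0) b = finite_rank \<phi> I (F u)"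
        unfolding F_def by blast
      show ?thesis
        unfolding op_trace_proj[OF represents_l2_operator[OF repA] b(1)] b(2) F_def[symmetric] cinner_finite_rank_self r_def ..
    qed
    have rm [measurable]: "r \<in> borel_measurable \<xi>"
    proof -
      have "(\<lambda>u. cinner (\<phi> e) (F u)) \<in> borel_measurable \<xi>" for e
        by (rule borel_measurable_continuous_on[OF _ Fm])
          (intro continuous_at_imp_continuous_on ballI linear_continuous_at bounded_linear_cinner_right)
      then show ?thesis unfolding r_def by measurable
    qed
    have rb: "norm (r u) \<le> (\<Sum>e\<in>I. (2 * norm (\<phi> e))\<^sup>2)" if u: "u \<in> space \<xi>" for u
    proof -
      have "r u \<le> (\<Sum>e\<in>I. (2 * norm (\<phi> e))\<^sup>2)"
        unfolding r_def using norm_cinner_le[of _ "F u"] FV(2)[OF u] by (intro sum_mono power_mono) auto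
      moreover have "0 \<le> r u" unfolding r_def by (intro sum_nonneg) simp
      ultimately show ?thesis by simp
    qed
    have ri: "integrable \<xi> r" by (rule xi.integrable_const_bound[OF _ rm]) (rule AE_I2, rule rb)
    have tr_gamma: "op_trace (leb k0) (\<gamma> k0 O A) = complex_of_real (\<integral>u. r u \<partial>\<xi>)"
      unfolding de_finetti[OF k0 bA] integral_complex_of_real[symmetric]
      by (intro Bochner_Integration.integral_cong refl tr_xi)
    define tr where "tr n = op_trace (leb k0) (\<Gamma>p (s n) k0 O A)" for n
    \<comment> \<open>A strictly increasing \<open>s\<close> satisfies s n \<ge> n, so from n = k0
      on the partial trace onto \<open>k0\<close> particles exists.\<close>
    have sn: "k0 \<le> s n" if "k0 \<le> n" for n using seq_suble[OF subseq, of n] that by simp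
    have bG: "bounded_op (leb k0) (\<Gamma>p (s n) k0)" if "k0 \<le> n" for n
      using Gamma_partial[OF k0 sn[OF that]] by (simp add: is_partial_trace_def trace_class_def)
    have bg: "bounded_op (leb k0) (\<gamma> k0)" using gamma_trace_class[OF k0] by (simp add: trace_class_def)
    have tr_quad: "ennreal (Re (tr n)) \<le> quad_form (leb (s n)) (tensor_id k0 (s n) Q) (\<psi> (s n))" if n: "k0 \<le> n" for n
    proof -
      have "tr n = op_trace (leb (s n)) (proj_op (leb (s n)) (\<psi> (s n)) O tensor_id k0 (s n) A)"
        unfolding tr_def using Gamma_partial[OF k0 sn[OF n]] bA by (simp add: is_partial_trace_def Gamma)
      moreover have "ennreal (Re (op_trace (leb (s n)) (proj_op (leb (s n)) (\<psi> (s n)) O tensor_id k0 (s n) A)))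
          \<le> quad_form (leb (s n)) (tensor_id k0 (s n) Q) (\<psi> (s n))"
        unfolding A_def
      proof (rule op_trace_tensor_le_quad_form[OF sn[OF n] Q \<phi>])
        show "\<psi> (s n) \<in> L2 (leb (s n))" using sn[OF n] k0 by (intro psi_L2) simp
        fix x y assume "(x, y) \<in> lift_graph (leb k0) Q"
        then have "(x, y) \<in> S O S" using LS(2) by simp
        then show "x \<bullet> finite_rank \<phi> I x \<le> x \<bullet> y"
          unfolding \<phi>_def Z_def by (rule finite_rank_le[OF Y I])
      qed
      ultimately show ?thesis by simp
    qed
    have "tr \<longlonglongrightarrow> op_trace (leb k0) (\<gamma> k0 O A)"
    proof (rule LIMSEQ_I)
      fix e :: real assume e: "e > 0"
      \<comment> \<open>The added 1 keeps \<open>C\<close> positive when \<open>I\<close> is empty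
        or all \<open>\<phi> i\<close> vanish, so e / C is a legitimate threshold.\<close>
      define C where "C = (\<Sum>i\<in>I. 4 * (norm (\<phi> i))\<^sup>2) + 1"
      have C: "C > 0" unfolding C_def by (intro add_nonneg_pos sum_nonneg) auto
      have "ennreal (e / C) > 0" using e C by simp
      from order_tendstoD(2)[OF gamma_limit[OF k0] this] obtain n0
        where n0: "\<And>n. n0 \<le> n \<Longrightarrow> trace_norm (leb k0) (op_diff (leb k0) (\<Gamma>p (s n) k0) (\<gamma> k0)) < ennreal (e / C)"
        unfolding eventually_sequentially by blast
      show "\<exists>n0. \<forall>n\<ge>n0. norm (tr n - op_trace (leb k0) (\<gamma> k0 O A)) < e"
      proof (intro exI allI impI)
        fix n assume n: "max n0 k0 \<le> n"
        have "norm (tr n - op_trace (leb k0) (\<gamma> k0 O A)) \<le> e / C * (\<Sum>i\<in>I. 4 * (norm (\<phi> i))\<^sup>2)"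
          unfolding tr_def A_def
          using n e C by (intro op_trace_finite_rank_diff \<phi> bG bg less_imp_le[OF n0]) auto
        also have "\<dots> < e / C * C" using e C by (intro mult_strict_left_mono) (auto simp: C_def)
        finally show "norm (tr n - op_trace (leb k0) (\<gamma> k0 O A)) < e" using C by simp
      qed
    qed
    then have conv: "(\<lambda>n. ennreal (Re (tr n))) \<longlonglongrightarrow> ennreal (Re (op_trace (leb k0) (\<gamma> k0 O A)))"
      by (intro tendsto_ennrealI tendsto_Re)
    have "ennreal (\<integral>u. r u \<partial>\<xi>) = limsup (\<lambda>n. ennreal (Re (tr n)))"
      unfolding lim_imp_Limsup[OF sequentially_bot conv] tr_gamma by simp
    \<comment> \<open>The comparison holds from n = k0 on, which suffices for an upper
      limit.\<close>
    also have "\<dots> \<le> limsup ((\<lambda>j. quad_form (leb j) (tensor_id k0 j Q) (\<psi> j)) \<circ> s)"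
      using tr_quad by (intro Limsup_mono) (auto simp: eventually_sequentially)
    also have "\<dots> \<le> lims" unfolding lims_def by (rule limsup_subseq_mono[OF subseq])
    finally have "ennreal (\<integral>u. r u \<partial>\<xi>) \<le> lims" .
    moreover have "(\<integral>\<^sup>+u. ennreal (r u) \<partial>\<xi>) = ennreal (\<integral>u. r u \<partial>\<xi>)"
      
      by (rule nn_integral_eq_integral[OF ri]) (simp add: r_def sum_nonneg)
    ultimately show ?thesis by (simp add: r_eq)
  qed
  have yosida_bound: "(\<integral>\<^sup>+u. ennreal ((norm (Z m (F u)))\<^sup>2) \<partial>\<xi>) \<le> lims" for m
  proof -
    \<comment> \<open>Numbering the countable basis replaces the net of finite subsets by an
      increasing sequence, to which monotone convergence under the integral applies.\<close>
    define I where "I N = {e \<in> ?B. to_nat_on ?B e < N}" for N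
    have I: "finite (I N)" "I N \<subseteq> ?B" for N
    proof -
      have "inj_on (to_nat_on ?B) (I N)" using inj_on_to_nat_on[OF countable_basis_leb] by (rule inj_on_subset) (auto simp: I_def)
      moreover have "finite (to_nat_on ?B ` I N)" by (rule finite_subset[of _ "{..<N}"]) (auto simp: I_def)
      ultimately show "finite (I N)" by (rule finite_imageD[rotated])
    qed (auto simp: I_def)
    let ?g = "\<lambda>N u. \<Sum>e\<in>I N. (cmod (cinner (emb (leb k0) e) (Z m (F u))))\<^sup>2"
    have gm: "(\<lambda>u. ennreal (?g N u)) \<in> borel_measurable \<xi>" for N
    proof -
      have "(\<lambda>u. cinner (emb (leb k0) e) (Z m (F u))) \<in> borel_measurable \<xi>" for e
        by (rule borel_measurable_continuous_on[OF _ Fm])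
          (intro continuous_at_imp_continuous_on ballI linear_continuous_at bounded_linear_compose[OF bounded_linear_cinner_right Zbl])
      then show ?thesis by measurable
    qed
    have "(\<integral>\<^sup>+u. ennreal ((norm (Z m (F u)))\<^sup>2) \<partial>\<xi>) \<le> (\<integral>\<^sup>+u. (SUP N. ennreal (?g N u)) \<partial>\<xi>)"
    proof (rule nn_integral_mono)
      fix u
      show "ennreal ((norm (Z m (F u)))\<^sup>2) \<le> (SUP N. ennreal (?g N u))" (is "_ \<le> ?s")
      proof (cases "?s = \<infinity>")
        case False
        obtain K where K: "K \<ge> 0" "?s = ennreal K" using ennreal_not_top_real[OF False] by blast
        have "(norm (Z m (F u)))\<^sup>2 \<le> K"
        proof (rule has_sum_le_finite_sums[OF some_basis.has_sum_norm[OF ZV]])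
          fix J assume J: "finite J" "J \<subseteq> ?B"
          \<comment> \<open>Every finite set of basis vectors lies in some \<open>I N\<close>, so a
            finite supremum over \<open>N\<close> bounds all partial sums in Parseval's
            identity.\<close>
          obtain N where N: "\<forall>i\<in>to_nat_on ?B ` J. i < N" using finite_nat_set_iff_bounded J(1) by blast
          have "(\<Sum>e\<in>J. (cmod (cinner (emb (leb k0) e) (Z m (F u))))\<^sup>2) \<le> ?g N u"
            using J N by (intro sum_mono2 I) (auto simp: I_def)
          moreover have "ennreal (?g N u) \<le> ennreal K" unfolding K(2)[symmetric] by (rule SUP_upper) simp
          ultimately show "(\<Sum>e\<in>J. (cmod (cinner (emb (leb k0) e) (Z m (F u))))\<^sup>2) \<le> K" using K(1) by simp
        qed
        then show ?thesis unfolding K(2) by (rule ennreal_leI)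
      qed (simp only: infinity_ennreal_def top_greatest)
    qed
    also have "\<dots> = (SUP N. \<integral>\<^sup>+u. ennreal (?g N u) \<partial>\<xi>)"
    proof (rule nn_integral_monotone_convergence_SUP[OF _ gm])
      show "incseq (\<lambda>N u. ennreal (?g N u))"
        by (intro incseq_SucI le_funI ennreal_leI sum_mono2 I) (auto simp: I_def)
    qed
    also have "\<dots> \<le> lims" using finite_bound[OF I] by (intro SUP_least)
    finally show ?thesis .
  qed
  have "(\<integral>\<^sup>+u. quad_form (leb k0) Q (tensor_power k0 u) \<partial>\<xi>) \<le> (\<integral>\<^sup>+u. (SUP m. ennreal ((norm (Z m (F u)))\<^sup>2)) \<partial>\<xi>)"
  proof (rule nn_integral_mono)
    fix u assume "u \<in> space \<xi>"
    then have "tensor_power k0 u \<in> L2 (leb k0)" by (intro tensor_power(1)) (simp add: sp sphere_iff)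
    from quad_form_le_SUP[OF Q this]
    show "quad_form (leb k0) Q (tensor_power k0 u) \<le> (SUP m. ennreal ((norm (Z m (F u)))\<^sup>2))"
      unfolding Z_def F_def S_def .
  qed
  also have "\<dots> = (SUP m. \<integral>\<^sup>+u. ennreal ((norm (Z m (F u)))\<^sup>2) \<partial>\<xi>)"
  proof (rule nn_integral_monotone_convergence_SUP)
    show "incseq (\<lambda>m u. ennreal ((norm (Z m (F u)))\<^sup>2))"
    proof (intro incseq_SucI le_funI ennreal_leI)
      fix m u
      \<comment> \<open>\<open>yosida_increment\<close> bounds a square by the difference of the
        squared norms, so a smaller parameter gives a larger norm.\<close>
      have "1 / real (Suc (Suc m)) \<le> 1 / real (Suc m)" by (simp add: field_simps)
      from order_trans[OF zero_le_power2 VV.yosida_increment[OF LS(1) m0 this, of "F u"]]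
      show "(norm (Z m (F u)))\<^sup>2 \<le> (norm (Z (Suc m) (F u)))\<^sup>2" unfolding Z_def by simp
    qed
    show "(\<lambda>u. ennreal ((norm (Z m (F u)))\<^sup>2)) \<in> borel_measurable \<xi>" for m
    proof -
      have "(\<lambda>u. norm (Z m (F u))) \<in> borel_measurable \<xi>"
        by (rule borel_measurable_continuous_on[OF _ Fm])
          (intro continuous_at_imp_continuous_on ballI continuous_norm linear_continuous_at Zbl)
      then show ?thesis by measurable
    qed
  qed
  also have "\<dots> \<le> lims" using yosida_bound by (intro SUP_least)
  finally have xi_bound: "(\<integral>\<^sup>+u. quad_form (leb k0) Q (tensor_power k0 u) \<partial>\<xi>) \<le> lims" .
  let ?N = "borel_of (weak_topology (euclidean :: (real^3) topology))"
  \<comment> \<open>\<open>distr\<close> is defined for every map; measurability of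
    \<open>mod_square\<close> is recovered from the fact that the push-forward \<open>\<nu>\<close>
    is a probability measure.\<close>
  have meas: "mod_square \<in> measurable \<xi> ?N"
    using \<open>prob_space \<nu>\<close> unfolding pushforward
    by (rule measurable_if_prob_space_distr) (simp add: sp mod_square_prob)
  have "(\<integral>\<^sup>+\<rho>. quad_form_sqrt_power k0 Q \<rho> \<partial>\<nu>) \<le> (\<integral>\<^sup>+u. quad_form_sqrt_power k0 Q (mod_square u) \<partial>\<xi>)"
    unfolding pushforward by (rule nn_integral_distr_le[OF meas])
  also have "\<dots> \<le> (\<integral>\<^sup>+u. quad_form (leb k0) Q (tensor_power k0 u) \<partial>\<xi>)"
  proof (rule nn_integral_mono_AE)
    have "AE u in \<xi>. u \<in> support_of (l2_sphere_topology lborel) \<xi>" by (rule AE_support[OF xi countable_basis_lborel])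
    then show "AE u in \<xi>. quad_form_sqrt_power k0 Q (mod_square u) \<le> quad_form (leb k0) Q (tensor_power k0 u)"
      using AE_space
    proof eventually_elim
      fix u assume u: "u \<in> support_of (l2_sphere_topology lborel) \<xi>" "u \<in> space \<xi>"
      then have "u \<in> L2 lborel" by (simp add: sp sphere_iff)
      from sqrt_density_mod_square[OF this] Q_abs[OF u(1)]
      show "quad_form_sqrt_power k0 Q (mod_square u) \<le> quad_form (leb k0) Q (tensor_power k0 u)"
        by (simp add: quad_form_sqrt_power_def)
    qed
  qed
  also note xi_bound
  finally show ?thesis unfolding lims_def .
qed

end
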